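(* Assume the setting and the standing assumptions (1)–(4) described in the context. Let $A\in\mathcal C_m$ with $L_1(A)>L_2(A)$. There are $\delta>0$, $\iota\in\mathscr I$, $c>0$, $\alpha>0$, all depending only on $A$, such that for any $B_1\neq B_2$ in $\mathcal C_m$ with $\mathrm{dist}(B_i,A)<\delta$, $i=1,2$ (for which $L_1(B_i)>L_2(B_i)$, so that $\overline{\mathfrak v}^{(\infty)}(B_i)$ is defined), we have $$\mu\{x\in X: d(\overline{\mathfrak v}^{(\infty)}(B_1)(x),\overline{\mathfrak v}^{(\infty)}(B_2)(x))>\mathrm{dist}(B_1,B_2)^\alpha\}<\omega_\iota(\mathrm{dist}(B_1,B_2)),$$ where $\omega_\iota(h):=[\iota(c\log(1/h))]^{1/2}$. Moreover, $$\int_Xd\big(\overline{\mathfrak v}^{(\infty)}(B_1)(x),\overline{\mathfrak v}^{(\infty)}(B_2)(x)\big)\,d\mu(x)<\omega_\iota(\mathrm{dist}(B_1,B_2)).$$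
   Context: Base and exponents. $(X,\mu)$ is a probability space and $T:X\to X$ is an invertible ergodic measure-preserving transformation. For measurable $A:X\to \mathrm{Mat}(m,\mathbb R)$ put $A^{(n)}(x)=A(T^{n-1}x)\cdots A(Tx)A(x)$. Singular values of a matrix $g$ are written $s_1(g)\ge\dots\ge s_m(g)\ge0$; the Lyapunov exponent $L_i(A)\in[-\infty,\infty)$ is the $\mu$-a.e. constant limit of $\frac1n\log s_i(A^{(n)}(x))$ (with $\log 0=-\infty$). $\wedge_kA$ is the $k$-th exterior power. Space of cocycles. $\mathcal C$ is a class of measurable functions $A:X\to\mathrm{Mat}(m,\mathbb R)$ ($m\in\mathbb N$ not fixed) with $\|A\|\in L^\infty(\mu)$ and such that $\wedge_kA\in\mathcal C$ for $k\le m$. $\mathcal C_m$ denotes the $\mathrm{Mat}(m,\mathbb R)$-valued elements; each $\mathcal C_m$ carries a distance $\mathrm{dist}$ with $\mathrm{dist}(B,A)\ge\|B-A\|_{L^\infty}$, and $\mathcal C_m\ni A\mapsto\wedge_kA\in\mathcal C_{\binom mk}$ is locally Lipschitz. Put $L_1^{(n)}(A)=\int_X\frac1n\log\|A^{(n)}(x)\|\,d\mu(x)$. Uniform $L^2$-boundedness. $A\in\mathcal C_m$ is uniformly $L^2$-bounded if there are $\delta>0$, $C<\infty$ with $\|\frac1n\log\|B^{(n)}(\cdot)\|\,\|_{L^2}<C$ for all $n\ge1$ and all $B\in\mathcal C_m$ with $\mathrm{dist}(B,A)<\delta$. Compatibility. $\Xi$ is a set of measurable functions $\xi:X\to\mathbb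 R$ (observables). For $N\in\mathbb N$ let $\mathscr F_N(A)$ be the algebra generated by the sets $\{x:\|A^{(n)}(x)\|\le c\}$, $\{x:\|A^{(n)}(x)\|\ge c\}$, $c\ge0$, $0\le n\le N$. $\Xi$ and $A$ are compatible if for all $N$, all $F\in\mathscr F_N(A)$ and all $\epsilon>0$ there is $\xi\in\Xi$ with $\mathbf 1_F\le\xi$ and $\int\xi\,d\mu\le\mu(F)+\epsilon$. LDT estimates. $\mathscr P$ is a set of triplets $(n_0,\varepsilon,\iota)$ (LDT parameters), $n_0\in\mathbb N$, $\varepsilon,\iota:(0,\infty)\to(0,\infty)$, $\varepsilon$ non-increasing, $\iota$ continuous, strictly decreasing to $0$, with $e^{-c_0t}<\iota(t)<t^{-10}$ for all large $t$, for some $c_0>0$. Write $\varepsilon_n=\varepsilon(n)$, $\iota_n=\iota(n)$. An observable $\xi$ satisfies a base-LDT if for every $\epsilon>0$ there is $(n_0,\varepsilon,\iota)\in\mathscr P$ such that for all $n\ge n_0$: $\varepsilon_n\le\epsilon$ and $\mu\{x:|\frac1n\sum_{j=0}^{n-1}\xi(T^jx)-\int\xi\,d\mu|>\varepsilon_n\}<\iota_n$. A cocycle $A\in\mathcal C_m$ satisfies a uniform fiber-LDT if for every $\epsilon>0$ there are $(n_0,\varepsilon,\iota)\in\mathscr P$ and a neighborhood of $A$ in $\mathcal C_m$ such that for every $B$ in it and all $n\ge n_0$: $\varepsilon_n\le\epsilon$ and $\mu\{x:|\frac1n\log\|B^{(n)}(x)\|-L_1^{(n)}(B)|>\varepsilon_n\}<\iota_n$.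 $\mathscr I$ denotes the set of deviation measure functions, i.e. finite linear combinations with positive coefficients of third components of elements of $\mathscr P$. Standing assumptions. (1) $\Xi$ is compatible with every $A\in\mathcal C$. (2) Every $\xi\in\Xi$ satisfies a base-LDT. (3) Every $A\in\mathcal C$ with $L_1(A)>-\infty$ is uniformly $L^2$-bounded. (4) Every $A\in\mathcal C$ with $L_1(A)>L_2(A)$ satisfies a uniform fiber-LDT. Objects in the claim. For a matrix $g$ with $s_1(g)>s_2(g)$, $\overline{\mathfrak v}(g)\in\mathbb P(\mathbb R^m)$ is the line of eigenvectors of $g^*g$ with eigenvalue $s_1(g)^2$. If $L_1(B)>L_2(B)$, $\overline{\mathfrak v}^{(\infty)}(B)(x)=\lim_{n\to\infty}\overline{\mathfrak v}(B^{(n)}(x))$, which exists for $\mu$-a.e. $x$. $d$ is the normalized projective distance $d(\hat p,\hat q)=\frac2\pi\arccos\frac{|\langle p,q\rangle|}{\|p\|\|q\|}$. *)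

theory Defs
  imports
    "HOL-Probability.Probability"
    "Jordan_Normal_Form.Char_Poly"
    "Jordan_Normal_Form.DL_Submatrix"
begin

section \<open>Matrices\<close>

text \<open>The dimension \<open>m\<close> varies inside a class of cocycles (exterior powers change it), so matrices are
  those of the Jordan normal form library, whose dimension is a value.\<close>

definition vec_len :: "real vec \<Rightarrow> real" where
  "vec_len v = sqrt (scalar_prod v v)"

definition mat_norm :: "real mat \<Rightarrow> real" where
  "mat_norm g = (SUP v \<in> {v \<in> carrier_vec (dim_col g). vec_len v \<le> 1}. vec_len (g *\<^sub>v v))"

text \<open>Singular values in non-increasing order: square roots of the eigenvalues of \<open>g\<^sup>* g\<close>, listed with
  multiplicity.  \<open>sing_val g i\<close> is \<open>s\<^sub>i(g)\<close>, so it is meaningful for \<open>1 \<le> i \<le> m\<close>.\<close>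

definition singular_values :: "real mat \<Rightarrow> real list" where
  "singular_values g =
     rev (sorted_list_of_multiset (image_mset sqrt (proots (char_poly (transpose_mat g * g)))))"

definition sing_val :: "real mat \<Rightarrow> nat \<Rightarrow> real" where
  "sing_val g i = singular_values g ! (i - 1)"

text \<open>Matrix of the \<open>k\<close>-th exterior power with respect to the basis
  \<open>e\<^bsub>i\<^sub>1\<^esub> \<and> \<dots> \<and> e\<^bsub>i\<^sub>k\<^esub>\<close> (\<open>i\<^sub>1 < \<dots> < i\<^sub>k\<close>, lexicographically ordered): its entries are the
  \<open>k \<times> k\<close> minors.\<close>

definition index_tuples :: "nat \<Rightarrow> nat \<Rightarrow> nat list list" where
  "index_tuples m k = filter (\<lambda>I. length I = k) (List.subseqs [0..<m])"

definition ext_power :: "nat \<Rightarrow> real mat \<Rightarrow> real mat" where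
  "ext_power k g =
     (let m = dim_row g; Is = index_tuples m k in
      Matrix.mat (m choose k) (m choose k)
        (\<lambda>(i, j). Determinant.det (submatrix g (set (Is ! i)) (set (Is ! j)))))"


section \<open>Projective space\<close>

text \<open>Points of the projective space of \<open>\<real>\<^sup>m\<close> are lines through the origin, as sets of vectors.\<close>

definition line_of :: "real vec \<Rightarrow> real vec set" where
  "line_of p = {c \<cdot>\<^sub>v p | c. True}"

definition proj_space :: "nat \<Rightarrow> real vec set set" where
  "proj_space m = {line_of p | p. p \<in> carrier_vec m \<and> p \<noteq> 0\<^sub>v m}"

definition line_rep :: "real vec set \<Rightarrow> real vec" where
  "line_rep P = (SOME p. p \<in> P \<and> p \<noteq> 0\<^sub>v (dim_vec p))"

text \<open>The value does not depend on the chosen representatives.\<close>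

definition proj_dist :: "real vec set \<Rightarrow> real vec set \<Rightarrow> real" where
  "proj_dist P Q =
     (let p = line_rep P; q = line_rep Q in
      2 / pi * arccos (\<bar>scalar_prod p q\<bar> / (vec_len p * vec_len q)))"

text \<open>The eigenspace of \<open>g\<^sup>* g\<close> for \<open>s\<^sub>1(g)\<^sup>2\<close>; it is a line exactly when \<open>s\<^sub>1(g)\<^sup>2\<close> is a simple eigenvalue.\<close>

definition most_expanding :: "real mat \<Rightarrow> real vec set" where
  "most_expanding g =
     {v \<in> carrier_vec (dim_col g). (transpose_mat g * g) *\<^sub>v v = (sing_val g 1)\<^sup>2 \<cdot>\<^sub>v v}"


section \<open>Base dynamics, cocycles and Lyapunov exponents\<close>

definition ergodic_automorphism :: "'a measure \<Rightarrow> ('a \<Rightarrow> 'a) \<Rightarrow> bool" where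
  "ergodic_automorphism M T \<longleftrightarrow>
     bij_betw T (space M) (space M) \<and>
     T \<in> measurable M M \<and> the_inv_into (space M) T \<in> measurable M M \<and>
     (\<forall>E\<in>sets M. measure M (T -` E \<inter> space M) = measure M E) \<and>
     (\<forall>E\<in>sets M. T -` E \<inter> space M = E \<longrightarrow> measure M E = 0 \<or> measure M E = 1)"

primrec iterate :: "('a \<Rightarrow> 'a) \<Rightarrow> ('a \<Rightarrow> real mat) \<Rightarrow> nat \<Rightarrow> 'a \<Rightarrow> real mat" where
  "iterate T A 0 x = 1\<^sub>m (dim_row (A x))"
| "iterate T A (Suc n) x = A ((T ^^ n) x) * iterate T A n x"

definition elog :: "real \<Rightarrow> ereal" where
  "elog t = (if t = 0 then -\<infinity> else ereal (ln t))"

definition finite_scale_log :: "('a \<Rightarrow> 'a) \<Rightarrow> ('a \<Rightarrow> real mat) \<Rightarrow> nat \<Rightarrow> 'a \<Rightarrow> ereal" where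
  "finite_scale_log T A n x = ereal (1 / real n) * elog (mat_norm (iterate T A n x))"

text \<open>The \<open>\<mu>\<close>-a.e. constant limit; meaningful for \<open>A\<close> with values in \<open>Mat(m, \<real>)\<close> and \<open>1 \<le> i \<le> m\<close>.\<close>

definition lyap :: "'a measure \<Rightarrow> ('a \<Rightarrow> 'a) \<Rightarrow> ('a \<Rightarrow> real mat) \<Rightarrow> nat \<Rightarrow> ereal" where
  "lyap M T A i =
     (THE l. AE x in M. (\<lambda>n. ereal (1 / real n) * elog (sing_val (iterate T A n x) i)) \<longlonglongrightarrow> l)"

text \<open>Integrals of extended real functions whose positive part is integrable; the value may be \<open>-\<infinity>\<close>.\<close>

definition ereal_integral :: "'a measure \<Rightarrow> ('a \<Rightarrow> ereal) \<Rightarrow> ereal" where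
  "ereal_integral M f =
     enn2ereal (\<integral>\<^sup>+x. e2ennreal (f x) \<partial>M) - enn2ereal (\<integral>\<^sup>+x. e2ennreal (- f x) \<partial>M)"

definition lyap_fin :: "'a measure \<Rightarrow> ('a \<Rightarrow> 'a) \<Rightarrow> ('a \<Rightarrow> real mat) \<Rightarrow> nat \<Rightarrow> ereal" where
  "lyap_fin M T A n = ereal_integral M (finite_scale_log T A n)"

text \<open>Convergence in projective space of the most expanding directions, which
  have to be defined (i.e. lines) for all large \<open>n\<close>.\<close>

definition expanding_limit ::
    "('a \<Rightarrow> 'a) \<Rightarrow> ('a \<Rightarrow> real mat) \<Rightarrow> 'a \<Rightarrow> real vec set \<Rightarrow> bool" where
  "expanding_limit T A x P \<longleftrightarrow>
     P \<in> proj_space (dim_row (A x)) \<and>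
     (\<forall>\<^sub>F n in sequentially. most_expanding (iterate T A n x) \<in> proj_space (dim_row (A x))) \<and>
     (\<lambda>n. proj_dist (most_expanding (iterate T A n x)) P) \<longlonglongrightarrow> 0"

text \<open>At points where the limit does not exist (a null set if \<open>L\<^sub>1 > L\<^sub>2\<close>), an arbitrary fixed
  line is chosen.\<close>

definition expanding_dir :: "('a \<Rightarrow> 'a) \<Rightarrow> ('a \<Rightarrow> real mat) \<Rightarrow> 'a \<Rightarrow> real vec set" where
  "expanding_dir T A x =
     (if \<exists>P. expanding_limit T A x P then (THE P. expanding_limit T A x P)
      else line_of (unit_vec (dim_row (A x)) 0))"


section \<open>Spaces of cocycles\<close>

definition Linf_norm :: "'a measure \<Rightarrow> ('a \<Rightarrow> real mat) \<Rightarrow> ereal" where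
  "Linf_norm M A = esssup M (\<lambda>x. ereal (mat_norm (A x)))"

definition bounded_cocycle :: "'a measure \<Rightarrow> nat \<Rightarrow> ('a \<Rightarrow> real mat) \<Rightarrow> bool" where
  "bounded_cocycle M m A \<longleftrightarrow>
     (\<forall>x\<in>space M. A x \<in> carrier_mat m m) \<and>
     (\<forall>i<m. \<forall>j<m. (\<lambda>x. A x $$ (i, j)) \<in> borel_measurable M) \<and>
     Linf_norm M A < \<infinity>"

text \<open>\<open>C m\<close> is the set of \<open>Mat(m, \<real>)\<close>-valued elements (\<open>m \<ge> 1\<close>) and \<open>dst m\<close> its distance.\<close>

definition cocycle_space ::
    "'a measure \<Rightarrow> (nat \<Rightarrow> ('a \<Rightarrow> real mat) set)
      \<Rightarrow> (nat \<Rightarrow> ('a \<Rightarrow> real mat) \<Rightarrow> ('a \<Rightarrow> real mat) \<Rightarrow> real) \<Rightarrow> bool" where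
  "cocycle_space M C dst \<longleftrightarrow>
     C 0 = {} \<and>
     (\<forall>m. \<forall>A\<in>C m. bounded_cocycle M m A) \<and>
     (\<forall>m. \<forall>A\<in>C m. \<forall>k\<in>{1..m}. (\<lambda>x. ext_power k (A x)) \<in> C (m choose k)) \<and>
     (\<forall>m. Metric_space (C m) (dst m)) \<and>
     (\<forall>m. \<forall>A\<in>C m. \<forall>B\<in>C m. Linf_norm M (\<lambda>x. B x - A x) \<le> ereal (dst m B A)) \<and>
     (\<forall>m. \<forall>A\<in>C m. \<forall>k\<in>{1..m}. \<exists>r>0. \<exists>K. \<forall>B\<^sub>1\<in>C m. \<forall>B\<^sub>2\<in>C m.
        dst m B\<^sub>1 A < r \<longrightarrow> dst m B\<^sub>2 A < r \<longrightarrow>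
        dst (m choose k) (\<lambda>x. ext_power k (B\<^sub>1 x)) (\<lambda>x. ext_power k (B\<^sub>2 x)) \<le> K * dst m B\<^sub>1 B\<^sub>2)"

definition L2_norm_ereal :: "'a measure \<Rightarrow> ('a \<Rightarrow> ereal) \<Rightarrow> ennreal" where
  "L2_norm_ereal M f =
     (let I = \<integral>\<^sup>+x. (e2ennreal \<bar>f x\<bar>)\<^sup>2 \<partial>M in if I = \<infinity> then \<infinity> else ennreal (sqrt (enn2real I)))"

definition uniformly_L2_bounded ::
    "'a measure \<Rightarrow> ('a \<Rightarrow> 'a) \<Rightarrow> (nat \<Rightarrow> ('a \<Rightarrow> real mat) set)
      \<Rightarrow> (nat \<Rightarrow> ('a \<Rightarrow> real mat) \<Rightarrow> ('a \<Rightarrow> real mat) \<Rightarrow> real) \<Rightarrow> nat \<Rightarrow> ('a \<Rightarrow> real mat) \<Rightarrow> bool" where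
  "uniformly_L2_bounded M T C dst m A \<longleftrightarrow>
     (\<exists>\<delta>>0. \<exists>K::real. \<forall>n\<ge>1. \<forall>B\<in>C m. dst m B A < \<delta> \<longrightarrow>
        L2_norm_ereal M (finite_scale_log T B n) < ennreal K)"


section \<open>Observables and compatibility\<close>

definition norm_level_algebra ::
    "'a measure \<Rightarrow> ('a \<Rightarrow> 'a) \<Rightarrow> ('a \<Rightarrow> real mat) \<Rightarrow> nat \<Rightarrow> 'a set set" where
  "norm_level_algebra M T A N =
     Sigma_Algebra.algebra (space M) hull
       ({{x \<in> space M. mat_norm (iterate T A n x) \<le> c} | n c. n \<le> N \<and> 0 \<le> c} \<union>
        {{x \<in> space M. mat_norm (iterate T A n x) \<ge> c} | n c. n \<le> N \<and> 0 \<le> c})"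

definition compatible ::
    "'a measure \<Rightarrow> ('a \<Rightarrow> 'a) \<Rightarrow> ('a \<Rightarrow> real) set \<Rightarrow> ('a \<Rightarrow> real mat) \<Rightarrow> bool" where
  "compatible M T \<Xi> A \<longleftrightarrow>
     (\<forall>N. \<forall>F\<in>norm_level_algebra M T A N. \<forall>\<epsilon>>0. \<exists>\<xi>\<in>\<Xi>.
        (\<forall>x\<in>space M. indicator F x \<le> \<xi> x) \<and>
        integrable M \<xi> \<and> integral\<^sup>L M \<xi> \<le> measure M F + \<epsilon>)"


section \<open>Large deviation estimates\<close>

type_synonym ldt_param = "nat \<times> (real \<Rightarrow> real) \<times> (real \<Rightarrow> real)"

definition is_ldt_param :: "ldt_param \<Rightarrow> bool" where
  "is_ldt_param = (\<lambda>(n\<^sub>0, \<epsilon>, \<iota>).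
     (\<forall>t>0. \<epsilon> t > 0 \<and> \<iota> t > 0) \<and>
     antimono_on {0<..} \<epsilon> \<and>
     continuous_on {0<..} \<iota> \<and> strict_antimono_on {0<..} \<iota> \<and> (\<iota> \<longlongrightarrow> 0) at_top \<and>
     (\<exists>c\<^sub>0>0. \<forall>\<^sub>F t in at_top. exp (- c\<^sub>0 * t) < \<iota> t \<and> \<iota> t < t powr (-10)))"

text \<open>Integrability of the observable is implicit in the presence of its (finite) integral.
  Scales are positive, hence the restriction to \<open>n \<ge> 1\<close> below.\<close>

definition base_LDT ::
    "'a measure \<Rightarrow> ('a \<Rightarrow> 'a) \<Rightarrow> ldt_param set \<Rightarrow> ('a \<Rightarrow> real) \<Rightarrow> bool" where
  "base_LDT M T \<P> \<xi> \<longleftrightarrow>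
     integrable M \<xi> \<and>
     (\<forall>e>0. \<exists>(n\<^sub>0, \<epsilon>, \<iota>)\<in>\<P>. \<forall>n\<ge>1. n \<ge> n\<^sub>0 \<longrightarrow>
        \<epsilon> (real n) \<le> e \<and>
        measure M {x \<in> space M.
          \<bar>1 / real n * (\<Sum>j<n. \<xi> ((T ^^ j) x)) - integral\<^sup>L M \<xi>\<bar> > \<epsilon> (real n)} < \<iota> (real n))"

definition uniform_fiber_LDT ::
    "'a measure \<Rightarrow> ('a \<Rightarrow> 'a) \<Rightarrow> (nat \<Rightarrow> ('a \<Rightarrow> real mat) set)
      \<Rightarrow> (nat \<Rightarrow> ('a \<Rightarrow> real mat) \<Rightarrow> ('a \<Rightarrow> real mat) \<Rightarrow> real)
      \<Rightarrow> ldt_param set \<Rightarrow> nat \<Rightarrow> ('a \<Rightarrow> real mat) \<Rightarrow> bool" where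
  "uniform_fiber_LDT M T C dst \<P> m A \<longleftrightarrow>
     (\<forall>e>0. \<exists>(n\<^sub>0, \<epsilon>, \<iota>)\<in>\<P>. \<exists>r>0. \<forall>B\<in>C m. dst m B A < r \<longrightarrow>
       (\<forall>n\<ge>1. n \<ge> n\<^sub>0 \<longrightarrow>
          \<epsilon> (real n) \<le> e \<and>
          measure M {x \<in> space M.
            \<bar>finite_scale_log T B n x - lyap_fin M T B n\<bar> > ereal (\<epsilon> (real n))} < \<iota> (real n)))"

text \<open>Finite non-empty linear combinations with positive coefficients of third components.\<close>

definition deviation_functions :: "ldt_param set \<Rightarrow> (real \<Rightarrow> real) set" where
  "deviation_functions \<P> =
     {\<lambda>t. \<Sum>\<iota>\<in>S. a \<iota> * \<iota> t | S a.
        finite S \<and> S \<noteq> {} \<and> S \<subseteq> (\<lambda>(n\<^sub>0, \<epsilon>, \<iota>). \<iota>) ` \<P> \<and> (\<forall>\<iota>\<in>S. a \<iota> > 0)}"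

definition deviation_modulus :: "real \<Rightarrow> (real \<Rightarrow> real) \<Rightarrow> real \<Rightarrow> real" where
  "deviation_modulus c \<iota> h = (\<iota> (c * ln (1 / h))) powr (1 / 2)"

end

theory Submission
  imports Defs
begin

text \<open>Continuity of the most expanding direction of \<open>B\<^bsup>(n)\<^esup>\<close> at a fixed scale \<open>n\<close> is elementary: where
  \<open>s\<^sub>2(B\<^bsup>(n)\<^esup>) / s\<^sub>1(B\<^bsup>(n)\<^esup>)\<close> is small, perturbing the matrix or multiplying it on the left by one more factor moves the
  direction by little (\<open>hs_dist_most_expanding_perturb\<close>, \<open>hs_dist_most_expanding_mult\<close>).  If, outside a set
  of measure \<open>O(\<iota>\<^sub>n)\<close>, the norm of \<open>B\<^bsup>(n)\<^esup>\<close> is close to \<open>e\<^bsup>l n\<^esup>\<close> and its second singular value exponentially smaller,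
  then outside a set of measure \<open>O(\<Sum>\<^bsub>j\<ge>n\<^esub> \<iota>\<^sub>j)\<close> the directions converge, and the one at scale \<open>n\<close> is exponentially
  close to the limit (\<open>direction_convergence\<close>).  For two cocycles at distance \<open>h\<close> one compares the directions at a
  scale \<open>n\<close> proportional to \<open>log (1/h)\<close>, at which \<open>h e\<^bsup>W n\<^esup>\<close> is still a small power of \<open>h\<close> (\<open>compare_directions\<close>).
  The square root in the modulus pays for the sum over \<open>j \<ge> n\<close> (\<open>choose_scale\<close>).

  It remains to find such estimates for the norms that hold uniformly for all \<open>B\<close> near \<open>A\<close>.

  Upper bounds.  The set where no iterate of \<open>A\<close> up to time \<open>N\<close> realises a given growth bound belongs to the algebra
  generated by norm level sets and is small for large \<open>N\<close>.  An observable dominates it, so the base estimate controls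
  the visits of orbits to it, and splitting orbits into good blocks gives the growth bound for every \<open>B\<close> near \<open>A\<close>
  outside a set of measure \<open>\<iota>\<^sub>n\<close> (\<open>uniform_upper_bound\<close>).  Applied to \<open>A\<close> itself, this shows that the first exponent
  exists (\<open>exponent_exists\<close>).  Applied to the exterior square, whose norm is comparable to \<open>s\<^sub>1 s\<^sub>2\<close>, it
  bounds \<open>s\<^sub>2\<close> once \<open>s\<^sub>1\<close> is bounded from below.

  Lower bounds.  By the fiber estimate it suffices to bound the means \<open>u n\<close> of \<open>(1/n) log \<parallel>B\<^bsup>(n)\<^esup>\<parallel>\<close> from below at all
  scales, uniformly in \<open>B\<close>.  A matrix with a large gap is nearly of rank one, and for such matrices
  \<open>\<parallel>g\<^sub>2 g\<^sub>1 g\<^sub>0\<parallel>\<close> is nearly \<open>\<parallel>g\<^sub>2 g\<^sub>1\<parallel> \<parallel>g\<^sub>1 g\<^sub>0\<parallel> / \<parallel>g\<^sub>1\<parallel>\<close> (\<open>norm_three_product\<close>).  For four consecutive blocks of length \<open>n\<close>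
  this is a lower bound for the norm at scale \<open>4n\<close> by those at scales \<open>n\<close> and \<open>2n\<close>; it is integrated with the
  help of the \<open>L\<^sup>2\<close> bound on the exceptional set (\<open>four_block\<close>).  By induction along \<open>n\<^sub>0, 2n\<^sub>0, 4n\<^sub>0, \<dots>\<close> the means
  never fall far below their initial values (\<open>dyadic_lower_bound\<close>), and at the two fixed scales \<open>n\<^sub>0\<close> and \<open>2n\<^sub>0\<close> these
  are close to the exponent of \<open>A\<close> by continuity (\<open>pinned_cocycle_near\<close>).

  The projective distance is handled through the Hilbert--Schmidt distance of orthogonal projections; this
  and power iteration also give the measurability of the limit directions (\<open>measurable_expanding_dir\<close>).\<close>

no_notation inner (infix \<open>\<bullet>\<close> 70)
no_notation vec_nth (infixl \<open>$\<close> 90)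

section \<open>Length of vectors and operator norm of matrices\<close>

lemma vec_len_L2_set: "vec_len v = L2_set (\<lambda>i. v $ i) {0..<dim_vec v}"
  by (simp add: vec_len_def L2_set_def scalar_prod_def power2_eq_square)

lemma vec_len_nonneg [simp]: "0 \<le> vec_len v"
  by (simp add: vec_len_L2_set)

lemma vec_len_sq: "(vec_len v)\<^sup>2 = v \<bullet> v"
  by (simp add: vec_len_def scalar_prod_def sum_nonneg)

lemma vec_len_eq_0_iff:
  assumes "v \<in> carrier_vec n" shows "vec_len v = 0 \<longleftrightarrow> v = 0\<^sub>v n"
  using assms by (auto simp: vec_len_L2_set L2_set_eq_0_iff intro!: eq_vecI)

lemma vec_len_smult [simp]: "vec_len (c \<cdot>\<^sub>v v) = \<bar>c\<bar> * vec_len v"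
proof -
  have "vec_len (c \<cdot>\<^sub>v v) = sqrt (c\<^sup>2 * (v \<bullet> v))"
    by (simp add: vec_len_def power2_eq_square mult.assoc)
  then show ?thesis by (simp add: real_sqrt_mult vec_len_def)
qed

lemma vec_len_zero [simp]: "vec_len (0\<^sub>v n) = 0"
  using vec_len_eq_0_iff[of "0\<^sub>v n" n] by simp

lemma vec_len_add:
  assumes "v \<in> carrier_vec n" "w \<in> carrier_vec n"
  shows "vec_len (v + w) \<le> vec_len v + vec_len w"
proof -
  have "vec_len (v + w) = L2_set (\<lambda>i. v $ i + w $ i) {0..<n}"
    using assms by (auto simp: vec_len_L2_set intro!: L2_set_cong)
  also have "\<dots> \<le> vec_len v + vec_len w"
    using L2_set_triangle_ineq[of "\<lambda>i. v $ i" "\<lambda>i. w $ i" "{0..<n}"] assms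
    by (simp add: vec_len_L2_set)
  finally show ?thesis .
qed

lemma vec_len_minus:
  assumes "v \<in> carrier_vec n" "w \<in> carrier_vec n"
  shows "vec_len v - vec_len w \<le> vec_len (v + w)"
proof -
  have "v = (v + w) + (-1) \<cdot>\<^sub>v w" using assms by (auto intro!: eq_vecI)
  then have "vec_len v \<le> vec_len (v + w) + vec_len ((-1) \<cdot>\<^sub>v w)"
    using assms vec_len_add[of "v + w" n "(-1) \<cdot>\<^sub>v w"] by simp
  then show ?thesis by simp
qed

lemma Cauchy_Schwarz_vec:
  assumes "v \<in> carrier_vec n" "w \<in> carrier_vec n"
  shows "\<bar>v \<bullet> w\<bar> \<le> vec_len v * vec_len w"
proof -
  have "\<bar>v \<bullet> w\<bar> \<le> (\<Sum>i = 0..<n. \<bar>v $ i\<bar> * \<bar>w $ i\<bar>)"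
    using assms by (auto simp: scalar_prod_def abs_mult intro: order_trans[OF sum_abs])
  also have "\<dots> \<le> vec_len v * vec_len w"
    using L2_set_mult_ineq[of "\<lambda>i. v $ i" "\<lambda>i. w $ i" "{0..<n}"] assms by (simp add: vec_len_L2_set)
  finally show ?thesis .
qed

lemma vec_len_ge_entry: "i < dim_vec v \<Longrightarrow> \<bar>v $ i\<bar> \<le> vec_len v"
proof -
  assume i: "i < dim_vec v"
  have "(v $ i)\<^sup>2 \<le> v \<bullet> v" unfolding scalar_prod_def power2_eq_square
    using i by (intro member_le_sum) auto
  then show ?thesis unfolding vec_len_def
    by (metis real_sqrt_abs real_sqrt_le_mono)
qed

lemma vec_len_le_sum: "vec_len v \<le> (\<Sum>i = 0..<dim_vec v. \<bar>v $ i\<bar>)"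
  unfolding vec_len_L2_set by (rule L2_set_le_sum_abs)

lemma vec_len_unit [simp]: "i < n \<Longrightarrow> vec_len (unit_vec n i) = 1"
  by (simp add: vec_len_def)

lemma mult_mat_vec_entry_sum:
  assumes "g \<in> carrier_mat r c" "v \<in> carrier_vec c"
  shows "vec_len (g *\<^sub>v v) \<le> (\<Sum>i<r. \<Sum>j<c. \<bar>g $$ (i, j)\<bar>) * vec_len v"
proof -
  have "vec_len (g *\<^sub>v v) \<le> (\<Sum>i = 0..<r. \<bar>(g *\<^sub>v v) $ i\<bar>)"
    using vec_len_le_sum[of "g *\<^sub>v v"] assms by simp
  also have "\<dots> \<le> (\<Sum>i = 0..<r. \<Sum>j<c. \<bar>g $$ (i, j)\<bar> * vec_len v)"
  proof (rule sum_mono)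
    fix i assume i: "i \<in> {0..<r}"
    have "\<bar>(g *\<^sub>v v) $ i\<bar> = \<bar>\<Sum>j = 0..<c. g $$ (i, j) * v $ j\<bar>"
      using i assms by (simp add: scalar_prod_def)
    also have "\<dots> \<le> (\<Sum>j = 0..<c. \<bar>g $$ (i, j)\<bar> * \<bar>v $ j\<bar>)"
      by (rule order_trans[OF sum_abs]) (simp add: abs_mult)
    also have "\<dots> \<le> (\<Sum>j = 0..<c. \<bar>g $$ (i, j)\<bar> * vec_len v)"
      using assms by (intro sum_mono mult_left_mono vec_len_ge_entry) auto
    finally show "\<bar>(g *\<^sub>v v) $ i\<bar> \<le> (\<Sum>j<c. \<bar>g $$ (i, j)\<bar> * vec_len v)"
      by (simp add: atLeast0LessThan)
  qed
  also have "\<dots> = (\<Sum>i<r. \<Sum>j<c. \<bar>g $$ (i, j)\<bar>) * vec_len v"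
    by (simp add: sum_distrib_right atLeast0LessThan)
  finally show ?thesis .
qed

lemma mat_norm_bdd:
  "bdd_above ((\<lambda>v. vec_len (g *\<^sub>v v)) ` {v \<in> carrier_vec (dim_col g). vec_len v \<le> 1})"
proof (rule bdd_aboveI2)
  fix v assume v: "v \<in> {v \<in> carrier_vec (dim_col g). vec_len v \<le> 1}"
  let ?S = "\<Sum>i<dim_row g. \<Sum>j<dim_col g. \<bar>g $$ (i, j)\<bar>"
  have "vec_len (g *\<^sub>v v) \<le> ?S * vec_len v"
    using v mult_mat_vec_entry_sum[of g "dim_row g" "dim_col g" v] by auto
  also have "\<dots> \<le> ?S" using v by (intro mult_left_le sum_nonneg) auto
  finally show "vec_len (g *\<^sub>v v) \<le> ?S" .
qed

lemma mat_norm_nonneg [simp]: "0 \<le> mat_norm g"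
  unfolding mat_norm_def
  by (rule cSUP_upper2[OF mat_norm_bdd, of "0\<^sub>v (dim_col g)"]) auto

lemma mat_norm_bound:
  assumes "g \<in> carrier_mat r c" "v \<in> carrier_vec c"
  shows "vec_len (g *\<^sub>v v) \<le> mat_norm g * vec_len v"
proof (cases "vec_len v = 0")
  case True
  then have "v = 0\<^sub>v c" using vec_len_eq_0_iff assms by blast
  then have "g *\<^sub>v v = 0\<^sub>v r" using assms by (auto intro!: eq_vecI)
  then show ?thesis using True by simp
next
  case False
  let ?u = "(1 / vec_len v) \<cdot>\<^sub>v v"
  have "vec_len (g *\<^sub>v ?u) \<le> mat_norm g" unfolding mat_norm_def
    by (rule cSUP_upper[OF _ mat_norm_bdd]) (use assms False in auto)
  moreover have "g *\<^sub>v ?u = (1 / vec_len v) \<cdot>\<^sub>v (g *\<^sub>v v)"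
    using assms by (simp add: mult_mat_vec)
  ultimately have "vec_len (g *\<^sub>v v) / vec_len v \<le> mat_norm g" by simp
  moreover have "vec_len v > 0" using False vec_len_nonneg[of v] by linarith
  ultimately show ?thesis by (simp add: pos_divide_le_eq)
qed

lemma mat_norm_leI:
  assumes "g \<in> carrier_mat r c" "0 \<le> t"
    and "\<And>v. v \<in> carrier_vec c \<Longrightarrow> vec_len (g *\<^sub>v v) \<le> t * vec_len v"
  shows "mat_norm g \<le> t"
  unfolding mat_norm_def
proof (rule cSUP_least)
  show "{v \<in> carrier_vec (dim_col g). vec_len v \<le> 1} \<noteq> {}"
    by (auto intro!: exI[of _ "0\<^sub>v (dim_col g)"])
  fix v assume "v \<in> {v \<in> carrier_vec (dim_col g). vec_len v \<le> 1}"
  then have v: "v \<in> carrier_vec c" "vec_len v \<le> 1" using assms by auto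
  have "vec_len (g *\<^sub>v v) \<le> t * vec_len v" using assms(3) v by auto
  also have "\<dots> \<le> t" using v assms(2) by (simp add: mult_left_le)
  finally show "vec_len (g *\<^sub>v v) \<le> t" .
qed

lemma mat_norm_le_entry_sum:
  assumes "g \<in> carrier_mat r c"
  shows "mat_norm g \<le> (\<Sum>i<r. \<Sum>j<c. \<bar>g $$ (i, j)\<bar>)"
  using assms by (intro mat_norm_leI mult_mat_vec_entry_sum sum_nonneg) auto

lemma mat_norm_mult:
  assumes "g \<in> carrier_mat r k" "h \<in> carrier_mat k c"
  shows "mat_norm (g * h) \<le> mat_norm g * mat_norm h"
proof (rule mat_norm_leI[of _ r c])
  fix v :: "real vec" assume v: "v \<in> carrier_vec c"
  have "vec_len ((g * h) *\<^sub>v v) = vec_len (g *\<^sub>v (h *\<^sub>v v))" using assms v by simp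
  also have "\<dots> \<le> mat_norm g * vec_len (h *\<^sub>v v)"
    using assms v by (intro mat_norm_bound) auto
  also have "\<dots> \<le> mat_norm g * (mat_norm h * vec_len v)"
    using assms v by (intro mult_left_mono mat_norm_bound) auto
  finally show "vec_len (g * h *\<^sub>v v) \<le> mat_norm g * mat_norm h * vec_len v" by (simp add: mult.assoc)
qed (use assms in auto)

lemma mat_norm_add:
  assumes "g \<in> carrier_mat r c" "h \<in> carrier_mat r c"
  shows "mat_norm (g + h) \<le> mat_norm g + mat_norm h"
proof (rule mat_norm_leI[of _ r c])
  fix v :: "real vec" assume v: "v \<in> carrier_vec c"
  have "vec_len ((g + h) *\<^sub>v v) \<le> vec_len (g *\<^sub>v v) + vec_len (h *\<^sub>v v)"
    using assms v by (simp add: add_mult_distrib_mat_vec vec_len_add[of _ r])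
  also have "\<dots> \<le> mat_norm g * vec_len v + mat_norm h * vec_len v"
    using assms v by (intro add_mono mat_norm_bound) auto
  finally show "vec_len ((g + h) *\<^sub>v v) \<le> (mat_norm g + mat_norm h) * vec_len v"
    by (simp add: distrib_right)
qed (use assms in auto)

lemma mat_norm_uminus:
  assumes "g \<in> carrier_mat r c" shows "mat_norm (- g) = mat_norm g"
proof -
  have "vec_len (- g *\<^sub>v v) = vec_len (g *\<^sub>v v)" if "v \<in> carrier_vec c" for v
  proof -
    have "- g *\<^sub>v v = (-1) \<cdot>\<^sub>v (g *\<^sub>v v)"
      using assms that by (auto intro!: eq_vecI)
    then show ?thesis by simp
  qed
  then show ?thesis using assms unfolding mat_norm_def by (auto intro!: SUP_cong)
qed

lemma mat_norm_diff_commute: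
  assumes "g \<in> carrier_mat r c" "h \<in> carrier_mat r c"
  shows "mat_norm (g - h) = mat_norm (h - g)"
proof -
  have "g - h = - (h - g)" using assms by (auto intro!: eq_matI)
  then show ?thesis using mat_norm_uminus[of "h - g" r c] assms by (metis minus_carrier_mat)
qed

lemma mat_norm_one [simp]: "n \<ge> 1 \<Longrightarrow> mat_norm (1\<^sub>m n) = 1"
proof (rule antisym)
  show "mat_norm (1\<^sub>m n) \<le> 1" by (rule mat_norm_leI[of _ n n]) auto
  assume "n \<ge> 1"
  then show "1 \<le> mat_norm (1\<^sub>m n)"
    using mat_norm_bound[of "1\<^sub>m n" n n "unit_vec n 0"] by simp
qed

lemma scalar_prod_transpose:
  fixes g :: "real mat"
  assumes "g \<in> carrier_mat r c" "v \<in> carrier_vec c" "w \<in> carrier_vec r"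
  shows "(g *\<^sub>v v) \<bullet> w = v \<bullet> (transpose_mat g *\<^sub>v w)"
  using assms transpose_vec_mult_scalar[of g r c v w] comm_scalar_prod[of "g *\<^sub>v v" r w]
  by (metis comm_scalar_prod mult_mat_vec_carrier transpose_carrier_mat)

lemma scalar_prod_gram:
  fixes g :: "real mat"
  assumes "g \<in> carrier_mat r c" "v \<in> carrier_vec c" "w \<in> carrier_vec c"
  shows "(g *\<^sub>v v) \<bullet> (g *\<^sub>v w) = v \<bullet> ((transpose_mat g * g) *\<^sub>v w)"
  using assms scalar_prod_transpose[of g r c v "g *\<^sub>v w"] by simp

section \<open>Spectral theorem for real symmetric matrices\<close>

text \<open>The fundamental theorem of algebra provides a complex eigenvalue.  It is real: compare \<open>A a \<bullet> b\<close> with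
  \<open>a \<bullet> A b\<close> for the real part \<open>a\<close> and the imaginary part \<open>b\<close> of an eigenvector.\<close>

lemma symmetric_real_eigenvector:
  fixes A :: "real mat"
  assumes A: "A \<in> carrier_mat n n" and sym: "transpose_mat A = A" and n: "n > 0"
  obtains e v where "v \<in> carrier_vec n" "vec_len v = 1" "A *\<^sub>v v = e \<cdot>\<^sub>v v"
proof -
  define Ac where "Ac = map_mat complex_of_real A"
  have Ac: "Ac \<in> carrier_mat n n" using A by (simp add: Ac_def)
  have "degree (char_poly Ac) = n" using degree_monic_char_poly[OF Ac] by simp
  then have "\<not> constant (poly (char_poly Ac))" using n by (simp add: constant_degree)
  then obtain k where "poly (char_poly Ac) k = 0" using fundamental_theorem_of_algebra by blast
  then have "eigenvalue Ac k" using eigenvalue_root_char_poly[OF Ac] by simp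
  then obtain w where w: "w \<in> carrier_vec n" "w \<noteq> 0\<^sub>v n" "Ac *\<^sub>v w = k \<cdot>\<^sub>v w"
    unfolding eigenvalue_def eigenvector_def using Ac by auto
  define a where "a = map_vec Re w"
  define b where "b = map_vec Im w"
  have a: "a \<in> carrier_vec n" and b: "b \<in> carrier_vec n" using w by (auto simp: a_def b_def)
  have comp: "(\<Sum>j = 0..<n. complex_of_real (A $$ (i, j)) * w $ j) = k * w $ i" if "i < n" for i
    using arg_cong[OF w(3), of "\<lambda>v. v $ i"] that w(1) A
    by (simp add: Ac_def scalar_prod_def)
  have Aa: "A *\<^sub>v a = Re k \<cdot>\<^sub>v a - Im k \<cdot>\<^sub>v b"
  proof (rule eq_vecI)
    fix i assume "i < dim_vec (Re k \<cdot>\<^sub>v a - Im k \<cdot>\<^sub>v b)"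
    then have i: "i < n" using b by auto
    from arg_cong[OF comp[OF i], of Re]
    show "(A *\<^sub>v a) $ i = (Re k \<cdot>\<^sub>v a - Im k \<cdot>\<^sub>v b) $ i"
      using i w(1) A by (simp add: scalar_prod_def a_def b_def)
  qed (use A b in auto)
  have Ab: "A *\<^sub>v b = Re k \<cdot>\<^sub>v b + Im k \<cdot>\<^sub>v a"
  proof (rule eq_vecI)
    fix i assume "i < dim_vec (Re k \<cdot>\<^sub>v b + Im k \<cdot>\<^sub>v a)"
    then have i: "i < n" using a by auto
    from arg_cong[OF comp[OF i], of Im]
    show "(A *\<^sub>v b) $ i = (Re k \<cdot>\<^sub>v b + Im k \<cdot>\<^sub>v a) $ i"
      using i w(1) A by (simp add: scalar_prod_def a_def b_def)
  qed (use A a in auto)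
  have "(A *\<^sub>v a) \<bullet> b = a \<bullet> (A *\<^sub>v b)"
    using scalar_prod_transpose[OF A a b] sym by simp
  then have "Im k * (a \<bullet> a + b \<bullet> b) = 0"
    unfolding Aa Ab using a b
    by (simp add: minus_scalar_prod_distrib[of _ n] scalar_prod_add_distrib[of _ n] algebra_simps)
  moreover have "a \<bullet> a + b \<bullet> b \<noteq> 0"
  proof
    assume "a \<bullet> a + b \<bullet> b = 0"
    then have "(vec_len a)\<^sup>2 + (vec_len b)\<^sup>2 = 0" by (simp add: vec_len_sq)
    then have "vec_len a = 0" "vec_len b = 0" by (auto simp: sum_power2_eq_zero_iff)
    then have ab: "a = 0\<^sub>v n" "b = 0\<^sub>v n" using vec_len_eq_0_iff a b by auto
    have "w = 0\<^sub>v n"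
    proof (rule eq_vecI)
      fix i assume "i < dim_vec (0\<^sub>v n)"
      then have i: "i < n" by simp
      have "Re (w $ i) = 0" using arg_cong[OF ab(1), of "\<lambda>v. v $ i"] i w(1) by (simp add: a_def)
      moreover have "Im (w $ i) = 0" using arg_cong[OF ab(2), of "\<lambda>v. v $ i"] i w(1) by (simp add: b_def)
      ultimately show "w $ i = 0\<^sub>v n $ i" using i by (simp add: complex_eq_iff)
    qed (use w in auto)
    with w show False by simp
  qed
  ultimately have k: "Im k = 0" by simp
  have "\<exists>v e. v \<in> carrier_vec n \<and> v \<noteq> 0\<^sub>v n \<and> A *\<^sub>v v = e \<cdot>\<^sub>v v"
  proof (cases "a = 0\<^sub>v n")
    case False
    have "A *\<^sub>v a = Re k \<cdot>\<^sub>v a" unfolding Aa k using a b by (auto intro!: eq_vecI)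
    with a False show ?thesis by blast
  next
    case True
    have "A *\<^sub>v b = Re k \<cdot>\<^sub>v b" unfolding Ab k using a b by (auto intro!: eq_vecI)
    moreover have "b \<noteq> 0\<^sub>v n"
      using \<open>a \<bullet> a + b \<bullet> b \<noteq> 0\<close> True by auto
    ultimately show ?thesis using b by blast
  qed
  then obtain v e where v: "v \<in> carrier_vec n" "v \<noteq> 0\<^sub>v n" "A *\<^sub>v v = e \<cdot>\<^sub>v v" by blast
  have l: "vec_len v \<noteq> 0" using v vec_len_eq_0_iff by blast
  define u where "u = (1 / vec_len v) \<cdot>\<^sub>v v"
  have "A *\<^sub>v u = e \<cdot>\<^sub>v u" unfolding u_def using v A by (simp add: mult_mat_vec smult_smult_assoc mult.commute)
  moreover have "vec_len u = 1" using l by (simp add: u_def)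
  moreover have "u \<in> carrier_vec n" using v by (simp add: u_def)
  ultimately show thesis using that by blast
qed

text \<open>The Householder reflection exchanging two unit vectors replaces the choice of an orthonormal basis
  extending a given unit vector.\<close>

lemma householder:
  fixes v w :: "real vec"
  assumes v: "v \<in> carrier_vec n" "vec_len v = 1" and w: "w \<in> carrier_vec n" "vec_len w = 1"
  obtains W where "W \<in> carrier_mat n n" "transpose_mat W = W" "W * W = 1\<^sub>m n" "W *\<^sub>v w = v"
proof (cases "v = w")
  case True
  show thesis by (rule that[of "1\<^sub>m n"]) (use True w in auto)
next
  case False
  define u where "u = w - v"
  have u: "u \<in> carrier_vec n" using v w by (simp add: u_def)
  define s where "s = u \<bullet> u"
  have vv: "v \<bullet> v = 1" "w \<bullet> w = 1" using v w vec_len_sq[of v] vec_len_sq[of w] by auto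
  have vw: "v \<bullet> w = w \<bullet> v" using v w comm_scalar_prod by blast
  have s2: "s = 2 - 2 * (w \<bullet> v)" unfolding s_def u_def using v w vv vw
    by (simp add: minus_scalar_prod_distrib[of _ n] scalar_prod_minus_distrib[of _ n])
  have "u \<noteq> 0\<^sub>v n"
  proof
    assume u0: "u = 0\<^sub>v n"
    have "v = w"
    proof (rule eq_vecI)
      fix i assume "i < dim_vec w"
      then have "i < n" using w by simp
      then show "v $ i = w $ i" using arg_cong[OF u0, of "\<lambda>v. v $ i"] v w by (simp add: u_def)
    qed (use v w in auto)
    with False show False ..
  qed
  then have s0: "s \<noteq> 0" unfolding s_def using vec_len_sq[of u] vec_len_eq_0_iff[OF u] by auto
  define W where "W = Matrix.mat n n (\<lambda>(i, j). (if i = j then 1 else 0) - 2 * u $ i * u $ j / s)"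
  have W: "W \<in> carrier_mat n n" by (simp add: W_def)
  have Wt: "transpose_mat W = W" by (auto simp: W_def intro!: eq_matI)
  have Wx: "(W *\<^sub>v x) $ i = x $ i - 2 * (u \<bullet> x) / s * u $ i" if "x \<in> carrier_vec n" "i < n" for x i
  proof -
    have "(W *\<^sub>v x) $ i = (\<Sum>j = 0..<n. ((if i = j then 1 else 0) - 2 * u $ i * u $ j / s) * x $ j)"
      using that by (simp add: W_def scalar_prod_def)
    also have "\<dots> = (\<Sum>j = 0..<n. (if i = j then x $ j else 0)) - 2 * u $ i / s * (\<Sum>j = 0..<n. u $ j * x $ j)"
      unfolding sum_distrib_left sum_subtractf[symmetric] by (intro sum.cong) (auto simp: algebra_simps)
    also have "(\<Sum>j = 0..<n. (if i = j then x $ j else 0)) = x $ i" using that by simp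
    also have "(\<Sum>j = 0..<n. u $ j * x $ j) = u \<bullet> x" using that by (simp add: scalar_prod_def)
    finally show ?thesis by simp
  qed
  have WW: "W *\<^sub>v (W *\<^sub>v x) = x" if x: "x \<in> carrier_vec n" for x
  proof -
    have "u \<bullet> (W *\<^sub>v x) = (\<Sum>i = 0..<n. u $ i * (x $ i - 2 * (u \<bullet> x) / s * u $ i))"
      using x W Wx by (simp add: scalar_prod_def[of u "W *\<^sub>v x"])
    also have "\<dots> = (\<Sum>i = 0..<n. u $ i * x $ i) - 2 * (u \<bullet> x) / s * (\<Sum>i = 0..<n. u $ i * u $ i)"
      unfolding sum_distrib_left sum_subtractf[symmetric] by (intro sum.cong) (auto simp: algebra_simps)
    also have "\<dots> = - (u \<bullet> x)" using u x s0 by (simp add: scalar_prod_def s_def)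
    finally have *: "u \<bullet> (W *\<^sub>v x) = - (u \<bullet> x)" .
    show ?thesis
    proof (rule eq_vecI)
      fix i assume "i < dim_vec x"
      then have i: "i < n" using x by simp
      have "W *\<^sub>v x \<in> carrier_vec n" using W x by simp
      from Wx[OF this i] Wx[OF x i] * show "(W *\<^sub>v (W *\<^sub>v x)) $ i = x $ i" by simp
    qed (use W x in auto)
  qed
  have WW1: "W * W = 1\<^sub>m n"
  proof (rule eq_matI)
    fix i j assume "i < dim_row (1\<^sub>m n)" "j < dim_col (1\<^sub>m n)"
    then have ij: "i < n" "j < n" by auto
    have "X $$ (i, j) = (X *\<^sub>v unit_vec n j) $ i" if "X \<in> carrier_mat n n" for X :: "real mat"
      using ij that by simp
    from this[OF mult_carrier_mat[OF W W]] have "(W * W) $$ (i, j) = ((W * W) *\<^sub>v unit_vec n j) $ i" .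
    also have "(W * W) *\<^sub>v unit_vec n j = unit_vec n j" using WW[of "unit_vec n j"] W by simp
    finally show "(W * W) $$ (i, j) = 1\<^sub>m n $$ (i, j)" using ij by simp
  qed (use W in auto)
  have "W *\<^sub>v w = v"
  proof (rule eq_vecI)
    fix i assume "i < dim_vec v"
    then have i: "i < n" using v by simp
    have "2 * (u \<bullet> w) = s" unfolding s2 u_def using v w vv vw
      by (simp add: minus_scalar_prod_distrib[of _ n])
    with Wx[OF w(1) i] s0 have "(W *\<^sub>v w) $ i = w $ i - u $ i" by simp
    then show "(W *\<^sub>v w) $ i = v $ i" using i v w by (simp add: u_def)
  qed (use W v in auto)
  with W Wt WW1 show thesis by (rule that)
qed

text \<open>Induction on the dimension.  Conjugation with a reflection that takes the first basis vector to an
  eigenvector splits off a block of size one.\<close>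

lemma spectral_theorem:
  fixes A :: "real mat"
  assumes "A \<in> carrier_mat n n" "transpose_mat A = A"
  shows "\<exists>V e. \<forall>i<n. V i \<in> carrier_vec n \<and> A *\<^sub>v V i = e i \<cdot>\<^sub>v V i \<and>
           (\<forall>j<n. V i \<bullet> V j = (if i = j then 1 else 0))"
  using assms
proof (induction n arbitrary: A)
  case 0 then show ?case by simp
next
  case (Suc n)
  note A = Suc.prems(1) and sym = Suc.prems(2)
  obtain e0 v where v: "v \<in> carrier_vec (Suc n)" "vec_len v = 1" "A *\<^sub>v v = e0 \<cdot>\<^sub>v v"
    using symmetric_real_eigenvector[OF A sym] by blast
  define f :: "real vec" where "f = unit_vec (Suc n) 0"
  have f: "f \<in> carrier_vec (Suc n)" "vec_len f = 1" unfolding f_def by auto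
  obtain W where W: "W \<in> carrier_mat (Suc n) (Suc n)" "transpose_mat W = W" "W * W = 1\<^sub>m (Suc n)" "W *\<^sub>v f = v"
    using householder[OF v(1,2) f] by blast
  have WWx: "W *\<^sub>v (W *\<^sub>v x) = x" if "x \<in> carrier_vec (Suc n)" for x
  proof -
    have "W *\<^sub>v (W *\<^sub>v x) = (W * W) *\<^sub>v x"
      using assoc_mult_mat_vec[OF W(1) W(1) that] by simp
    then show ?thesis using that W(3) by simp
  qed
  define A' where "A' = W * A * W"
  have A': "A' \<in> carrier_mat (Suc n) (Suc n)" using W A by (simp add: A'_def)
  have A's: "transpose_mat A' = A'"
  proof -
    have "transpose_mat A' = transpose_mat W * transpose_mat (W * A)"
      unfolding A'_def by (rule transpose_mult[OF mult_carrier_mat[OF W(1) A] W(1)])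
    also have "\<dots> = W * (A * W)" using W(2) sym transpose_mult[OF W(1) A] by simp
    finally show ?thesis unfolding A'_def using assoc_mult_mat[OF W(1) A W(1)] by simp
  qed
  have A'f: "A' *\<^sub>v f = e0 \<cdot>\<^sub>v f"
  proof -
    have "A' *\<^sub>v f = W *\<^sub>v (A *\<^sub>v (W *\<^sub>v f))" unfolding A'_def using W(1) A f(1) by (simp add: assoc_mult_mat_vec[of _ "Suc n" "Suc n" _ "Suc n"])
    also have "\<dots> = e0 \<cdot>\<^sub>v (W *\<^sub>v (W *\<^sub>v f))" using v(1,3) W(1,4) f(1) by (simp add: mult_mat_vec)
    finally show ?thesis using WWx f by simp
  qed
  have col0: "A' $$ (i, 0) = (if i = 0 then e0 else 0)" if "i < Suc n" for i
  proof -
    have "A' $$ (i, 0) = (A' *\<^sub>v f) $ i" using that A' by (simp add: f_def)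
    then show ?thesis using that unfolding A'f by (simp add: f_def)
  qed
  have row0: "A' $$ (0, i) = (if i = 0 then e0 else 0)" if "i < Suc n" for i
  proof -
    have "A' $$ (0, i) = transpose_mat A' $$ (i, 0)" using A' that by simp
    then show ?thesis using col0[OF that] A's by simp
  qed
  define A3 where "A3 = Matrix.mat n n (\<lambda>(i, j). A' $$ (Suc i, Suc j))"
  have A3: "A3 \<in> carrier_mat n n" by (simp add: A3_def)
  have A3s: "transpose_mat A3 = A3"
  proof (rule eq_matI)
    fix i j assume "i < dim_row A3" "j < dim_col A3"
    then have ij: "i < n" "j < n" by (auto simp: A3_def)
    have "A' $$ (Suc j, Suc i) = transpose_mat A' $$ (Suc i, Suc j)" using ij A' by simp
    then show "transpose_mat A3 $$ (i, j) = A3 $$ (i, j)" using ij A's by (simp add: A3_def)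
  qed (auto simp: A3_def)
  from Suc.IH[OF A3 A3s] obtain U e where
    U: "\<And>i. i < n \<Longrightarrow> U i \<in> carrier_vec n" "\<And>i. i < n \<Longrightarrow> A3 *\<^sub>v U i = e i \<cdot>\<^sub>v U i"
      "\<And>i j. i < n \<Longrightarrow> j < n \<Longrightarrow> U i \<bullet> U j = (if i = j then 1 else 0)" by blast
  define V where "V = (\<lambda>i. case i of 0 \<Rightarrow> f | Suc k \<Rightarrow> vCons 0 (U k))"
  define e' where "e' = (\<lambda>i. case i of 0 \<Rightarrow> e0 | Suc k \<Rightarrow> e k)"
  have fC: "f = vCons 1 (0\<^sub>v n)"
  proof (rule eq_vecI)
    fix i assume "i < dim_vec (vCons 1 (0\<^sub>v n))"
    then show "f $ i = vCons 1 (0\<^sub>v n) $ i" by (cases i) (auto simp: f_def)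
  qed (simp add: f_def)
  have VC: "V i \<in> carrier_vec (Suc n)" if "i < Suc n" for i
    using that f U by (cases i) (auto simp: V_def)
  have Vorth: "V i \<bullet> V j = (if i = j then 1 else 0)" if "i < Suc n" "j < Suc n" for i j
    using that U by (cases i; cases j) (auto simp: V_def fC)
  have Veig: "A' *\<^sub>v V i = e' i \<cdot>\<^sub>v V i" if i: "i < Suc n" for i
  proof (cases i)
    case 0 then show ?thesis using A'f by (simp add: V_def e'_def)
  next
    case (Suc k)
    then have k: "k < n" using i by simp
    show ?thesis
    proof (rule eq_vecI)
      fix l assume "l < dim_vec (e' i \<cdot>\<^sub>v V i)"
      then have l: "l < Suc n" using VC[OF i] by auto
      have "(A' *\<^sub>v V i) $ l = (\<Sum>j = 0..<Suc n. A' $$ (l, j) * V i $ j)"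
        using l A' VC[OF i] by (simp add: scalar_prod_def)
      also have "\<dots> = (\<Sum>j = 0..<n. A' $$ (l, Suc j) * U k $ j)"
        using U(1)[OF k] Suc by (simp add: sum.atLeast0_lessThan_Suc_shift V_def del: sum.op_ivl_Suc)
      also have "\<dots> = e k * V i $ l"
      proof (cases l)
        case 0 then show ?thesis using row0 Suc by (simp add: V_def)
      next
        case (Suc p)
        then have p: "p < n" using l by simp
        have "(\<Sum>j = 0..<n. A' $$ (l, Suc j) * U k $ j) = (A3 *\<^sub>v U k) $ p"
          using p U(1)[OF k] Suc by (simp add: A3_def scalar_prod_def)
        also have "\<dots> = e k * U k $ p" using U k p by (simp add: U(2)) (metis U(1) carrier_vecD index_smult_vec(1))
        finally show ?thesis using Suc \<open>i = Suc k\<close> U(1)[OF k] p by (simp add: V_def)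
      qed
      finally show "(A' *\<^sub>v V i) $ l = (e' i \<cdot>\<^sub>v V i) $ l" using l VC[OF i] Suc by (simp add: e'_def)
    qed (use A' VC[OF i] in auto)
  qed
  show ?case
  proof (intro exI[of _ "\<lambda>i. W *\<^sub>v V i"] exI[of _ e'] allI impI conjI)
    fix i assume i: "i < Suc n"
    show "W *\<^sub>v V i \<in> carrier_vec (Suc n)" using W VC[OF i] by simp
    have "A *\<^sub>v (W *\<^sub>v V i) = W *\<^sub>v (W *\<^sub>v (A *\<^sub>v (W *\<^sub>v V i)))"
      using WWx[of "A *\<^sub>v (W *\<^sub>v V i)"] A W(1) VC[OF i] by simp
    also have "W *\<^sub>v (A *\<^sub>v (W *\<^sub>v V i)) = A' *\<^sub>v V i"
      unfolding A'_def using W(1) A VC[OF i] by (simp add: assoc_mult_mat_vec[of _ "Suc n" "Suc n" _ "Suc n"])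
    finally show "A *\<^sub>v (W *\<^sub>v V i) = e' i \<cdot>\<^sub>v (W *\<^sub>v V i)"
      using Veig[OF i] W(1) VC[OF i] by (simp add: mult_mat_vec)
    fix j assume j: "j < Suc n"
    have "(W *\<^sub>v V i) \<bullet> (W *\<^sub>v V j) = V i \<bullet> ((transpose_mat W * W) *\<^sub>v V j)"
      using scalar_prod_gram[OF W(1) VC[OF i] VC[OF j]] .
    then show "(W *\<^sub>v V i) \<bullet> (W *\<^sub>v V j) = (if i = j then 1 else 0)"
      using Vorth[OF i j] W(2,3) VC[OF j] by simp
  qed
qed

section \<open>Singular values and right singular vectors\<close>

lemma orthonormal_matrix:
  fixes V :: "nat \<Rightarrow> real vec"
  assumes V: "\<And>i. i < m \<Longrightarrow> V i \<in> carrier_vec m"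
    and orth: "\<And>i j. i < m \<Longrightarrow> j < m \<Longrightarrow> V i \<bullet> V j = (if i = j then 1 else 0)"
  defines "P \<equiv> mat_of_cols m (map V [0..<m])"
  shows "P \<in> carrier_mat m m" "transpose_mat P * P = 1\<^sub>m m" "P * transpose_mat P = 1\<^sub>m m"
    "\<And>i. i < m \<Longrightarrow> col P i = V i"
proof -
  show P: "P \<in> carrier_mat m m" unfolding P_def by (metis length_map length_upt mat_of_cols_carrier(1) minus_nat.diff_0)
  show c: "col P i = V i" if "i < m" for i
    using that V unfolding P_def by (subst col_mat_of_cols) auto
  show PP: "transpose_mat P * P = 1\<^sub>m m"
  proof (rule eq_matI)
    fix i j assume "i < dim_row (1\<^sub>m m)" "j < dim_col (1\<^sub>m m)"
    then show "(transpose_mat P * P) $$ (i, j) = 1\<^sub>m m $$ (i, j)"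
      using P c orth by simp
  qed (use P in auto)
  show "P * transpose_mat P = 1\<^sub>m m"
    using mat_mult_left_right_inverse[OF _ P PP] P by simp
qed

lemma Parseval:
  fixes V :: "nat \<Rightarrow> real vec"
  assumes V: "\<And>i. i < m \<Longrightarrow> V i \<in> carrier_vec m"
    and orth: "\<And>i j. i < m \<Longrightarrow> j < m \<Longrightarrow> V i \<bullet> V j = (if i = j then 1 else 0)"
    and x: "x \<in> carrier_vec m" and y: "y \<in> carrier_vec m"
  shows "x \<bullet> y = (\<Sum>i<m. (V i \<bullet> x) * (V i \<bullet> y))"
proof -
  define P where "P = mat_of_cols m (map V [0..<m])"
  note P = orthonormal_matrix[of m V, OF V orth, folded P_def]
  have Pi: "(transpose_mat P *\<^sub>v z) $ i = V i \<bullet> z" if "i < m" "z \<in> carrier_vec m" for z i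
    using that P(1,4) by simp
  have "x \<bullet> y = (P *\<^sub>v (transpose_mat P *\<^sub>v x)) \<bullet> y"
    using P(1,3) x assoc_mult_mat_vec[of P m m "transpose_mat P" m x] by simp
  also have "\<dots> = (transpose_mat P *\<^sub>v x) \<bullet> (transpose_mat P *\<^sub>v y)"
    using scalar_prod_transpose[OF P(1) _ y, of "transpose_mat P *\<^sub>v x"] P(1) x by simp
  also have "\<dots> = (\<Sum>i<m. (transpose_mat P *\<^sub>v x) $ i * (transpose_mat P *\<^sub>v y) $ i)"
    using P(1) by (simp add: scalar_prod_def[of "transpose_mat P *\<^sub>v x"] atLeast0LessThan)
  also have "\<dots> = (\<Sum>i<m. (V i \<bullet> x) * (V i \<bullet> y))"
    using Pi x y by (intro sum.cong) auto
  finally show ?thesis .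
qed

lemma orthonormal_expansion_entry:
  fixes V :: "nat \<Rightarrow> real vec"
  assumes V: "\<And>i. i < m \<Longrightarrow> V i \<in> carrier_vec m"
    and orth: "\<And>i j. i < m \<Longrightarrow> j < m \<Longrightarrow> V i \<bullet> V j = (if i = j then 1 else 0)"
    and x: "x \<in> carrier_vec m" and k: "k < m"
  shows "x $ k = (\<Sum>i<m. V i $ k * (V i \<bullet> x))"
proof -
  have "x $ k = unit_vec m k \<bullet> x" using x k by simp
  also have "\<dots> = (\<Sum>i<m. (V i \<bullet> unit_vec m k) * (V i \<bullet> x))"
    using Parseval[OF V orth] x by simp
  also have "\<dots> = (\<Sum>i<m. V i $ k * (V i \<bullet> x))"
    using V k by (intro sum.cong) auto
  finally show ?thesis .
qed

definition right_singular_basis :: "nat \<Rightarrow> real mat \<Rightarrow> (nat \<Rightarrow> real vec) \<Rightarrow> bool" where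
  "right_singular_basis m g V \<longleftrightarrow>
     (\<forall>i<m. V i \<in> carrier_vec m \<and>
        (transpose_mat g * g) *\<^sub>v V i = (sing_val g (Suc i))\<^sup>2 \<cdot>\<^sub>v V i \<and>
        (\<forall>j<m. V i \<bullet> V j = (if i = j then 1 else 0)))"

text \<open>The roots of the characteristic polynomial of \<open>g\<^sup>* g\<close> are the eigenvalues produced by the spectral
  theorem, so sorting the eigenvectors by their eigenvalues matches them with the list of singular
  values.\<close>

lemma right_singular_basis_exists:
  assumes g: "g \<in> carrier_mat m m"
  shows "\<exists>V. right_singular_basis m g V"
    and "length (singular_values g) = m"
    and "\<And>i. i < m \<Longrightarrow> 0 \<le> sing_val g (Suc i)"
    and "\<And>i j. i \<le> j \<Longrightarrow> j < m \<Longrightarrow> sing_val g (Suc j) \<le> sing_val g (Suc i)"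
proof -
  define G where "G = transpose_mat g * g"
  have G: "G \<in> carrier_mat m m" using g by (simp add: G_def)
  have Gs: "transpose_mat G = G" using g by (simp add: G_def transpose_mult[of _ m m])
  from spectral_theorem[OF G Gs] obtain U e where
    U: "\<And>i. i < m \<Longrightarrow> U i \<in> carrier_vec m" and
    Ue: "\<And>i. i < m \<Longrightarrow> G *\<^sub>v U i = e i \<cdot>\<^sub>v U i" and
    Uo: "\<And>i j. i < m \<Longrightarrow> j < m \<Longrightarrow> U i \<bullet> U j = (if i = j then 1 else 0)" by blast
  define P where "P = mat_of_cols m (map U [0..<m])"
  note P = orthonormal_matrix[of m U, OF U Uo, folded P_def]
  define D where "D = Matrix.mat m m (\<lambda>(i, j). if i = j then e i else 0)"
  have D: "D \<in> carrier_mat m m" by (simp add: D_def)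
  have "transpose_mat P * (G * P) = D"
  proof (rule eq_matI)
    fix i j assume "i < dim_row D" "j < dim_col D"
    then have ij: "i < m" "j < m" by (auto simp: D_def)
    have "(transpose_mat P * (G * P)) $$ (i, j) = col P i \<bullet> col (G * P) j"
      using ij P(1) G by simp
    also have "col (G * P) j = G *\<^sub>v col P j" by (rule col_mult2[OF G P(1) ij(2)])
    also have "\<dots> = e j \<cdot>\<^sub>v U j" using ij P(4) Ue by simp
    finally show "(transpose_mat P * (G * P)) $$ (i, j) = D $$ (i, j)"
      using ij P(4) U[OF ij(1)] U[OF ij(2)] Uo[OF ij] by (simp add: D_def)
  qed (use P(1) G D in auto)
  then have "P * D * transpose_mat P = P * (transpose_mat P * (G * P)) * transpose_mat P" by simp
  also have "\<dots> = (P * transpose_mat P) * G * (P * transpose_mat P)"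
  proof -
    have T: "transpose_mat P \<in> carrier_mat m m" "G * P \<in> carrier_mat m m" using P(1) G by auto
    show ?thesis using P(1) G T
      by (smt (verit) assoc_mult_mat mult_carrier_mat)
  qed
  finally have GPD: "P * D * transpose_mat P = G" using P(3) G by simp
  have "similar_mat_wit G D P (transpose_mat P)"
    by (rule similar_mat_witI[of _ _ m]) (use P G D GPD in auto)
  then have "char_poly G = char_poly D" using char_poly_similar unfolding similar_mat_def by blast
  also have "\<dots> = (\<Prod>a\<leftarrow>diag_mat D. [:- a, 1:])"
    by (rule char_poly_upper_triangular[OF D]) (auto simp: D_def)
  also have "diag_mat D = map e [0..<m]" unfolding diag_mat_def D_def by (auto intro!: map_cong)
  finally have cp: "char_poly G = (\<Prod>a\<leftarrow>map e [0..<m]. [:- a, 1:])" .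
  have "proots (\<Prod>a\<leftarrow>xs. [:- a, 1:]) = mset xs" for xs :: "real list"
  proof (induction xs)
    case (Cons a xs)
    have "(\<Prod>a\<leftarrow>xs. [:- a, 1:]) \<noteq> 0" by (auto simp: prod_list_zero_iff)
    then show ?case using Cons by (simp add: proots_mult del: mult_pCons_left)
  qed simp
  then have pr: "proots (char_poly G) = mset (map e [0..<m])" unfolding cp by blast
  define s where "s = sqrt \<circ> e"
  define I where "I = rev (sort_key s [0..<m])"
  have Iset: "set I = {..<m}" "distinct I" "length I = m" by (auto simp: I_def)
  have sv: "singular_values g = map s I"
  proof -
    have "singular_values g = rev (sort (map s [0..<m]))"
      unfolding singular_values_def G_def[symmetric] pr s_def
      by (simp add: image_mset.compositionality mset_map[symmetric] del: mset_map)
    also have "sort (map s [0..<m]) = map s (sort_key s [0..<m])"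
      by (rule properties_for_sort) auto
    finally show ?thesis by (simp add: I_def rev_map)
  qed
  show "length (singular_values g) = m" using sv Iset by simp
  have svi: "sing_val g (Suc i) = s (I ! i)" if "i < m" for i
    using that Iset by (simp add: sing_val_def sv)
  have Ii: "I ! i < m" if "i < m" for i using that Iset nth_mem[of i I] by auto
  have epos: "0 \<le> e i" if i: "i < m" for i
  proof -
    have "(g *\<^sub>v U i) \<bullet> (g *\<^sub>v U i) = U i \<bullet> (e i \<cdot>\<^sub>v U i)"
      using scalar_prod_gram[OF g U[OF i] U[OF i]] Ue[OF i] by (simp add: G_def)
    also have "\<dots> = e i" using Uo[OF i i] U[OF i] by simp
    finally have "e i = (vec_len (g *\<^sub>v U i))\<^sup>2" by (simp add: vec_len_sq)
    then show ?thesis by simp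
  qed
  show "0 \<le> sing_val g (Suc i)" if "i < m" for i
    using svi[OF that] epos[OF Ii[OF that]] by (simp add: s_def)
  show "sing_val g (Suc j) \<le> sing_val g (Suc i)" if "i \<le> j" "j < m" for i j
  proof -
    have "sorted (map s (sort_key s [0..<m]))" by simp
    then have "sorted (rev (map s I))" by (simp add: I_def rev_map)
    then have "map s I ! j \<le> map s I ! i"
      using that Iset by (intro sorted_rev_nth_mono) auto
    then show ?thesis using that svi Iset by simp
  qed
  have "right_singular_basis m g (\<lambda>i. U (I ! i))"
    unfolding right_singular_basis_def
  proof (intro allI impI conjI)
    fix i assume i: "i < m"
    show "U (I ! i) \<in> carrier_vec m" using U Ii i by simp
    have "(sing_val g (Suc i))\<^sup>2 = e (I ! i)" using svi[OF i] epos[OF Ii[OF i]] by (simp add: s_def)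
    then show "transpose_mat g * g *\<^sub>v U (I ! i) = (sing_val g (Suc i))\<^sup>2 \<cdot>\<^sub>v U (I ! i)"
      using Ue[OF Ii[OF i]] by (simp add: G_def)
    fix j assume j: "j < m"
    show "U (I ! i) \<bullet> U (I ! j) = (if i = j then 1 else 0)"
      using Uo[OF Ii[OF i] Ii[OF j]] i j Iset by (simp add: nth_eq_iff_index_eq)
  qed
  then show "\<exists>V. right_singular_basis m g V" by blast
qed

context
  fixes m :: nat and g :: "real mat" and V :: "nat \<Rightarrow> real vec"
  assumes g: "g \<in> carrier_mat m m" and rsb: "right_singular_basis m g V"
begin

lemma rsb_carrier: "i < m \<Longrightarrow> V i \<in> carrier_vec m"
  and rsb_orth: "i < m \<Longrightarrow> j < m \<Longrightarrow> V i \<bullet> V j = (if i = j then 1 else 0)"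
  and rsb_eig: "i < m \<Longrightarrow> (transpose_mat g * g) *\<^sub>v V i = (sing_val g (Suc i))\<^sup>2 \<cdot>\<^sub>v V i"
  using rsb by (auto simp: right_singular_basis_def)

lemma rsb_len: "i < m \<Longrightarrow> vec_len (V i) = 1"
  using rsb_orth[of i i] by (simp add: vec_len_def)

lemma rsb_Parseval:
  "x \<in> carrier_vec m \<Longrightarrow> y \<in> carrier_vec m \<Longrightarrow> x \<bullet> y = (\<Sum>i<m. (V i \<bullet> x) * (V i \<bullet> y))"
  using Parseval[of m V x y] rsb_carrier rsb_orth by blast

lemma rsb_gram_coeff:
  assumes "i < m" "x \<in> carrier_vec m"
  shows "V i \<bullet> ((transpose_mat g * g) *\<^sub>v x) = (sing_val g (Suc i))\<^sup>2 * (V i \<bullet> x)"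
proof -
  have G: "transpose_mat (transpose_mat g * g) = transpose_mat g * g"
    using g by (simp add: transpose_mult[of _ m m])
  have "((transpose_mat g * g) *\<^sub>v V i) \<bullet> x = V i \<bullet> (transpose_mat (transpose_mat g * g) *\<^sub>v x)"
    using g assms rsb_carrier by (intro scalar_prod_transpose[of _ m m]) auto
  then show ?thesis using rsb_eig[OF assms(1)] assms rsb_carrier[OF assms(1)] unfolding G
    by (simp del: assoc_mult_mat_vec)
qed

lemma rsb_mult_coeff:
  assumes "i < m" "x \<in> carrier_vec m"
  shows "(g *\<^sub>v V i) \<bullet> (g *\<^sub>v x) = (sing_val g (Suc i))\<^sup>2 * (V i \<bullet> x)"
  using scalar_prod_gram[OF g rsb_carrier[OF assms(1)] assms(2)] rsb_gram_coeff[OF assms] by (simp only:)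

lemma rsb_norm_sq:
  assumes x: "x \<in> carrier_vec m"
  shows "(vec_len (g *\<^sub>v x))\<^sup>2 = (\<Sum>i<m. (sing_val g (Suc i))\<^sup>2 * (V i \<bullet> x)\<^sup>2)"
proof -
  have "(vec_len (g *\<^sub>v x))\<^sup>2 = x \<bullet> ((transpose_mat g * g) *\<^sub>v x)"
    using scalar_prod_gram[OF g x x] by (simp only: vec_len_sq)
  also have "\<dots> = (\<Sum>i<m. (V i \<bullet> x) * (V i \<bullet> ((transpose_mat g * g) *\<^sub>v x)))"
    using x g by (intro rsb_Parseval) auto
  also have "\<dots> = (\<Sum>i<m. (sing_val g (Suc i))\<^sup>2 * (V i \<bullet> x)\<^sup>2)"
    using rsb_gram_coeff x by (intro sum.cong) (auto simp: power2_eq_square simp del: assoc_mult_mat_vec)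
  finally show ?thesis .
qed

lemma rsb_len_mult: "i < m \<Longrightarrow> vec_len (g *\<^sub>v V i) = sing_val g (Suc i)"
proof -
  assume i: "i < m"
  have "(vec_len (g *\<^sub>v V i))\<^sup>2 = (sing_val g (Suc i))\<^sup>2"
    using rsb_mult_coeff[OF i rsb_carrier[OF i]] rsb_orth[OF i i] by (simp add: vec_len_sq)
  then show ?thesis using right_singular_basis_exists(3)[OF g i] vec_len_nonneg
    by (metis power2_eq_iff_nonneg)
qed

lemma rsb_tail_bound:
  assumes x: "x \<in> carrier_vec m" and k: "k < m" and orth: "\<And>i. i < k \<Longrightarrow> V i \<bullet> x = 0"
  shows "vec_len (g *\<^sub>v x) \<le> sing_val g (Suc k) * vec_len x"
proof -
  have "(vec_len (g *\<^sub>v x))\<^sup>2 \<le> (\<Sum>i<m. (sing_val g (Suc k))\<^sup>2 * (V i \<bullet> x)\<^sup>2)"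
    unfolding rsb_norm_sq[OF x]
  proof (rule sum_mono)
    fix i assume i: "i \<in> {..<m}"
    show "(sing_val g (Suc i))\<^sup>2 * (V i \<bullet> x)\<^sup>2 \<le> (sing_val g (Suc k))\<^sup>2 * (V i \<bullet> x)\<^sup>2"
    proof (cases "i < k")
      case True then show ?thesis using orth by simp
    next
      case False
      then have "sing_val g (Suc i) \<le> sing_val g (Suc k)"
        using right_singular_basis_exists(4)[OF g, of k i] i by simp
      then show ?thesis using right_singular_basis_exists(3)[OF g] i
        by (intro mult_right_mono power_mono) auto
    qed
  qed
  also have "\<dots> = (sing_val g (Suc k) * vec_len x)\<^sup>2"
    unfolding sum_distrib_left[symmetric] power_mult_distrib vec_len_sq rsb_Parseval[OF x x]
    by (simp add: power2_eq_square)
  finally show ?thesis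
    using right_singular_basis_exists(3)[OF g k] by (simp add: power2_le_iff_abs_le)
qed

lemma rsb_expansion:
  assumes "x \<in> carrier_vec m" "\<And>i. 0 < i \<Longrightarrow> i < m \<Longrightarrow> V i \<bullet> x = 0" "m \<ge> 1"
  shows "x = (V 0 \<bullet> x) \<cdot>\<^sub>v V 0"
proof (rule eq_vecI)
  fix k assume "k < dim_vec ((V 0 \<bullet> x) \<cdot>\<^sub>v V 0)"
  then have k: "k < m" using rsb_carrier[of 0] assms(3) by simp
  have "x $ k = (\<Sum>i<m. V i $ k * (V i \<bullet> x))"
    by (rule orthonormal_expansion_entry[OF rsb_carrier rsb_orth assms(1) k])
  also have "\<dots> = (\<Sum>i\<in>{0}. V i $ k * (V i \<bullet> x))"
    using assms by (intro sum.mono_neutral_right) (auto simp: Suc_le_eq)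
  finally show "x $ k = ((V 0 \<bullet> x) \<cdot>\<^sub>v V 0) $ k" using k rsb_carrier[of 0] assms(3) by (simp add: mult.commute)
qed (use assms rsb_carrier[of 0] in auto)

end

lemma sing_val_1_eq_norm:
  assumes g: "g \<in> carrier_mat m m" and m: "m \<ge> 1"
  shows "sing_val g 1 = mat_norm g"
proof -
  obtain V where V: "right_singular_basis m g V" using right_singular_basis_exists(1)[OF g] by blast
  have m0: "0 < m" using m by simp
  show ?thesis
  proof (rule antisym)
    show "sing_val g 1 \<le> mat_norm g"
      using mat_norm_bound[OF g rsb_carrier[OF g V m0]] rsb_len_mult[OF g V m0] rsb_len[OF g V m0]
      by simp
    show "mat_norm g \<le> sing_val g 1"
      by (rule mat_norm_leI[OF g])
        (use rsb_tail_bound[OF g V _ m0] right_singular_basis_exists(3)[OF g m0] in auto)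
  qed
qed

section \<open>Perturbing the top singular vector, and norms of products\<close>

text \<open>A unit vector whose orthogonal complement is contracted by \<open>g\<close> relative to \<open>\<parallel>g\<parallel>\<close> is close to the most
  expanding direction \<open>V\<^sub>0\<close>.  Let \<open>w\<close> be the component of \<open>V\<^sub>0\<close> orthogonal to \<open>v\<close>.  Testing
  \<open>g\<^sup>* g V\<^sub>0 = \<parallel>g\<parallel>\<^sup>2 V\<^sub>0\<close> against \<open>w\<close> gives \<open>\<parallel>g\<parallel>\<^sup>2 \<parallel>w\<parallel>\<^sup>2 = g V\<^sub>0 \<bullet> g w \<le> \<parallel>g\<parallel> t \<parallel>w\<parallel>\<close>.\<close>

lemma top_vector_deviation:
  assumes g: "g \<in> carrier_mat m m" and V: "right_singular_basis m g V" and m: "m \<ge> 1"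
    and v: "v \<in> carrier_vec m" "vec_len v = 1"
    and t: "0 \<le> t" "\<And>w. w \<in> carrier_vec m \<Longrightarrow> v \<bullet> w = 0 \<Longrightarrow> vec_len (g *\<^sub>v w) \<le> t * vec_len w"
  shows "sqrt (1 - (v \<bullet> V 0)\<^sup>2) * mat_norm g \<le> t"
proof -
  have m0: "0 < m" using m by simp
  note u = rsb_carrier[OF g V m0] and ul = rsb_len[OF g V m0] and uo = rsb_orth[OF g V m0 m0]
  define w where "w = V 0 + (- (v \<bullet> V 0)) \<cdot>\<^sub>v v"
  have w: "w \<in> carrier_vec m" using u v by (simp add: w_def)
  have vv: "v \<bullet> v = 1" using v vec_len_sq[of v] by simp
  have vw: "v \<bullet> w = 0" unfolding w_def using u v vv
    by (simp add: scalar_prod_add_distrib[of _ m])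
  have uw: "V 0 \<bullet> w = 1 - (v \<bullet> V 0)\<^sup>2" unfolding w_def using u v uo comm_scalar_prod[OF u v(1)]
    by (simp add: scalar_prod_add_distrib[of _ m] power2_eq_square)
  have ww: "(vec_len w)\<^sup>2 = 1 - (v \<bullet> V 0)\<^sup>2"
  proof -
    have "w \<bullet> w = V 0 \<bullet> w + (- (v \<bullet> V 0)) * (v \<bullet> w)"
      by (subst (1) w_def) (use u v w in \<open>simp add: add_scalar_prod_distrib[of _ m]\<close>)
    then show ?thesis using vw uw by (simp add: vec_len_sq)
  qed
  have s1: "sing_val g (Suc 0) = mat_norm g" using sing_val_1_eq_norm[OF g m] by simp
  have "(mat_norm g)\<^sup>2 * (vec_len w)\<^sup>2 = (g *\<^sub>v V 0) \<bullet> (g *\<^sub>v w)"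
    using rsb_mult_coeff[OF g V m0 w] s1 ww uw by simp
  also have "\<dots> \<le> vec_len (g *\<^sub>v V 0) * vec_len (g *\<^sub>v w)"
    using Cauchy_Schwarz_vec[of "g *\<^sub>v V 0" m "g *\<^sub>v w"] g u w by auto
  also have "\<dots> \<le> mat_norm g * (t * vec_len w)"
    using t(2)[OF w vw] rsb_len_mult[OF g V m0] s1 by (simp add: mult_left_mono)
  finally have "(mat_norm g * vec_len w) * (mat_norm g * vec_len w) \<le> t * (mat_norm g * vec_len w)"
    by (simp add: power2_eq_square mult_ac)
  then have "mat_norm g * vec_len w \<le> t"
    using t(1) mult_nonneg_nonneg[OF mat_norm_nonneg vec_len_nonneg, of g w]
    by (cases "mat_norm g * vec_len w = 0") (auto simp: mult_le_cancel_right)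
  moreover have "vec_len w = sqrt (1 - (v \<bullet> V 0)\<^sup>2)"
    using ww by (metis real_sqrt_unique vec_len_nonneg)
  ultimately show ?thesis by (simp add: mult.commute)
qed

text \<open>The elementary step behind the avalanche principle.  Up to an error of size \<open>s\<^sub>2(g\<^sub>1)\<close>, the matrix
  \<open>g\<^sub>1\<close> has rank one, and for a rank-one \<open>g\<^sub>1\<close> the norm of \<open>g\<^sub>2 g\<^sub>1 g\<^sub>0\<close> is exactly
  \<open>\<parallel>g\<^sub>2 g\<^sub>1\<parallel> \<parallel>g\<^sub>1 g\<^sub>0\<parallel> / \<parallel>g\<^sub>1\<parallel>\<close>.\<close>

lemma norm_three_product:
  assumes g0: "g0 \<in> carrier_mat m m" and g1: "g1 \<in> carrier_mat m m" and g2: "g2 \<in> carrier_mat m m"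
    and m: "m \<ge> 2"
  shows "mat_norm (g2 * g1) * mat_norm (g1 * g0) \<le>
    mat_norm g1 * mat_norm (g2 * (g1 * g0)) + 3 * mat_norm g1 * sing_val g1 2 * mat_norm g2 * mat_norm g0"
proof -
  obtain V where V: "right_singular_basis m g1 V" using right_singular_basis_exists(1)[OF g1] by blast
  have m0: "0 < m" "1 < m" using m by auto
  note u = rsb_carrier[OF g1 V m0(1)] and ul = rsb_len[OF g1 V m0(1)] and uo = rsb_orth[OF g1 V m0(1) m0(1)]
  define s1 where "s1 = mat_norm g1"
  define s2 where "s2 = sing_val g1 2"
  have s2: "0 \<le> s2" using right_singular_basis_exists(3)[OF g1 m0(2)] by (simp add: s2_def numeral_2_eq_2)
  have s1: "0 \<le> s1" by (simp add: s1_def)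
  have tail: "vec_len (g1 *\<^sub>v y) \<le> s2 * vec_len y" if "y \<in> carrier_vec m" "V 0 \<bullet> y = 0" for y
    using rsb_tail_bound[OF g1 V that(1) m0(2)] that(2) by (simp add: s2_def numeral_2_eq_2)
  have gV: "vec_len (g1 *\<^sub>v V 0) = s1"
    using rsb_len_mult[OF g1 V m0(1)] sing_val_1_eq_norm[OF g1] m by (simp add: s1_def)
  have split: "\<exists>y. y \<in> carrier_vec m \<and> V 0 \<bullet> y = 0 \<and> vec_len y \<le> vec_len x \<and> x = (V 0 \<bullet> x) \<cdot>\<^sub>v V 0 + y"
    if x: "x \<in> carrier_vec m" for x
  proof -
    let ?y = "x + (- (V 0 \<bullet> x)) \<cdot>\<^sub>v V 0"
    have y: "?y \<in> carrier_vec m" using x u by simp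
    have o: "V 0 \<bullet> ?y = 0" using x u uo by (simp add: scalar_prod_add_distrib[of _ m])
    have e: "x = (V 0 \<bullet> x) \<cdot>\<^sub>v V 0 + ?y" using x u by (auto intro!: eq_vecI)
    have "x \<bullet> x = (V 0 \<bullet> x)\<^sup>2 + ?y \<bullet> ?y"
    proof -
      have "x \<bullet> x = ((V 0 \<bullet> x) \<cdot>\<^sub>v V 0 + ?y) \<bullet> ((V 0 \<bullet> x) \<cdot>\<^sub>v V 0 + ?y)" using e by simp
      also have "\<dots> = (V 0 \<bullet> x)\<^sup>2 + ?y \<bullet> ?y"
        using u y o uo comm_scalar_prod[OF u y]
        by (simp add: scalar_prod_add_distrib[of _ m] add_scalar_prod_distrib[of _ m] power2_eq_square)
      finally show ?thesis .
    qed
    then have "(vec_len ?y)\<^sup>2 \<le> (vec_len x)\<^sup>2" by (simp add: vec_len_sq)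
    then have "vec_len ?y \<le> vec_len x" by (rule power2_le_imp_le) simp
    with y o e show ?thesis by blast
  qed
  \<comment> \<open>Up to errors of size \<open>s2\<close>, \<open>g1 * g0\<close> and \<open>g2 * g1\<close> are rank-one matrices of norms \<open>s1 \<parallel>z\<parallel>\<close> and \<open>a\<close>.\<close>
  define z where "z = transpose_mat g0 *\<^sub>v V 0"
  have z: "z \<in> carrier_vec m" using g0 u by (simp add: z_def)
  define a where "a = vec_len (g2 *\<^sub>v (g1 *\<^sub>v V 0))"
  have zV: "V 0 \<bullet> (g0 *\<^sub>v x) = z \<bullet> x" if "x \<in> carrier_vec m" for x
    using scalar_prod_transpose[OF g0 that u] comm_scalar_prod[OF u, of "g0 *\<^sub>v x"]
      comm_scalar_prod[OF z that] that g0 by (simp add: z_def)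
  have g1V: "g1 *\<^sub>v V 0 \<in> carrier_vec m" using g1 u by simp
  have dec: "\<exists>y. y \<in> carrier_vec m \<and> vec_len y \<le> s2 * vec_len x \<and> g1 *\<^sub>v x = (V 0 \<bullet> x) \<cdot>\<^sub>v (g1 *\<^sub>v V 0) + y"
    if x: "x \<in> carrier_vec m" for x
  proof -
    obtain y where y: "y \<in> carrier_vec m" "V 0 \<bullet> y = 0" "vec_len y \<le> vec_len x" "x = (V 0 \<bullet> x) \<cdot>\<^sub>v V 0 + y"
      using split[OF x] by blast
    have "g1 *\<^sub>v x = g1 *\<^sub>v ((V 0 \<bullet> x) \<cdot>\<^sub>v V 0 + y)" using y(4) by simp
    also have "\<dots> = (V 0 \<bullet> x) \<cdot>\<^sub>v (g1 *\<^sub>v V 0) + g1 *\<^sub>v y"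
      using g1 u y(1) by (simp add: mult_add_distrib_mat_vec[of _ m m] mult_mat_vec)
    finally show ?thesis using tail[OF y(1,2)] mult_left_mono[OF y(3) s2] g1 y(1)
      by (intro exI[of _ "g1 *\<^sub>v y"]) auto
  qed
  have A: "mat_norm (g1 * g0) \<le> s1 * vec_len z + s2 * mat_norm g0"
  proof (rule mat_norm_leI[of _ m m])
    fix x :: "real vec" assume x: "x \<in> carrier_vec m"
    obtain y where y: "y \<in> carrier_vec m" "vec_len y \<le> s2 * vec_len (g0 *\<^sub>v x)"
      "g1 *\<^sub>v (g0 *\<^sub>v x) = (V 0 \<bullet> (g0 *\<^sub>v x)) \<cdot>\<^sub>v (g1 *\<^sub>v V 0) + y"
      using dec[of "g0 *\<^sub>v x"] g0 x by auto
    have "vec_len (g1 * g0 *\<^sub>v x) = vec_len ((z \<bullet> x) \<cdot>\<^sub>v (g1 *\<^sub>v V 0) + y)"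
      using y(3) zV[OF x] g0 g1 x by simp
    also have "\<dots> \<le> \<bar>z \<bullet> x\<bar> * s1 + vec_len y"
      using vec_len_add[of "(z \<bullet> x) \<cdot>\<^sub>v (g1 *\<^sub>v V 0)" m y] g1V y(1) gV by simp
    also have "\<dots> \<le> (vec_len z * vec_len x) * s1 + s2 * (mat_norm g0 * vec_len x)"
      using Cauchy_Schwarz_vec[OF z x] s1 s2 y(2) mat_norm_bound[OF g0 x]
      by (intro add_mono mult_right_mono order_trans[OF y(2)] mult_left_mono) auto
    finally show "vec_len (g1 * g0 *\<^sub>v x) \<le> (s1 * vec_len z + s2 * mat_norm g0) * vec_len x"
      by (simp add: algebra_simps)
  qed (use g0 g1 s1 s2 in auto)
  have B: "mat_norm (g2 * g1) \<le> a + s2 * mat_norm g2"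
  proof (rule mat_norm_leI[of _ m m])
    fix x :: "real vec" assume x: "x \<in> carrier_vec m"
    obtain y where y: "y \<in> carrier_vec m" "vec_len y \<le> s2 * vec_len x"
      "g1 *\<^sub>v x = (V 0 \<bullet> x) \<cdot>\<^sub>v (g1 *\<^sub>v V 0) + y"
      using dec[OF x] by auto
    have "vec_len (g2 * g1 *\<^sub>v x) = vec_len ((V 0 \<bullet> x) \<cdot>\<^sub>v (g2 *\<^sub>v (g1 *\<^sub>v V 0)) + g2 *\<^sub>v y)"
      using y(1,3) g2 g1 g1V x by (simp add: mult_add_distrib_mat_vec[of _ m m] mult_mat_vec)
    also have "\<dots> \<le> \<bar>V 0 \<bullet> x\<bar> * a + vec_len (g2 *\<^sub>v y)"
      using vec_len_add[of "(V 0 \<bullet> x) \<cdot>\<^sub>v (g2 *\<^sub>v (g1 *\<^sub>v V 0))" m "g2 *\<^sub>v y"] g1V g2 y(1) by (simp add: a_def)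
    also have "\<dots> \<le> vec_len x * a + mat_norm g2 * (s2 * vec_len x)"
      using Cauchy_Schwarz_vec[OF u x] ul y(2) mat_norm_bound[OF g2 y(1)]
      by (intro add_mono mult_right_mono order_trans[OF mat_norm_bound[OF g2 y(1)]] mult_left_mono) (auto simp: a_def)
    finally show "vec_len (g2 * g1 *\<^sub>v x) \<le> (a + s2 * mat_norm g2) * vec_len x"
      by (simp add: algebra_simps)
  qed (use g2 g1 s2 in \<open>auto simp: a_def\<close>)
  have C: "vec_len z * a \<le> mat_norm (g2 * (g1 * g0)) + s2 * mat_norm g2 * mat_norm g0"
  proof (cases "vec_len z = 0")
    case True then show ?thesis using s2 by simp
  next
    case False
    then have zp: "0 < vec_len z" by (simp add: order_less_le)
    obtain y where y: "y \<in> carrier_vec m" "vec_len y \<le> s2 * vec_len (g0 *\<^sub>v z)"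
      "g1 *\<^sub>v (g0 *\<^sub>v z) = (V 0 \<bullet> (g0 *\<^sub>v z)) \<cdot>\<^sub>v (g1 *\<^sub>v V 0) + y"
      using dec[of "g0 *\<^sub>v z"] g0 z by auto
    have ee: "g2 * (g1 * g0) *\<^sub>v z = ((vec_len z)\<^sup>2) \<cdot>\<^sub>v (g2 *\<^sub>v (g1 *\<^sub>v V 0)) + g2 *\<^sub>v y"
    proof -
      have "g2 * (g1 * g0) *\<^sub>v z = g2 *\<^sub>v (g1 *\<^sub>v (g0 *\<^sub>v z))"
        using assoc_mult_mat_vec[OF g2 mult_carrier_mat[OF g1 g0] z] assoc_mult_mat_vec[OF g1 g0 z] by simp
      also have "\<dots> = g2 *\<^sub>v (((vec_len z)\<^sup>2) \<cdot>\<^sub>v (g1 *\<^sub>v V 0) + y)" using y(3) zV[OF z] by (simp add: vec_len_sq)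
      also have "\<dots> = ((vec_len z)\<^sup>2) \<cdot>\<^sub>v (g2 *\<^sub>v (g1 *\<^sub>v V 0)) + g2 *\<^sub>v y"
        using y(1) g2 g1V by (simp add: mult_add_distrib_mat_vec[of _ m m] mult_mat_vec)
      finally show ?thesis .
    qed
    have "(vec_len z)\<^sup>2 * a - vec_len (g2 *\<^sub>v y) \<le> vec_len (g2 * (g1 * g0) *\<^sub>v z)"
      unfolding ee using vec_len_minus[of "((vec_len z)\<^sup>2) \<cdot>\<^sub>v (g2 *\<^sub>v (g1 *\<^sub>v V 0))" m "g2 *\<^sub>v y"] g2 g1V y(1)
      by (simp add: a_def)
    also have "\<dots> \<le> mat_norm (g2 * (g1 * g0)) * vec_len z"
      using g0 g1 g2 z by (intro mat_norm_bound[of _ m m]) auto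
    finally have "(vec_len z)\<^sup>2 * a \<le> mat_norm (g2 * (g1 * g0)) * vec_len z + vec_len (g2 *\<^sub>v y)" by simp
    also have "vec_len (g2 *\<^sub>v y) \<le> mat_norm g2 * (s2 * (mat_norm g0 * vec_len z))"
      using mat_norm_bound[OF g2 y(1)] y(2) mat_norm_bound[OF g0 z] s2
      by (meson mat_norm_nonneg mult_left_mono order_trans)
    finally have "vec_len z * (vec_len z * a) \<le> vec_len z * (mat_norm (g2 * (g1 * g0)) + s2 * mat_norm g2 * mat_norm g0)"
      by (simp add: power2_eq_square algebra_simps)
    then show ?thesis using zp by simp
  qed
  define X where "X = mat_norm (g1 * g0)"
  define Y where "Y = mat_norm (g2 * g1)"
  define n0 where "n0 = mat_norm g0"
  define n2 where "n2 = mat_norm g2"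
  define R where "R = mat_norm (g2 * (g1 * g0))"
  have nn: "0 \<le> n0" "0 \<le> n2" "0 \<le> R" "0 \<le> X" "0 \<le> Y" "0 \<le> a" "0 \<le> vec_len z"
    by (auto simp: n0_def n2_def R_def X_def Y_def a_def)
  have X: "X \<le> s1 * n0" using mat_norm_mult[OF g1 g0] by (simp add: X_def s1_def n0_def)
  have Y: "Y \<le> n2 * s1" using mat_norm_mult[OF g2 g1] by (simp add: Y_def s1_def n2_def)
  \<comment> \<open>Where \<open>X\<close> or \<open>Y\<close> is smaller than its error the claim is trivial; otherwise A, B and C multiply.\<close>
  have "Y * X \<le> s1 * R + 3 * s1 * s2 * n2 * n0"
  proof (cases "X \<le> s2 * n0 \<or> Y \<le> s2 * n2")
    case True
    then have "Y * X \<le> s1 * s2 * n2 * n0"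
    proof
      assume "X \<le> s2 * n0"
      then have "Y * X \<le> (n2 * s1) * (s2 * n0)" using Y nn s1 by (intro mult_mono) auto
      then show ?thesis by (simp add: mult_ac)
    next
      assume "Y \<le> s2 * n2"
      then have "Y * X \<le> (s2 * n2) * (s1 * n0)" using X nn s2 by (intro mult_mono) auto
      then show ?thesis by (simp add: mult_ac)
    qed
    moreover have "0 \<le> s1 * R" "0 \<le> s1 * s2 * n2 * n0" using nn s1 s2 by auto
    ultimately show ?thesis by linarith
  next
    case False
    have "(Y - s2 * n2) * (X - s2 * n0) \<le> a * (s1 * vec_len z)"
      using False A B nn by (intro mult_mono) (auto simp: X_def Y_def n0_def n2_def)
    also have "\<dots> = s1 * (vec_len z * a)" by simp
    also have "\<dots> \<le> s1 * (R + s2 * n2 * n0)" using C s1 by (intro mult_left_mono) (auto simp: R_def n0_def n2_def)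
    finally have "Y * X \<le> s1 * R + s1 * s2 * n2 * n0 + (s2 * n0) * Y + (s2 * n2) * X - (s2 * n2) * (s2 * n0)"
      by (simp add: algebra_simps)
    moreover have "(s2 * n0) * Y \<le> (s2 * n0) * (n2 * s1)" using Y nn s2 by (intro mult_left_mono) auto
    moreover have "(s2 * n2) * X \<le> (s2 * n2) * (s1 * n0)" using X nn s2 by (intro mult_left_mono) auto
    moreover have "0 \<le> (s2 * n2) * (s2 * n0)" using nn s2 by auto
    ultimately show ?thesis by (simp add: algebra_simps)
  qed
  then show ?thesis by (simp add: X_def Y_def R_def n0_def n2_def s1_def s2_def)
qed

section \<open>Lines and their orthogonal projections\<close>

text \<open>A line is encoded by the matrix entries of the orthogonal projection onto it.  This turns the
  projective distance into a Euclidean one (the Hilbert--Schmidt distance of projections), which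
  satisfies the triangle inequality for free and depends measurably on the data.\<close>

definition line_proj :: "real vec set \<Rightarrow> nat \<times> nat \<Rightarrow> real" where
  "line_proj P = (\<lambda>(i, j). line_rep P $ i * line_rep P $ j / (line_rep P \<bullet> line_rep P))"

definition hs_dist :: "nat \<Rightarrow> real vec set \<Rightarrow> real vec set \<Rightarrow> real" where
  "hs_dist m P Q = L2_set (\<lambda>x. line_proj P x - line_proj Q x) ({..<m} \<times> {..<m})"

lemma hs_dist_nonneg [simp]: "0 \<le> hs_dist m P Q"
  by (simp add: hs_dist_def)

lemma hs_dist_commute: "hs_dist m P Q = hs_dist m Q P"
  by (simp add: hs_dist_def L2_set_def power2_commute)

lemma hs_dist_triangle: "hs_dist m P R \<le> hs_dist m P Q + hs_dist m Q R"
proof -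
  have "hs_dist m P R = L2_set (\<lambda>x. (line_proj P x - line_proj Q x) + (line_proj Q x - line_proj R x)) ({..<m} \<times> {..<m})"
    by (simp add: hs_dist_def)
  also have "\<dots> \<le> hs_dist m P Q + hs_dist m Q R"
    unfolding hs_dist_def by (rule L2_set_triangle_ineq)
  finally show ?thesis .
qed

lemma line_of_smult:
  assumes "c \<noteq> 0" shows "line_of (c \<cdot>\<^sub>v p) = line_of p"
proof -
  have "\<exists>d. b \<cdot>\<^sub>v p = d \<cdot>\<^sub>v (c \<cdot>\<^sub>v p)" for b
    by (rule exI[of _ "b / c"]) (use assms in \<open>simp add: smult_smult_assoc\<close>)
  moreover have "\<exists>d. b \<cdot>\<^sub>v (c \<cdot>\<^sub>v p) = d \<cdot>\<^sub>v p" for b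
    by (rule exI[of _ "b * c"]) (simp add: smult_smult_assoc)
  ultimately show ?thesis unfolding line_of_def by blast
qed

lemma proj_space_unit:
  assumes "P \<in> proj_space m"
  obtains p where "p \<in> carrier_vec m" "vec_len p = 1" "P = line_of p"
proof -
  obtain p where p: "p \<in> carrier_vec m" "p \<noteq> 0\<^sub>v m" "P = line_of p"
    using assms unfolding proj_space_def by auto
  have l: "vec_len p \<noteq> 0" using p vec_len_eq_0_iff by blast
  show thesis
    by (rule that[of "(1 / vec_len p) \<cdot>\<^sub>v p"]) (use p l in \<open>auto simp: line_of_smult\<close>)
qed

lemma unit_line_in_proj_space:
  assumes "p \<in> carrier_vec m" "vec_len p = 1" shows "line_of p \<in> proj_space m"
  unfolding proj_space_def using assms by (auto intro!: exI[of _ p])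

lemma line_rep_unit:
  assumes p: "p \<in> carrier_vec m" "vec_len p = 1"
  obtains c where "c \<noteq> 0" "line_rep (line_of p) = c \<cdot>\<^sub>v p"
proof -
  let ?Q = "\<lambda>q. q \<in> line_of p \<and> q \<noteq> 0\<^sub>v (dim_vec q)"
  have p0: "p \<noteq> 0\<^sub>v m" using p by auto
  have "p \<in> line_of p" unfolding line_of_def by (auto intro!: exI[of _ 1])
  then have "?Q p" using p p0 by auto
  then have Q: "?Q (line_rep (line_of p))" unfolding line_rep_def by (rule someI)
  then obtain c where c: "line_rep (line_of p) = c \<cdot>\<^sub>v p" unfolding line_of_def by auto
  have "c \<noteq> 0" using Q c p by auto
  then show thesis using c that by blast
qed

lemma line_proj_unit:
  assumes p: "p \<in> carrier_vec m" "vec_len p = 1" and ij: "i < m" "j < m"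
  shows "line_proj (line_of p) (i, j) = p $ i * p $ j"
proof -
  obtain c where c: "c \<noteq> 0" "line_rep (line_of p) = c \<cdot>\<^sub>v p" using line_rep_unit[OF p] .
  have "p \<bullet> p = 1" using p vec_len_sq[of p] by simp
  then show ?thesis using c p ij by (simp add: line_proj_def)
qed

lemma proj_dist_unit:
  assumes p: "p \<in> carrier_vec m" "vec_len p = 1" and q: "q \<in> carrier_vec m" "vec_len q = 1"
  shows "proj_dist (line_of p) (line_of q) = 2 / pi * arccos \<bar>p \<bullet> q\<bar>"
proof -
  obtain c where c: "c \<noteq> 0" "line_rep (line_of p) = c \<cdot>\<^sub>v p" using line_rep_unit[OF p] .
  obtain d where d: "d \<noteq> 0" "line_rep (line_of q) = d \<cdot>\<^sub>v q" using line_rep_unit[OF q] .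
  show ?thesis unfolding proj_dist_def Let_def c(2) d(2) using c(1) d(1) p q
    by (simp add: abs_mult)
qed

lemma hs_dist_unit:
  assumes p: "p \<in> carrier_vec m" "vec_len p = 1" and q: "q \<in> carrier_vec m" "vec_len q = 1"
  shows "(hs_dist m (line_of p) (line_of q))\<^sup>2 = 2 - 2 * (p \<bullet> q)\<^sup>2"
proof -
  have pp: "(\<Sum>i<m. p $ i * p $ i) = 1" and qq: "(\<Sum>i<m. q $ i * q $ i) = 1"
    using p q vec_len_sq[of p] vec_len_sq[of q] by (simp_all add: scalar_prod_def atLeast0LessThan)
  have pq: "p \<bullet> q = (\<Sum>i<m. p $ i * q $ i)" using p q by (simp add: scalar_prod_def atLeast0LessThan)
  have "(hs_dist m (line_of p) (line_of q))\<^sup>2 =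
      (\<Sum>(i, j)\<in>{..<m} \<times> {..<m}. (p $ i * p $ j - q $ i * q $ j)\<^sup>2)"
    unfolding hs_dist_def L2_set_def
    by (auto intro!: sum.cong simp: line_proj_unit[OF p] line_proj_unit[OF q] sum_nonneg)
  also have "\<dots> = (\<Sum>i<m. \<Sum>j<m. (p $ i * p $ i) * (p $ j * p $ j) + (q $ i * q $ i) * (q $ j * q $ j)
        - 2 * ((p $ i * q $ i) * (p $ j * q $ j)))"
    by (simp add: sum.cartesian_product[symmetric] power2_eq_square algebra_simps)
  also have "\<dots> = (\<Sum>i<m. p $ i * p $ i) * (\<Sum>i<m. p $ i * p $ i) + (\<Sum>i<m. q $ i * q $ i) * (\<Sum>i<m. q $ i * q $ i)
        - 2 * ((\<Sum>i<m. p $ i * q $ i) * (\<Sum>i<m. p $ i * q $ i))"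
    unfolding sum_product by (simp add: sum.distrib sum_subtractf sum_distrib_left)
  finally show ?thesis unfolding pp qq pq by (simp add: power2_eq_square)
qed

lemma unit_scalar_prod_le_1:
  assumes p: "p \<in> carrier_vec m" "vec_len p = 1" and q: "q \<in> carrier_vec m" "vec_len q = 1"
  shows "\<bar>p \<bullet> q\<bar> \<le> 1"
  using Cauchy_Schwarz_vec[OF p(1) q(1)] p q by simp

lemma sin_ge_chord:
  fixes x :: real
  assumes "0 \<le> x" "x \<le> pi / 2" shows "2 / pi * x \<le> sin x"
proof -
  have "convex_on {0..pi/2} (\<lambda>x::real. - sin x)"
  proof (rule f''_ge0_imp_convex[where f' = "\<lambda>x. - cos x" and f'' = sin])
    fix x :: real assume x: "x \<in> {0..pi/2}"
    show "((\<lambda>x. - sin x) has_real_derivative - cos x) (at x)" by (auto intro!: derivative_eq_intros)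
    show "((\<lambda>x. - cos x) has_real_derivative sin x) (at x)" by (auto intro!: derivative_eq_intros)
    show "0 \<le> sin x" using x by (intro sin_ge_zero) auto
  qed simp
  from convex_onD[OF this, of "x / (pi / 2)" 0 "pi/2"] assms
  show ?thesis by (simp add: field_simps)
qed

text \<open>For lines at angle \<open>\<phi>\<close> the distances are \<open>2\<phi>/\<pi>\<close> and \<open>\<surd>2 sin \<phi>\<close>, and \<open>2\<phi>/\<pi> \<le> sin \<phi> \<le> \<phi>\<close>.\<close>

lemma proj_dist_hs_dist:
  assumes P: "P \<in> proj_space m" and Q: "Q \<in> proj_space m"
  shows "proj_dist P Q = 2 / pi * arccos (sqrt (1 - (hs_dist m P Q)\<^sup>2 / 2))"
    and "proj_dist P Q \<le> hs_dist m P Q"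
    and "hs_dist m P Q \<le> 3 * proj_dist P Q"
    and "0 \<le> proj_dist P Q" and "proj_dist P Q \<le> 1"
proof -
  obtain p where p: "p \<in> carrier_vec m" "vec_len p = 1" "P = line_of p" using proj_space_unit[OF P] .
  obtain q where q: "q \<in> carrier_vec m" "vec_len q = 1" "Q = line_of q" using proj_space_unit[OF Q] .
  define c where "c = \<bar>p \<bullet> q\<bar>"
  have c: "0 \<le> c" "c \<le> 1" using unit_scalar_prod_le_1[OF p(1,2) q(1,2)] by (auto simp: c_def)
  define \<theta> where "\<theta> = arccos c"
  have \<theta>: "0 \<le> \<theta>" "\<theta> \<le> pi / 2" using c arccos_lbound[of c] arccos_le_pi2[of c] by (auto simp: \<theta>_def)
  have d: "proj_dist P Q = 2 / pi * \<theta>" using proj_dist_unit[OF p(1,2) q(1,2)] by (simp add: p q c_def \<theta>_def)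
  have h: "(hs_dist m P Q)\<^sup>2 = 2 - 2 * c\<^sup>2" using hs_dist_unit[OF p(1,2) q(1,2)] by (simp add: p q c_def)
  show "proj_dist P Q = 2 / pi * arccos (sqrt (1 - (hs_dist m P Q)\<^sup>2 / 2))"
    unfolding d h \<theta>_def using c by (simp add: diff_divide_distrib)
  have s: "sin \<theta> = sqrt (1 - c\<^sup>2)" using c by (simp add: \<theta>_def sin_arccos_abs)
  have hs: "hs_dist m P Q = sqrt 2 * sin \<theta>"
  proof -
    have "hs_dist m P Q = sqrt (2 - 2 * c\<^sup>2)" using h by (metis hs_dist_nonneg real_sqrt_unique)
    also have "\<dots> = sqrt (2 * (1 - c\<^sup>2))" by (simp add: right_diff_distrib)
    finally show ?thesis unfolding s by (simp only: real_sqrt_mult)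
  qed
  have sin0: "0 \<le> sin \<theta>" using \<theta> by (intro sin_ge_zero) auto
  have "proj_dist P Q \<le> sin \<theta>" unfolding d using sin_ge_chord \<theta> by simp
  also have "\<dots> \<le> sqrt 2 * sin \<theta>" using sin0 mult_right_mono[of 1 "sqrt 2" "sin \<theta>"] by simp
  finally show "proj_dist P Q \<le> hs_dist m P Q" by (simp add: hs)
  have "hs_dist m P Q \<le> sqrt 2 * \<theta>" unfolding hs using sin_x_le_x[of \<theta>] \<theta> by simp
  also have "\<dots> = (sqrt 2 * pi / 2) * proj_dist P Q" unfolding d by simp
  also have "\<dots> \<le> 3 * proj_dist P Q"
  proof (rule mult_right_mono)
    have "sqrt 2 \<le> 3 / 2" by (rule real_le_lsqrt) (auto simp: power2_eq_square)
    moreover have "pi \<le> 4" using pi_less_4 by simp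
    ultimately have "sqrt 2 * pi \<le> 3 / 2 * 4" by (intro mult_mono) auto
    then show "sqrt 2 * pi / 2 \<le> 3" by simp
    show "0 \<le> proj_dist P Q" unfolding d using \<theta> by simp
  qed
  finally show "hs_dist m P Q \<le> 3 * proj_dist P Q" .
  show "0 \<le> proj_dist P Q" "proj_dist P Q \<le> 1" unfolding d using \<theta> by (auto simp: field_simps)
qed

lemma hs_dist_0_imp_eq:
  assumes P: "P \<in> proj_space m" and Q: "Q \<in> proj_space m" and 0: "hs_dist m P Q = 0"
  shows "P = Q"
proof -
  obtain p where p: "p \<in> carrier_vec m" "vec_len p = 1" "P = line_of p" using proj_space_unit[OF P] .
  obtain q where q: "q \<in> carrier_vec m" "vec_len q = 1" "Q = line_of q" using proj_space_unit[OF Q] .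
  have c: "(p \<bullet> q)\<^sup>2 = 1" using hs_dist_unit[OF p(1,2) q(1,2)] 0 by (simp add: p q)
  define w where "w = p + (- (p \<bullet> q)) \<cdot>\<^sub>v q"
  have w: "w \<in> carrier_vec m" using p q by (simp add: w_def)
  have 1: "p \<bullet> p = 1" "q \<bullet> q = 1" using p q vec_len_sq[of p] vec_len_sq[of q] by auto
  have "w \<bullet> w = 1 - (p \<bullet> q)\<^sup>2" unfolding w_def using p q 1 comm_scalar_prod[OF p(1) q(1)]
    by (simp add: scalar_prod_add_distrib[of _ m] add_scalar_prod_distrib[of _ m] power2_eq_square algebra_simps)
  then have "w = 0\<^sub>v m" using c vec_len_sq[of w] vec_len_eq_0_iff[OF w] by simp
  have "p = (p \<bullet> q) \<cdot>\<^sub>v q"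
  proof (rule eq_vecI)
    fix i assume "i < dim_vec ((p \<bullet> q) \<cdot>\<^sub>v q)"
    then have i: "i < m" using q by simp
    show "p $ i = ((p \<bullet> q) \<cdot>\<^sub>v q) $ i"
      using arg_cong[OF \<open>w = 0\<^sub>v m\<close>, of "\<lambda>v. v $ i"] i p q by (simp add: w_def)
  qed (use p q in auto)
  moreover have "p \<bullet> q \<noteq> 0" using c by auto
  ultimately show "P = Q" using line_of_smult[of "p \<bullet> q" q] p q by simp
qed

lemma hs_dist_tendsto_0:
  assumes "\<And>i j. i < m \<Longrightarrow> j < m \<Longrightarrow> (\<lambda>n. line_proj (L n) (i, j)) \<longlonglongrightarrow> line_proj P (i, j)"
  shows "(\<lambda>n. hs_dist m (L n) P) \<longlonglongrightarrow> 0"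
proof -
  have "(\<lambda>n. hs_dist m (L n) P) \<longlonglongrightarrow> L2_set (\<lambda>x. line_proj P x - line_proj P x) ({..<m} \<times> {..<m})"
    unfolding hs_dist_def L2_set_def using assms by (intro tendsto_intros) auto
  then show ?thesis by (simp add: L2_set_def)
qed

lemma line_proj_diff_le_hs_dist:
  assumes "i < m" "j < m"
  shows "\<bar>line_proj P (i, j) - line_proj Q (i, j)\<bar> \<le> hs_dist m P Q"
proof -
  have "\<bar>line_proj P (i, j) - line_proj Q (i, j)\<bar> = sqrt ((line_proj P (i, j) - line_proj Q (i, j))\<^sup>2)" by simp
  also have "\<dots> \<le> hs_dist m P Q" unfolding hs_dist_def L2_set_def
    using assms by (intro real_sqrt_le_mono member_le_sum[of "(i, j)" "{..<m} \<times> {..<m}" "\<lambda>x. (line_proj P x - line_proj Q x)\<^sup>2"]) auto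
  finally show ?thesis .
qed

text \<open>The set of rank-one projections is closed: the identities \<open>R\<^sub>a\<^sub>b R\<^sub>c\<^sub>d = R\<^sub>a\<^sub>d R\<^sub>c\<^sub>b\<close> and \<open>tr R = 1\<close> pass to
  limits, and any non-zero column of the limit spans the limiting line.\<close>

lemma proj_space_closed:
  assumes L: "\<forall>\<^sub>F n in sequentially. L n \<in> proj_space m"
    and R: "\<And>i j. i < m \<Longrightarrow> j < m \<Longrightarrow> (\<lambda>n. line_proj (L n) (i, j)) \<longlonglongrightarrow> R (i, j)"
  shows "\<exists>P\<in>proj_space m. \<forall>i<m. \<forall>j<m. line_proj P (i, j) = R (i, j)"
proof -
  have ev: "\<forall>\<^sub>F n in sequentially. \<exists>p. p \<in> carrier_vec m \<and> vec_len p = 1 \<and> (\<forall>i<m. \<forall>j<m. line_proj (L n) (i, j) = p $ i * p $ j)"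
    using L
  proof eventually_elim
    case (elim n)
    then obtain p where p: "p \<in> carrier_vec m" "vec_len p = 1" "L n = line_of p" using proj_space_unit by blast
    then show ?case using line_proj_unit[OF p(1,2)] by auto
  qed
  have tr: "(\<Sum>i<m. R (i, i)) = 1"
  proof -
    have "(\<lambda>n. \<Sum>i<m. line_proj (L n) (i, i)) \<longlonglongrightarrow> (\<Sum>i<m. R (i, i))"
      using R by (intro tendsto_sum) auto
    moreover have "\<forall>\<^sub>F n in sequentially. (\<Sum>i<m. line_proj (L n) (i, i)) = 1"
      using ev
    proof eventually_elim
      case (elim n)
      then obtain p where p: "p \<in> carrier_vec m" "vec_len p = 1" "\<forall>i<m. \<forall>j<m. line_proj (L n) (i, j) = p $ i * p $ j" by blast
      then have "(\<Sum>i<m. line_proj (L n) (i, i)) = p \<bullet> p" by (simp add: scalar_prod_def atLeast0LessThan)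
      then show ?case using p vec_len_sq[of p] by simp
    qed
    ultimately have "(\<lambda>n. 1) \<longlonglongrightarrow> (\<Sum>i<m. R (i, i))" by (rule Lim_transform_eventually)
    then show ?thesis by (simp add: LIMSEQ_const_iff)
  qed
  have rk: "R (a, b) * R (c, d) = R (a, d) * R (c, b)" if "a < m" "b < m" "c < m" "d < m" for a b c d
  proof -
    have "(\<lambda>n. line_proj (L n) (a, b) * line_proj (L n) (c, d) - line_proj (L n) (a, d) * line_proj (L n) (c, b))
        \<longlonglongrightarrow> R (a, b) * R (c, d) - R (a, d) * R (c, b)"
      using R that by (intro tendsto_intros) auto
    moreover have "\<forall>\<^sub>F n in sequentially. line_proj (L n) (a, b) * line_proj (L n) (c, d) - line_proj (L n) (a, d) * line_proj (L n) (c, b) = 0"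
      using ev by eventually_elim (use that in auto)
    ultimately have "(\<lambda>n. 0) \<longlonglongrightarrow> R (a, b) * R (c, d) - R (a, d) * R (c, b)" by (rule Lim_transform_eventually)
    then have "R (a, b) * R (c, d) - R (a, d) * R (c, b) = 0" by (simp add: LIMSEQ_const_iff)
    then show ?thesis by simp
  qed
  have sy: "R (a, b) = R (b, a)" if "a < m" "b < m" for a b
  proof -
    have "\<forall>\<^sub>F n in sequentially. line_proj (L n) (a, b) = line_proj (L n) (b, a)"
      using ev by eventually_elim (use that in auto)
    then have "(\<lambda>n. line_proj (L n) (b, a)) \<longlonglongrightarrow> R (a, b)" by (rule Lim_transform_eventually[OF R[OF that]])
    then show ?thesis using R[OF that(2,1)] by (rule LIMSEQ_unique)
  qed
  have "\<exists>k<m. R (k, k) \<noteq> 0"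
  proof (rule ccontr)
    assume "\<not> (\<exists>k<m. R (k, k) \<noteq> 0)"
    then have "(\<Sum>i<m. R (i, i)) = 0" by (intro sum.neutral) auto
    with tr show False by simp
  qed
  then obtain k where k: "k < m" "R (k, k) \<noteq> 0" by blast
  have "(\<lambda>n. line_proj (L n) (k, k)) \<longlonglongrightarrow> R (k, k)" using R k by auto
  moreover have "\<forall>\<^sub>F n in sequentially. 0 \<le> line_proj (L n) (k, k)"
    using ev by eventually_elim (use k in auto)
  ultimately have "0 \<le> R (k, k)" by (rule tendsto_lowerbound) simp
  then have kp: "0 < R (k, k)" using k by simp
  define p where "p = Matrix.vec m (\<lambda>i. R (i, k) / sqrt (R (k, k)))"
  have p: "p \<in> carrier_vec m" by (simp add: p_def)
  have pp: "p $ i * p $ j = R (i, j)" if "i < m" "j < m" for i j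
  proof -
    have "p $ i * p $ j = R (i, k) * R (j, k) / R (k, k)" using that kp by (simp add: p_def)
    also have "R (i, k) * R (j, k) = R (i, k) * R (k, j)" using sy k that by simp
    also have "\<dots> = R (i, j) * R (k, k)" using rk that k by simp
    finally show ?thesis using kp by simp
  qed
  have "p \<bullet> p = (\<Sum>i<m. R (i, i))" using p pp by (simp add: scalar_prod_def atLeast0LessThan)
  then have l: "vec_len p = 1" using tr by (simp add: vec_len_def)
  show ?thesis
    using unit_line_in_proj_space[OF p l] line_proj_unit[OF p l] pp by (auto intro!: bexI[of _ "line_of p"])
qed

section \<open>Most expanding directions\<close>

lemma most_expanding_line:
  assumes g: "g \<in> carrier_mat m m" and m: "m \<ge> 2" and V: "right_singular_basis m g V"
    and gap: "sing_val g 2 < mat_norm g"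
  shows "most_expanding g = line_of (V 0)"
proof -
  have m0: "0 < m" using m by simp
  have s1: "sing_val g 1 = mat_norm g" using sing_val_1_eq_norm[OF g] m by simp
  have s1': "sing_val g (Suc 0) = mat_norm g" using s1 by simp
  note V0 = rsb_carrier[OF g V m0]
  have G: "transpose_mat g * g \<in> carrier_mat m m" using g by simp
  show ?thesis
  proof (rule Set.set_eqI, rule iffI)
    fix v assume "v \<in> most_expanding g"
    then have v: "v \<in> carrier_vec m" "(transpose_mat g * g) *\<^sub>v v = (mat_norm g)\<^sup>2 \<cdot>\<^sub>v v"
      using g unfolding most_expanding_def s1 by auto
    have "V i \<bullet> v = 0" if i: "0 < i" "i < m" for i
    proof -
      have "(sing_val g (Suc i))\<^sup>2 * (V i \<bullet> v) = V i \<bullet> ((transpose_mat g * g) *\<^sub>v v)"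
        using rsb_gram_coeff[OF g V i(2) v(1)] by (simp only:)
      also have "\<dots> = (mat_norm g)\<^sup>2 * (V i \<bullet> v)"
        unfolding v(2) using rsb_carrier[OF g V i(2)] v(1) by simp
      finally have "(sing_val g (Suc i))\<^sup>2 * (V i \<bullet> v) = (mat_norm g)\<^sup>2 * (V i \<bullet> v)" .
      then have *: "((mat_norm g)\<^sup>2 - (sing_val g (Suc i))\<^sup>2) * (V i \<bullet> v) = 0"
        unfolding left_diff_distrib by linarith
      have "sing_val g (Suc i) \<le> sing_val g 2"
        using right_singular_basis_exists(4)[OF g, of 1 i] i by (simp add: numeral_2_eq_2)
      then have "(sing_val g (Suc i))\<^sup>2 < (mat_norm g)\<^sup>2"
        using gap right_singular_basis_exists(3)[OF g i(2)] by (intro power_strict_mono) auto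
      with * show ?thesis by auto
    qed
    then have "v = (V 0 \<bullet> v) \<cdot>\<^sub>v V 0" using rsb_expansion[OF g V v(1)] m0 by simp
    then show "v \<in> line_of (V 0)" unfolding line_of_def by blast
  next
    fix v assume "v \<in> line_of (V 0)"
    then obtain c where v: "v = c \<cdot>\<^sub>v V 0" unfolding line_of_def by auto
    have "(transpose_mat g * g) *\<^sub>v v = c \<cdot>\<^sub>v ((transpose_mat g * g) *\<^sub>v V 0)"
      unfolding v by (rule mult_mat_vec[OF G V0])
    also have "\<dots> = (mat_norm g)\<^sup>2 \<cdot>\<^sub>v v"
      unfolding rsb_eig[OF g V m0] s1' v by (simp add: smult_smult_assoc mult.commute)
    finally show "v \<in> most_expanding g" unfolding most_expanding_def s1 using v V0 g by simp
  qed
qed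

text \<open>If \<open>s\<^sub>1 = s\<^sub>2\<close>, the eigenspace contains two orthonormal vectors and is not a line.\<close>

lemma most_expanding_in_proj_space_iff:
  assumes g: "g \<in> carrier_mat m m" and m: "m \<ge> 2"
  shows "most_expanding g \<in> proj_space m \<longleftrightarrow> sing_val g 2 < mat_norm g"
proof -
  obtain V where V: "right_singular_basis m g V" using right_singular_basis_exists(1)[OF g] by blast
  have m0: "0 < m" "1 < m" using m by auto
  have s1: "sing_val g 1 = mat_norm g" using sing_val_1_eq_norm[OF g] m by simp
  have s12: "sing_val g 2 \<le> mat_norm g"
    using right_singular_basis_exists(4)[OF g, of 0 1] m0 s1 by (simp add: numeral_2_eq_2)
  show ?thesis
  proof
    assume "sing_val g 2 < mat_norm g"
    from most_expanding_line[OF g m V this]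
    show "most_expanding g \<in> proj_space m"
      using unit_line_in_proj_space[OF rsb_carrier[OF g V m0(1)] rsb_len[OF g V m0(1)]] by simp
  next
    assume "most_expanding g \<in> proj_space m"
    then obtain p where p: "p \<in> carrier_vec m" "vec_len p = 1" "most_expanding g = line_of p"
      using proj_space_unit by blast
    show "sing_val g 2 < mat_norm g"
    proof (rule ccontr)
      assume "\<not> ?thesis"
      with s12 have e: "sing_val g 2 = sing_val g 1" using s1 by simp
      have "V 0 \<in> most_expanding g" "V 1 \<in> most_expanding g"
        using rsb_eig[OF g V m0(1)] rsb_eig[OF g V m0(2)] rsb_carrier[OF g V m0(1)] rsb_carrier[OF g V m0(2)] e g
        unfolding most_expanding_def by (auto simp: numeral_2_eq_2 simp del: assoc_mult_mat_vec)
      then obtain c d where cd: "V 0 = c \<cdot>\<^sub>v p" "V 1 = d \<cdot>\<^sub>v p" unfolding p(3) line_of_def by auto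
      have pp: "p \<bullet> p = 1" using p vec_len_sq[of p] by simp
      have "c * c = 1" "d * d = 1" "c * d = 0"
        using rsb_orth[OF g V m0(1) m0(1)] rsb_orth[OF g V m0(2) m0(2)] rsb_orth[OF g V m0(1) m0(2)] pp
        unfolding cd by auto
      then show False by auto
    qed
  qed
qed

text \<open>The two comparisons of most expanding directions needed below, of \<open>g\<close> with \<open>h g\<close> and of two nearby
  matrices, only differ in the bound for the second matrix on the complement of the most expanding
  direction of the first one.\<close>

lemma hs_dist_most_expanding:
  assumes g1: "g1 \<in> carrier_mat m m" and g2: "g2 \<in> carrier_mat m m" and m: "m \<ge> 2"
    and gap1: "sing_val g1 2 < mat_norm g1" and gap2: "sing_val g2 2 < mat_norm g2"
    and t: "0 \<le> t" "\<And>w. w \<in> carrier_vec m \<Longrightarrow> vec_len (g1 *\<^sub>v w) \<le> sing_val g1 2 * vec_len w \<Longrightarrow> vec_len (g2 *\<^sub>v w) \<le> t * vec_len w"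
  shows "hs_dist m (most_expanding g1) (most_expanding g2) * mat_norm g2 \<le> 2 * t"
proof -
  obtain V where V: "right_singular_basis m g1 V" using right_singular_basis_exists(1)[OF g1] by blast
  obtain U where U: "right_singular_basis m g2 U" using right_singular_basis_exists(1)[OF g2] by blast
  have m0: "0 < m" "1 < m" using m by auto
  note v = rsb_carrier[OF g1 V m0(1)] rsb_len[OF g1 V m0(1)]
  note u = rsb_carrier[OF g2 U m0(1)] rsb_len[OF g2 U m0(1)]
  have "sqrt (1 - (V 0 \<bullet> U 0)\<^sup>2) * mat_norm g2 \<le> t"
  proof (rule top_vector_deviation[OF g2 U _ v t(1)])
    fix w :: "real vec" assume w: "w \<in> carrier_vec m" "V 0 \<bullet> w = 0"
    show "vec_len (g2 *\<^sub>v w) \<le> t * vec_len w"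
      using t(2)[OF w(1)] rsb_tail_bound[OF g1 V w(1) m0(2)] w(2) by (simp add: numeral_2_eq_2)
  qed (use m0 in simp)
  moreover have "hs_dist m (most_expanding g1) (most_expanding g2) = sqrt 2 * sqrt (1 - (V 0 \<bullet> U 0)\<^sup>2)"
  proof -
    have "(hs_dist m (most_expanding g1) (most_expanding g2))\<^sup>2 = 2 * (1 - (V 0 \<bullet> U 0)\<^sup>2)"
      unfolding most_expanding_line[OF g1 m V gap1] most_expanding_line[OF g2 m U gap2]
      using hs_dist_unit[OF v u] by (simp add: right_diff_distrib)
    then have "hs_dist m (most_expanding g1) (most_expanding g2) = sqrt (2 * (1 - (V 0 \<bullet> U 0)\<^sup>2))"
      using real_sqrt_unique[OF _ hs_dist_nonneg] by metis
    then show ?thesis by (simp only: real_sqrt_mult)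
  qed
  ultimately have "hs_dist m (most_expanding g1) (most_expanding g2) * mat_norm g2 \<le> sqrt 2 * t"
    using mult_left_mono[of _ t "sqrt 2"] by simp
  also have "\<dots> \<le> 2 * t" using t(1) by (intro mult_right_mono) (auto intro: real_le_lsqrt)
  finally show ?thesis .
qed

lemma hs_dist_most_expanding_mult:
  assumes g: "g \<in> carrier_mat m m" and h: "h \<in> carrier_mat m m" and m: "m \<ge> 2"
    and gap1: "sing_val g 2 < mat_norm g" and gap2: "sing_val (h * g) 2 < mat_norm (h * g)"
  shows "hs_dist m (most_expanding g) (most_expanding (h * g)) * mat_norm (h * g) \<le> 2 * (mat_norm h * sing_val g 2)"
proof (rule hs_dist_most_expanding[OF g _ m gap1 gap2])
  show "h * g \<in> carrier_mat m m" using g h by simp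
  show "0 \<le> mat_norm h * sing_val g 2"
    using right_singular_basis_exists(3)[OF g, of 1] m by (simp add: numeral_2_eq_2)
  fix w :: "real vec" assume w: "w \<in> carrier_vec m" "vec_len (g *\<^sub>v w) \<le> sing_val g 2 * vec_len w"
  have "vec_len (h * g *\<^sub>v w) \<le> mat_norm h * vec_len (g *\<^sub>v w)"
    using mat_norm_bound[OF h, of "g *\<^sub>v w"] g h w by simp
  also have "\<dots> \<le> mat_norm h * (sing_val g 2 * vec_len w)" using w(2) by (intro mult_left_mono) auto
  finally show "vec_len (h * g *\<^sub>v w) \<le> mat_norm h * sing_val g 2 * vec_len w" by simp
qed

lemma hs_dist_most_expanding_perturb:
  assumes g: "g \<in> carrier_mat m m" and h: "h \<in> carrier_mat m m" and m: "m \<ge> 2"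
    and gap1: "sing_val g 2 < mat_norm g" and gap2: "sing_val h 2 < mat_norm h"
  shows "hs_dist m (most_expanding g) (most_expanding h) * mat_norm h \<le> 2 * (sing_val g 2 + mat_norm (h - g))"
proof (rule hs_dist_most_expanding[OF g h m gap1 gap2])
  show "0 \<le> sing_val g 2 + mat_norm (h - g)"
    using right_singular_basis_exists(3)[OF g, of 1] m by (simp add: numeral_2_eq_2)
  fix w :: "real vec" assume w: "w \<in> carrier_vec m" "vec_len (g *\<^sub>v w) \<le> sing_val g 2 * vec_len w"
  have "h *\<^sub>v w = g *\<^sub>v w + (h - g) *\<^sub>v w"
    using g h w by (auto intro!: eq_vecI simp: scalar_prod_def sum.distrib[symmetric] left_diff_distrib)
  then have "vec_len (h *\<^sub>v w) \<le> vec_len (g *\<^sub>v w) + vec_len ((h - g) *\<^sub>v w)"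
    using vec_len_add[of "g *\<^sub>v w" m "(h - g) *\<^sub>v w"] mult_mat_vec_carrier[OF minus_carrier_mat[OF g] w(1)] g w by simp
  also have "\<dots> \<le> sing_val g 2 * vec_len w + mat_norm (h - g) * vec_len w"
    using w g h by (intro add_mono mat_norm_bound[of _ m m]) auto
  finally show "vec_len (h *\<^sub>v w) \<le> (sing_val g 2 + mat_norm (h - g)) * vec_len w" by (simp add: distrib_right)
qed

text \<open>Power iteration: the normalised powers of \<open>g\<^sup>* g\<close> detect by their traces whether \<open>s\<^sub>1(g)\<close> is simple, and then
  converge to the projection onto the most expanding direction.  This is what makes the direction
  a measurable function of the matrix.\<close>

definition gram_power :: "real mat \<Rightarrow> nat \<Rightarrow> nat \<times> nat \<Rightarrow> real" where
  "gram_power g k = (\<lambda>ij. ((transpose_mat g * g) ^\<^sub>m k) $$ ij / ((mat_norm g)\<^sup>2) ^ k)"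

lemma gram_power_expansion:
  assumes g: "g \<in> carrier_mat m m" and V: "right_singular_basis m g V" and ab: "a < m" "b < m"
  shows "gram_power g k (a, b) = (\<Sum>i<m. ((sing_val g (Suc i) / mat_norm g)\<^sup>2) ^ k * (V i $ a * V i $ b))"
proof -
  define G where "G = transpose_mat g * g"
  have G: "G \<in> carrier_mat m m" using g by (simp add: G_def)
  have Gk: "G ^\<^sub>m k \<in> carrier_mat m m" for k using G by (rule pow_carrier_mat)
  have coeff: "V i \<bullet> ((G ^\<^sub>m k) *\<^sub>v x) = ((sing_val g (Suc i))\<^sup>2) ^ k * (V i \<bullet> x)"
    if "i < m" "x \<in> carrier_vec m" for i x
    using that(2)
  proof (induction k arbitrary: x)
    case 0 then show ?case using G by simp
  next
    case (Suc k)
    have "V i \<bullet> ((G ^\<^sub>m Suc k) *\<^sub>v x) = V i \<bullet> ((G ^\<^sub>m k) *\<^sub>v (G *\<^sub>v x))"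
      using assoc_mult_mat_vec[OF Gk G Suc.prems] by simp
    also have "\<dots> = ((sing_val g (Suc i))\<^sup>2) ^ k * (V i \<bullet> (G *\<^sub>v x))" using Suc.IH[of "G *\<^sub>v x"] G Suc.prems by simp
    also have "V i \<bullet> (G *\<^sub>v x) = (sing_val g (Suc i))\<^sup>2 * (V i \<bullet> x)"
      using rsb_gram_coeff[OF g V that(1) Suc.prems] unfolding G_def .
    finally show ?case by simp
  qed
  have mult_unit: "X $$ (a, b) = (X *\<^sub>v unit_vec m b) $ a" if "X \<in> carrier_mat m m" for X :: "real mat"
    using that ab by simp
  have "(G ^\<^sub>m k) $$ (a, b) = ((G ^\<^sub>m k) *\<^sub>v unit_vec m b) $ a" by (rule mult_unit[OF Gk])
  also have "\<dots> = (\<Sum>i<m. V i $ a * (V i \<bullet> ((G ^\<^sub>m k) *\<^sub>v unit_vec m b)))"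
    by (rule orthonormal_expansion_entry[OF rsb_carrier[OF g V] rsb_orth[OF g V] _ ab(1)]) (use Gk[of k] in auto)
  also have "\<dots> = (\<Sum>i<m. ((sing_val g (Suc i))\<^sup>2) ^ k * (V i $ a * V i $ b))"
  proof (rule sum.cong)
    fix i assume "i \<in> {..<m}"
    then have i: "i < m" by simp
    show "V i $ a * (V i \<bullet> ((G ^\<^sub>m k) *\<^sub>v unit_vec m b)) = ((sing_val g (Suc i))\<^sup>2) ^ k * (V i $ a * V i $ b)"
      using coeff[OF i, of "unit_vec m b"] rsb_carrier[OF g V i] ab(2) by simp
  qed simp
  finally show ?thesis unfolding gram_power_def G_def[symmetric]
    by (simp add: sum_divide_distrib power_divide field_simps)
qed

lemma gram_power_tendsto:
  assumes g: "g \<in> carrier_mat m m" and m: "m \<ge> 2" and V: "right_singular_basis m g V"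
    and gap: "sing_val g 2 < mat_norm g" and ab: "a < m" "b < m"
  shows "(\<lambda>k. gram_power g k (a, b)) \<longlonglongrightarrow> line_proj (most_expanding g) (a, b)"
proof -
  have m0: "0 < m" using m by simp
  have s1: "sing_val g (Suc 0) = mat_norm g" using sing_val_1_eq_norm[OF g] m by simp
  have s2: "0 \<le> sing_val g 2" using right_singular_basis_exists(3)[OF g, of 1] m by (simp add: numeral_2_eq_2)
  then have np: "0 < mat_norm g" using gap by linarith
  have lim: "(\<lambda>k. ((sing_val g (Suc i) / mat_norm g)\<^sup>2) ^ k) \<longlonglongrightarrow> (if i = 0 then 1 else 0)" if "i < m" for i
  proof (cases "i = 0")
    case True then show ?thesis using np s1 by simp
  next
    case False
    have "sing_val g (Suc i) \<le> sing_val g 2"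
      using right_singular_basis_exists(4)[OF g, of 1 i] that False by (simp add: numeral_2_eq_2)
    then have "sing_val g (Suc i) / mat_norm g < 1" using gap np by simp
    moreover have "0 \<le> sing_val g (Suc i) / mat_norm g" using right_singular_basis_exists(3)[OF g that] np by simp
    ultimately have "(sing_val g (Suc i) / mat_norm g)\<^sup>2 < 1" by (simp add: power_less_one_iff abs_square_less_1)
    then show ?thesis using False by (simp add: LIMSEQ_realpow_zero)
  qed
  have "(\<lambda>k. gram_power g k (a, b)) \<longlonglongrightarrow> (\<Sum>i<m. (if i = 0 then 1 else 0) * (V i $ a * V i $ b))"
    unfolding gram_power_expansion[OF g V ab] using lim by (intro tendsto_sum tendsto_mult tendsto_const) auto
  also have "(\<Sum>i<m. (if i = 0 then 1 else 0) * (V i $ a * V i $ b)) = V 0 $ a * V 0 $ b"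
  proof -
    have "(\<Sum>i<m. (if i = 0 then 1 else 0) * (V i $ a * V i $ b)) = (\<Sum>i<m. if i = 0 then V i $ a * V i $ b else 0)"
      by (intro sum.cong) auto
    then show ?thesis using m0 by (simp add: sum.delta)
  qed
  also have "\<dots> = line_proj (most_expanding g) (a, b)"
    using line_proj_unit[OF rsb_carrier[OF g V m0] rsb_len[OF g V m0] ab] most_expanding_line[OF g m V gap] by simp
  finally show ?thesis .
qed

text \<open>The trace is \<open>\<Sum>\<^sub>i (s\<^sub>i / s\<^sub>1)\<^bsup>2k\<^esup>\<close>, which tends to the multiplicity of \<open>s\<^sub>1\<close>.  For \<open>g = 0\<close>, division by zero
  makes it vanish for \<open>k \<ge> 1\<close>, in accordance with the absence of a gap.\<close>

lemma gap_iff_gram_trace: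
  assumes g: "g \<in> carrier_mat m m" and m: "m \<ge> 2"
  shows "sing_val g 2 < mat_norm g \<longleftrightarrow> (\<lambda>k. \<Sum>a<m. gram_power g k (a, a)) \<longlonglongrightarrow> 1"
proof -
  obtain V where V: "right_singular_basis m g V" using right_singular_basis_exists(1)[OF g] by blast
  have m0: "0 < m" "1 < m" using m by auto
  have s1: "sing_val g (Suc 0) = mat_norm g" using sing_val_1_eq_norm[OF g] m by simp
  have s12: "sing_val g 2 \<le> mat_norm g" "0 \<le> sing_val g 2"
    using right_singular_basis_exists(4)[OF g, of 0 1] right_singular_basis_exists(3)[OF g, of 1] m0 s1 by (simp_all add: numeral_2_eq_2)
  have VV: "(\<Sum>a<m. V i $ a * V i $ a) = 1" if "i < m" for i
    using rsb_orth[OF g V that that] rsb_carrier[OF g V that] by (simp add: scalar_prod_def atLeast0LessThan)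
  have tr: "(\<Sum>a<m. gram_power g k (a, a)) = (\<Sum>i<m. ((sing_val g (Suc i) / mat_norm g)\<^sup>2) ^ k)" for k
  proof -
    have "(\<Sum>a<m. gram_power g k (a, a)) = (\<Sum>a<m. \<Sum>i<m. ((sing_val g (Suc i) / mat_norm g)\<^sup>2) ^ k * (V i $ a * V i $ a))"
      using gram_power_expansion[OF g V] by (intro sum.cong) auto
    also have "\<dots> = (\<Sum>i<m. \<Sum>a<m. ((sing_val g (Suc i) / mat_norm g)\<^sup>2) ^ k * (V i $ a * V i $ a))" by (rule sum.swap)
    also have "\<dots> = (\<Sum>i<m. ((sing_val g (Suc i) / mat_norm g)\<^sup>2) ^ k)"
      unfolding sum_distrib_left[symmetric] using VV by (intro sum.cong) auto
    finally show ?thesis .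
  qed
  show ?thesis
  proof
    assume gap: "sing_val g 2 < mat_norm g"
    have "(\<lambda>k. \<Sum>a<m. gram_power g k (a, a)) \<longlonglongrightarrow> (\<Sum>a<m. line_proj (most_expanding g) (a, a))"
      using gram_power_tendsto[OF g m V gap] by (intro tendsto_sum) auto
    also have "(\<Sum>a<m. line_proj (most_expanding g) (a, a)) = (\<Sum>a<m. V 0 $ a * V 0 $ a)"
      using line_proj_unit[OF rsb_carrier[OF g V m0(1)] rsb_len[OF g V m0(1)]] most_expanding_line[OF g m V gap]
      by (intro sum.cong) auto
    finally show "(\<lambda>k. \<Sum>a<m. gram_power g k (a, a)) \<longlonglongrightarrow> 1" using VV m0 by simp
  next
    assume lim: "(\<lambda>k. \<Sum>a<m. gram_power g k (a, a)) \<longlonglongrightarrow> 1"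
    show "sing_val g 2 < mat_norm g"
    proof (rule ccontr)
      assume "\<not> ?thesis"
      with s12 have e: "sing_val g 2 = mat_norm g" by simp
      show False
      proof (cases "mat_norm g = 0")
        case True
        have "(\<Sum>a<m. gram_power g k (a, a)) = 0" if "k \<ge> 1" for k
          unfolding tr using True that by simp
        then have "\<forall>\<^sub>F k in sequentially. (\<Sum>a<m. gram_power g k (a, a)) = 0" unfolding eventually_sequentially by blast
        from Lim_transform_eventually[OF lim this] show False by (simp add: LIMSEQ_const_iff)
      next
        case False
        have "2 \<le> (\<Sum>a<m. gram_power g k (a, a))" for k
        proof -
          have "(\<Sum>i\<in>{0, 1}. ((sing_val g (Suc i) / mat_norm g)\<^sup>2) ^ k) \<le> (\<Sum>i<m. ((sing_val g (Suc i) / mat_norm g)\<^sup>2) ^ k)"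
            using m0 by (intro sum_mono2) auto
          then show ?thesis unfolding tr using False s1 e by (simp add: numeral_2_eq_2)
        qed
        then have "2 \<le> (1::real)" by (intro LIMSEQ_le_const[OF lim]) auto
        then show False by simp
      qed
    qed
  qed
qed

section \<open>The exterior square\<close>

lemma subseqs_sorted_wrt:
  "ys \<in> set (List.subseqs xs) \<Longrightarrow> sorted_wrt P xs \<Longrightarrow> sorted_wrt P ys \<and> set ys \<subseteq> set xs"
proof (induction xs arbitrary: ys)
  case (Cons x xs)
  have xs: "sorted_wrt P xs" "\<forall>z\<in>set xs. P x z" using Cons.prems(2) by auto
  have "ys \<in> set (List.subseqs xs) \<or> (\<exists>zs\<in>set (List.subseqs xs). ys = x # zs)"
    using Cons.prems(1) by (simp add: Let_def image_iff) blast
  then show ?case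
  proof
    assume "ys \<in> set (List.subseqs xs)"
    from Cons.IH[OF this xs(1)] show ?case by auto
  next
    assume "\<exists>zs\<in>set (List.subseqs xs). ys = x # zs"
    then obtain zs where zs: "zs \<in> set (List.subseqs xs)" "ys = x # zs" by blast
    from Cons.IH[OF zs(1) xs(1)] show ?case using xs(2) zs(2) by auto
  qed
qed simp

lemma index_tuples_2:
  shows "set (index_tuples m 2) = (\<lambda>(a, b). [a, b]) ` {(a, b). a < b \<and> b < m}"
    and "distinct (index_tuples m 2)"
    and "length (index_tuples m 2) = m choose 2"
proof -
  have dm: "distinct (map set (index_tuples m 2))"
    unfolding index_tuples_def by (rule distinct_map_filter) (simp add: distinct_set_subseqs)
  show d: "distinct (index_tuples m 2)" using dm by (simp add: distinct_map)
  have sub: "sorted_wrt (<) I \<and> set I \<subseteq> {0..<m} \<and> length I = 2" if "I \<in> set (index_tuples m 2)" for I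
    using that subseqs_sorted_wrt[of I "[0..<m]" "(<)"] unfolding index_tuples_def by auto
  show e: "set (index_tuples m 2) = (\<lambda>(a, b). [a, b]) ` {(a, b). a < b \<and> b < m}"
  proof (intro Set.set_eqI iffI)
    fix I assume "I \<in> set (index_tuples m 2)"
    from sub[OF this] have I: "sorted_wrt (<) I" "set I \<subseteq> {0..<m}" "length I = 2" by auto
    from I(3) obtain a b where ab: "I = [a, b]" by (auto simp: numeral_2_eq_2 length_Suc_conv)
    show "I \<in> (\<lambda>(a, b). [a, b]) ` {(a, b). a < b \<and> b < m}" using I unfolding ab by auto
  next
    fix I assume "I \<in> (\<lambda>(a, b). [a, b]) ` {(a, b). a < b \<and> b < m}"
    then obtain a b where ab: "I = [a, b]" "a < b" "b < m" by auto
    have "{a, b} \<in> Pow (set [0..<m])" using ab by auto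
    then have "{a, b} \<in> set ` set (List.subseqs [0..<m])" unfolding subseqs_powset .
    then obtain J where J: "J \<in> set (List.subseqs [0..<m])" "set J = {a, b}" by auto
    have sJ: "sorted_wrt (<) J" using subseqs_sorted_wrt[OF J(1), of "(<)"] by simp
    have "J = [a, b]"
      by (rule strict_sorted_equal) (use sJ J ab in auto)
    then show "I \<in> set (index_tuples m 2)" using J ab unfolding index_tuples_def by simp
  qed
  have "length (index_tuples m 2) = card (set ` set (index_tuples m 2))"
    using dm by (metis distinct_card length_map set_map)
  also have "set ` set (index_tuples m 2) = {B. B \<subseteq> {..<m} \<and> card B = 2}"
  proof (intro Set.set_eqI iffI)
    fix B assume "B \<in> set ` set (index_tuples m 2)"
    then show "B \<in> {B. B \<subseteq> {..<m} \<and> card B = 2}" unfolding e by auto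
  next
    fix B assume B: "B \<in> {B. B \<subseteq> {..<m} \<and> card B = 2}"
    then obtain a b where ab: "B = {a, b}" "a \<noteq> b" by (auto simp: card_2_iff)
    have "B = set [min a b, max a b]" using ab by (auto simp: min_def max_def)
    moreover have "[min a b, max a b] \<in> set (index_tuples m 2)" unfolding e using ab B by (auto simp: min_def max_def)
    ultimately show "B \<in> set ` set (index_tuples m 2)" by blast
  qed
  also have "card {B. B \<subseteq> {..<m} \<and> card B = 2} = m choose 2" using n_subsets[of "{..<m}" 2] by simp
  finally show "length (index_tuples m 2) = m choose 2" .
qed

text \<open>The \<open>i\<close>-th basis vector of the exterior square is \<open>e\<^sub>a \<and> e\<^sub>b\<close> with \<open>a = pair_fst m i < b = pair_snd m i\<close>.\<close>

definition pair_fst :: "nat \<Rightarrow> nat \<Rightarrow> nat" where "pair_fst m i = index_tuples m 2 ! i ! 0"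
definition pair_snd :: "nat \<Rightarrow> nat \<Rightarrow> nat" where "pair_snd m i = index_tuples m 2 ! i ! 1"

lemma index_tuples_2_nth:
  assumes "i < m choose 2"
  shows "index_tuples m 2 ! i = [pair_fst m i, pair_snd m i]" "pair_fst m i < pair_snd m i" "pair_snd m i < m"
proof -
  have "index_tuples m 2 ! i \<in> set (index_tuples m 2)" using assms index_tuples_2(3) by simp
  then obtain a b where "index_tuples m 2 ! i = [a, b]" "a < b" "b < m" unfolding index_tuples_2(1) by auto
  then show "index_tuples m 2 ! i = [pair_fst m i, pair_snd m i]" "pair_fst m i < pair_snd m i" "pair_snd m i < m"
    by (simp_all add: pair_fst_def pair_snd_def)
qed

text \<open>Sums over pairs become half of full double sums, so that the identities below can be checked without
  knowing how the pairs are enumerated.\<close>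

lemma sum_pairs:
  fixes F :: "nat \<Rightarrow> nat \<Rightarrow> real"
  assumes sym: "\<And>a b. F a b = F b a" and diag: "\<And>a. F a a = 0"
  shows "(\<Sum>i<m choose 2. F (pair_fst m i) (pair_snd m i)) = (\<Sum>a<m. \<Sum>b<m. F a b) / 2"
proof -
  have "(\<Sum>i<m choose 2. F (pair_fst m i) (pair_snd m i))
      = (\<Sum>i<length (index_tuples m 2). (\<lambda>I. F (I ! 0) (I ! 1)) (index_tuples m 2 ! i))"
    by (simp add: index_tuples_2(3) pair_fst_def pair_snd_def)
  also have "\<dots> = (\<Sum>I\<in>set (index_tuples m 2). F (I ! 0) (I ! 1))"
    using index_tuples_2(2)[of m]
    by (subst sum.distinct_set_conv_list) (simp_all add: sum_list_sum_nth atLeast0LessThan)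
  also have "\<dots> = (\<Sum>(a, b)\<in>{(a, b). a < b \<and> b < m}. F a b)"
    unfolding index_tuples_2(1) by (subst sum.reindex) (auto simp: inj_on_def intro!: sum.cong)
  finally have 1: "(\<Sum>i<m choose 2. F (pair_fst m i) (pair_snd m i)) = (\<Sum>(a, b)\<in>{(a, b). a < b \<and> b < m}. F a b)" .
  let ?L = "{(a, b). a < b \<and> b < m}" and ?U = "{(a, b). b < a \<and> a < m}" and ?D = "(\<lambda>a. (a, a)) ` {..<m}"
  have fin: "finite ?L" "finite ?U" by (rule finite_subset[of _ "{..<m} \<times> {..<m}"]; auto)+
  have "{..<m} \<times> {..<m} = (?L \<union> ?U) \<union> ?D" by auto
  then have "(\<Sum>a<m. \<Sum>b<m. F a b) = (\<Sum>(a, b)\<in>(?L \<union> ?U) \<union> ?D. F a b)" by (simp add: sum.cartesian_product)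
  also have "\<dots> = (\<Sum>(a, b)\<in>?L \<union> ?U. F a b) + (\<Sum>(a, b)\<in>?D. F a b)"
    by (rule sum.union_disjoint) (use fin in auto)
  also have "(\<Sum>(a, b)\<in>?D. F a b) = 0" using diag by (intro sum.neutral) auto
  also have "(\<Sum>(a, b)\<in>?L \<union> ?U. F a b) = (\<Sum>(a, b)\<in>?L. F a b) + (\<Sum>(a, b)\<in>?U. F a b)"
    by (rule sum.union_disjoint) (use fin in auto)
  also have "(\<Sum>(a, b)\<in>?U. F a b) = (\<Sum>(a, b)\<in>?L. F a b)"
    by (rule sum.reindex_bij_witness[of _ "\<lambda>(a, b). (b, a)" "\<lambda>(a, b). (b, a)"]) (auto simp: sym)
  finally show ?thesis using 1 by simp
qed

lemma pick_pair:
  assumes "(a::nat) < b" shows "pick {a, b} 0 = a" "pick {a, b} (Suc 0) = b"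
proof -
  show 0: "pick {a, b} 0 = a" using assms by (auto intro!: Least_equality)
  have "pick {a, b} (Suc 0) = (LEAST x. x \<in> {a, b} \<and> pick {a, b} 0 < x)" by simp
  also have "\<dots> = b" unfolding 0 using assms by (intro Least_equality) auto
  finally show "pick {a, b} (Suc 0) = b" .
qed

lemma det_2x2:
  fixes A :: "real mat"
  assumes A: "A \<in> carrier_mat 2 2"
  shows "Determinant.det A = A $$ (0, 0) * A $$ (1, 1) - A $$ (0, 1) * A $$ (1, 0)"
proof -
  have d: "Determinant.det (mat_delete A 0 0) = A $$ (1, 1)" "Determinant.det (mat_delete A 1 0) = A $$ (0, 1)"
    using A by (simp_all add: det_single mat_delete_def)
  have "Determinant.det A = (\<Sum>i<2. A $$ (i, 0) * cofactor A i 0)"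
    by (rule laplace_expansion_column[OF A]) simp
  also have "\<dots> = A $$ (0, 0) * cofactor A 0 0 + A $$ (1, 0) * cofactor A 1 0"
    by (simp add: numeral_2_eq_2)
  finally show ?thesis using d by (simp add: cofactor_def)
qed

definition wedge :: "nat \<Rightarrow> real vec \<Rightarrow> real vec \<Rightarrow> real vec" where
  "wedge m v w = Matrix.vec (m choose 2)
     (\<lambda>i. v $ pair_fst m i * w $ pair_snd m i - v $ pair_snd m i * w $ pair_fst m i)"

lemma wedge_carrier [simp]: "wedge m v w \<in> carrier_vec (m choose 2)"
  by (simp add: wedge_def)

lemma ext_power_2_carrier [simp]:
  "g \<in> carrier_mat m m \<Longrightarrow> ext_power 2 g \<in> carrier_mat (m choose 2) (m choose 2)"
  by (auto simp: ext_power_def Let_def)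

lemma ext_power_2_entry:
  assumes g: "g \<in> carrier_mat m m" and ij: "i < m choose 2" "j < m choose 2"
  shows "ext_power 2 g $$ (i, j) =
    g $$ (pair_fst m i, pair_fst m j) * g $$ (pair_snd m i, pair_snd m j)
    - g $$ (pair_fst m i, pair_snd m j) * g $$ (pair_snd m i, pair_fst m j)"
proof -
  note i = index_tuples_2_nth[OF ij(1)] and j = index_tuples_2_nth[OF ij(2)]
  let ?I = "{pair_fst m i, pair_snd m i}" and ?J = "{pair_fst m j, pair_snd m j}"
  have "{k. k < m \<and> k \<in> ?I} = ?I" "{k. k < m \<and> k \<in> ?J} = ?J" using i j by auto
  then have c: "card {k. k < m \<and> k \<in> ?I} = 2" "card {k. k < m \<and> k \<in> ?J} = 2" using i j by simp_all
  have S: "submatrix g ?I ?J \<in> carrier_mat 2 2" using c g by (intro carrier_matI) (simp_all add: dim_submatrix)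
  have e: "submatrix g ?I ?J $$ (p, q) = g $$ (pick ?I p, pick ?J q)" if "p < 2" "q < 2" for p q
    by (rule submatrix_index) (use c g that in simp_all)
  have "ext_power 2 g $$ (i, j) = Determinant.det (submatrix g ?I ?J)"
    using g ij i(1) j(1) by (simp add: ext_power_def Let_def)
  also have "\<dots> = submatrix g ?I ?J $$ (0, 0) * submatrix g ?I ?J $$ (1, 1) - submatrix g ?I ?J $$ (0, 1) * submatrix g ?I ?J $$ (1, 0)"
    by (rule det_2x2[OF S])
  finally show ?thesis using e pick_pair[OF i(2)] pick_pair[OF j(2)] by simp
qed

lemma ext_power_2_wedge:
  assumes g: "g \<in> carrier_mat m m" and v: "v \<in> carrier_vec m" and w: "w \<in> carrier_vec m"
  shows "ext_power 2 g *\<^sub>v wedge m v w = wedge m (g *\<^sub>v v) (g *\<^sub>v w)"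
proof (rule eq_vecI)
  fix i assume "i < dim_vec (wedge m (g *\<^sub>v v) (g *\<^sub>v w))"
  then have i: "i < m choose 2" by (simp add: wedge_def)
  define a where "a = pair_fst m i"
  define b where "b = pair_snd m i"
  have ab: "a < m" "b < m" using index_tuples_2_nth[OF i] by (auto simp: a_def b_def)
  have gv: "(g *\<^sub>v x) $ k = (\<Sum>c<m. g $$ (k, c) * x $ c)" if "k < m" "x \<in> carrier_vec m" for k x
    using that g by (simp add: scalar_prod_def atLeast0LessThan)
  define F where "F = (\<lambda>c d. (g $$ (a, c) * g $$ (b, d) - g $$ (a, d) * g $$ (b, c)) * (v $ c * w $ d - v $ d * w $ c))"
  have "(ext_power 2 g *\<^sub>v wedge m v w) $ i = (\<Sum>j<m choose 2. ext_power 2 g $$ (i, j) * wedge m v w $ j)"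
    using i ext_power_2_carrier[OF g] by (simp add: scalar_prod_def atLeast0LessThan wedge_def)
  also have "\<dots> = (\<Sum>j<m choose 2. F (pair_fst m j) (pair_snd m j))"
    using i by (intro sum.cong) (auto simp: ext_power_2_entry[OF g] wedge_def F_def a_def b_def)
  also have "\<dots> = (\<Sum>c<m. \<Sum>d<m. F c d) / 2" by (rule sum_pairs) (auto simp: F_def algebra_simps)
  also have "(\<Sum>c<m. \<Sum>d<m. F c d) = (\<Sum>c<m. \<Sum>d<m.
       (g $$ (a, c) * v $ c) * (g $$ (b, d) * w $ d) - (g $$ (a, c) * w $ c) * (g $$ (b, d) * v $ d)
     - (g $$ (b, c) * v $ c) * (g $$ (a, d) * w $ d) + (g $$ (b, c) * w $ c) * (g $$ (a, d) * v $ d))"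
    by (intro sum.cong) (auto simp: F_def algebra_simps)
  also have "\<dots> = (g *\<^sub>v v) $ a * (g *\<^sub>v w) $ b - (g *\<^sub>v w) $ a * (g *\<^sub>v v) $ b
      - (g *\<^sub>v v) $ b * (g *\<^sub>v w) $ a + (g *\<^sub>v w) $ b * (g *\<^sub>v v) $ a"
    unfolding gv[OF ab(1) v] gv[OF ab(1) w] gv[OF ab(2) v] gv[OF ab(2) w] sum_product
    by (simp add: sum.distrib sum_subtractf)
  finally show "(ext_power 2 g *\<^sub>v wedge m v w) $ i = wedge m (g *\<^sub>v v) (g *\<^sub>v w) $ i"
    using i by (simp add: wedge_def a_def[symmetric] b_def[symmetric] del: index_mult_mat_vec)
qed (use ext_power_2_carrier[OF g] in \<open>auto simp: wedge_def\<close>)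

lemma wedge_len:
  assumes v: "v \<in> carrier_vec m" and w: "w \<in> carrier_vec m"
  shows "(vec_len (wedge m v w))\<^sup>2 = (v \<bullet> v) * (w \<bullet> w) - (v \<bullet> w)\<^sup>2"
proof -
  define F where "F = (\<lambda>a b. (v $ a * w $ b - v $ b * w $ a) * (v $ a * w $ b - v $ b * w $ a))"
  have sp: "x \<bullet> y = (\<Sum>c<m. x $ c * y $ c)" if "y \<in> carrier_vec m" for x y :: "real vec"
    using that by (simp add: scalar_prod_def atLeast0LessThan)
  have "(vec_len (wedge m v w))\<^sup>2 = (\<Sum>j<m choose 2. F (pair_fst m j) (pair_snd m j))"
    by (simp add: vec_len_sq scalar_prod_def atLeast0LessThan wedge_def F_def)
  also have "\<dots> = (\<Sum>c<m. \<Sum>d<m. F c d) / 2" by (rule sum_pairs) (auto simp: F_def algebra_simps)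
  also have "(\<Sum>c<m. \<Sum>d<m. F c d) = (\<Sum>c<m. \<Sum>d<m. (v $ c * v $ c) * (w $ d * w $ d) - (v $ c * w $ c) * (v $ d * w $ d)
      - (v $ c * w $ c) * (v $ d * w $ d) + (w $ c * w $ c) * (v $ d * v $ d))"
    by (intro sum.cong) (auto simp: F_def algebra_simps)
  also have "\<dots> = (v \<bullet> v) * (w \<bullet> w) - (v \<bullet> w) * (v \<bullet> w) - (v \<bullet> w) * (v \<bullet> w) + (w \<bullet> w) * (v \<bullet> v)"
    unfolding sp[OF v] sp[OF w] sum_product by (simp add: sum.distrib sum_subtractf sum_negf sum_distrib_left mult_ac)
  finally show ?thesis by (simp add: power2_eq_square)
qed

lemma wedge_unit_vec:
  assumes "j < m choose 2"
  shows "wedge m (unit_vec m (pair_fst m j)) (unit_vec m (pair_snd m j)) = unit_vec (m choose 2) j"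
proof (rule eq_vecI)
  note j = index_tuples_2_nth[OF assms]
  fix i assume "i < dim_vec (unit_vec (m choose 2) j)"
  then have i0: "i < m choose 2" by simp
  note i = index_tuples_2_nth[OF i0]
  have "i = j \<longleftrightarrow> index_tuples m 2 ! i = index_tuples m 2 ! j"
    using index_tuples_2(2,3)[of m] i0 assms by (simp add: nth_eq_iff_index_eq)
  then have "i = j \<longleftrightarrow> pair_fst m i = pair_fst m j \<and> pair_snd m i = pair_snd m j" unfolding i(1) j(1) by simp
  then show "wedge m (unit_vec m (pair_fst m j)) (unit_vec m (pair_snd m j)) $ i = unit_vec (m choose 2) j $ i"
    using i j i0 assms by (auto simp: wedge_def)
qed (simp add: wedge_def)

text \<open>It suffices to compare the two matrices on the vectors \<open>e\<^sub>a \<and> e\<^sub>b\<close>, where the compatibility with \<open>wedge\<close> applies.\<close>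

lemma ext_power_2_mult:
  assumes g: "g \<in> carrier_mat m m" and h: "h \<in> carrier_mat m m"
  shows "ext_power 2 (g * h) = ext_power 2 g * ext_power 2 h"
proof (rule eq_matI)
  have E: "ext_power 2 g \<in> carrier_mat (m choose 2) (m choose 2)" "ext_power 2 h \<in> carrier_mat (m choose 2) (m choose 2)"
    "ext_power 2 (g * h) \<in> carrier_mat (m choose 2) (m choose 2)" using g h by simp_all
  show "dim_row (ext_power 2 (g * h)) = dim_row (ext_power 2 g * ext_power 2 h)"
    "dim_col (ext_power 2 (g * h)) = dim_col (ext_power 2 g * ext_power 2 h)" using E by auto
  fix i j assume "i < dim_row (ext_power 2 g * ext_power 2 h)" "j < dim_col (ext_power 2 g * ext_power 2 h)"
  then have ij: "i < m choose 2" "j < m choose 2" using E by auto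
  have mult_unit: "X $$ (i, j) = (X *\<^sub>v unit_vec (m choose 2) j) $ i" if "X \<in> carrier_mat (m choose 2) (m choose 2)" for X :: "real mat"
    using that ij by simp
  let ?v = "unit_vec m (pair_fst m j) :: real vec" and ?w = "unit_vec m (pair_snd m j) :: real vec"
  have vw: "?v \<in> carrier_vec m" "?w \<in> carrier_vec m" by auto
  have hvw: "h *\<^sub>v ?v \<in> carrier_vec m" "h *\<^sub>v ?w \<in> carrier_vec m" using h by auto
  have "ext_power 2 (g * h) *\<^sub>v unit_vec (m choose 2) j = wedge m ((g * h) *\<^sub>v ?v) ((g * h) *\<^sub>v ?w)"
    using ext_power_2_wedge[OF mult_carrier_mat[OF g h] vw] wedge_unit_vec[OF ij(2)] by simp
  also have "\<dots> = wedge m (g *\<^sub>v (h *\<^sub>v ?v)) (g *\<^sub>v (h *\<^sub>v ?w))"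
    unfolding assoc_mult_mat_vec[OF g h vw(1)] assoc_mult_mat_vec[OF g h vw(2)] ..
  also have "\<dots> = ext_power 2 g *\<^sub>v (ext_power 2 h *\<^sub>v unit_vec (m choose 2) j)"
    using ext_power_2_wedge[OF g hvw] ext_power_2_wedge[OF h vw] wedge_unit_vec[OF ij(2)] by simp
  also have "\<dots> = (ext_power 2 g * ext_power 2 h) *\<^sub>v unit_vec (m choose 2) j"
    by (rule assoc_mult_mat_vec[OF E(1,2), symmetric]) simp
  finally show "ext_power 2 (g * h) $$ (i, j) = (ext_power 2 g * ext_power 2 h) $$ (i, j)"
    unfolding mult_unit[OF E(3)] mult_unit[OF mult_carrier_mat[OF E(1,2)]] by (rule arg_cong)
qed

text \<open>The value on the left is the length of the image of \<open>V\<^sub>0 \<and> V\<^sub>1\<close>, because \<open>g V\<^sub>0\<close> and \<open>g V\<^sub>1\<close> are orthogonal.\<close>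

lemma sing_val_le_ext_power_norm:
  assumes g: "g \<in> carrier_mat m m" and m: "m \<ge> 2"
  shows "mat_norm g * sing_val g 2 \<le> mat_norm (ext_power 2 g)"
proof -
  obtain V where V: "right_singular_basis m g V" using right_singular_basis_exists(1)[OF g] by blast
  have m0: "0 < m" "1 < m" using m by auto
  note v = rsb_carrier[OF g V m0(1)] rsb_carrier[OF g V m0(2)]
  have o: "V 0 \<bullet> V 0 = 1" "V 1 \<bullet> V 1 = 1" "V 0 \<bullet> V 1 = 0"
    using rsb_orth[OF g V m0(1) m0(1)] rsb_orth[OF g V m0(2) m0(2)] rsb_orth[OF g V m0(1) m0(2)] by auto
  have go: "(g *\<^sub>v V 0) \<bullet> (g *\<^sub>v V 1) = 0" using rsb_mult_coeff[OF g V m0(1) v(2)] o by simp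
  have gl: "vec_len (g *\<^sub>v V 0) = mat_norm g" "vec_len (g *\<^sub>v V 1) = sing_val g 2"
    using rsb_len_mult[OF g V m0(1)] rsb_len_mult[OF g V m0(2)] sing_val_1_eq_norm[OF g] m by (simp_all add: numeral_2_eq_2)
  have s2: "0 \<le> sing_val g 2" using right_singular_basis_exists(3)[OF g m0(2)] by (simp add: numeral_2_eq_2)
  have "(vec_len (wedge m (V 0) (V 1)))\<^sup>2 = 1" using wedge_len[OF v] o by simp
  then have 1: "vec_len (wedge m (V 0) (V 1)) = 1" using vec_len_nonneg by (simp add: power2_eq_1_iff) (smt (verit) vec_len_nonneg)
  have gvc: "g *\<^sub>v V 0 \<in> carrier_vec m" "g *\<^sub>v V 1 \<in> carrier_vec m" using g v by auto
  have "(vec_len (wedge m (g *\<^sub>v V 0) (g *\<^sub>v V 1)))\<^sup>2 = (mat_norm g * sing_val g 2)\<^sup>2"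
    using wedge_len[OF gvc] go gl by (simp add: vec_len_sq[symmetric] power_mult_distrib)
  then have "vec_len (wedge m (g *\<^sub>v V 0) (g *\<^sub>v V 1)) = mat_norm g * sing_val g 2"
    using s2 by (simp add: power2_eq_iff_nonneg)
  then show ?thesis
    using mat_norm_bound[OF ext_power_2_carrier[OF g] wedge_carrier, of "V 0" "V 1"] ext_power_2_wedge[OF g v] 1 by simp
qed

text \<open>A crude constant suffices for exponents.  Up to an error of length \<open>s\<^sub>2\<close>, each column of \<open>g\<close> is a multiple
  of \<open>g V\<^sub>0\<close>.  In a \<open>2 \<times> 2\<close> minor the products of the main terms cancel, and each of the six
  remaining products is at most \<open>s\<^sub>1 s\<^sub>2\<close>.\<close>

lemma ext_power_norm_le_sing_val:
  assumes g: "g \<in> carrier_mat m m" and m: "m \<ge> 2"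
  shows "mat_norm (ext_power 2 g) \<le> 6 * (real (m choose 2))\<^sup>2 * (mat_norm g * sing_val g 2)"
proof -
  obtain V where V: "right_singular_basis m g V" using right_singular_basis_exists(1)[OF g] by blast
  have m0: "0 < m" "1 < m" using m by auto
  note v = rsb_carrier[OF g V m0(1)] rsb_len[OF g V m0(1)] rsb_orth[OF g V m0(1) m0(1)]
  define s1 where "s1 = mat_norm g"
  define s2 where "s2 = sing_val g 2"
  have s2: "0 \<le> s2" using right_singular_basis_exists(3)[OF g m0(2)] by (simp add: s2_def numeral_2_eq_2)
  have s21: "s2 \<le> s1" using right_singular_basis_exists(4)[OF g, of 0 1] m0 sing_val_1_eq_norm[OF g]
    by (simp add: numeral_2_eq_2 s1_def s2_def)
  have gV: "g *\<^sub>v V 0 \<in> carrier_vec m" "vec_len (g *\<^sub>v V 0) = s1"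
    using g v rsb_len_mult[OF g V m0(1)] sing_val_1_eq_norm[OF g] m by (auto simp: s1_def)
  have dec: "\<exists>\<alpha> y. \<bar>\<alpha>\<bar> \<le> 1 \<and> y \<in> carrier_vec m \<and> vec_len y \<le> s2 \<and> (\<forall>a<m. g $$ (a, c) = \<alpha> * (g *\<^sub>v V 0) $ a + y $ a)"
    if c: "c < m" for c
  proof -
    define e :: "real vec" where "e = unit_vec m c"
    have e: "e \<in> carrier_vec m" "vec_len e = 1" "e \<bullet> e = 1" using c vec_len_sq[of e] by (auto simp: e_def)
    define x where "x = e + (- (V 0 \<bullet> e)) \<cdot>\<^sub>v V 0"
    have x: "x \<in> carrier_vec m" using e v by (simp add: x_def)
    have ox: "V 0 \<bullet> x = 0" unfolding x_def using e v by (simp add: scalar_prod_add_distrib[of _ m])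
    have "x \<bullet> x = e \<bullet> x" by (subst (1) x_def) (use e v x ox in \<open>simp add: add_scalar_prod_distrib[of _ m]\<close>)
    also have "\<dots> \<le> vec_len x" using Cauchy_Schwarz_vec[OF e(1) x] e(2) by simp
    finally have "vec_len x * vec_len x \<le> 1 * vec_len x" by (simp add: vec_len_sq[symmetric] power2_eq_square)
    then have lx: "vec_len x \<le> 1" using vec_len_nonneg[of x] by (cases "vec_len x = 0") (auto simp: mult_le_cancel_right)
    have "vec_len (g *\<^sub>v x) \<le> s2 * vec_len x"
      using rsb_tail_bound[OF g V x m0(2)] ox by (simp add: s2_def numeral_2_eq_2)
    also have "\<dots> \<le> s2" using lx s2 by (simp add: mult_left_le)
    finally have y: "vec_len (g *\<^sub>v x) \<le> s2" .
    have "g *\<^sub>v x = g *\<^sub>v e + (- (V 0 \<bullet> e)) \<cdot>\<^sub>v (g *\<^sub>v V 0)"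
      unfolding x_def using g e v by (simp add: mult_add_distrib_mat_vec[of _ m m] mult_mat_vec)
    then have "g $$ (a, c) = (V 0 \<bullet> e) * (g *\<^sub>v V 0) $ a + (g *\<^sub>v x) $ a" if "a < m" for a
      using that g c gV(1) by (simp add: e_def)
    moreover have "\<bar>V 0 \<bullet> e\<bar> \<le> 1" using Cauchy_Schwarz_vec[OF v(1) e(1)] v e by simp
    ultimately show ?thesis using y g x by (intro exI[of _ "V 0 \<bullet> e"] exI[of _ "g *\<^sub>v x"]) auto
  qed
  have entry: "\<bar>g $$ (a, c) * g $$ (b, d) - g $$ (a, d) * g $$ (b, c)\<bar> \<le> 6 * (s1 * s2)"
    if "a < m" "b < m" "c < m" "d < m" for a b c d
  proof -
    obtain \<alpha> y where y: "\<bar>\<alpha>\<bar> \<le> 1" "y \<in> carrier_vec m" "vec_len y \<le> s2" "\<forall>a<m. g $$ (a, c) = \<alpha> * (g *\<^sub>v V 0) $ a + y $ a"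
      using dec[OF \<open>c < m\<close>] by blast
    obtain \<beta> z where z: "\<bar>\<beta>\<bar> \<le> 1" "z \<in> carrier_vec m" "vec_len z \<le> s2" "\<forall>a<m. g $$ (a, d) = \<beta> * (g *\<^sub>v V 0) $ a + z $ a"
      using dec[OF \<open>d < m\<close>] by blast
    define p where "p = (g *\<^sub>v V 0)"
    have pc: "p \<in> carrier_vec m" "vec_len p = s1" using gV by (simp_all only: p_def)
    have pb: "\<bar>p $ k\<bar> \<le> s1" "\<bar>y $ k\<bar> \<le> s2" "\<bar>z $ k\<bar> \<le> s2" if "k < m" for k
      using vec_len_ge_entry[of k p] vec_len_ge_entry[of k y] vec_len_ge_entry[of k z] that pc y(2,3) z(2,3)
      by auto
    have pr: "\<bar>\<gamma> * (r * t)\<bar> \<le> s1 * s2" if "\<bar>\<gamma>\<bar> \<le> 1" "\<bar>r\<bar> \<le> s1" "\<bar>t\<bar> \<le> s2" for \<gamma> r t :: real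
    proof -
      have "\<bar>\<gamma>\<bar> * (\<bar>r\<bar> * \<bar>t\<bar>) \<le> 1 * (s1 * s2)" using that s2 s21 by (intro mult_mono) auto
      then show ?thesis by (simp add: abs_mult)
    qed
    have "g $$ (a, c) * g $$ (b, d) - g $$ (a, d) * g $$ (b, c) =
      \<alpha> * (p $ a * z $ b) - \<alpha> * (p $ b * z $ a) + \<beta> * (p $ b * y $ a) - \<beta> * (p $ a * y $ b)
      + (1 * (y $ a * z $ b) - 1 * (z $ a * y $ b))"
      using y(4) z(4) that by (simp add: p_def algebra_simps del: index_mult_mat_vec)
    moreover have "\<bar>\<alpha> * (p $ a * z $ b)\<bar> \<le> s1 * s2" "\<bar>\<alpha> * (p $ b * z $ a)\<bar> \<le> s1 * s2"
      "\<bar>\<beta> * (p $ b * y $ a)\<bar> \<le> s1 * s2" "\<bar>\<beta> * (p $ a * y $ b)\<bar> \<le> s1 * s2"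
      using pb that y(1) z(1) by (intro pr; simp)+
    moreover have "\<bar>1 * (y $ a * z $ b)\<bar> \<le> s1 * s2" "\<bar>1 * (z $ a * y $ b)\<bar> \<le> s1 * s2"
      using pb[OF \<open>a < m\<close>] pb[OF \<open>b < m\<close>] s21 by (intro pr; simp)+
    ultimately show ?thesis by linarith
  qed
  have "mat_norm (ext_power 2 g) \<le> (\<Sum>i<m choose 2. \<Sum>j<m choose 2. \<bar>ext_power 2 g $$ (i, j)\<bar>)"
    by (rule mat_norm_le_entry_sum[OF ext_power_2_carrier[OF g]])
  also have "\<dots> \<le> (\<Sum>i<m choose 2. \<Sum>j<m choose 2. 6 * (s1 * s2))"
  proof (intro sum_mono)
    fix i j assume "i \<in> {..<m choose 2}" "j \<in> {..<m choose 2}"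
    then have ij: "i < m choose 2" "j < m choose 2" by auto
    note i = index_tuples_2_nth[OF ij(1)] and j = index_tuples_2_nth[OF ij(2)]
    show "\<bar>ext_power 2 g $$ (i, j)\<bar> \<le> 6 * (s1 * s2)"
      unfolding ext_power_2_entry[OF g ij] by (rule entry) (use i j in auto)
  qed
  also have "\<dots> = 6 * (real (m choose 2))\<^sup>2 * (s1 * s2)" by (simp add: power2_eq_square)
  finally show ?thesis by (simp add: s1_def s2_def)
qed

section \<open>Measurability of the operator norm\<close>

text \<open>Countably many test vectors determine the norm, which is what makes it measurable.\<close>

lemma mat_norm_le_rational:
  assumes g: "g \<in> carrier_mat r c" and t: "0 \<le> t"
    and q: "\<And>qs :: rat list. vec_len (g *\<^sub>v Matrix.vec c (\<lambda>i. of_rat (qs ! i))) \<le> t * vec_len (Matrix.vec c (\<lambda>i. of_rat (qs ! i)))"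
  shows "mat_norm g \<le> t"
proof (rule mat_norm_leI[OF g t])
  fix v :: "real vec" assume v: "v \<in> carrier_vec c"
  let ?K = "t + mat_norm g"
  show "vec_len (g *\<^sub>v v) \<le> t * vec_len v"
  proof (rule field_le_epsilon)
    fix e :: real assume e: "0 < e"
    define d where "d = e / ((?K + 1) * (real c + 1))"
    have K: "0 \<le> ?K" using t by simp
    have d: "0 < d" unfolding d_def using e K by (intro divide_pos_pos mult_pos_pos) auto
    have "\<forall>i. \<exists>q::rat. \<bar>v $ i - of_rat q\<bar> < d"
    proof
      fix i
      obtain q where "v $ i < of_rat q" "of_rat q < v $ i + d" using of_rat_dense[of "v $ i" "v $ i + d"] d by auto
      then show "\<exists>q::rat. \<bar>v $ i - of_rat q\<bar> < d" by (intro exI[of _ q]) auto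
    qed
    then obtain f where f: "\<And>i. \<bar>v $ i - of_rat (f i :: rat)\<bar> < d" by metis
    define w where "w = Matrix.vec c (\<lambda>i. of_rat (map f [0..<c] ! i) :: real)"
    have w: "w \<in> carrier_vec c" by (simp add: w_def)
    define u where "u = v - w"
    have u: "u \<in> carrier_vec c" using v w by (simp add: u_def)
    have "vec_len u \<le> (\<Sum>i = 0..<c. \<bar>u $ i\<bar>)" using vec_len_le_sum[of u] u by simp
    also have "\<dots> \<le> (\<Sum>i = 0..<c. d)"
      by (intro sum_mono) (use f v in \<open>auto simp: u_def w_def less_imp_le\<close>)
    finally have lu: "vec_len u \<le> real c * d" by simp
    have vw: "v = w + u" "w = v + (- 1) \<cdot>\<^sub>v u" using v w by (auto simp: u_def intro!: eq_vecI)
    have lw: "vec_len w \<le> vec_len v + vec_len u"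
      using vec_len_add[OF v, of "(- 1) \<cdot>\<^sub>v u"] u by (subst vw(2)) simp
    have "g *\<^sub>v v = g *\<^sub>v w + g *\<^sub>v u" unfolding vw(1) using g w u by (rule mult_add_distrib_mat_vec)
    then have "vec_len (g *\<^sub>v v) \<le> vec_len (g *\<^sub>v w) + vec_len (g *\<^sub>v u)"
      using vec_len_add[of "g *\<^sub>v w" r "g *\<^sub>v u"] g w u by simp
    also have "\<dots> \<le> t * vec_len w + mat_norm g * vec_len u"
      using q[of "map f [0..<c]"] mat_norm_bound[OF g u] unfolding w_def by (rule add_mono)
    also have "\<dots> \<le> t * (vec_len v + vec_len u) + mat_norm g * vec_len u"
      using lw t by (intro add_mono mult_left_mono) auto
    also have "\<dots> = t * vec_len v + ?K * vec_len u" by (simp add: algebra_simps)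
    also have "\<dots> \<le> t * vec_len v + (?K + 1) * ((real c + 1) * d)"
    proof -
      have cd: "real c * d \<le> (real c + 1) * d" using d by (simp add: algebra_simps)
      then have "?K * vec_len u \<le> (?K + 1) * ((real c + 1) * d)"
        using order_trans[OF lu cd] K d by (intro mult_mono) auto
      then show ?thesis by simp
    qed
    also have "(?K + 1) * ((real c + 1) * d) = e"
    proof -
      have "?K + 1 \<noteq> 0" "real c + 1 \<noteq> 0" using K by linarith+
      then show ?thesis unfolding d_def by simp
    qed
    finally show "vec_len (g *\<^sub>v v) \<le> t * vec_len v + e" by simp
  qed
qed

lemma borel_measurable_mat_norm:
  assumes g: "\<And>x. x \<in> space M \<Longrightarrow> g x \<in> carrier_mat r c"
    and [measurable]: "\<And>i j. i < r \<Longrightarrow> j < c \<Longrightarrow> (\<lambda>x. g x $$ (i, j)) \<in> borel_measurable M"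
  shows "(\<lambda>x. mat_norm (g x)) \<in> borel_measurable M"
proof -
  let ?q = "\<lambda>qs :: rat list. Matrix.vec c (\<lambda>i. of_rat (qs ! i)) :: real vec"
  have ln: "vec_len (g x *\<^sub>v ?q qs) = sqrt (\<Sum>i<r. (\<Sum>j<c. g x $$ (i, j) * of_rat (qs ! j))\<^sup>2)" if "x \<in> space M" for x qs
    using g[OF that] by (auto simp: vec_len_L2_set L2_set_def scalar_prod_def atLeast0LessThan intro!: sum.cong)
  have [measurable]: "(\<lambda>x. vec_len (g x *\<^sub>v ?q qs)) \<in> borel_measurable M" for qs
  proof -
    have "(\<lambda>x. sqrt (\<Sum>i<r. (\<Sum>j<c. g x $$ (i, j) * of_rat (qs ! j))\<^sup>2)) \<in> borel_measurable M"
      using assms(2) by (intro measurable_compose[OF _ borel_measurable_sqrt] borel_measurable_sum borel_measurable_power borel_measurable_times) auto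
    then show ?thesis using ln by (subst measurable_cong) auto
  qed
  show ?thesis
  proof (rule borel_measurable_iff_le[THEN iffD2], rule allI)
    fix t
    show "{x \<in> space M. mat_norm (g x) \<le> t} \<in> sets M"
    proof (cases "0 \<le> t")
      case True
      have "{x \<in> space M. mat_norm (g x) \<le> t} = {x \<in> space M. \<forall>qs. vec_len (g x *\<^sub>v ?q qs) \<le> t * vec_len (?q qs)}"
      proof (intro Collect_cong conj_cong refl iffI allI)
        fix x qs assume x: "x \<in> space M" and le: "mat_norm (g x) \<le> t"
        have "vec_len (g x *\<^sub>v ?q qs) \<le> mat_norm (g x) * vec_len (?q qs)" using g[OF x] by (intro mat_norm_bound) auto
        also have "\<dots> \<le> t * vec_len (?q qs)" using le by (intro mult_right_mono) auto
        finally show "vec_len (g x *\<^sub>v ?q qs) \<le> t * vec_len (?q qs)" .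
      next
        fix x assume x: "x \<in> space M" and "\<forall>qs. vec_len (g x *\<^sub>v ?q qs) \<le> t * vec_len (?q qs)"
        then show "mat_norm (g x) \<le> t" using mat_norm_le_rational[OF g[OF x] True] by blast
      qed
      also have "\<dots> \<in> sets M" by measurable
      finally show ?thesis .
    next
      case False
      then have e: "{x \<in> space M. mat_norm (g x) \<le> t} = {}"
        using mat_norm_nonneg by (auto simp: not_le intro: less_le_trans)
      show ?thesis unfolding e by simp
    qed
  qed
qed

section \<open>Cocycles over an ergodic automorphism\<close>

locale ergodic_system = prob_space M for M :: "'a measure" +
  fixes T :: "'a \<Rightarrow> 'a"
  assumes ergodic: "ergodic_automorphism M T"
begin

lemma T_measurable [measurable]: "T \<in> measurable M M"
  using ergodic by (simp add: ergodic_automorphism_def)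

lemma T_pow_measurable [measurable]: "(T ^^ n) \<in> measurable M M"
  by (induction n) auto

lemma T_pow_space: "x \<in> space M \<Longrightarrow> (T ^^ n) x \<in> space M"
  using measurable_space[OF T_pow_measurable] .

lemma distr_T: "distr M M T = M"
proof (rule measure_eqI)
  fix E assume "E \<in> sets (distr M M T)"
  then have E: "E \<in> sets M" by simp
  then show "emeasure (distr M M T) E = emeasure M E"
    using ergodic by (simp add: emeasure_distr ergodic_automorphism_def emeasure_eq_measure)
qed simp

lemma distr_T_pow: "distr M M (T ^^ n) = M"
proof (induction n)
  case 0 then show ?case by (simp add: distr_id2)
next
  case (Suc n)
  have "distr M M (T ^^ Suc n) = distr (distr M M (T ^^ n)) M T"
    by (simp only: funpow.simps distr_distr[OF T_measurable T_pow_measurable])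
  also have "\<dots> = M" unfolding Suc distr_T ..
  finally show ?case .
qed

lemma AE_T_pow:
  assumes "AE x in M. P x" shows "AE x in M. P ((T ^^ n) x)"
proof -
  have "AE x in distr M M (T ^^ n). P x" unfolding distr_T_pow by (rule assms)
  then show ?thesis by (rule AE_distrD[OF T_pow_measurable])
qed

lemma AE_T_pow_all:
  assumes "AE x in M. P x" shows "AE x in M. \<forall>n. P ((T ^^ n) x)"
  using AE_T_pow[OF assms] by (simp add: AE_all_countable)

lemma integral_T_pow:
  assumes "f \<in> borel_measurable M"
  shows "integral\<^sup>L M (\<lambda>x. f ((T ^^ n) x)) = integral\<^sup>L M (f :: _ \<Rightarrow> real)"
  using integral_distr[OF T_pow_measurable assms, of n] distr_T_pow by simp

lemma integrable_T_pow:
  assumes "integrable M (f :: _ \<Rightarrow> real)"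
  shows "integrable M (\<lambda>x. f ((T ^^ n) x))"
proof -
  have "integrable (distr M M (T ^^ n)) f" unfolding distr_T_pow by (rule assms)
  then show ?thesis by (rule integrable_distr[OF T_pow_measurable])
qed

lemma prob_T_pow:
  assumes "E \<in> sets M"
  shows "prob {x \<in> space M. (T ^^ n) x \<in> E} = prob E"
proof -
  have "{x \<in> space M. (T ^^ n) x \<in> E} = (T ^^ n) -` E \<inter> space M" by auto
  then show ?thesis using measure_distr[OF T_pow_measurable assms, of n] distr_T_pow by simp
qed

text \<open>A set that grows under preimages has the same measure as the union of all its preimages, which is
  invariant.\<close>

lemma ergodic_zero_one:
  assumes E: "E \<in> sets M" and sub: "\<And>x. x \<in> E \<Longrightarrow> T x \<in> E"
  shows "prob E = 0 \<or> prob E = 1"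
proof -
  define F where "F = (\<lambda>n. {x \<in> space M. (T ^^ n) x \<in> E})"
  have F: "F n \<in> sets M" for n unfolding F_def using E by measurable
  have Fp: "prob (F n) = prob E" for n unfolding F_def by (rule prob_T_pow[OF E])
  have inc: "incseq F"
    by (rule incseq_SucI) (auto simp: F_def sub)
  have U: "(\<Union>n. F n) \<in> sets M" using F by auto
  have "prob (\<Union>n. F n) = prob E"
  proof -
    have "(\<lambda>n. prob (F n)) \<longlonglongrightarrow> prob (\<Union>n. F n)" using F inc by (intro finite_Lim_measure_incseq) auto
    then show ?thesis unfolding Fp by (simp add: LIMSEQ_const_iff)
  qed
  moreover have "T -` (\<Union>n. F n) \<inter> space M = (\<Union>n. F n)"
  proof (intro Set.set_eqI iffI)
    fix x assume "x \<in> T -` (\<Union>n. F n) \<inter> space M"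
    then obtain n where "(T ^^ n) (T x) \<in> E" "x \<in> space M" by (auto simp: F_def)
    then have "x \<in> F (Suc n)" by (simp add: F_def funpow_swap1)
    then show "x \<in> (\<Union>n. F n)" by blast
  next
    fix x assume "x \<in> (\<Union>n. F n)"
    then obtain n where n: "(T ^^ n) x \<in> E" "x \<in> space M" by (auto simp: F_def)
    then have "(T ^^ n) (T x) \<in> E" using sub[OF n(1)] by (simp add: funpow_swap1)
    moreover have "T x \<in> space M" using n T_pow_space[of x 1] by simp
    ultimately show "x \<in> T -` (\<Union>n. F n) \<inter> space M" using n by (auto simp: F_def)
  qed
  ultimately show ?thesis using ergodic U unfolding ergodic_automorphism_def by metis
qed

text \<open>The superlevel sets are forward invariant, hence null or of full measure.\<close>

lemma AE_const_of_subinvariant: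
  fixes f :: "'a \<Rightarrow> ereal"
  assumes f [measurable]: "f \<in> borel_measurable M" and sub: "\<And>x. x \<in> space M \<Longrightarrow> f x \<le> f (T x)"
  shows "\<exists>c. AE x in M. f x = c"
proof -
  have E: "{x \<in> space M. f x \<ge> t} \<in> sets M" for t by measurable
  have 01: "prob {x \<in> space M. f x \<ge> t} = 0 \<or> prob {x \<in> space M. f x \<ge> t} = 1" for t
    by (rule ergodic_zero_one[OF E]) (use sub T_pow_space[of _ 1] in \<open>auto intro: order_trans\<close>)
  define S where "S = {t. prob {x \<in> space M. f x \<ge> t} = 1}"
  define c where "c = Sup S"
  have lower: "AE x in M. f x \<ge> t" if "t \<in> S" for t
    using that prob_Collect_eq_1[of "\<lambda>x. t \<le> f x"] unfolding S_def by auto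
  have le: "AE x in M. c \<le> f x"
  proof -
    obtain u :: "nat \<Rightarrow> ereal" where u: "range u \<subseteq> S \<or> S = {}" "S \<noteq> {} \<Longrightarrow> Sup S = (SUP n. u n)"
      using Sup_countable_SUP[of S] by metis
    show ?thesis
    proof (cases "S = {}")
      case True then show ?thesis by (simp add: c_def bot_ereal_def)
    next
      case False
      have "AE x in M. \<forall>n. u n \<le> f x"
        unfolding AE_all_countable using lower u(1) False by auto
      then show ?thesis unfolding c_def u(2)[OF False] by eventually_elim (auto intro: SUP_least)
    qed
  qed
  have ge: "AE x in M. f x \<le> c"
  proof -
    have lt: "AE x in M. f x < t" if "c < t" for t
    proof -
      have "t \<notin> S" using that unfolding c_def by (meson Sup_upper not_less)
      then have "prob {x \<in> space M. f x \<ge> t} = 0" using 01 unfolding S_def by auto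
      then have "AE x in M. \<not> t \<le> f x" using prob_Collect_eq_0[of "\<lambda>x. t \<le> f x"] E by auto
      then show ?thesis by (simp add: not_le)
    qed
    have "AE x in M. \<forall>q::rat. c < ereal (of_rat q) \<longrightarrow> f x < ereal (of_rat q)"
      unfolding AE_all_countable using lt by (auto simp: AE_impI)
    then show ?thesis
    proof eventually_elim
      case (elim x)
      show "f x \<le> c"
      proof (rule ccontr)
        assume "\<not> f x \<le> c"
        then have "c < f x" by simp
        then obtain r1 where r1: "c < ereal r1" "ereal r1 < f x" using ereal_dense2 by blast
        then obtain r2 where r2: "ereal r1 < ereal r2" "ereal r2 < f x" using ereal_dense2 by blast
        obtain q :: rat where q: "r1 < of_rat q" "of_rat q < r2" using of_rat_dense r2(1) by auto
        have "c < ereal (of_rat q)" using r1(1) q(1) by (metis less_ereal.simps(1) less_trans)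
        moreover have "ereal (of_rat q) < f x" using q(2) r2(2) by (metis less_ereal.simps(1) less_trans)
        ultimately show False using elim by (meson less_asym)
      qed
    qed
  qed
  from le ge have "AE x in M. f x = c" by eventually_elim auto
  then show ?thesis by blast
qed

definition measurable_cocycle :: "nat \<Rightarrow> ('a \<Rightarrow> real mat) \<Rightarrow> bool" where
  "measurable_cocycle m A \<longleftrightarrow> (\<forall>x\<in>space M. A x \<in> carrier_mat m m) \<and>
     (\<forall>i<m. \<forall>j<m. (\<lambda>x. A x $$ (i, j)) \<in> borel_measurable M)"

lemma iterate_carrier:
  assumes "measurable_cocycle m A" "x \<in> space M"
  shows "iterate T A n x \<in> carrier_mat m m"
proof (induction n)
  case 0 then show ?case using assms by (auto simp: measurable_cocycle_def)
next
  case (Suc n)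
  have "A ((T ^^ n) x) \<in> carrier_mat m m" using assms T_pow_space by (auto simp: measurable_cocycle_def)
  then show ?case using Suc by simp
qed

lemma cocycle_carrier: "measurable_cocycle m A \<Longrightarrow> x \<in> space M \<Longrightarrow> A x \<in> carrier_mat m m"
  by (simp add: measurable_cocycle_def)

lemma iterate_measurable:
  assumes A: "measurable_cocycle m A" and ij: "i < m" "j < m"
  shows "(\<lambda>x. iterate T A n x $$ (i, j)) \<in> borel_measurable M"
  using ij
proof (induction n arbitrary: i j)
  case 0
  have "(\<lambda>x. if i = j then 1 else 0 :: real) \<in> borel_measurable M" by simp
  moreover have "dim_row (A x) = m" if "x \<in> space M" for x using cocycle_carrier[OF A that] by simp
  ultimately show ?case using 0
    by (subst measurable_cong[where g = "\<lambda>x. if i = j then 1 else 0"]) auto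
next
  case (Suc n)
  have e: "iterate T A (Suc n) x $$ (i, j) = (\<Sum>k<m. A ((T ^^ n) x) $$ (i, k) * iterate T A n x $$ (k, j))"
    if "x \<in> space M" for x
    using cocycle_carrier[OF A T_pow_space[OF that, of n]] iterate_carrier[OF A that, of n] Suc.prems
    by (simp add: scalar_prod_def atLeast0LessThan)
  have "(\<lambda>x. A ((T ^^ n) x) $$ (i, k)) \<in> borel_measurable M" if "k < m" for k
  proof -
    have "(\<lambda>x. A x $$ (i, k)) \<in> borel_measurable M" using A Suc.prems that by (simp add: measurable_cocycle_def)
    then show ?thesis by (rule measurable_compose[OF T_pow_measurable])
  qed
  then have "(\<lambda>x. \<Sum>k<m. A ((T ^^ n) x) $$ (i, k) * iterate T A n x $$ (k, j)) \<in> borel_measurable M"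
    using Suc by (intro borel_measurable_sum borel_measurable_times) auto
  then show ?case using e by (subst measurable_cong) auto
qed

abbreviation cnorm :: "('a \<Rightarrow> real mat) \<Rightarrow> nat \<Rightarrow> 'a \<Rightarrow> real" where
  "cnorm A n x \<equiv> mat_norm (iterate T A n x)"

lemma cnorm_measurable:
  "measurable_cocycle m A \<Longrightarrow> (\<lambda>x. cnorm A n x) \<in> borel_measurable M"
  by (rule borel_measurable_mat_norm[of M _ m m]) (auto simp: iterate_carrier iterate_measurable)

lemma iterate_add:
  assumes A: "measurable_cocycle m A" and x: "x \<in> space M"
  shows "iterate T A (n + k) x = iterate T A n ((T ^^ k) x) * iterate T A k x"
proof (induction n)
  case 0
  then show ?case using cocycle_carrier[OF A T_pow_space[OF x, of k]] iterate_carrier[OF A x, of k] by simp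
next
  case (Suc n)
  have "iterate T A (Suc n + k) x = A ((T ^^ n) ((T ^^ k) x)) * (iterate T A n ((T ^^ k) x) * iterate T A k x)"
    using Suc by (simp add: funpow_add)
  also have "\<dots> = (A ((T ^^ n) ((T ^^ k) x)) * iterate T A n ((T ^^ k) x)) * iterate T A k x"
    by (rule assoc_mult_mat[symmetric, OF cocycle_carrier[OF A T_pow_space[OF T_pow_space[OF x]]]
          iterate_carrier[OF A T_pow_space[OF x]] iterate_carrier[OF A x]])
  finally show ?case by simp
qed

lemma cnorm_add_le:
  assumes A: "measurable_cocycle m A" and x: "x \<in> space M"
  shows "cnorm A (n + k) x \<le> cnorm A n ((T ^^ k) x) * cnorm A k x"
  unfolding iterate_add[OF A x]
  by (rule mat_norm_mult[OF iterate_carrier[OF A T_pow_space[OF x]] iterate_carrier[OF A x]])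

lemma cnorm_0: "measurable_cocycle m A \<Longrightarrow> m \<ge> 1 \<Longrightarrow> x \<in> space M \<Longrightarrow> cnorm A 0 x = 1"
  using cocycle_carrier[of m A x] by auto

lemma cnorm_1: "measurable_cocycle m A \<Longrightarrow> x \<in> space M \<Longrightarrow> cnorm A (Suc 0) x = mat_norm (A x)"
  using cocycle_carrier[of m A x] by auto

lemma cnorm_exp_bound:
  assumes A: "measurable_cocycle m A" and m: "m \<ge> 1" and K: "AE x in M. mat_norm (A x) \<le> exp K"
  shows "AE x in M. \<forall>n k. cnorm A n ((T ^^ k) x) \<le> exp (K * real n)"
proof -
  have "AE x in M. x \<in> space M \<and> (\<forall>n. mat_norm (A ((T ^^ n) x)) \<le> exp K)" using AE_T_pow_all[OF K] by auto
  then have "AE x in M. \<forall>n. cnorm A n x \<le> exp (K * real n)"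
  proof eventually_elim
    case (elim x)
    then have x: "x \<in> space M" and b: "\<And>n. mat_norm (A ((T ^^ n) x)) \<le> exp K" by auto
    show ?case
    proof
      fix n show "cnorm A n x \<le> exp (K * real n)"
      proof (induction n)
        case 0 then show ?case using cnorm_0[OF A m x] by simp
      next
        case (Suc n)
        have "cnorm A (Suc n) x \<le> mat_norm (A ((T ^^ n) x)) * cnorm A n x"
          using mat_norm_mult[OF cocycle_carrier[OF A T_pow_space[OF x, of n]] iterate_carrier[OF A x, of n]] by simp
        also have "\<dots> \<le> exp K * exp (K * real n)" using b Suc by (intro mult_mono) auto
        finally show ?case by (simp add: exp_add[symmetric] algebra_simps)
      qed
    qed
  qed
  from AE_T_pow_all[OF this] show ?thesis by eventually_elim auto
qed

lemma iterate_diff_bound: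
  assumes A: "measurable_cocycle m A" and B: "measurable_cocycle m B" and m: "m \<ge> 1" and K: "0 \<le> K"
    and KA: "AE x in M. mat_norm (A x) \<le> exp K" and KB: "AE x in M. mat_norm (B x) \<le> exp K"
    and h: "0 \<le> h" "AE x in M. mat_norm (B x - A x) \<le> h"
  shows "AE x in M. \<forall>n k. mat_norm (iterate T B n ((T ^^ k) x) - iterate T A n ((T ^^ k) x)) \<le> real n * exp (K * real n) * h"
proof -
  have "AE x in M. x \<in> space M" by auto
  then have "AE x in M. \<forall>n. mat_norm (iterate T B n x - iterate T A n x) \<le> real n * exp (K * real n) * h"
    using AE_T_pow_all[OF KB] AE_T_pow_all[OF h(2)] cnorm_exp_bound[OF A m KA]
  proof eventually_elim
    case (elim x)
    then have x: "x \<in> space M" and b: "\<And>n. mat_norm (B ((T ^^ n) x)) \<le> exp K"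
      and d: "\<And>n. mat_norm (B ((T ^^ n) x) - A ((T ^^ n) x)) \<le> h" by auto
    have a: "cnorm A n x \<le> exp (K * real n)" for n using elim(4)[rule_format, of n 0] by simp
    show ?case
    proof
      fix n show "mat_norm (iterate T B n x - iterate T A n x) \<le> real n * exp (K * real n) * h"
      proof (induction n)
        case 0
        have "mat_norm (1\<^sub>m m - 1\<^sub>m m) \<le> 0" using mat_norm_le_entry_sum[OF minus_carrier_mat[OF one_carrier_mat], of "1\<^sub>m m" m] by simp
        then show ?case using cocycle_carrier[OF A x] cocycle_carrier[OF B x] by simp
      next
        case (Suc n)
        define b' where "b' = B ((T ^^ n) x)"
        define a' where "a' = A ((T ^^ n) x)"
        define bn where "bn = iterate T B n x"
        define an where "an = iterate T A n x"
        have c: "b' \<in> carrier_mat m m" "a' \<in> carrier_mat m m" "bn \<in> carrier_mat m m" "an \<in> carrier_mat m m"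
          using cocycle_carrier[OF A T_pow_space[OF x, of n]] cocycle_carrier[OF B T_pow_space[OF x, of n]]
            iterate_carrier[OF A x] iterate_carrier[OF B x] by (auto simp: b'_def a'_def bn_def an_def)
        have cc: "bn - an \<in> carrier_mat m m" "b' - a' \<in> carrier_mat m m" using c by (auto intro: minus_carrier_mat)
        have "b' * bn - a' * an = b' * (bn - an) + (b' - a') * an"
        proof -
          have "b' * (bn - an) = b' * bn - b' * an" "(b' - a') * an = b' * an - a' * an"
            using c by (auto simp: mult_minus_distrib_mat minus_mult_distrib_mat)
          then show ?thesis using c by (auto intro!: eq_matI)
        qed
        then have "mat_norm (b' * bn - a' * an) \<le> mat_norm (b' * (bn - an)) + mat_norm ((b' - a') * an)"
          using mat_norm_add[OF mult_carrier_mat[OF c(1) cc(1)] mult_carrier_mat[OF cc(2) c(4)]] by simp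
        also have "\<dots> \<le> mat_norm b' * mat_norm (bn - an) + mat_norm (b' - a') * mat_norm an"
          by (intro add_mono mat_norm_mult[OF c(1) cc(1)] mat_norm_mult[OF cc(2) c(4)])
        also have "\<dots> \<le> exp K * (real n * exp (K * real n) * h) + h * exp (K * real n)"
          using b[of n] d[of n] a[of n] Suc h(1) by (intro add_mono mult_mono) (auto simp: b'_def a'_def bn_def an_def)
        also have "\<dots> \<le> exp K * (real n * exp (K * real n) * h) + h * (exp K * exp (K * real n))"
        proof -
          have "1 \<le> exp K" using K by simp
          then have "exp (K * real n) \<le> exp K * exp (K * real n)" by simp
          then show ?thesis using h(1) by (intro add_left_mono mult_left_mono) auto
        qed
        also have "\<dots> = real (Suc n) * exp (K * real (Suc n)) * h"
          by (simp add: algebra_simps exp_add[symmetric])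
        finally show ?case by (simp add: b'_def a'_def bn_def an_def)
      qed
    qed
  qed
  from AE_T_pow_all[OF this] show ?thesis by eventually_elim auto
qed

lemma ext_power_cocycle:
  assumes A: "measurable_cocycle m A" and "m \<ge> 2"
  shows "measurable_cocycle (m choose 2) (\<lambda>x. ext_power 2 (A x))"
  unfolding measurable_cocycle_def
proof (intro conjI ballI allI impI)
  fix x assume "x \<in> space M"
  then show "ext_power 2 (A x) \<in> carrier_mat (m choose 2) (m choose 2)" using cocycle_carrier[OF A] by simp
next
  fix i j assume ij: "i < m choose 2" "j < m choose 2"
  note i = index_tuples_2_nth[OF ij(1)] and j = index_tuples_2_nth[OF ij(2)]
  have "(\<lambda>x. A x $$ (p, q)) \<in> borel_measurable M" if "p < m" "q < m" for p q
    using A that by (simp add: measurable_cocycle_def)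
  then have "(\<lambda>x. A x $$ (pair_fst m i, pair_fst m j) * A x $$ (pair_snd m i, pair_snd m j)
      - A x $$ (pair_fst m i, pair_snd m j) * A x $$ (pair_snd m i, pair_fst m j)) \<in> borel_measurable M"
    using i j by (intro borel_measurable_diff borel_measurable_times) auto
  then show "(\<lambda>x. ext_power 2 (A x) $$ (i, j)) \<in> borel_measurable M"
    using ext_power_2_entry[OF cocycle_carrier[OF A] ij] by (subst measurable_cong) auto
qed

lemma ext_power_iterate:
  assumes A: "measurable_cocycle m A" and x: "x \<in> space M"
  shows "iterate T (\<lambda>x. ext_power 2 (A x)) (Suc n) x = ext_power 2 (iterate T A (Suc n) x)"
proof (induction n)
  case 0
  have c: "A x \<in> carrier_mat m m" using cocycle_carrier[OF A x] .
  note E = ext_power_2_carrier[OF c]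
  show ?case using c right_mult_one_mat[OF E] carrier_matD(1)[OF E] by simp
next
  case (Suc n)
  have "iterate T (\<lambda>x. ext_power 2 (A x)) (Suc (Suc n)) x
      = ext_power 2 (A ((T ^^ Suc n) x)) * ext_power 2 (iterate T A (Suc n) x)" using Suc by simp
  also have "\<dots> = ext_power 2 (A ((T ^^ Suc n) x) * iterate T A (Suc n) x)"
    by (rule ext_power_2_mult[symmetric, OF cocycle_carrier[OF A T_pow_space[OF x]] iterate_carrier[OF A x]])
  finally show ?case by simp
qed

end

section \<open>Deviation functions\<close>

lemma deviation_functions_add:
  assumes "\<iota>\<^sub>1 \<in> deviation_functions \<P>" "\<iota>\<^sub>2 \<in> deviation_functions \<P>"
  shows "(\<lambda>t. \<iota>\<^sub>1 t + \<iota>\<^sub>2 t) \<in> deviation_functions \<P>"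
proof -
  let ?I = "(\<lambda>(n\<^sub>0, \<epsilon>, \<iota>). \<iota>) ` \<P>"
  obtain S1 a1 where 1: "finite S1" "S1 \<noteq> {}" "S1 \<subseteq> ?I" "\<forall>\<iota>\<in>S1. a1 \<iota> > 0" "\<iota>\<^sub>1 = (\<lambda>t. \<Sum>\<iota>\<in>S1. a1 \<iota> * \<iota> t)"
    using assms(1) unfolding deviation_functions_def by blast
  obtain S2 a2 where 2: "finite S2" "S2 \<noteq> {}" "S2 \<subseteq> ?I" "\<forall>\<iota>\<in>S2. a2 \<iota> > 0" "\<iota>\<^sub>2 = (\<lambda>t. \<Sum>\<iota>\<in>S2. a2 \<iota> * \<iota> t)"
    using assms(2) unfolding deviation_functions_def by blast
  define a where "a = (\<lambda>\<iota>. (if \<iota> \<in> S1 then a1 \<iota> else 0) + (if \<iota> \<in> S2 then a2 \<iota> else 0))"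
  have e: "(\<Sum>\<iota>\<in>S. b \<iota> * \<iota> t) = (\<Sum>\<iota>\<in>S1 \<union> S2. (if \<iota> \<in> S then b \<iota> else 0) * \<iota> t)" if "S \<subseteq> S1 \<union> S2" for S b t
  proof -
    have "(\<Sum>\<iota>\<in>S1 \<union> S2. (if \<iota> \<in> S then b \<iota> else 0) * \<iota> t) = (\<Sum>\<iota>\<in>S. (if \<iota> \<in> S then b \<iota> else 0) * \<iota> t)"
      using 1(1) 2(1) that by (intro sum.mono_neutral_right) auto
    then show ?thesis by simp
  qed
  have "\<iota>\<^sub>1 t + \<iota>\<^sub>2 t = (\<Sum>\<iota>\<in>S1 \<union> S2. a \<iota> * \<iota> t)" for t
    unfolding 1(5) 2(5) e[of S1 a1 t, OF Un_upper1] e[of S2 a2 t, OF Un_upper2] sum.distrib[symmetric]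
    by (simp add: a_def distrib_right)
  then have "(\<lambda>t. \<iota>\<^sub>1 t + \<iota>\<^sub>2 t) = (\<lambda>t. \<Sum>\<iota>\<in>S1 \<union> S2. a \<iota> * \<iota> t)" by blast
  moreover have "\<forall>\<iota>\<in>S1 \<union> S2. a \<iota> > 0" using 1(4) 2(4) by (auto simp: a_def add_pos_pos)
  ultimately show ?thesis unfolding deviation_functions_def
    using 1(1-3) 2(1-3) by (intro CollectI exI[of _ "S1 \<union> S2"] exI[of _ a]) auto
qed

lemma deviation_functions_single:
  assumes "(n\<^sub>0, \<epsilon>, \<iota>) \<in> \<P>" shows "\<iota> \<in> deviation_functions \<P>"
  unfolding deviation_functions_def
  using assms by (intro CollectI exI[of _ "{\<iota>}"] exI[of _ "\<lambda>_. 1"]) force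

lemma deviation_function_props:
  assumes \<P>: "\<forall>p\<in>\<P>. is_ldt_param p" and \<iota>: "\<iota> \<in> deviation_functions \<P>"
  shows "\<And>t. 0 < t \<Longrightarrow> 0 < \<iota> t"
    and "\<And>s t. 0 < s \<Longrightarrow> s \<le> t \<Longrightarrow> \<iota> t \<le> \<iota> s"
    and "\<exists>c>0. \<forall>\<^sub>F t in at_top. \<iota> t \<le> c * t powr (-10)"
    and "\<exists>c>0. \<exists>c\<^sub>0>0. \<forall>\<^sub>F t in at_top. c * exp (- c\<^sub>0 * t) \<le> \<iota> t"
proof -
  let ?I = "(\<lambda>(n\<^sub>0, \<epsilon>, \<iota>). \<iota>) ` \<P>"
  obtain S a where S: "finite S" "S \<noteq> {}" "S \<subseteq> ?I" "\<forall>\<iota>\<in>S. a \<iota> > 0" and e: "\<iota> = (\<lambda>t. \<Sum>\<iota>\<in>S. a \<iota> * \<iota> t)"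
    using \<iota> unfolding deviation_functions_def by blast
  have p: "(\<forall>t>0. j t > 0) \<and> strict_antimono_on {0<..} j \<and>
      (\<exists>c\<^sub>0>0. \<forall>\<^sub>F t in at_top. exp (- c\<^sub>0 * t) < j t \<and> j t < t powr (-10))" if "j \<in> S" for j
  proof -
    have "j \<in> ?I" using S(3) that by (rule subsetD)
    then obtain n0 ep where "(n0, ep, j) \<in> \<P>" by auto
    then show ?thesis using \<P> unfolding is_ldt_param_def by fastforce
  qed
  show "0 < \<iota> t" if "0 < t" for t
    unfolding e using S p that by (intro sum_pos) auto
  show "\<iota> t \<le> \<iota> s" if st: "0 < s" "s \<le> t" for s t
    unfolding e
  proof (rule sum_mono)
    fix j assume j: "j \<in> S"
    have "j t \<le> j s"
    proof (cases "s = t")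
      case False
      then have "j t < j s" using p[OF j] st unfolding monotone_on_def by auto
      then show ?thesis by simp
    qed simp
    then show "a j * j t \<le> a j * j s" using S(4) j by (intro mult_left_mono) (auto intro: less_imp_le)
  qed
  show "\<exists>c>0. \<forall>\<^sub>F t in at_top. \<iota> t \<le> c * t powr (-10)"
  proof (intro exI conjI)
    show "0 < sum a S" using S by (intro sum_pos) auto
    have "\<forall>\<^sub>F t in at_top. j t \<le> t powr (-10)" if j: "j \<in> S" for j
    proof -
      obtain c0 where "\<forall>\<^sub>F t in at_top. exp (- c0 * t) < j t \<and> j t < t powr (-10)" using p[OF j] by blast
      then show ?thesis by eventually_elim simp
    qed
    then have "\<forall>\<^sub>F t in at_top. \<forall>j\<in>S. j t \<le> t powr (-10)"
      using S(1) by (intro eventually_ball_finite) auto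
    then show "\<forall>\<^sub>F t in at_top. \<iota> t \<le> sum a S * t powr (-10)"
    proof eventually_elim
      case (elim t)
      show ?case unfolding e sum_distrib_right
        using elim S(4) by (intro sum_mono mult_left_mono) (auto intro: less_imp_le)
    qed
  qed
  obtain j where j: "j \<in> S" using S(2) by blast
  obtain c0 where c0: "c0 > 0" "\<forall>\<^sub>F t in at_top. exp (- c0 * t) < j t \<and> j t < t powr (-10)" using p[OF j] by blast
  have low: "\<forall>\<^sub>F t in at_top. a j * exp (- c0 * t) \<le> \<iota> t"
    using c0(2) eventually_gt_at_top[of 0]
  proof eventually_elim
    case (elim t)
    have "a j * exp (- c0 * t) \<le> a j * j t" using elim S(4) j by (intro mult_left_mono) (auto intro: less_imp_le)
    also have "\<dots> \<le> \<iota> t" unfolding e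
    proof (rule member_le_sum[OF j _ S(1), of "\<lambda>\<iota>. a \<iota> * \<iota> t"])
      fix i assume "i \<in> S - {j}"
      then have "i \<in> S" by simp
      then have "0 < a i" "0 < i t" using S(4) p[OF \<open>i \<in> S\<close>] elim(2) by blast+
      then show "0 \<le> a i * i t" by simp
    qed
    finally show ?case .
  qed
  have "0 < a j" using S(4) j by simp
  then show "\<exists>c>0. \<exists>c\<^sub>0>0. \<forall>\<^sub>F t in at_top. c * exp (- c\<^sub>0 * t) \<le> \<iota> t"
    by (rule exI[of _ "a j", OF conjI]) (rule exI[of _ c0], rule conjI[OF c0(1) low])
qed

text \<open>The decay \<open>t\<^bsup>-10\<^esup>\<close> leaves ample room: square roots of deviation functions are summable, and remain so when
  multiplied by the scale.\<close>

lemma deviation_function_sums: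
  assumes \<P>: "\<forall>p\<in>\<P>. is_ldt_param p" and \<iota>: "\<iota> \<in> deviation_functions \<P>"
  shows "summable (\<lambda>n. \<iota> (real n))" and "summable (\<lambda>n. sqrt (\<iota> (real n)))"
    and "(\<lambda>n. \<iota> (real n)) \<longlonglongrightarrow> 0"
    and "\<exists>c>0. \<forall>\<^sub>F n in sequentially. real n * sqrt (\<iota> (real n)) \<le> c / (real n)\<^sup>2"
proof -
  obtain c where c: "c > 0" "\<forall>\<^sub>F t in at_top. \<iota> t \<le> c * t powr (-10)"
    using deviation_function_props(3)[OF \<P> \<iota>] by blast
  have "\<forall>\<^sub>F n in sequentially. \<iota> (real n) \<le> c * real n powr (-10)"
    using c(2) filterlim_real_sequentially unfolding filterlim_iff by blast
  then have ev: "\<forall>\<^sub>F n in sequentially. 0 < \<iota> (real n) \<and> \<iota> (real n) \<le> c * (1 / real n ^ 5)\<^sup>2 \<and> n \<ge> 1"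
    using eventually_ge_at_top[of 1]
  proof eventually_elim
    case (elim n)
    have "real n powr (-10) = (1 / real n ^ 5)\<^sup>2"
      using elim by (simp add: powr_minus powr_realpow[of "real n" 10, simplified] divide_inverse power_mult[symmetric] power_inverse)
    then show ?case using elim deviation_function_props(1)[OF \<P> \<iota>, of "real n"] by simp
  qed
  have ev5: "\<forall>\<^sub>F n in sequentially. sqrt (\<iota> (real n)) \<le> sqrt c * (1 / real n ^ 5)"
    using ev
  proof eventually_elim
    case (elim n)
    have "sqrt (\<iota> (real n)) \<le> sqrt (c * (1 / real n ^ 5)\<^sup>2)" using elim by simp
    then show ?case using elim by (simp add: real_sqrt_mult real_sqrt_divide)
  qed
  have s5: "summable (\<lambda>n. sqrt c * (1 / real n ^ 5))"
    using inverse_power_summable[of 5, where 'a = real] by (intro summable_mult) (simp add: divide_inverse)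
  show sq: "summable (\<lambda>n. sqrt (\<iota> (real n)))"
    by (rule summable_comparison_test_ev[OF _ s5]) (use ev ev5 in \<open>eventually_elim, auto\<close>)
  have s10: "summable (\<lambda>n. c * (1 / real n ^ 5)\<^sup>2)"
    using inverse_power_summable[of 10, where 'a = real]
    by (intro summable_mult) (simp add: divide_inverse power_mult[symmetric] power_inverse)
  show s: "summable (\<lambda>n. \<iota> (real n))"
    by (rule summable_comparison_test_ev[OF _ s10]) (use ev in \<open>eventually_elim, auto\<close>)
  show "(\<lambda>n. \<iota> (real n)) \<longlonglongrightarrow> 0" by (rule summable_LIMSEQ_zero[OF s])
  show "\<exists>c>0. \<forall>\<^sub>F n in sequentially. real n * sqrt (\<iota> (real n)) \<le> c / (real n)\<^sup>2"
  proof (intro exI[of _ "sqrt c"] conjI)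
    show "0 < sqrt c" using c by simp
    show "\<forall>\<^sub>F n in sequentially. real n * sqrt (\<iota> (real n)) \<le> sqrt c / (real n)\<^sup>2"
      using ev ev5
    proof eventually_elim
      case (elim n)
      have n: "1 \<le> real n" using elim by simp
      have "real n * sqrt (\<iota> (real n)) \<le> real n * (sqrt c * (1 / real n ^ 5))" using elim n by (intro mult_left_mono) auto
      also have "\<dots> = sqrt c / real n ^ 4" using n by (simp add: field_simps eval_nat_numeral)
      also have "\<dots> \<le> sqrt c / (real n)\<^sup>2" using n c by (intro divide_left_mono power_increasing) auto
      finally show ?case .
    qed
  qed
qed

section \<open>Finite scale logarithms\<close>

lemma scaled_elog_le_iff:
  assumes "n \<ge> 1" "0 \<le> t"
  shows "ereal (1 / real n) * elog t \<le> ereal c \<longleftrightarrow> t \<le> exp (real n * c)"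
proof (cases "t = 0")
  case True then show ?thesis using assms by (simp add: elog_def)
next
  case False
  then have t: "0 < t" using assms by simp
  have "ereal (1 / real n) * elog t \<le> ereal c \<longleftrightarrow> ln t \<le> real n * c"
    using assms False by (simp add: elog_def field_simps)
  also have "\<dots> \<longleftrightarrow> t \<le> exp (real n * c)" using t by (metis exp_ln_iff ln_ge_iff exp_le_cancel_iff)
  finally show ?thesis .
qed

lemma scaled_elog_ge_iff:
  assumes "n \<ge> 1" "0 \<le> t"
  shows "ereal c \<le> ereal (1 / real n) * elog t \<longleftrightarrow> exp (real n * c) \<le> t"
proof (cases "t = 0")
  case True then show ?thesis using assms by (simp add: elog_def)
next
  case False
  then have t: "0 < t" using assms by simp
  have "ereal c \<le> ereal (1 / real n) * elog t \<longleftrightarrow> real n * c \<le> ln t"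
    using assms False by (simp add: elog_def field_simps)
  also have "\<dots> \<longleftrightarrow> exp (real n * c) \<le> t" using t by (simp add: ln_ge_iff)
  finally show ?thesis .
qed

lemma elog_measurable:
  assumes [measurable]: "f \<in> borel_measurable M"
  shows "(\<lambda>x. elog (f x)) \<in> borel_measurable M"
  unfolding elog_def by measurable

lemma scaled_elog_limit_comparable:
  assumes "(\<lambda>n. ereal (1 / real n) * elog (a n)) \<longlonglongrightarrow> l"
    and "\<And>n. 0 \<le> a n" "\<And>n. 0 \<le> b n" "c > 0" "\<forall>\<^sub>F n in sequentially. b n \<le> c * a n" "\<forall>\<^sub>F n in sequentially. a n \<le> c * b n"
  shows "(\<lambda>n. ereal (1 / real n) * elog (b n)) \<longlonglongrightarrow> l"
proof -
  have d: "(\<lambda>n. 1 / real n * \<bar>ln c\<bar>) \<longlonglongrightarrow> 0" using tendsto_mult_left_zero[OF lim_1_over_n, of "\<bar>ln c\<bar>"] by simp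
  have key: "\<forall>\<^sub>F n in sequentially. ereal (1 / real n) * elog (q n) \<le> ereal (1 / real n) * elog (p n) + ereal (1 / real n * \<bar>ln c\<bar>)"
    if "\<And>n. 0 \<le> p n" "\<And>n. 0 \<le> q n" "\<forall>\<^sub>F n in sequentially. q n \<le> c * p n" for p q :: "nat \<Rightarrow> real"
    using that(3) eventually_ge_at_top[of 1]
  proof eventually_elim
    case (elim n)
    show ?case
    proof (cases "q n = 0")
      case True then show ?thesis using elim by (simp add: elog_def)
    next
      case False
      then have q: "0 < q n" using that(2)[of n] by simp
      then have p: "0 < p n" using elim assms(4) that(1)[of n] by (cases "p n = 0") auto
      have "ln (q n) \<le> ln (c * p n)" using elim q by simp
      also have "\<dots> = ln c + ln (p n)" using assms(4) p by (simp add: ln_mult)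
      finally have "1 / real n * ln (q n) \<le> 1 / real n * (ln (p n) + \<bar>ln c\<bar>)" by (intro mult_left_mono) auto
      then show ?thesis using p q by (simp add: elog_def distrib_left)
    qed
  qed
  have up: "limsup (\<lambda>n. ereal (1 / real n) * elog (b n)) \<le> l"
  proof -
    have "limsup (\<lambda>n. ereal (1 / real n) * elog (b n)) \<le> limsup (\<lambda>n. ereal (1 / real n) * elog (a n) + ereal (1 / real n * \<bar>ln c\<bar>))"
      by (rule Limsup_mono[OF key]) (use assms in auto)
    also have "(\<lambda>n. ereal (1 / real n) * elog (a n) + ereal (1 / real n * \<bar>ln c\<bar>)) \<longlonglongrightarrow> l + ereal 0"
      using assms(1) d by (intro tendsto_add_ereal_general) auto
    then have "limsup (\<lambda>n. ereal (1 / real n) * elog (a n) + ereal (1 / real n * \<bar>ln c\<bar>)) = l"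
      by (simp add: lim_imp_Limsup)
    finally show ?thesis .
  qed
  have lo: "l \<le> liminf (\<lambda>n. ereal (1 / real n) * elog (b n))"
  proof -
    have "(\<lambda>n. ereal (1 / real n) * elog (a n) + ereal (- (1 / real n * \<bar>ln c\<bar>))) \<longlonglongrightarrow> l + ereal (-0)"
      using assms(1) tendsto_minus[OF d] by (intro tendsto_add_ereal_general) auto
    then have "l = liminf (\<lambda>n. ereal (1 / real n) * elog (a n) + ereal (- (1 / real n * \<bar>ln c\<bar>)))"
      by (simp add: lim_imp_Liminf)
    also have "\<dots> \<le> liminf (\<lambda>n. ereal (1 / real n) * elog (b n))"
    proof (rule Liminf_mono)
      have "\<forall>\<^sub>F n in sequentially. ereal (1 / real n) * elog (a n) \<le> ereal (1 / real n) * elog (b n) + ereal (1 / real n * \<bar>ln c\<bar>)"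
        by (rule key) (use assms in auto)
      then show "\<forall>\<^sub>F n in sequentially. ereal (1 / real n) * elog (a n) + ereal (- (1 / real n * \<bar>ln c\<bar>)) \<le> ereal (1 / real n) * elog (b n)"
      proof eventually_elim
        case (elim n) then show ?case
          by (cases "ereal (1 / real n) * elog (a n)"; cases "ereal (1 / real n) * elog (b n)") auto
      qed
    qed
    finally show ?thesis .
  qed
  have "liminf (\<lambda>n. ereal (1 / real n) * elog (b n)) \<le> limsup (\<lambda>n. ereal (1 / real n) * elog (b n))"
    by (rule Liminf_le_Limsup) simp
  with up lo show ?thesis by (intro Liminf_eq_Limsup) auto
qed

section \<open>Uniform upper bounds and the first Lyapunov exponent\<close>

locale ldt_system = ergodic_system M T for M :: "'a measure" and T +
  fixes C :: "nat \<Rightarrow> ('a \<Rightarrow> real mat) set"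
    and dst :: "nat \<Rightarrow> ('a \<Rightarrow> real mat) \<Rightarrow> ('a \<Rightarrow> real mat) \<Rightarrow> real"
    and \<Xi> :: "('a \<Rightarrow> real) set"
    and \<P> :: "ldt_param set"
  assumes C_space: "cocycle_space M C dst"
    and \<Xi>_measurable: "\<forall>\<xi>\<in>\<Xi>. \<xi> \<in> borel_measurable M"
    and \<P>_params: "\<forall>p\<in>\<P>. is_ldt_param p"
    and compatible: "\<forall>k. \<forall>B\<in>C k. compatible M T \<Xi> B"
    and base_LDT: "\<forall>\<xi>\<in>\<Xi>. base_LDT M T \<P> \<xi>"
begin

lemma C_dim: "A \<in> C m \<Longrightarrow> m \<ge> 1"
  using C_space by (cases m) (auto simp: cocycle_space_def)

lemma C_measurable: "A \<in> C m \<Longrightarrow> measurable_cocycle m A"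
  using C_space by (simp add: cocycle_space_def bounded_cocycle_def measurable_cocycle_def)

lemma C_metric: "Metric_space (C m) (dst m)"
  using C_space by (simp add: cocycle_space_def)

lemma C_ext_power: "A \<in> C m \<Longrightarrow> m \<ge> 2 \<Longrightarrow> (\<lambda>x. ext_power 2 (A x)) \<in> C (m choose 2)"
  using C_space by (auto simp: cocycle_space_def)

lemma dst_bound:
  assumes "A \<in> C m" "B \<in> C m"
  shows "AE x in M. mat_norm (B x - A x) \<le> dst m B A"
proof -
  have "Linf_norm M (\<lambda>x. B x - A x) \<le> ereal (dst m B A)" using C_space assms by (simp add: cocycle_space_def)
  moreover have "AE x in M. ereal (mat_norm (B x - A x)) \<le> Linf_norm M (\<lambda>x. B x - A x)"
    unfolding Linf_norm_def by (rule esssup_AE)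
  ultimately show ?thesis by (auto elim!: eventually_mono) (meson ereal_less_eq(3) order_trans)
qed

lemma uniform_bound:
  assumes A: "A \<in> C m"
  obtains K where "K \<ge> t" "K \<ge> 0" "\<And>B. B \<in> C m \<Longrightarrow> dst m B A < 1 \<Longrightarrow> AE x in M. mat_norm (B x) \<le> exp K"
proof -
  have "Linf_norm M A < \<infinity>" using A C_space by (simp add: cocycle_space_def bounded_cocycle_def)
  then obtain r where r: "Linf_norm M A \<le> ereal r" by (cases "Linf_norm M A") auto
  have "AE x in M. ereal (mat_norm (A x)) \<le> Linf_norm M A" unfolding Linf_norm_def by (rule esssup_AE)
  then have Ar: "AE x in M. mat_norm (A x) \<le> r" by eventually_elim (use r in \<open>meson ereal_less_eq(3) order_trans\<close>)
  define K where "K = max (max t 0) (ln (max r 0 + 1))"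
  have K: "max r 0 + 1 \<le> exp K"
  proof -
    have "ln (max r 0 + 1) \<le> K" by (simp add: K_def)
    then have "exp (ln (max r 0 + 1)) \<le> exp K" by (rule exp_le_cancel_iff[THEN iffD2])
    moreover have "exp (ln (max r 0 + 1)) = max r 0 + 1" by (intro exp_ln) auto
    ultimately show ?thesis by linarith
  qed
  show thesis
  proof (rule that[of K])
    fix B assume B: "B \<in> C m" "dst m B A < 1"
    have "AE x in M. x \<in> space M" by auto
    then show "AE x in M. mat_norm (B x) \<le> exp K" using Ar dst_bound[OF A B(1)]
    proof eventually_elim
      case (elim x)
      have c: "A x \<in> carrier_mat m m" "B x \<in> carrier_mat m m"
        using cocycle_carrier[OF C_measurable] A B elim by auto
      have "B x = A x + (B x - A x)" using c by (auto intro!: eq_matI)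
      then have "mat_norm (B x) \<le> mat_norm (A x) + mat_norm (B x - A x)"
        using mat_norm_add[OF c(1) minus_carrier_mat[OF c(1)], of "B x"] by simp
      also have "\<dots> \<le> max r 0 + 1" using elim B(2) by linarith
      finally show ?case using K by linarith
    qed
  qed (auto simp: K_def)
qed

text \<open>The orbit is cut into blocks on which the norm is at most \<open>e\<^bsup>ka\<^esup>\<close>; points in the bad set \<open>E\<close> and the
  last \<open>N\<close> steps are paid for with the trivial bound \<open>e\<^bsup>K\<^esup>\<close> per step.\<close>

lemma block_bound:
  fixes a K :: real
  assumes B: "measurable_cocycle m B" and m: "m \<ge> 1" and x: "x \<in> space M"
    and K: "\<And>n k. cnorm B n ((T ^^ k) x) \<le> exp (K * real n)" "0 \<le> K"
    and blocks: "\<And>k. (T ^^ k) x \<notin> E \<Longrightarrow> \<exists>n. 1 \<le> n \<and> n \<le> N \<and> cnorm B n ((T ^^ k) x) \<le> exp (a * real n)"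
  shows "cnorm B n ((T ^^ k) x) \<le> exp (a * real n + (K + \<bar>a\<bar>) * (real (card {j. j < n \<and> (T ^^ (j + k)) x \<in> E}) + real N))"
proof (induction n arbitrary: k rule: less_induct)
  case (less n)
  let ?S = "\<lambda>n k. {j. j < n \<and> (T ^^ (j + k)) x \<in> E}"
  have K': "0 \<le> K + \<bar>a\<bar>" using K(2) by simp
  show ?case
  proof (cases "n \<le> N")
    case True
    have "K * real n \<le> a * real n + (K + \<bar>a\<bar>) * real n" by (simp add: algebra_simps mult_left_mono[of "- a" "\<bar>a\<bar>" "real n", simplified]) (smt (verit) mult_nonneg_nonneg of_nat_0_le_iff mult_minus_left)
    also have "\<dots> \<le> a * real n + (K + \<bar>a\<bar>) * (real (card (?S n k)) + real N)"
      using True K' by (intro add_left_mono mult_left_mono) auto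
    finally show ?thesis using K(1)[of n k] by (meson exp_le_cancel_iff order_trans)
  next
    case False
    have step: "cnorm B n ((T ^^ k) x) \<le> exp (a * real (n - p) + (K + \<bar>a\<bar>) * (real (card (?S (n - p) (p + k))) + real N)) * q"
      if p: "1 \<le> p" "p \<le> n" and q: "cnorm B p ((T ^^ k) x) \<le> q" for p q
    proof -
      have "cnorm B n ((T ^^ k) x) \<le> cnorm B (n - p) ((T ^^ p) ((T ^^ k) x)) * cnorm B p ((T ^^ k) x)"
        using cnorm_add_le[OF B T_pow_space[OF x, of k], of "n - p" p] p by simp
      also have "\<dots> = cnorm B (n - p) ((T ^^ (p + k)) x) * cnorm B p ((T ^^ k) x)" by (simp add: funpow_add)
      also have "\<dots> \<le> exp (a * real (n - p) + (K + \<bar>a\<bar>) * (real (card (?S (n - p) (p + k))) + real N)) * q"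
        using less.IH[of "n - p" "p + k"] p q by (intro mult_mono) auto
      finally show ?thesis .
    qed
    have sub: "(\<lambda>j. j + p) ` ?S (n - p) (p + k) \<subseteq> ?S n k" for p by (auto simp: add.assoc)
    have card_le: "card (?S (n - p) (p + k)) \<le> card (?S n k)" for p
      using card_mono[OF _ sub[of p]] card_image[of "\<lambda>j. j + p" "?S (n - p) (p + k)"] by (simp add: inj_on_def)
    show ?thesis
    proof (cases "(T ^^ k) x \<in> E")
      case True
      have n1: "1 \<le> n" using False by simp
      have "insert 0 ((\<lambda>j. j + 1) ` ?S (n - 1) (1 + k)) \<subseteq> ?S n k" using sub[of 1] True n1 by auto
      then have "card (insert 0 ((\<lambda>j. j + 1) ` ?S (n - 1) (1 + k))) \<le> card (?S n k)" by (intro card_mono) auto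
      also have "card (insert 0 ((\<lambda>j. j + 1) ` ?S (n - 1) (1 + k))) = Suc (card (?S (n - 1) (1 + k)))"
        by (subst card_insert_disjoint) (auto simp: card_image)
      finally have c: "real (card (?S (n - 1) (1 + k))) + 1 \<le> real (card (?S n k))" by linarith
      have "cnorm B n ((T ^^ k) x) \<le> exp (a * real (n - 1) + (K + \<bar>a\<bar>) * (real (card (?S (n - 1) (1 + k))) + real N)) * exp K"
        using step[of 1 "exp K"] K(1)[of 1 k] n1 by simp
      also have "\<dots> = exp (a * real n + (K - a) + (K + \<bar>a\<bar>) * (real (card (?S (n - 1) (1 + k))) + real N))"
        using n1 by (simp add: exp_add[symmetric] of_nat_diff algebra_simps)
      also have "\<dots> \<le> exp (a * real n + (K + \<bar>a\<bar>) * (real (card (?S n k)) + real N))"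
      proof -
        have "(K + \<bar>a\<bar>) * (real (card (?S (n - 1) (1 + k))) + 1) \<le> (K + \<bar>a\<bar>) * real (card (?S n k))"
          using c K' by (rule mult_left_mono)
        then show ?thesis by (simp add: algebra_simps)
      qed
      finally show ?thesis .
    next
      case nE: False
      obtain p where p: "1 \<le> p" "p \<le> N" "cnorm B p ((T ^^ k) x) \<le> exp (a * real p)" using blocks[OF nE] by blast
      have pn: "p \<le> n" using p False by simp
      have "cnorm B n ((T ^^ k) x) \<le> exp (a * real (n - p) + (K + \<bar>a\<bar>) * (real (card (?S (n - p) (p + k))) + real N)) * exp (a * real p)"
        by (rule step[OF p(1) pn p(3)])
      also have "\<dots> = exp (a * real n + (K + \<bar>a\<bar>) * (real (card (?S (n - p) (p + k))) + real N))"
        using pn by (simp add: exp_add[symmetric] of_nat_diff algebra_simps)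
      also have "\<dots> \<le> exp (a * real n + (K + \<bar>a\<bar>) * (real (card (?S n k)) + real N))"
        using card_le[of p] K' by (simp add: mult_left_mono)
      finally show ?thesis .
    qed
  qed
qed

lemma bad_set_in_algebra:
  assumes A: "measurable_cocycle m A"
  shows "{x \<in> space M. \<forall>n. 1 \<le> n \<and> n \<le> N \<longrightarrow> \<not> cnorm A n x \<le> exp (a * real n)} \<in> norm_level_algebra M T A N"
  unfolding norm_level_algebra_def hull_def
proof (rule InterI)
  fix t
  let ?S = "{{x \<in> space M. mat_norm (iterate T A n x) \<le> c} | n c. n \<le> N \<and> 0 \<le> c} \<union>
        {{x \<in> space M. mat_norm (iterate T A n x) \<ge> c} | n c. n \<le> N \<and> 0 \<le> c}"
  assume "t \<in> {t. Sigma_Algebra.algebra (space M) t \<and> ?S \<subseteq> t}"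
  then have alg: "Sigma_Algebra.algebra (space M) t" and S: "?S \<subseteq> t" by auto
  interpret t: Sigma_Algebra.algebra "space M" t by (rule alg)
  have L: "{x \<in> space M. cnorm A n x \<le> exp (a * real n)} \<in> t" if "n \<in> {1..N}" for n
  proof (rule subsetD[OF S], rule UnI1)
    show "{x \<in> space M. cnorm A n x \<le> exp (a * real n)} \<in> {{x \<in> space M. mat_norm (iterate T A n x) \<le> c} | n c. n \<le> N \<and> 0 \<le> c}"
      using that by (intro CollectI exI[of _ n] exI[of _ "exp (a * real n)"]) auto
  qed
  have "space M - (\<Union>n\<in>{1..N}. {x \<in> space M. cnorm A n x \<le> exp (a * real n)}) \<in> t"
    using L by (intro t.compl_sets t.finite_UN) auto
  also have "space M - (\<Union>n\<in>{1..N}. {x \<in> space M. cnorm A n x \<le> exp (a * real n)}) =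
     {x \<in> space M. \<forall>n. 1 \<le> n \<and> n \<le> N \<longrightarrow> \<not> cnorm A n x \<le> exp (a * real n)}" by auto
  finally show "{x \<in> space M. \<forall>n. 1 \<le> n \<and> n \<le> N \<longrightarrow> \<not> cnorm A n x \<le> exp (a * real n)} \<in> t" .
qed

text \<open>Uniform upper semicontinuity.  The bad set, where no time up to \<open>N\<close> realises the exponential bound, is
  defined by \<open>A\<close> alone and dominated by an observable, so the base estimate controls how often orbits
  visit it; finitely many good times survive a small perturbation of \<open>A\<close>.\<close>

lemma uniform_upper_bound:
  assumes A: "A \<in> C m" and hit: "AE x in M. \<exists>n\<ge>1. cnorm A n x \<le> exp (a * real n)" and a': "a < a'"
  shows "\<exists>\<delta>>0. \<exists>\<iota>\<in>deviation_functions \<P>. \<exists>n\<^sub>1\<ge>1. \<forall>B\<in>C m. dst m B A < \<delta> \<longrightarrow>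
    (\<forall>n\<ge>n\<^sub>1. prob {x \<in> space M. exp (a' * real n) < cnorm B n x} < \<iota> (real n))"
proof -
  note Am = C_measurable[OF A] and m = C_dim[OF A]
  have [measurable]: "(\<lambda>x. cnorm A n x) \<in> borel_measurable M" for n by (rule cnorm_measurable[OF Am])
  define b where "b = (a + a') / 2"
  have b: "a < b" "b < a'" using a' by (auto simp: b_def)
  obtain K where K: "K \<ge> b" "K \<ge> 0" "\<And>B. B \<in> C m \<Longrightarrow> dst m B A < 1 \<Longrightarrow> AE x in M. mat_norm (B x) \<le> exp K"
    using uniform_bound[OF A] by blast
  define K' where "K' = K + \<bar>b\<bar>"
  have K': "0 \<le> K'" using K(2) by (simp add: K'_def)
  define \<eta> where "\<eta> = (a' - b) / (6 * (K' + 1))"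
  have \<eta>: "0 < \<eta>" using b K' by (simp add: \<eta>_def)
  have \<eta>K: "K' * (3 * \<eta>) \<le> (a' - b) / 2"
  proof -
    have "K' * (3 * \<eta>) = (K' / (K' + 1)) * ((a' - b) / 2)" unfolding \<eta>_def using K' by (simp add: field_simps)
    also have "\<dots> \<le> 1 * ((a' - b) / 2)" using K' b by (intro mult_right_mono) auto
    finally show ?thesis by simp
  qed
  define E where "E = (\<lambda>N. {x \<in> space M. \<forall>n. 1 \<le> n \<and> n \<le> N \<longrightarrow> \<not> cnorm A n x \<le> exp (a * real n)})"
  have E [measurable]: "E N \<in> sets M" for N unfolding E_def by measurable
  have "(\<lambda>N. prob (E N)) \<longlonglongrightarrow> prob (\<Inter>N. E N)"
    by (rule finite_Lim_measure_decseq) (auto simp: decseq_def E_def E[unfolded E_def])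
  moreover have "prob (\<Inter>N. E N) = 0"
  proof -
    have "AE x in M. x \<notin> (\<Inter>N. E N)" using hit by eventually_elim (auto simp: E_def)
    moreover have "(\<Inter>N. E N) \<in> sets M" by measurable
    ultimately show ?thesis using prob_eq_0 by blast
  qed
  ultimately have "(\<lambda>N. prob (E N)) \<longlonglongrightarrow> 0" by simp
  then have "\<forall>\<^sub>F N in sequentially. prob (E N) < \<eta>" using \<eta> by (rule order_tendstoD)
  then obtain N where N: "N \<ge> 1" "prob (E N) < \<eta>" unfolding eventually_sequentially by (meson le_cases max.cobounded1 max.cobounded2)
  have "E N \<in> norm_level_algebra M T A N" unfolding E_def by (rule bad_set_in_algebra[OF Am])
  then obtain \<xi> where \<xi>: "\<xi> \<in> \<Xi>" "\<And>x. x \<in> space M \<Longrightarrow> indicator (E N) x \<le> \<xi> x" "integrable M \<xi>" "integral\<^sup>L M \<xi> \<le> prob (E N) + \<eta>"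
    using compatible A \<eta> unfolding compatible_def by blast
  have [measurable]: "\<xi> \<in> borel_measurable M" using \<xi>(3) by simp
  obtain n0 \<epsilon> \<iota> where p: "(n0, \<epsilon>, \<iota>) \<in> \<P>" "\<And>n. n \<ge> 1 \<Longrightarrow> n \<ge> n0 \<Longrightarrow> \<epsilon> (real n) \<le> \<eta>"
     "\<And>n. n \<ge> 1 \<Longrightarrow> n \<ge> n0 \<Longrightarrow> prob {x \<in> space M. \<bar>1 / real n * (\<Sum>j<n. \<xi> ((T ^^ j) x)) - integral\<^sup>L M \<xi>\<bar> > \<epsilon> (real n)} < \<iota> (real n)"
    using base_LDT \<xi>(1) \<eta> unfolding base_LDT_def by fast
  define \<mu> where "\<mu> = Min ((\<lambda>n. exp (b * real n) - exp (a * real n)) ` {1..N})"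
  have \<mu>: "0 < \<mu>" unfolding \<mu>_def using N(1) b by (subst Min_gr_iff) auto
  define \<delta> where "\<delta> = min 1 (\<mu> / (real N * exp (K * real N)))"
  have \<delta>: "0 < \<delta>" using \<mu> N(1) by (simp add: \<delta>_def)
  define n1 where "n1 = max (max 1 n0) (nat \<lceil>2 * K' * real N / (a' - b)\<rceil>)"
  have main: "prob {x \<in> space M. exp (a' * real n) < cnorm B n x} < \<iota> (real n)"
    if B: "B \<in> C m" "dst m B A < \<delta>" and n: "n \<ge> n1" for B n
  proof -
    note Bm = C_measurable[OF B(1)]
    have [measurable]: "(\<lambda>x. cnorm B n x) \<in> borel_measurable M" for n by (rule cnorm_measurable[OF Bm])
    have n': "n \<ge> 1" "n \<ge> n0" using n by (auto simp: n1_def)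
    have d1: "dst m B A < 1" and d0: "0 \<le> dst m B A"
      using B(2) Metric_space.nonneg[OF C_metric] by (auto simp: \<delta>_def)
    have AA: "dst m A A < 1" using Metric_space.mdist_zero[OF C_metric A] by simp
    note BK = K(3)[OF B(1) d1] and AK = K(3)[OF A AA]
    have "AE x in M. x \<in> space M" by auto
    then have ae: "AE x in M. \<not> \<bar>1 / real n * (\<Sum>j<n. \<xi> ((T ^^ j) x)) - integral\<^sup>L M \<xi>\<bar> > \<epsilon> (real n) \<longrightarrow> cnorm B n x \<le> exp (a' * real n)"
      using iterate_diff_bound[OF Am Bm m K(2) AK BK d0 dst_bound[OF A B(1)]] cnorm_exp_bound[OF Bm m BK]
    proof eventually_elim
      case (elim x)
      then have x: "x \<in> space M" by blast
      have bl: "\<exists>n. 1 \<le> n \<and> n \<le> N \<and> cnorm B n ((T ^^ k) x) \<le> exp (b * real n)" if "(T ^^ k) x \<notin> E N" for k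
      proof -
        have "\<exists>i. (1 \<le> i \<and> i \<le> N) \<and> cnorm A i ((T ^^ k) x) \<le> exp (a * real i)"
          using that T_pow_space[OF x, of k] by (simp add: E_def)
        then obtain i where i: "1 \<le> i" "i \<le> N" "cnorm A i ((T ^^ k) x) \<le> exp (a * real i)" by (elim exE conjE)
        have c: "iterate T A i ((T ^^ k) x) \<in> carrier_mat m m" "iterate T B i ((T ^^ k) x) \<in> carrier_mat m m"
          using iterate_carrier[OF Am T_pow_space[OF x]] iterate_carrier[OF Bm T_pow_space[OF x]] by auto
        have "iterate T B i ((T ^^ k) x) = iterate T A i ((T ^^ k) x) + (iterate T B i ((T ^^ k) x) - iterate T A i ((T ^^ k) x))"
          using c by (auto intro!: eq_matI)
        then have "cnorm B i ((T ^^ k) x) \<le> cnorm A i ((T ^^ k) x) + mat_norm (iterate T B i ((T ^^ k) x) - iterate T A i ((T ^^ k) x))"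
          using mat_norm_add[OF c(1) minus_carrier_mat[OF c(1)], of "iterate T B i ((T ^^ k) x)"] by simp
        also have "\<dots> \<le> exp (a * real i) + real i * exp (K * real i) * dst m B A"
          using i(3) elim(2)[rule_format, of i k] by (intro add_mono)
        also have "real i * exp (K * real i) * dst m B A \<le> \<mu>"
        proof -
          have "real i * exp (K * real i) \<le> real N * exp (K * real N)"
            using i K(2) by (intro mult_mono) (auto intro: mult_left_mono)
          then have "real i * exp (K * real i) * dst m B A \<le> (real N * exp (K * real N)) * (\<mu> / (real N * exp (K * real N)))"
            by (rule mult_mono) (use B(2) d0 in \<open>auto simp: \<delta>_def\<close>)
          then show ?thesis using N(1) by simp
        qed
        also have "\<mu> \<le> exp (b * real i) - exp (a * real i)" unfolding \<mu>_def using i by (intro Min_le) auto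
        finally show ?thesis using i by (intro exI[of _ i]) simp
      qed
      show ?case
      proof
        assume dev: "\<not> \<bar>1 / real n * (\<Sum>j<n. \<xi> ((T ^^ j) x)) - integral\<^sup>L M \<xi>\<bar> > \<epsilon> (real n)"
        have "1 / real n * (\<Sum>j<n. \<xi> ((T ^^ j) x)) \<le> 3 * \<eta>"
          using dev p(2)[OF n'] \<xi>(4) N(2) by linarith
        then have s: "(\<Sum>j<n. \<xi> ((T ^^ j) x)) \<le> 3 * \<eta> * real n" using n' by (simp add: field_simps)
        have "real (card {j. j < n \<and> (T ^^ (j + 0)) x \<in> E N}) = (\<Sum>j<n. indicator (E N) ((T ^^ j) x))"
        proof -
          have "{j. j < n \<and> (T ^^ (j + 0)) x \<in> E N} = {j \<in> {..<n}. (T ^^ j) x \<in> E N}" by auto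
          then show ?thesis by (simp add: indicator_def sum.If_cases Int_def)
        qed
        also have "\<dots> \<le> (\<Sum>j<n. \<xi> ((T ^^ j) x))" using \<xi>(2) T_pow_space[OF x] by (intro sum_mono) auto
        finally have cd: "real (card {j. j < n \<and> (T ^^ (j + 0)) x \<in> E N}) \<le> 3 * \<eta> * real n" using s by simp
        have "cnorm B n ((T ^^ 0) x) \<le> exp (b * real n + K' * (real (card {j. j < n \<and> (T ^^ (j + 0)) x \<in> E N}) + real N))"
          unfolding K'_def using bl elim(3) by (intro block_bound[OF Bm m x _ K(2)]) auto
        also have "\<dots> \<le> exp (a' * real n)"
        proof -
          have "K' * (real (card {j. j < n \<and> (T ^^ (j + 0)) x \<in> E N}) + real N) \<le> K' * (3 * \<eta> * real n + real N)"
            using cd K' by (intro mult_left_mono) auto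
          also have "\<dots> = K' * (3 * \<eta>) * real n + K' * real N" by (simp add: algebra_simps)
          also have "\<dots> \<le> (a' - b) / 2 * real n + (a' - b) / 2 * real n"
          proof (intro add_mono mult_right_mono \<eta>K)
            have "2 * K' * real N / (a' - b) \<le> real n" using n by (simp add: n1_def)
            then show "K' * real N \<le> (a' - b) / 2 * real n" using b by (simp add: field_simps)
          qed simp
          finally have "K' * (real (card {j. j < n \<and> (T ^^ (j + 0)) x \<in> E N}) + real N) \<le> a' * real n - b * real n"
            by (simp add: algebra_simps)
          then show ?thesis by simp
        qed
        finally show "cnorm B n x \<le> exp (a' * real n)" by simp
      qed
    qed
    have "prob {x \<in> space M. exp (a' * real n) < cnorm B n x} \<le>
        prob {x \<in> space M. \<bar>1 / real n * (\<Sum>j<n. \<xi> ((T ^^ j) x)) - integral\<^sup>L M \<xi>\<bar> > \<epsilon> (real n)}"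
      by (rule finite_measure_mono_AE) (use ae in \<open>auto elim!: eventually_mono\<close>)
    then show ?thesis using p(3)[OF n'] by simp
  qed
  show ?thesis
    using \<delta> deviation_functions_single[OF p(1)] main
    by (intro exI[of _ \<delta>] conjI bexI[of _ \<iota>] exI[of _ n1]) (auto simp: n1_def)
qed

end

context ergodic_system
begin

lemma lyap_eqI:
  assumes "AE x in M. (\<lambda>n. ereal (1 / real n) * elog (sing_val (iterate T A n x) i)) \<longlonglongrightarrow> l"
  shows "lyap M T A i = l"
  unfolding lyap_def
proof (rule the_equality)
  show "AE x in M. (\<lambda>n. ereal (1 / real n) * elog (sing_val (iterate T A n x) i)) \<longlonglongrightarrow> l" by (rule assms)
  fix l' assume "AE x in M. (\<lambda>n. ereal (1 / real n) * elog (sing_val (iterate T A n x) i)) \<longlonglongrightarrow> l'"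
  with assms have "AE x in M. l' = l" by eventually_elim (rule LIMSEQ_unique)
  then show "l' = l" by simp
qed

text \<open>A relation rather than a function, because the existence of the limit is a theorem.\<close>

definition exponent :: "('a \<Rightarrow> real mat) \<Rightarrow> ereal \<Rightarrow> bool" where
  "exponent A l \<longleftrightarrow> (AE x in M. (\<lambda>n. ereal (1 / real n) * elog (cnorm A n x)) \<longlonglongrightarrow> l)"

lemma exponent_lyap_1:
  assumes A: "measurable_cocycle m A" and m: "m \<ge> 1" and l: "exponent A l"
  shows "lyap M T A 1 = l"
proof (rule lyap_eqI)
  have "AE x in M. x \<in> space M" by auto
  then show "AE x in M. (\<lambda>n. ereal (1 / real n) * elog (sing_val (iterate T A n x) 1)) \<longlonglongrightarrow> l"
    using l unfolding exponent_def
  proof eventually_elim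
    case (elim x)
    then show ?case using sing_val_1_eq_norm[OF iterate_carrier[OF A, of x] m] by simp
  qed
qed

lemma exponent_hit:
  assumes l: "exponent A l" and a: "l < ereal a"
  shows "AE x in M. \<exists>n\<ge>1. cnorm A n x \<le> exp (a * real n)"
  using l unfolding exponent_def
proof eventually_elim
  case (elim x)
  have "\<forall>\<^sub>F n in sequentially. ereal (1 / real n) * elog (cnorm A n x) < ereal a"
    using elim a by (rule order_tendstoD(2))
  then have "\<forall>\<^sub>F n in sequentially. 1 \<le> n \<and> cnorm A n x \<le> exp (a * real n)"
    using eventually_ge_at_top[of 1]
  proof eventually_elim
    case (elim n)
    then have "ereal (1 / real n) * elog (cnorm A n x) \<le> ereal a" by (intro less_imp_le)
    then show ?case using elim scaled_elog_le_iff[of n "cnorm A n x" a] by (simp add: mult.commute del: times_ereal.simps)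
  qed
  then show ?case unfolding eventually_sequentially by (meson order_refl)
qed

text \<open>The liminf is constant because it
  can only increase along orbits: \<open>\<parallel>A\<^bsup>(n+1)\<^esup>(x)\<parallel> \<le> \<parallel>A\<^bsup>(n)\<^esup>(T x)\<parallel> \<parallel>A(x)\<parallel>\<close>.\<close>

lemma liminf_constant:
  assumes A: "measurable_cocycle m A" and m: "m \<ge> 1"
  shows "\<exists>l. AE x in M. liminf (\<lambda>n. ereal (1 / real n) * elog (cnorm A n x)) = l"
proof (rule AE_const_of_subinvariant)
  have [measurable]: "(\<lambda>x. elog (cnorm A n x)) \<in> borel_measurable M" for n
    by (intro elog_measurable cnorm_measurable[OF A])
  show "(\<lambda>x. liminf (\<lambda>n. ereal (1 / real n) * elog (cnorm A n x))) \<in> borel_measurable M" by measurable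
  fix x assume x: "x \<in> space M"
  let ?f = "\<lambda>x n. ereal (1 / real n) * elog (cnorm A n x)"
  show "liminf (?f x) \<le> liminf (?f (T x))"
  proof (rule ccontr)
    assume "\<not> liminf (?f x) \<le> liminf (?f (T x))"
    then have "liminf (?f (T x)) < liminf (?f x)" by simp
    then obtain c where c: "liminf (?f (T x)) < ereal c" "ereal c < liminf (?f x)" using ereal_dense2 by blast
    obtain c' where c': "ereal c < ereal c'" "ereal c' < liminf (?f x)" using ereal_dense2[OF c(2)] by blast
    have "\<forall>\<^sub>F n in sequentially. ereal c' < ?f x n" using c'(2) by (rule less_LiminfD)
    then have 1: "\<forall>\<^sub>F n in sequentially. ereal c' < ?f x (Suc n)"
      using eventually_sequentially_Suc[of "\<lambda>n. ereal c' < ?f x n"] by simp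
    have "\<exists>\<^sub>F n in sequentially. ?f (T x) n < ereal c"
    proof (rule ccontr)
      assume "\<not> ?thesis"
      then have "\<forall>\<^sub>F n in sequentially. ereal c \<le> ?f (T x) n" by (simp add: frequently_def not_less)
      then have "ereal c \<le> liminf (?f (T x))" by (rule Liminf_bounded)
      with c(1) show False by simp
    qed
    have "filterlim (\<lambda>n. exp (real n * (c' - c) + c')) at_top sequentially"
    proof (rule filterlim_compose[OF exp_at_top])
      have "filterlim (\<lambda>n. (c' - c) * real n) at_top sequentially"
        using c'(1) by (intro filterlim_tendsto_pos_mult_at_top[OF tendsto_const _ filterlim_real_sequentially]) auto
      then have "filterlim (\<lambda>n. c' + (c' - c) * real n) at_top sequentially"
        by (intro filterlim_tendsto_add_at_top[OF tendsto_const])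
      then show "filterlim (\<lambda>n. real n * (c' - c) + c') at_top sequentially" by (simp add: algebra_simps)
    qed
    then have 2: "\<forall>\<^sub>F n in sequentially. mat_norm (A x) < exp (real n * (c' - c) + c')"
      by (simp add: filterlim_at_top_dense)
    have "\<exists>\<^sub>F n in sequentially. False"
    proof (rule frequently_rev_mp[OF \<open>\<exists>\<^sub>F n in sequentially. ?f (T x) n < ereal c\<close>])
      show "\<forall>\<^sub>F n in sequentially. ?f (T x) n < ereal c \<longrightarrow> False"
        using 1 2 eventually_ge_at_top[of 1]
      proof eventually_elim
        case (elim n)
        show ?case
        proof
          assume "?f (T x) n < ereal c"
          then have "?f (T x) n \<le> ereal c" by (rule less_imp_le)
          then have u: "cnorm A n (T x) \<le> exp (real n * c)"
            using scaled_elog_le_iff[of n "cnorm A n (T x)" c] elim(3) by (simp del: times_ereal.simps iterate.simps)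
          have "exp (real (Suc n) * c') \<le> cnorm A (Suc n) x"
            using less_imp_le[OF elim(1)] scaled_elog_ge_iff[of "Suc n" "cnorm A (Suc n) x" c']
            by (simp del: times_ereal.simps iterate.simps)
          also have "\<dots> \<le> cnorm A n (T x) * mat_norm (A x)"
            using cnorm_add_le[OF A x, of n 1] cnorm_1[OF A x] by (simp del: iterate.simps)
          also have "\<dots> \<le> exp (real n * c) * mat_norm (A x)" using u by (intro mult_right_mono) auto
          also have "\<dots> < exp (real n * c) * exp (real n * (c' - c) + c')" using elim by simp
          also have "\<dots> = exp (real (Suc n) * c')" by (simp add: exp_add[symmetric] algebra_simps)
          finally show False by simp
        qed
      qed
    qed
    then show False by simp
  qed
qed

end

context ldt_system
begin

lemma Borel_Cantelli_deviation:
  assumes \<iota>: "\<iota> \<in> deviation_functions \<P>" and E: "\<And>n. E n \<in> sets M"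
    and le: "\<And>n. n \<ge> n1 \<Longrightarrow> prob (E n) \<le> \<iota> (real n)"
  shows "AE x in M. \<forall>\<^sub>F n in sequentially. x \<notin> E n"
proof -
  have "summable (\<lambda>n. measure M (E n))"
    by (rule summable_comparison_test'[OF deviation_function_sums(1)[OF \<P>_params \<iota>], of n1]) (use le in auto)
  then have "AE x in M. \<forall>\<^sub>F n in sequentially. x \<in> space M - E n"
    using E by (intro borel_cantelli_AE1) (auto simp: emeasure_eq_measure less_top[symmetric])
  then show ?thesis by eventually_elim (auto elim: eventually_mono)
qed

text \<open>The liminf of the finite scale logarithms is constant almost everywhere.  The uniform upper bound, applied to
  the cocycle itself, shows that the limsup does not exceed it.\<close>

lemma exponent_exists:
  assumes A: "A \<in> C m"
  shows "\<exists>l<\<infinity>. exponent A l"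
proof -
  note Am = C_measurable[OF A] and m = C_dim[OF A]
  have [measurable]: "(\<lambda>x. cnorm A n x) \<in> borel_measurable M" for n by (rule cnorm_measurable[OF Am])
  let ?f = "\<lambda>x n. ereal (1 / real n) * elog (cnorm A n x)"
  obtain l where l: "AE x in M. liminf (?f x) = l" using liminf_constant[OF Am m] by blast
  obtain K :: real where K: "K \<ge> 1" "K \<ge> 0" "\<And>B. B \<in> C m \<Longrightarrow> dst m B A < 1 \<Longrightarrow> AE x in M. mat_norm (B x) \<le> exp K"
    using uniform_bound[OF A] by blast
  have AA: "dst m A A = 0" using Metric_space.mdist_zero[OF C_metric A] by simp
  have AK: "AE x in M. mat_norm (A x) \<le> exp K" using K(3)[OF A] AA by simp
  have "AE x in M. liminf (?f x) \<le> ereal K"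
    using cnorm_exp_bound[OF Am m AK]
  proof eventually_elim
    case (elim x)
    have b: "cnorm A n x \<le> exp (real n * K)" for n
      using elim[rule_format, of n 0] by (simp add: mult.commute)
    have "\<forall>\<^sub>F n in sequentially. ?f x n \<le> ereal K"
      using eventually_ge_at_top[of 1] by eventually_elim (use b in \<open>simp add: scaled_elog_le_iff del: times_ereal.simps\<close>)
    then have "limsup (?f x) \<le> ereal K" by (rule Limsup_bounded)
    then show ?case using Liminf_le_Limsup[of sequentially "?f x"] by (meson order_trans trivial_limit_sequentially)
  qed
  with l have "AE x in M. l \<le> ereal K" by eventually_elim auto
  then have lK: "l \<le> ereal K" by simp
  have up: "AE x in M. \<forall>\<^sub>F n in sequentially. cnorm A n x \<le> exp (a' * real n)" if a': "l < ereal a'" for a'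
  proof -
    obtain a where a: "l < ereal a" "ereal a < ereal a'" using ereal_dense2[OF a'] by blast
    have "AE x in M. \<exists>n\<ge>1. cnorm A n x \<le> exp (a * real n)"
      using l
    proof eventually_elim
      case (elim x)
      show ?case
      proof (rule ccontr)
        assume "\<not> ?thesis"
        then have b: "exp (a * real n) < cnorm A n x" if "n \<ge> 1" for n using that by (meson not_le)
        have "\<forall>\<^sub>F n in sequentially. ereal a \<le> ?f x n"
          using eventually_ge_at_top[of 1]
          by eventually_elim (use b in \<open>simp add: scaled_elog_ge_iff mult.commute less_imp_le del: times_ereal.simps\<close>)
        then have "ereal a \<le> liminf (?f x)" by (rule Liminf_bounded)
        with elim a show False by simp
      qed
    qed
    then obtain \<delta> \<iota> n1 where u: "\<delta> > 0" "\<iota> \<in> deviation_functions \<P>"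
      "\<forall>B\<in>C m. dst m B A < \<delta> \<longrightarrow> (\<forall>n\<ge>n1. prob {x \<in> space M. exp (a' * real n) < cnorm B n x} < \<iota> (real n))"
      using uniform_upper_bound[OF A _, of a a'] a(2) by auto
    have u3: "prob {x \<in> space M. exp (a' * real n) < cnorm A n x} \<le> \<iota> (real n)" if "n \<ge> n1" for n
      using u(3) A AA u(1) that by (auto intro: less_imp_le)
    have "AE x in M. \<forall>\<^sub>F n in sequentially. x \<notin> {x \<in> space M. exp (a' * real n) < cnorm A n x}"
      by (rule Borel_Cantelli_deviation[OF u(2) _ u3]) measurable
    moreover have "AE x in M. x \<in> space M" by auto
    ultimately show ?thesis by eventually_elim (auto elim!: eventually_mono simp: not_less)
  qed
  have "AE x in M. \<forall>q::rat. l < ereal (of_rat q) \<longrightarrow> (\<forall>\<^sub>F n in sequentially. cnorm A n x \<le> exp (of_rat q * real n))"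
    unfolding AE_all_countable using up by (auto intro: AE_impI)
  with l have "AE x in M. ?f x \<longlonglongrightarrow> l"
  proof eventually_elim
    case (elim x)
    have "limsup (?f x) \<le> l"
    proof (rule ccontr)
      assume "\<not> limsup (?f x) \<le> l"
      then have "l < limsup (?f x)" by simp
      then obtain r1 where r1: "l < ereal r1" "ereal r1 < limsup (?f x)" using ereal_dense2 by blast
      then obtain r2 where r2: "ereal r1 < ereal r2" "ereal r2 < limsup (?f x)" using ereal_dense2 by blast
      obtain q :: rat where q: "r1 < of_rat q" "of_rat q < r2" using of_rat_dense r2(1) by auto
      have lq: "l < ereal (of_rat q)" using r1(1) q(1) by (metis less_ereal.simps(1) less_trans)
      have "\<forall>\<^sub>F n in sequentially. ?f x n \<le> ereal (of_rat q)"
        using elim(2)[rule_format, OF lq] eventually_ge_at_top[of 1]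
        by eventually_elim (simp add: scaled_elog_le_iff mult.commute del: times_ereal.simps)
      then have "limsup (?f x) \<le> ereal (of_rat q)" by (rule Limsup_bounded)
      also have "\<dots> < ereal r2" using q(2) by simp
      finally show False using r2(2) by simp
    qed
    moreover have "l \<le> limsup (?f x)" using elim(1) Liminf_le_Limsup[of sequentially "?f x"] by simp
    ultimately show ?case using elim(1) by (intro Liminf_eq_Limsup) auto
  qed
  then show ?thesis unfolding exponent_def using lK by (intro exI[of _ l]) auto
qed

lemma lyap_1: "A \<in> C m \<Longrightarrow> exponent A l \<Longrightarrow> lyap M T A 1 = l"
  by (rule exponent_lyap_1[OF C_measurable C_dim])

text \<open>Up to bounded factors, \<open>\<parallel>\<And>\<^sub>2 g\<parallel>\<close> is \<open>s\<^sub>1(g) s\<^sub>2(g)\<close>.\<close>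

lemma lyap_2:
  assumes A: "A \<in> C m" and m: "m \<ge> 2" and l1: "exponent A (ereal l1)"
    and lw: "exponent (\<lambda>x. ext_power 2 (A x)) lw"
  shows "lyap M T A 2 = lw - ereal l1"
proof (rule lyap_eqI)
  note Am = C_measurable[OF A]
  have "AE x in M. x \<in> space M" by auto
  then show "AE x in M. (\<lambda>n. ereal (1 / real n) * elog (sing_val (iterate T A n x) 2)) \<longlonglongrightarrow> lw - ereal l1"
    using l1 lw unfolding exponent_def
  proof eventually_elim
    case (elim x)
    define g where "g = (\<lambda>n. iterate T A n x)"
    define c where "c = 6 * (real (m choose 2))\<^sup>2 + 1"
    have g: "g n \<in> carrier_mat m m" for n unfolding g_def by (rule iterate_carrier[OF Am elim(1)])
    have s2: "0 \<le> sing_val (g n) 2" for n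
      using right_singular_basis_exists(3)[OF g, of 1] m by (simp add: numeral_2_eq_2)
    have ext: "\<forall>\<^sub>F n in sequentially. cnorm (\<lambda>x. ext_power 2 (A x)) n x = mat_norm (ext_power 2 (g n))"
      using eventually_ge_at_top[of 1]
    proof eventually_elim
      case (elim n)
      then show ?case using ext_power_iterate[OF Am \<open>x \<in> space M\<close>, of "n - 1"] by (simp add: g_def)
    qed
    have c0: "0 < c" unfolding c_def by (intro add_nonneg_pos) auto
    have up: "\<forall>\<^sub>F n in sequentially. mat_norm (g n) * sing_val (g n) 2 \<le> c * cnorm (\<lambda>x. ext_power 2 (A x)) n x"
      using ext
    proof eventually_elim
      case (elim n)
      have "mat_norm (g n) * sing_val (g n) 2 \<le> mat_norm (ext_power 2 (g n))" by (rule sing_val_le_ext_power_norm[OF g m])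
      also have "\<dots> \<le> c * mat_norm (ext_power 2 (g n))" using mult_right_mono[of 1 c "mat_norm (ext_power 2 (g n))"] by (simp add: c_def)
      finally show ?case using elim by simp
    qed
    have lo: "\<forall>\<^sub>F n in sequentially. cnorm (\<lambda>x. ext_power 2 (A x)) n x \<le> c * (mat_norm (g n) * sing_val (g n) 2)"
      using ext
    proof eventually_elim
      case (elim n)
      have "mat_norm (ext_power 2 (g n)) \<le> (c - 1) * (mat_norm (g n) * sing_val (g n) 2)"
        using ext_power_norm_le_sing_val[OF g m, of n] by (simp add: c_def)
      also have "\<dots> \<le> c * (mat_norm (g n) * sing_val (g n) 2)" using s2 by (intro mult_right_mono) auto
      finally show ?case using elim by simp
    qed
    have prod: "(\<lambda>n. ereal (1 / real n) * elog (mat_norm (g n) * sing_val (g n) 2)) \<longlonglongrightarrow> lw"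
      by (rule scaled_elog_limit_comparable[OF elim(3) _ _ c0 up lo]) (use s2 in auto)
    have "\<forall>\<^sub>F n in sequentially. -\<infinity> < ereal (1 / real n) * elog (mat_norm (g n))"
      using elim(2) unfolding g_def by (rule order_tendstoD(1)) simp
    then have pos: "\<forall>\<^sub>F n in sequentially. 0 < mat_norm (g n) \<and> 1 \<le> n"
      using eventually_ge_at_top[of 1]
    proof eventually_elim
      case (elim n)
      then have "mat_norm (g n) \<noteq> 0" by (auto simp: elog_def)
      then show ?case using mat_norm_nonneg[of "g n"] elim(2) by (simp add: order_less_le)
    qed
    have "(\<lambda>n. ereal (1 / real n * ln (mat_norm (g n)))) \<longlonglongrightarrow> ereal l1"
    proof (rule Lim_transform_eventually[OF elim(2)])
      show "\<forall>\<^sub>F n in sequentially. ereal (1 / real n) * elog (cnorm A n x) = ereal (1 / real n * ln (mat_norm (g n)))"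
        using pos by eventually_elim (simp add: g_def elog_def)
    qed
    then have "(\<lambda>n. ereal (1 / real n) * elog (mat_norm (g n) * sing_val (g n) 2) - ereal (1 / real n * ln (mat_norm (g n)))) \<longlonglongrightarrow> lw - ereal l1"
      by (intro tendsto_diff_ereal_general[OF prod]) auto
    then show ?case
    proof (rule Lim_transform_eventually)
      show "\<forall>\<^sub>F n in sequentially. ereal (1 / real n) * elog (mat_norm (g n) * sing_val (g n) 2) - ereal (1 / real n * ln (mat_norm (g n)))
          = ereal (1 / real n) * elog (sing_val (iterate T A n x) 2)"
        using pos
      proof eventually_elim
        case (elim n)
        show ?case
        proof (cases "sing_val (g n) 2 = 0")
          case True then show ?thesis using elim by (simp add: elog_def g_def)
        next
          case False
          then have "0 < sing_val (g n) 2" using s2[of n] by simp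
          then have "ln (mat_norm (g n) * sing_val (g n) 2) = ln (mat_norm (g n)) + ln (sing_val (g n) 2)"
            using elim by (simp add: ln_mult)
          then show ?thesis using False elim by (simp add: elog_def g_def add_divide_distrib)
        qed
      qed
    qed
  qed
qed

end

section \<open>Lower bounds on all scales\<close>

text \<open>Applying the three factor inequality to \<open>g\<^sub>2, g\<^sub>1, g\<^sub>0\<close> and then to \<open>g\<^sub>3, g\<^sub>2, g\<^sub>1 g\<^sub>0\<close>.\<close>

lemma norm_four_product:
  assumes g: "g0 \<in> carrier_mat m m" "g1 \<in> carrier_mat m m" "g2 \<in> carrier_mat m m" "g3 \<in> carrier_mat m m"
    and m: "m \<ge> 2"
    and U: "mat_norm g0 \<le> U" "mat_norm g1 \<le> U" "mat_norm g2 \<le> U" "mat_norm g3 \<le> U"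
    and \<sigma>: "sing_val g1 2 \<le> \<sigma>" "sing_val g2 2 \<le> \<sigma>"
    and P: "0 < P" "P \<le> mat_norm (g1 * g0)" "P \<le> mat_norm (g2 * g1)" "P \<le> mat_norm (g3 * g2)"
    and \<theta>: "6 * \<sigma> * U ^ 3 \<le> \<theta> * P\<^sup>2" "\<theta> \<le> 1 / 2" "0 \<le> \<theta>"
  shows "(1 - \<theta>)\<^sup>2 * (mat_norm (g3 * g2) * mat_norm (g2 * g1) * mat_norm (g1 * g0))
     \<le> mat_norm g1 * mat_norm g2 * mat_norm (g3 * (g2 * (g1 * g0)))"
proof -
  have s: "0 \<le> sing_val g1 2" "0 \<le> sing_val g2 2"
    using right_singular_basis_exists(3)[OF g(2), of 1] right_singular_basis_exists(3)[OF g(3), of 1] m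
    by (simp_all add: numeral_2_eq_2)
  have \<sigma>0: "0 \<le> \<sigma>" using s \<sigma> by linarith
  have U0: "0 \<le> U" using U(1) mat_norm_nonneg[of g0] by linarith
  define X where "X = mat_norm (g1 * g0)"
  define Y where "Y = mat_norm (g2 * g1)"
  define Z where "Z = mat_norm (g3 * g2)"
  define R where "R = mat_norm (g2 * (g1 * g0))"
  define Q where "Q = mat_norm (g3 * (g2 * (g1 * g0)))"
  define n0 where "n0 = mat_norm g0"
  define n1 where "n1 = mat_norm g1"
  define n2 where "n2 = mat_norm g2"
  define n3 where "n3 = mat_norm g3"
  define s1 where "s1 = sing_val g1 2"
  define s2 where "s2 = sing_val g2 2"
  have P': "P \<le> X" "P \<le> Y" "P \<le> Z" using P by (auto simp: X_def Y_def Z_def)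
  have pos: "0 < X" "0 < Y" "0 < Z" using P' P(1) by linarith+
  have nn: "0 \<le> n0" "0 \<le> n1" "0 \<le> n2" "0 \<le> n3" "0 \<le> R" "0 \<le> Q" "0 \<le> s1" "0 \<le> s2"
    using s by (auto simp: n0_def n1_def n2_def n3_def R_def Q_def s1_def s2_def)
  have Ub: "n0 \<le> U" "n1 \<le> U" "n2 \<le> U" "n3 \<le> U" using U by (auto simp: n0_def n1_def n2_def n3_def)
  have Sb: "s1 \<le> \<sigma>" "s2 \<le> \<sigma>" using \<sigma> by (auto simp: s1_def s2_def)
  have A: "Y * X \<le> n1 * R + 3 * n1 * s1 * n2 * n0"
    using norm_three_product[OF g(1,2,3) m] by (simp add: X_def Y_def R_def n0_def n1_def n2_def s1_def)
  have B: "Z * R \<le> n2 * Q + 3 * n2 * s2 * n3 * X"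
    using norm_three_product[OF mult_carrier_mat[OF g(2,1)] g(3,4) m] by (simp add: X_def Z_def R_def Q_def n2_def n3_def s2_def)
  have PP: "P\<^sup>2 \<le> Y * X" unfolding power2_eq_square using P' P(1) by (intro mult_mono) auto
  have e1: "3 * n1 * s1 * n2 * n0 \<le> (\<theta> / 2) * (Y * X)"
  proof -
    have "3 * n1 * s1 * n2 * n0 \<le> 3 * U * \<sigma> * U * U"
      using Ub Sb nn U0 \<sigma>0 by (intro mult_mono) auto
    also have "\<dots> = (6 * \<sigma> * U ^ 3) / 2" by (simp add: power3_eq_cube)
    also have "\<dots> \<le> (\<theta> * P\<^sup>2) / 2" using \<theta>(1) by simp
    also have "\<dots> \<le> (\<theta> / 2) * (Y * X)" using PP \<theta>(3) by (simp add: mult_left_mono)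
    finally show ?thesis .
  qed
  have YX: "0 < Y * X" using pos by simp
  have A': "(1 - \<theta>) * (Y * X) \<le> n1 * R" 
  proof -
    have "(\<theta> / 2) * (Y * X) \<le> \<theta> * (Y * X)" using \<theta>(3) YX by (intro mult_right_mono) auto
    then show ?thesis using A e1 unfolding left_diff_distrib mult_1 by linarith
  qed
  have halfYX: "(1 / 2) * (Y * X) \<le> (1 - \<theta>) * (Y * X)" using \<theta>(2) YX by (intro mult_right_mono) auto
  have RX: "P * X \<le> 2 * U * R"
  proof -
    have "P * X \<le> Y * X" using P' pos by (intro mult_right_mono) auto
    also have "\<dots> \<le> 2 * (n1 * R)" using A' halfYX by linarith
    also have "\<dots> \<le> 2 * (U * R)" using Ub nn by (intro mult_left_mono mult_right_mono) auto
    finally show ?thesis by simp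
  qed
  have e2: "3 * n2 * s2 * n3 * X \<le> \<theta> * (Z * R)"
  proof -
    have "3 * n2 * s2 * n3 * X \<le> 3 * U * \<sigma> * U * X"
      using Ub Sb nn U0 \<sigma>0 pos by (intro mult_mono) auto
    then have "P * (3 * n2 * s2 * n3 * X) \<le> P * (3 * U * \<sigma> * U * X)" using P(1) by simp
    also have "\<dots> = (3 * U * \<sigma> * U) * (P * X)" by simp
    also have "\<dots> \<le> (3 * U * \<sigma> * U) * (2 * U * R)" using RX U0 \<sigma>0 by (intro mult_left_mono) auto
    also have "\<dots> = (6 * \<sigma> * U ^ 3) * R" by (simp add: power3_eq_cube)
    also have "\<dots> \<le> (\<theta> * P\<^sup>2) * R" using \<theta>(1) nn by (intro mult_right_mono) auto
    also have "\<dots> = P * (\<theta> * (P * R))" by (simp add: power2_eq_square)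
    finally have "3 * n2 * s2 * n3 * X \<le> \<theta> * (P * R)" using P(1) by simp
    also have "\<dots> \<le> \<theta> * (Z * R)" using P' nn \<theta>(3) by (intro mult_left_mono mult_right_mono) auto
    finally show ?thesis .
  qed
  have B': "(1 - \<theta>) * (Z * R) \<le> n2 * Q" using B e2 by (simp add: left_diff_distrib)
  have "(1 - \<theta>)\<^sup>2 * (Z * Y * X) = ((1 - \<theta>) * Z) * ((1 - \<theta>) * (Y * X))" by (simp add: power2_eq_square)
  also have "\<dots> \<le> ((1 - \<theta>) * Z) * (n1 * R)" using A' \<theta>(2) pos by (intro mult_left_mono) auto
  also have "\<dots> = n1 * ((1 - \<theta>) * (Z * R))" by simp
  also have "\<dots> \<le> n1 * (n2 * Q)" using B' nn by (intro mult_left_mono) auto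
  finally show ?thesis by (simp add: X_def Y_def Z_def Q_def n1_def n2_def mult_ac)
qed

context ergodic_system
begin

text \<open>The \<open>L\<^sup>2\<close> bound excludes the value \<open>-\<infinity>\<close> outside a null set and turns the extended real quantities into
  integrals of real functions.\<close>

lemma L2_norm_finite_scale:
  assumes B: "measurable_cocycle m B" and n: "n \<ge> 1"
    and L2: "L2_norm_ereal M (finite_scale_log T B n) < ennreal K"
  shows "AE x in M. 0 < cnorm B n x"
    and "integrable M (\<lambda>x. (ln (cnorm B n x))\<^sup>2)"
    and "(\<integral>x. (ln (cnorm B n x))\<^sup>2 \<partial>M) \<le> (real n * K)\<^sup>2"
    and "integrable M (\<lambda>x. ln (cnorm B n x))"
    and "lyap_fin M T B n = ereal ((\<integral>x. ln (cnorm B n x) \<partial>M) / real n)"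
    and "0 < K"
proof -
  have [measurable]: "(\<lambda>x. cnorm B n x) \<in> borel_measurable M" by (rule cnorm_measurable[OF B])
  have [measurable]: "(\<lambda>x. finite_scale_log T B n x) \<in> borel_measurable M"
    unfolding finite_scale_log_def by (intro borel_measurable_ereal_times borel_measurable_const elog_measurable) measurable
  define I where "I = (\<integral>\<^sup>+x. (e2ennreal \<bar>finite_scale_log T B n x\<bar>)\<^sup>2 \<partial>M)"
  have e2m [measurable]: "e2ennreal \<in> borel_measurable borel" by simp
  have Ifin: "I \<noteq> \<infinity>" using L2 unfolding L2_norm_ereal_def I_def[symmetric] Let_def by (auto split: if_splits)
  then have sq: "ennreal (sqrt (enn2real I)) < ennreal K" using L2 unfolding L2_norm_ereal_def I_def[symmetric] Let_def by simp
  show K: "0 < K"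
  proof (rule ccontr)
    assume "\<not> 0 < K"
    then have "ennreal K = 0" by (simp add: ennreal_neg)
    with sq show False by simp
  qed
  have IK: "enn2real I \<le> K\<^sup>2"
  proof -
    have "sqrt (enn2real I) < K" using sq K by (simp add: ennreal_less_iff)
    then show ?thesis using K by (metis less_imp_le real_sqrt_le_iff real_sqrt_unique)
  qed
  have "AE x in M. (e2ennreal \<bar>finite_scale_log T B n x\<bar>)\<^sup>2 \<noteq> \<infinity>"
    using Ifin unfolding I_def by (intro nn_integral_PInf_AE) auto
  then show pos: "AE x in M. 0 < cnorm B n x"
  proof eventually_elim
    case (elim x)
    have "cnorm B n x \<noteq> 0"
    proof
      assume "cnorm B n x = 0"
      then have "finite_scale_log T B n x = -\<infinity>" using n by (simp add: finite_scale_log_def elog_def)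
      then show False using elim by (simp add: power2_eq_square)
    qed
    then show ?case using mat_norm_nonneg[of "iterate T B n x"] by (simp add: order_less_le)
  qed
  define h where "h = (\<lambda>x. 1 / real n * ln (cnorm B n x))"
  have hm [measurable]: "h \<in> borel_measurable M" unfolding h_def by measurable
  have fh: "AE x in M. finite_scale_log T B n x = ereal (h x)"
    using pos by eventually_elim (simp add: finite_scale_log_def elog_def h_def)
  have Ih: "I = (\<integral>\<^sup>+x. ennreal ((h x)\<^sup>2) \<partial>M)"
    unfolding I_def
  proof (rule nn_integral_cong_AE)
    show "AE x in M. (e2ennreal \<bar>finite_scale_log T B n x\<bar>)\<^sup>2 = ennreal ((h x)\<^sup>2)"
      using fh by eventually_elim (simp add: ennreal_power)
  qed
  have hi: "integrable M (\<lambda>x. (h x)\<^sup>2)"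
    using Ifin unfolding Ih by (intro integrableI_nonneg) (auto simp: less_top)
  have hI: "(\<integral>x. (h x)\<^sup>2 \<partial>M) \<le> K\<^sup>2"
    using IK unfolding Ih by (subst integral_eq_nn_integral) auto
  have lnh: "ln (cnorm B n x) = real n * h x" for x using n by (simp add: h_def)
  show "integrable M (\<lambda>x. (ln (cnorm B n x))\<^sup>2)" unfolding lnh power_mult_distrib using hi by simp
  show "(\<integral>x. (ln (cnorm B n x))\<^sup>2 \<partial>M) \<le> (real n * K)\<^sup>2"
    unfolding lnh power_mult_distrib using hI by (simp add: mult_left_mono)
  have hint: "integrable M h" by (rule square_integrable_imp_integrable[OF hm hi])
  then show "integrable M (\<lambda>x. ln (cnorm B n x))" unfolding lnh by simp
  have "lyap_fin M T B n = ereal (\<integral>x. h x \<partial>M)"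
  proof -
    obtain r q where rq: "0 \<le> r" "0 \<le> q" "(\<integral>\<^sup>+x. ennreal (h x) \<partial>M) = ennreal r"
      "(\<integral>\<^sup>+x. ennreal (- h x) \<partial>M) = ennreal q" "integral\<^sup>L M h = r - q"
      using hint by (elim integrableE) auto
    have "(\<integral>\<^sup>+x. e2ennreal (finite_scale_log T B n x) \<partial>M) = (\<integral>\<^sup>+x. ennreal (h x) \<partial>M)"
      by (rule nn_integral_cong_AE) (use fh in \<open>eventually_elim, simp\<close>)
    moreover have "(\<integral>\<^sup>+x. e2ennreal (- finite_scale_log T B n x) \<partial>M) = (\<integral>\<^sup>+x. ennreal (- h x) \<partial>M)"
      by (rule nn_integral_cong_AE) (use fh in \<open>eventually_elim, simp\<close>)
    ultimately show ?thesis unfolding lyap_fin_def ereal_integral_def using rq by (simp add: enn2ereal_ennreal)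
  qed
  then show "lyap_fin M T B n = ereal ((\<integral>x. ln (cnorm B n x) \<partial>M) / real n)"
    unfolding h_def by simp
qed

end

text \<open>A single cocycle \<open>B\<close> with the quantitative information that is uniform in a neighbourhood of \<open>A\<close>: \<open>l\<close> is the
  first exponent of \<open>A\<close>, its second exponent is below \<open>l - 100 \<gamma>\<close>, and all exceptional sets at scale
  \<open>n \<ge> N\<^sub>0\<close> have measure at most \<open>\<iota>\<^sub>n\<close>.

  The multiples of \<open>\<gamma>\<close> fit together as follows.  The mean exponents of \<open>B\<close> will be at least \<open>l - 16 \<gamma>\<close> at all
  scales.  Outside a small set the norm of \<open>B\<^bsup>(n)\<^esup>\<close> is then at least \<open>P = e\<^bsup>(l - 17 \<gamma>) n\<^esup>\<close>, and dividing the bound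
  for the exterior square by it gives \<open>s\<^sub>2(B\<^bsup>(n)\<^esup>) \<le> \<sigma> = e\<^bsup>(l - 83 \<gamma>) n\<^esup>\<close>.  Hence \<open>s\<^sub>2 / s\<^sub>1 \<le> e\<^bsup>- 66 \<gamma> n\<^esup>\<close>, which is the rate of
  convergence of the directions.  With the upper bound \<open>U = e\<^bsup>(l + \<gamma>) n\<^esup>\<close>, the relative error \<open>\<sigma> U\<^sup>3 / P\<^sup>4\<close> of the
  inequality for four blocks of length \<open>n\<close> is \<open>e\<^bsup>- 12 \<gamma> n\<^esup>\<close>.\<close>

locale ldt_cocycle = ergodic_system M T for M :: "'a measure" and T +
  fixes B :: "'a \<Rightarrow> real mat" and m :: nat and K c l \<gamma> :: real and \<iota> :: "real \<Rightarrow> real" and N\<^sub>0 :: nat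
  assumes B: "measurable_cocycle m B" and m2: "m \<ge> 2"
    and K0: "0 \<le> K" and BK: "AE x in M. mat_norm (B x) \<le> exp K"
    and c0: "0 < c" and \<gamma>0: "0 < \<gamma>" and N0: "1 \<le> N\<^sub>0"
    and norm_pos: "\<And>n. n \<ge> 1 \<Longrightarrow> AE x in M. 0 < cnorm B n x"
    and sq_integrable: "\<And>n. n \<ge> 1 \<Longrightarrow> integrable M (\<lambda>x. (ln (cnorm B n x))\<^sup>2)"
    and sq_bound: "\<And>n. n \<ge> 1 \<Longrightarrow> (\<integral>x. (ln (cnorm B n x))\<^sup>2 \<partial>M) \<le> (real n * c)\<^sup>2"
    and \<iota>_pos: "\<And>t. 0 < t \<Longrightarrow> 0 < \<iota> t"
    and \<iota>_mono: "\<And>s t. 0 < s \<Longrightarrow> s \<le> t \<Longrightarrow> \<iota> t \<le> \<iota> s"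
    and ldt: "\<And>n. n \<ge> N\<^sub>0 \<Longrightarrow> prob {x \<in> space M.
        \<gamma> < \<bar>ln (cnorm B n x) / real n - (\<integral>x. ln (cnorm B n x) \<partial>M) / real n\<bar>} \<le> \<iota> (real n)"
    and upper: "\<And>n. n \<ge> N\<^sub>0 \<Longrightarrow> prob {x \<in> space M. exp ((l + \<gamma>) * real n) < cnorm B n x} \<le> \<iota> (real n)"
    and upper2: "\<And>n. n \<ge> N\<^sub>0 \<Longrightarrow> prob {x \<in> space M.
        exp ((2 * l - 100 * \<gamma>) * real n) < cnorm (\<lambda>x. ext_power 2 (B x)) n x} \<le> \<iota> (real n)"
begin

abbreviation BB :: "'a \<Rightarrow> real mat" where "BB \<equiv> \<lambda>x. ext_power 2 (B x)"

definition L :: "nat \<Rightarrow> 'a \<Rightarrow> real" where "L n x = ln (cnorm B n x)"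
definition a :: "nat \<Rightarrow> real" where "a n = (\<integral>x. L n x \<partial>M)"
definition u :: "nat \<Rightarrow> real" where "u n = a n / real n"

lemma cnorm_B_measurable [measurable]: "(\<lambda>x. cnorm B n x) \<in> borel_measurable M"
  by (rule cnorm_measurable[OF B])

lemma cnorm_BB_measurable [measurable]: "(\<lambda>x. cnorm BB n x) \<in> borel_measurable M"
  by (rule cnorm_measurable[OF ext_power_cocycle[OF B m2]])

lemma L_measurable [measurable]: "(\<lambda>x. L n x) \<in> borel_measurable M"
  unfolding L_def by measurable

lemma L_sq_integrable: "n \<ge> 1 \<Longrightarrow> integrable M (\<lambda>x. (L n x)\<^sup>2)"
  unfolding L_def by (rule sq_integrable)

lemma L_integrable: "n \<ge> 1 \<Longrightarrow> integrable M (\<lambda>x. L n x)"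
  by (rule square_integrable_imp_integrable[OF L_measurable L_sq_integrable])

lemma norm_pos_all: "AE x in M. \<forall>n\<ge>1. \<forall>k. 0 < cnorm B n ((T ^^ k) x)"
proof -
  have "AE x in M. \<forall>n. n \<ge> 1 \<longrightarrow> 0 < cnorm B n x"
    unfolding AE_all_countable using norm_pos by (auto intro: AE_impI)
  from AE_T_pow_all[OF this] show ?thesis by eventually_elim auto
qed

lemma norm_bound_all: "AE x in M. \<forall>n k. cnorm B n ((T ^^ k) x) \<le> exp (K * real n)"
  using cnorm_exp_bound[OF B _ BK] m2 by simp

lemma a_subadditive:
  assumes "p \<ge> 1" "q \<ge> 1" shows "a (p + q) \<le> a p + a q"
proof -
  have "AE x in M. x \<in> space M" by auto
  then have "AE x in M. L (p + q) x \<le> L p ((T ^^ q) x) + L q x"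
    using norm_pos_all
  proof eventually_elim
    case (elim x)
    have pos: "0 < cnorm B p ((T ^^ q) x)" "0 < cnorm B q ((T ^^ 0) x)" "0 < cnorm B (p + q) ((T ^^ 0) x)"
      using elim(2)[rule_format, of p q] elim(2)[rule_format, of q 0] elim(2)[rule_format, of "p + q" 0] assms by simp_all
    have "ln (cnorm B (p + q) x) \<le> ln (cnorm B p ((T ^^ q) x) * cnorm B q x)"
      using pos cnorm_add_le[OF B elim(1), of p q] by simp
    then show ?case using pos by (simp add: L_def ln_mult)
  qed
  then have "a (p + q) \<le> (\<integral>x. L p ((T ^^ q) x) + L q x \<partial>M)"
    unfolding a_def using assms by (intro integral_mono_AE Bochner_Integration.integrable_add integrable_T_pow L_integrable) auto
  also have "\<dots> = a p + a q"
    unfolding a_def using assms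
    by (subst Bochner_Integration.integral_add) (auto intro!: integrable_T_pow L_integrable simp: integral_T_pow)
  finally show ?thesis .
qed

lemma a_le: "n \<ge> 1 \<Longrightarrow> a n \<le> K * real n"
proof -
  assume n: "n \<ge> 1"
  have "AE x in M. L n x \<le> K * real n"
    using norm_pos_all norm_bound_all
  proof eventually_elim
    case (elim x)
    have "0 < cnorm B n ((T ^^ 0) x)" using elim(1) n by blast
    moreover have "cnorm B n ((T ^^ 0) x) \<le> exp (K * real n)" using elim(2) by blast
    ultimately show ?case unfolding L_def by (metis funpow_0 ln_exp ln_le_cancel_iff exp_gt_zero)
  qed
  then have "a n \<le> (\<integral>x. K * real n \<partial>M)" unfolding a_def using n by (intro integral_mono_AE L_integrable) auto
  then show ?thesis by (simp add: prob_space)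
qed

lemma a_mult_le:
  assumes "q \<ge> 1" "n \<ge> 1" shows "a (q * n) \<le> real q * a n"
  using assms(1)
proof (induction q rule: nat_induct_at_least)
  case (Suc q)
  have "a (Suc q * n) \<le> a n + a (q * n)" using a_subadditive[of n "q * n"] Suc assms(2) by simp
  then show ?case using Suc by (simp add: algebra_simps)
qed simp

definition good :: "nat \<Rightarrow> 'a \<Rightarrow> bool" where
  "good n x \<longleftrightarrow> exp ((l - 17 * \<gamma>) * real n) \<le> cnorm B n x \<and> cnorm B n x \<le> exp ((l + \<gamma>) * real n) \<and>
     cnorm BB n x \<le> exp ((2 * l - 100 * \<gamma>) * real n)"

lemma good_measurable [measurable]: "Measurable.pred M (good n)"
  unfolding good_def by measurable

lemma prob_bad:
  assumes n: "n \<ge> N\<^sub>0" and un: "l - 16 * \<gamma> \<le> u n"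
  shows "prob {x \<in> space M. \<not> good n x} \<le> 3 * \<iota> (real n)"
proof -
  have n1: "1 \<le> n" using n N0 by simp
  define E1 where "E1 = {x \<in> space M. \<gamma> < \<bar>L n x / real n - u n\<bar>}"
  define E2 where "E2 = {x \<in> space M. exp ((l + \<gamma>) * real n) < cnorm B n x}"
  define E3 where "E3 = {x \<in> space M. exp ((2 * l - 100 * \<gamma>) * real n) < cnorm BB n x}"
  have [measurable]: "E1 \<in> sets M" "E2 \<in> sets M" "E3 \<in> sets M" unfolding E1_def E2_def E3_def by measurable
  have p: "prob E1 \<le> \<iota> (real n)" "prob E2 \<le> \<iota> (real n)" "prob E3 \<le> \<iota> (real n)"
    using ldt[OF n] upper[OF n] upper2[OF n] by (simp_all add: E1_def E2_def E3_def L_def u_def a_def)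
  have "AE x in M. x \<in> {x \<in> space M. \<not> good n x} \<longrightarrow> x \<in> E1 \<union> E2 \<union> E3"
    using norm_pos[OF n1]
  proof eventually_elim
    case (elim x)
    show ?case
    proof
      assume x: "x \<in> {x \<in> space M. \<not> good n x}"
      show "x \<in> E1 \<union> E2 \<union> E3"
      proof (rule ccontr)
        assume "x \<notin> E1 \<union> E2 \<union> E3"
        then have b: "\<bar>L n x / real n - u n\<bar> \<le> \<gamma>" "cnorm B n x \<le> exp ((l + \<gamma>) * real n)"
          "cnorm BB n x \<le> exp ((2 * l - 100 * \<gamma>) * real n)"
          using x by (auto simp: E1_def E2_def E3_def not_less)
        then have "l - 17 * \<gamma> \<le> L n x / real n" using un by linarith
        then have "(l - 17 * \<gamma>) * real n \<le> ln (cnorm B n x)" using n1 by (simp add: L_def field_simps)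
        then have "exp ((l - 17 * \<gamma>) * real n) \<le> cnorm B n x" using elim by (simp add: ln_ge_iff)
        then show False using b x by (auto simp: good_def)
      qed
    qed
  qed
  then have "prob {x \<in> space M. \<not> good n x} \<le> prob (E1 \<union> E2 \<union> E3)"
    by (intro finite_measure_mono_AE) auto
  also have "\<dots> \<le> prob (E1 \<union> E2) + prob E3" by (intro measure_Un_le) auto
  also have "\<dots> \<le> prob E1 + prob E2 + prob E3"
    using measure_Un_le[of E1 M E2] by simp
  finally show ?thesis using p by linarith
qed

lemma good_gap:
  assumes x: "x \<in> space M" and n: "n \<ge> 1" and g: "good n x"
  shows "sing_val (iterate T B n x) 2 \<le> exp ((l - 83 * \<gamma>) * real n)"
    and "sing_val (iterate T B n x) 2 < cnorm B n x"
proof -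
  note c = iterate_carrier[OF B x, of n]
  have "cnorm BB n x = mat_norm (ext_power 2 (iterate T B n x))"
    using ext_power_iterate[OF B x, of "n - 1"] n by simp
  then have "cnorm B n x * sing_val (iterate T B n x) 2 \<le> exp ((2 * l - 100 * \<gamma>) * real n)"
    using sing_val_le_ext_power_norm[OF c m2] g by (simp add: good_def)
  also have "\<dots> = exp ((l - 17 * \<gamma>) * real n) * exp ((l - 83 * \<gamma>) * real n)"
    by (simp add: exp_add[symmetric] algebra_simps)
  finally have "cnorm B n x * sing_val (iterate T B n x) 2 \<le> exp ((l - 17 * \<gamma>) * real n) * exp ((l - 83 * \<gamma>) * real n)" .
  also have "\<dots> \<le> cnorm B n x * exp ((l - 83 * \<gamma>) * real n)"
    using g by (intro mult_right_mono) (auto simp: good_def)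
  finally have *: "cnorm B n x * sing_val (iterate T B n x) 2 \<le> cnorm B n x * exp ((l - 83 * \<gamma>) * real n)" .
  have pos: "0 < cnorm B n x" using g by (auto simp: good_def intro: less_le_trans[OF exp_gt_zero])
  then show 1: "sing_val (iterate T B n x) 2 \<le> exp ((l - 83 * \<gamma>) * real n)" using * by simp
  also have "\<dots> < exp ((l - 17 * \<gamma>) * real n)" using \<gamma>0 n by simp
  finally show "sing_val (iterate T B n x) 2 < cnorm B n x" using g by (auto simp: good_def)
qed

text \<open>The logarithm of the inequality for four matrices, applied to four consecutive blocks of length \<open>n\<close>.\<close>

lemma four_block_pointwise:
  assumes x: "x \<in> space M" and n: "n \<ge> 1" and small: "exp (- (12 * \<gamma>) * real n) \<le> 1 / 12"
    and g: "good n x" "good n ((T ^^ n) x)" "good n ((T ^^ (2 * n)) x)" "good n ((T ^^ (3 * n)) x)"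
    and gg: "good (2 * n) x" "good (2 * n) ((T ^^ n) x)" "good (2 * n) ((T ^^ (2 * n)) x)"
    and pos: "0 < cnorm B (4 * n) x"
  shows "- 24 * exp (- (12 * \<gamma>) * real n) \<le>
    L (4 * n) x - L (2 * n) ((T ^^ (2 * n)) x) - L (2 * n) ((T ^^ n) x) - L (2 * n) x
      + L n ((T ^^ n) x) + L n ((T ^^ (2 * n)) x)"
proof -
  define h where "h = (\<lambda>i. iterate T B n ((T ^^ (i * n)) x))"
  have h: "h i \<in> carrier_mat m m" for i unfolding h_def by (rule iterate_carrier[OF B T_pow_space[OF x]])
  have step: "iterate T B (n + k) ((T ^^ (i * n)) x) = iterate T B n ((T ^^ k) ((T ^^ (i * n)) x)) * iterate T B k ((T ^^ (i * n)) x)" for k i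
    by (rule iterate_add[OF B T_pow_space[OF x]])
  have pw: "(T ^^ k) ((T ^^ (i * n)) x) = (T ^^ (k + i * n)) x" for k i by (simp add: funpow_add)
  have h2: "iterate T B (2 * n) ((T ^^ (i * n)) x) = h (Suc i) * h i" for i
    using step[of n i] pw[of n i] by (simp add: h_def mult_2)
  have h4: "iterate T B (4 * n) x = h 3 * (h 2 * (h 1 * h 0))"
  proof -
    have "iterate T B (4 * n) ((T ^^ (0 * n)) x) = iterate T B (n + (n + 2 * n)) ((T ^^ (0 * n)) x)" by simp
    also have "\<dots> = h 3 * iterate T B (n + 2 * n) ((T ^^ (0 * n)) x)"
      using step[of "n + 2 * n" 0] pw[of "n + 2 * n" 0] by (simp add: h_def)
    also have "iterate T B (n + 2 * n) ((T ^^ (0 * n)) x) = h 2 * iterate T B (2 * n) ((T ^^ (0 * n)) x)"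
      using step[of "2 * n" 0] pw[of "2 * n" 0] by (simp add: h_def)
    finally show ?thesis using h2[of 0] by (simp add: numeral_2_eq_2)
  qed
  have gi: "good n ((T ^^ (i * n)) x)" if "i < 4" for i
    using g that by (auto simp: eval_nat_numeral less_Suc_eq add.assoc)
  have ggi: "good (2 * n) ((T ^^ (i * n)) x)" if "i < 3" for i
    using gg that by (auto simp: eval_nat_numeral less_Suc_eq add.assoc)
  define U where "U = exp ((l + \<gamma>) * real n)"
  define \<sigma> where "\<sigma> = exp ((l - 83 * \<gamma>) * real n)"
  define P where "P = exp ((l - 17 * \<gamma>) * real (2 * n))"
  define \<theta> where "\<theta> = 6 * exp (- (12 * \<gamma>) * real n)"
  have hU: "mat_norm (h i) \<le> U" if "i < 4" for i using gi[OF that] by (simp add: h_def U_def good_def)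
  have h\<sigma>: "sing_val (h i) 2 \<le> \<sigma>" if "i < 4" for i
    using good_gap(1)[OF T_pow_space[OF x] n gi[OF that]] by (simp add: h_def \<sigma>_def)
  have hP: "P \<le> mat_norm (h (Suc i) * h i)" if "i < 3" for i
    using ggi[OF that] unfolding h2[symmetric] good_def P_def by simp
  have \<theta>: "6 * \<sigma> * U ^ 3 \<le> \<theta> * P\<^sup>2"
    unfolding \<sigma>_def U_def \<theta>_def P_def exp_of_nat_mult[symmetric] by (simp add: exp_add[symmetric] algebra_simps)
  have \<theta>b: "0 \<le> \<theta>" "\<theta> \<le> 1 / 2" using small by (auto simp: \<theta>_def)
  have main: "(1 - \<theta>)\<^sup>2 * (mat_norm (h 3 * h 2) * mat_norm (h 2 * h 1) * mat_norm (h 1 * h 0))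
     \<le> mat_norm (h 1) * mat_norm (h 2) * mat_norm (h 3 * (h 2 * (h 1 * h 0)))"
    by (rule norm_four_product[OF h h h h m2, where U = U and \<sigma> = \<sigma> and P = P])
      (use hU h\<sigma> hP[of 0] hP[of 1] hP[of 2] \<theta> \<theta>b in \<open>auto simp: P_def eval_nat_numeral\<close>)
  have hp: "0 < mat_norm (h i)" if "i < 4" for i
    using gi[OF that] unfolding good_def h_def by (auto intro: less_le_trans[OF exp_gt_zero])
  have hhp: "0 < mat_norm (h (Suc i) * h i)" if "i < 3" for i
    using hP[OF that] by (auto simp: P_def intro: less_le_trans[OF exp_gt_zero])
  have p32: "0 < mat_norm (h 3 * h 2)" "0 < mat_norm (h 2 * h 1)" "0 < mat_norm (h 1 * h 0)"
    using hhp[of 2] hhp[of 1] hhp[of 0] by (auto simp: eval_nat_numeral)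
  have p4: "0 < mat_norm (h 3 * (h 2 * (h 1 * h 0)))" using pos unfolding h4 .
  have "ln ((1 - \<theta>)\<^sup>2 * (mat_norm (h 3 * h 2) * mat_norm (h 2 * h 1) * mat_norm (h 1 * h 0)))
     \<le> ln (mat_norm (h 1) * mat_norm (h 2) * mat_norm (h 3 * (h 2 * (h 1 * h 0))))"
  proof (rule ln_mono)
    show "0 < (1 - \<theta>)\<^sup>2 * (mat_norm (h 3 * h 2) * mat_norm (h 2 * h 1) * mat_norm (h 1 * h 0))"
      using \<theta>b p32 by auto
  qed (rule main)
  moreover have "ln ((1 - \<theta>)\<^sup>2 * (mat_norm (h 3 * h 2) * mat_norm (h 2 * h 1) * mat_norm (h 1 * h 0)))
     = 2 * ln (1 - \<theta>) + (ln (mat_norm (h 3 * h 2)) + ln (mat_norm (h 2 * h 1)) + ln (mat_norm (h 1 * h 0)))"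
    using \<theta>b p32 by (simp add: ln_mult ln_realpow)
  moreover have "ln (mat_norm (h 1) * mat_norm (h 2) * mat_norm (h 3 * (h 2 * (h 1 * h 0))))
     = ln (mat_norm (h 1)) + ln (mat_norm (h 2)) + ln (mat_norm (h 3 * (h 2 * (h 1 * h 0))))"
    using hp[of 1] hp[of 2] p4 by (simp add: ln_mult)
  moreover have "- 2 * \<theta> \<le> ln (1 - \<theta>)"
  proof -
    have "- \<theta> - 2 * \<theta>\<^sup>2 \<le> ln (1 - \<theta>)" by (rule ln_one_minus_pos_lower_bound[OF \<theta>b])
    moreover have "2 * \<theta>\<^sup>2 \<le> \<theta>" using \<theta>b mult_left_mono[of \<theta> "1 / 2" \<theta>] by (simp add: power2_eq_square)
    ultimately show ?thesis by simp
  qed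
  ultimately have fin: "- 4 * \<theta> \<le> ln (mat_norm (h 3 * (h 2 * (h 1 * h 0)))) - ln (mat_norm (h 3 * h 2)) - ln (mat_norm (h 2 * h 1))
      - ln (mat_norm (h 1 * h 0)) + ln (mat_norm (h 1)) + ln (mat_norm (h 2))" by linarith
  have h21: "iterate T B (2 * n) ((T ^^ n) x) = h 2 * h 1" using h2[of 1] by (simp add: numeral_2_eq_2)
  have h1: "iterate T B n ((T ^^ n) x) = h 1" "iterate T B n ((T ^^ (2 * n)) x) = h 2" by (simp_all add: h_def)
  have e: "L (4 * n) x = ln (mat_norm (h 3 * (h 2 * (h 1 * h 0))))"
    "L (2 * n) ((T ^^ (2 * n)) x) = ln (mat_norm (h 3 * h 2))"
    "L (2 * n) ((T ^^ n) x) = ln (mat_norm (h 2 * h 1))"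
    "L (2 * n) x = ln (mat_norm (h 1 * h 0))"
    "L n ((T ^^ n) x) = ln (mat_norm (h 1))" "L n ((T ^^ (2 * n)) x) = ln (mat_norm (h 2))"
    using h4 h2[of 2] h21 h2[of 0] h1 by (simp_all add: L_def)
  show ?thesis unfolding e using fin by (simp add: \<theta>_def)
qed

end

text \<open>The first term is the error on good orbits.  The second one comes from the exceptional set: seven events,
  each of which fails with probability at most \<open>3 \<iota>\<^sub>n\<close>.\<close>

definition block_err :: "real \<Rightarrow> real \<Rightarrow> (real \<Rightarrow> real) \<Rightarrow> nat \<Rightarrow> real" where
  "block_err \<gamma> c \<iota> n = 24 * exp (- (12 * \<gamma>) * real n) + 12 * real n * c * sqrt (21 * \<iota> (real n))"

text \<open>Both terms are \<open>O(n\<^bsup>-2\<^esup>)\<close>, so the errors at the scales \<open>n, 2n, 4n, \<dots>\<close> form a geometric series.\<close>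

lemma block_err_sum:
  assumes \<P>: "\<forall>p\<in>\<P>. is_ldt_param p" and \<iota>: "\<iota> \<in> deviation_functions \<P>" and \<gamma>: "0 < \<gamma>" and c: "0 < c"
  shows "\<exists>n\<^sub>1\<ge>1. \<forall>n\<ge>n\<^sub>1. exp (- (12 * \<gamma>) * real n) \<le> 1 / 12 \<and> (\<forall>J. (\<Sum>j<J. block_err \<gamma> c \<iota> (2 ^ j * n)) \<le> \<gamma> * real n)"
proof -
  obtain c1 where c1: "c1 > 0" "\<forall>\<^sub>F n in sequentially. real n * sqrt (\<iota> (real n)) \<le> c1 / (real n)\<^sup>2"
    using deviation_function_sums(4)[OF \<P> \<iota>] by blast
  have "(\<lambda>n. real n * exp (- 6 * \<gamma>) ^ n) \<longlonglongrightarrow> 0"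
    by (rule powser_times_n_limit_0) (use \<gamma> in simp)
  then have "\<forall>\<^sub>F n in sequentially. real n * exp (- 6 * \<gamma>) ^ n < 1" by (rule order_tendstoD) simp
  then have e1: "\<forall>\<^sub>F n in sequentially. exp (- (12 * \<gamma>) * real n) \<le> 1 / (real n)\<^sup>2"
    using eventually_ge_at_top[of 1]
  proof eventually_elim
    case (elim n)
    have "(real n * exp (- 6 * \<gamma>) ^ n)\<^sup>2 \<le> 1\<^sup>2" using elim by (intro power_mono) auto
    moreover have "(exp (- 6 * \<gamma>) ^ n)\<^sup>2 = exp (- (12 * \<gamma>) * real n)"
      unfolding exp_of_nat_mult[symmetric] by (simp add: algebra_simps)
    ultimately have "(real n)\<^sup>2 * exp (- (12 * \<gamma>) * real n) \<le> 1" by (simp add: power_mult_distrib)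
    then show ?case using elim by (simp add: field_simps)
  qed
  define C where "C = 24 + 12 * c * sqrt 21 * c1"
  have C: "0 < C" using c c1 by (simp add: C_def add_pos_pos)
  have "\<forall>\<^sub>F n in sequentially. n \<ge> 1 \<and> exp (- (12 * \<gamma>) * real n) \<le> 1 / (real n)\<^sup>2 \<and> block_err \<gamma> c \<iota> n \<le> C / (real n)\<^sup>2"
    using e1 c1(2) eventually_ge_at_top[of 1]
  proof eventually_elim
    case (elim n)
    have "12 * real n * c * sqrt (21 * \<iota> (real n)) = 12 * c * sqrt 21 * (real n * sqrt (\<iota> (real n)))"
      by (simp add: real_sqrt_mult)
    also have "\<dots> \<le> 12 * c * sqrt 21 * (c1 / (real n)\<^sup>2)" using elim c by (intro mult_left_mono) auto
    finally have "block_err \<gamma> c \<iota> n \<le> 24 * (1 / (real n)\<^sup>2) + 12 * c * sqrt 21 * (c1 / (real n)\<^sup>2)"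
      using elim unfolding block_err_def by linarith
    also have "\<dots> = C / (real n)\<^sup>2" by (simp add: C_def add_divide_distrib)
    finally show ?case using elim by simp
  qed
  then obtain N where N: "\<And>n. n \<ge> N \<Longrightarrow> n \<ge> 1 \<and> exp (- (12 * \<gamma>) * real n) \<le> 1 / (real n)\<^sup>2 \<and> block_err \<gamma> c \<iota> n \<le> C / (real n)\<^sup>2"
    unfolding eventually_sequentially by blast
  define n1 where "n1 = max (max N 4) (nat \<lceil>2 * C / \<gamma>\<rceil>)"
  show ?thesis
  proof (intro exI[of _ n1] conjI allI impI)
    show "1 \<le> n1" by (simp add: n1_def)
    fix n J assume "n \<ge> n1"
    then have n: "n \<ge> N" "n \<ge> 4" "2 * C / \<gamma> \<le> real n" by (auto simp: n1_def)
    have "1 / (real n)\<^sup>2 \<le> 1 / 12"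
    proof -
      have "4\<^sup>2 \<le> (real n)\<^sup>2" using n by (intro power_mono) auto
      then show ?thesis using n(2) by (intro divide_left_mono) auto
    qed
    then show "exp (- (12 * \<gamma>) * real n) \<le> 1 / 12" using N[OF n(1)] by linarith
    have "(\<Sum>j<J. block_err \<gamma> c \<iota> (2 ^ j * n)) \<le> (\<Sum>j<J. C / (real n)\<^sup>2 * (1 / 4) ^ j)"
    proof (rule sum_mono)
      fix j
      have "n \<le> 2 ^ j * n" by simp
      then have "2 ^ j * n \<ge> N" using n(1) by linarith
      from N[OF this] have "block_err \<gamma> c \<iota> (2 ^ j * n) \<le> C / (real (2 ^ j * n))\<^sup>2" by blast
      also have "\<dots> = C / (real n)\<^sup>2 * (1 / 4) ^ j"
      proof -
        have "((2::real) ^ j)\<^sup>2 = 4 ^ j" by (simp add: power_mult[symmetric] mult.commute[of j 2] power_mult)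
        then show ?thesis by (simp add: power_mult_distrib power_one_over)
      qed
      finally show "block_err \<gamma> c \<iota> (2 ^ j * n) \<le> C / (real n)\<^sup>2 * (1 / 4) ^ j" .
    qed
    also have "\<dots> = C / (real n)\<^sup>2 * (\<Sum>j<J. (1 / 4) ^ j)" by (simp add: sum_distrib_left)
    also have "\<dots> \<le> C / (real n)\<^sup>2 * 2"
    proof (rule mult_left_mono)
      have "(\<Sum>j<J. (1 / 4 :: real) ^ j) = (1 - (1 / 4) ^ J) / (1 - 1 / 4)" by (simp add: sum_gp_strict)
      also have "\<dots> \<le> 2" by (simp add: field_simps)
      finally show "(\<Sum>j<J. (1 / 4 :: real) ^ j) \<le> 2" .
    qed (use C in auto)
    also have "\<dots> \<le> 2 * C"
    proof -
      have "1 \<le> (real n)\<^sup>2" using n(2) by (intro one_le_power) auto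
      then have "C / (real n)\<^sup>2 \<le> C / 1" using C n(2) by (intro divide_left_mono) auto
      from mult_right_mono[OF this, of 2] show ?thesis by (simp only: div_by_1 mult.commute[of C 2])
    qed
    also have "\<dots> \<le> \<gamma> * real n" using n(3) \<gamma> by (simp add: field_simps)
    finally show "(\<Sum>j<J. block_err \<gamma> c \<iota> (2 ^ j * n)) \<le> \<gamma> * real n" .
  qed
qed

text \<open>A weighted form of Young's inequality; it plays the part of the Cauchy--Schwarz inequality on the
  exceptional set.\<close>

lemma abs_le_weighted_square:
  fixes t :: real
  assumes "0 < w" "0 < k" shows "\<bar>t\<bar> \<le> w / (2 * k) * t\<^sup>2 + k / (2 * w)"
proof -
  have "0 \<le> (w * \<bar>t\<bar> - k)\<^sup>2 / (2 * k * w)" using assms by auto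
  also have "\<dots> = w / (2 * k) * t\<^sup>2 + k / (2 * w) - \<bar>t\<bar>"
    using assms by (simp add: power2_eq_square field_simps abs_mult_self_eq flip: abs_mult)
  finally show ?thesis by simp
qed

context ldt_cocycle
begin

text \<open>Integrating the pointwise inequality; on the exceptional set the logarithms are controlled by their
  \<open>L\<^sup>2\<close> norms, at the price of the square root of its measure.\<close>

lemma four_block:
  assumes n: "n \<ge> N\<^sub>0" and small: "exp (- (12 * \<gamma>) * real n) \<le> 1 / 12"
    and un: "l - 16 * \<gamma> \<le> u n" and u2n: "l - 16 * \<gamma> \<le> u (2 * n)"
  shows "3 * a (2 * n) - 2 * a n - block_err \<gamma> c \<iota> n \<le> a (4 * n)"
proof -
  have n1: "1 \<le> n" using n N0 by simp
  define S where "S = [(n, 0), (n, n), (n, 2 * n), (n, 3 * n), (2 * n, 0), (2 * n, n), (2 * n, 2 * n)]"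
  define E where "E = (\<lambda>(k, i). {x \<in> space M. \<not> good k ((T ^^ i) x)})"
  define Bd where "Bd = (\<Union>p\<in>set S. E p)"
  have E [measurable]: "E p \<in> sets M" for p unfolding E_def by (cases p) simp
  have Bd [measurable]: "Bd \<in> sets M" unfolding Bd_def by auto
  define p where "p = 21 * \<iota> (real n)"
  have p0: "0 < p" using \<iota>_pos n1 by (simp add: p_def)
  have pE: "prob (E q) \<le> 3 * \<iota> (real n)" if "q \<in> set S" for q
  proof -
    obtain k i where q: "q = (k, i)" by (cases q)
    have k: "k = n \<or> k = 2 * n" using that by (auto simp: S_def q)
    have Eq: "E q = {x \<in> space M. (T ^^ i) x \<in> {x \<in> space M. \<not> good k x}}"
      using T_pow_space by (auto simp: E_def q)
    have mk: "{x \<in> space M. \<not> good k x} \<in> sets M" by measurable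
    have "prob (E q) = prob {x \<in> space M. \<not> good k x}" unfolding Eq by (rule prob_T_pow[OF mk])
    also have "\<dots> \<le> 3 * \<iota> (real k)" using k n un u2n by (intro prob_bad) auto
    also have "\<dots> \<le> 3 * \<iota> (real n)" using k n1 by (auto intro!: \<iota>_mono)
    finally show ?thesis .
  qed
  have pBd: "prob Bd \<le> p"
  proof -
    have "prob Bd \<le> (\<Sum>q\<in>set S. prob (E q))" unfolding Bd_def by (intro measure_UNION_le) auto
    also have "\<dots> \<le> real (card (set S)) * (3 * \<iota> (real n))" by (rule sum_bounded_above) (rule pE)
    also have "\<dots> \<le> 7 * (3 * \<iota> (real n))"
    proof (rule mult_right_mono)
      show "real (card (set S)) \<le> 7" using card_length[of S] by (simp add: S_def)
      show "0 \<le> 3 * \<iota> (real n)" using \<iota>_pos[of "real n"] n1 by simp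
    qed
    finally show ?thesis by (simp add: p_def)
  qed
  \<comment> \<open>This weight balances \<open>n w c\<^sup>2\<close>, the contribution of the squares, with \<open>n p / w\<close>, that of the exceptional set.\<close>
  define w where "w = sqrt p / c"
  have w: "0 < w" using p0 c0 by (simp add: w_def)
  define rn where "rn = real n"
  have rn: "0 < rn" using n1 by (simp add: rn_def)
  define e where "e = 24 * exp (- (12 * \<gamma>) * real n)"
  define F where "F = (\<lambda>x. L (4 * n) x - L (2 * n) ((T ^^ (2 * n)) x) - L (2 * n) ((T ^^ n) x) - L (2 * n) x
      + L n ((T ^^ n) x) + L n ((T ^^ (2 * n)) x))"
  define H where "H = (\<lambda>x. e + w / (8 * rn) * (L (4 * n) x)\<^sup>2
      + w / (4 * rn) * ((L (2 * n) ((T ^^ (2 * n)) x))\<^sup>2 + (L (2 * n) ((T ^^ n) x))\<^sup>2 + (L (2 * n) x)\<^sup>2)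
      + w / (2 * rn) * ((L n ((T ^^ n) x))\<^sup>2 + (L n ((T ^^ (2 * n)) x))\<^sup>2)
      + 6 * rn / w * indicator Bd x)"
  have "AE x in M. x \<in> space M" by auto
  then have "AE x in M. 0 \<le> F x + H x"
    using norm_pos_all
  proof eventually_elim
    case (elim x)
    have nn: "0 \<le> w / (8 * rn) * (L (4 * n) x)\<^sup>2"
      "0 \<le> w / (4 * rn) * ((L (2 * n) ((T ^^ (2 * n)) x))\<^sup>2 + (L (2 * n) ((T ^^ n) x))\<^sup>2 + (L (2 * n) x)\<^sup>2)"
      "0 \<le> w / (2 * rn) * ((L n ((T ^^ n) x))\<^sup>2 + (L n ((T ^^ (2 * n)) x))\<^sup>2)"
      "0 \<le> e" using w rn by (auto simp: e_def)
    show ?case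
    proof (cases "x \<in> Bd")
      case False
      have g: "good k ((T ^^ i) x)" if "(k, i) \<in> set S" for k i
        using False that elim(1) unfolding Bd_def E_def by auto
      have "- e \<le> F x"
        using four_block_pointwise[OF elim(1) n1 small] g[of n 0] g[of n n] g[of n "2 * n"] g[of n "3 * n"]
          g[of "2 * n" 0] g[of "2 * n" n] g[of "2 * n" "2 * n"] elim(2)[rule_format, of "4 * n" 0] n1
        by (simp add: S_def e_def F_def)
      then show ?thesis using nn False by (simp add: H_def)
    next
      case True
      have 4: "\<bar>t\<bar> \<le> w / (8 * rn) * t\<^sup>2 + 2 * rn / w" for t
        using abs_le_weighted_square[OF w, of "4 * rn" t] rn by simp
      have 2: "\<bar>t\<bar> \<le> w / (4 * rn) * t\<^sup>2 + rn / w" for t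
        using abs_le_weighted_square[OF w, of "2 * rn" t] rn by simp
      have 1: "\<bar>t\<bar> \<le> w / (2 * rn) * t\<^sup>2 + rn / (2 * w)" for t
        using abs_le_weighted_square[OF w, of "rn" t] rn by simp
      have "H x = e + (w / (8 * rn) * (L (4 * n) x)\<^sup>2 + 2 * rn / w)
         + (w / (4 * rn) * (L (2 * n) ((T ^^ (2 * n)) x))\<^sup>2 + rn / w) + (w / (4 * rn) * (L (2 * n) ((T ^^ n) x))\<^sup>2 + rn / w)
         + (w / (4 * rn) * (L (2 * n) x)\<^sup>2 + rn / w)
         + (w / (2 * rn) * (L n ((T ^^ n) x))\<^sup>2 + rn / (2 * w)) + (w / (2 * rn) * (L n ((T ^^ (2 * n)) x))\<^sup>2 + rn / (2 * w))"
        using True w by (simp add: H_def distrib_left field_simps)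
      then show ?thesis unfolding F_def
        using nn(4) 4[of "L (4 * n) x"] 2[of "L (2 * n) ((T ^^ (2 * n)) x)"] 2[of "L (2 * n) ((T ^^ n) x)"] 2[of "L (2 * n) x"]
          1[of "L n ((T ^^ n) x)"] 1[of "L n ((T ^^ (2 * n)) x)"] by linarith
    qed
  qed
  then have FH: "0 \<le> (\<integral>x. F x + H x \<partial>M)" by (rule integral_nonneg_AE)
  have k: "1 \<le> 4 * n" "1 \<le> 2 * n" using n1 by auto
  have iL [simp]: "integrable M (\<lambda>x. L k ((T ^^ i) x))" "integrable M (\<lambda>x. L k x)" if "1 \<le> k" for k i
    using integrable_T_pow[OF L_integrable[OF that]] L_integrable[OF that] by auto
  have iL2 [simp]: "integrable M (\<lambda>x. (L k ((T ^^ i) x))\<^sup>2)" "integrable M (\<lambda>x. (L k x)\<^sup>2)" if "1 \<le> k" for k i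
    using integrable_T_pow[OF L_sq_integrable[OF that]] L_sq_integrable[OF that] by auto
  define Q where "Q = (\<lambda>k. \<integral>x. (L k x)\<^sup>2 \<partial>M)"
  have vL: "(\<integral>x. L k ((T ^^ i) x) \<partial>M) = a k" "(\<integral>x. L k x \<partial>M) = a k" for k i
    using integral_T_pow[OF L_measurable, of k i] by (auto simp: a_def)
  have vL2: "(\<integral>x. (L k ((T ^^ i) x))\<^sup>2 \<partial>M) = Q k" "(\<integral>x. (L k x)\<^sup>2 \<partial>M) = Q k" for k i
    using integral_T_pow[of "\<lambda>x. (L k x)\<^sup>2" i] by (auto simp: Q_def)
  have iF: "integrable M F" unfolding F_def using n1 k by simp
  have hbL2: "has_bochner_integral M (\<lambda>x. (L k ((T ^^ i) x))\<^sup>2) (Q k)" "has_bochner_integral M (\<lambda>x. (L k x)\<^sup>2) (Q k)"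
    if "1 \<le> k" for k i using that by (simp_all only: has_bochner_integral_iff vL2 iL2 simp_thms)
  have hbe: "has_bochner_integral M (\<lambda>x. e) e" by (simp add: has_bochner_integral_iff prob_space)
  have hbi: "has_bochner_integral M (\<lambda>x. indicator Bd x) (prob Bd)" by (simp add: has_bochner_integral_iff emeasure_eq_measure)
  have "has_bochner_integral M H (e + w / (8 * rn) * Q (4 * n) + w / (4 * rn) * (Q (2 * n) + Q (2 * n) + Q (2 * n))
      + w / (2 * rn) * (Q n + Q n) + 6 * rn / w * prob Bd)"
    unfolding H_def by (intro has_bochner_integral_add has_bochner_integral_mult_right hbL2 hbe hbi k n1)
  then have iH: "integrable M H" and vH': "(\<integral>x. H x \<partial>M) = e + w / (8 * rn) * Q (4 * n) + w / (4 * rn) * (Q (2 * n) + Q (2 * n) + Q (2 * n))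
      + w / (2 * rn) * (Q n + Q n) + 6 * rn / w * prob Bd" by (simp_all only: has_bochner_integral_iff)
  have vF: "(\<integral>x. F x \<partial>M) = a (4 * n) - 3 * a (2 * n) + 2 * a n"
    unfolding F_def using n1 k by (simp add: vL)
  have vH: "(\<integral>x. H x \<partial>M) = e + w / (8 * rn) * Q (4 * n) + w / (4 * rn) * (3 * Q (2 * n)) + w / (2 * rn) * (2 * Q n) + 6 * rn / w * prob Bd"
    unfolding vH' by simp
  have Qb: "Q k \<le> (real k * c)\<^sup>2" if "1 \<le> k" for k using sq_bound[OF that] by (simp add: Q_def L_def)
  have q4: "w / (8 * rn) * Q (4 * n) \<le> 2 * rn * w * c\<^sup>2"
  proof -
    have "w / (8 * rn) * Q (4 * n) \<le> w / (8 * rn) * (real (4 * n) * c)\<^sup>2" using Qb[OF k(1)] w rn by (intro mult_left_mono) auto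
    also have "\<dots> = 2 * rn * w * c\<^sup>2" using rn by (simp add: rn_def power2_eq_square)
    finally show ?thesis .
  qed
  have q2: "w / (4 * rn) * (3 * Q (2 * n)) \<le> 3 * rn * w * c\<^sup>2"
  proof -
    have "w / (4 * rn) * (3 * Q (2 * n)) \<le> w / (4 * rn) * (3 * (real (2 * n) * c)\<^sup>2)" using Qb[OF k(2)] w rn by (intro mult_left_mono) auto
    also have "\<dots> = 3 * rn * w * c\<^sup>2" using rn by (simp add: rn_def power2_eq_square)
    finally show ?thesis .
  qed
  have q1: "w / (2 * rn) * (2 * Q n) \<le> rn * w * c\<^sup>2"
  proof -
    have "w / (2 * rn) * (2 * Q n) \<le> w / (2 * rn) * (2 * (real n * c)\<^sup>2)" using Qb[OF n1] w rn by (intro mult_left_mono) auto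
    also have "\<dots> = rn * w * c\<^sup>2" using rn by (simp add: rn_def power2_eq_square)
    finally show ?thesis .
  qed
  have qp: "6 * rn / w * prob Bd \<le> 6 * rn / w * p" using pBd w rn by (intro mult_left_mono) auto
  have s: "rn * w * c\<^sup>2 = rn * c * sqrt p" using c0 by (simp add: w_def power2_eq_square)
  have s': "rn / w * p = rn * c * sqrt p"
  proof -
    have gen: "rn / (r / c) * (r * r) = rn * c * r" if "0 < r" for r
      using that c0 by (simp add: field_simps)
    have "sqrt p * sqrt p = p" "0 < sqrt p" using p0 by auto
    then show ?thesis using gen[of "sqrt p"] unfolding w_def by (simp only:)
  qed
  have "0 \<le> a (4 * n) - 3 * a (2 * n) + 2 * a n + (e + 6 * (rn * w * c\<^sup>2) + 6 * (rn / w * p))"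
    using FH q4 q2 q1 qp unfolding Bochner_Integration.integral_add[OF iF iH] vF vH by (simp add: algebra_simps)
  then show ?thesis unfolding s s' by (simp add: block_err_def e_def rn_def p_def mult_ac)
qed

text \<open>The defect \<open>y\<^sub>j = 2 a\<^bsub>n\<^sub>j\<^esub> - a\<^bsub>n\<^sub>j\<^sub>+\<^sub>1\<^esub>\<close> of additivity along \<open>n\<^sub>j = 2\<^sup>j n\<^sub>0\<close> is nearly non-increasing by the four block
  inequality, hence bounded by \<open>13 \<gamma> n\<^sub>0\<close>; the mean exponent loses only \<open>y\<^sub>j / n\<^sub>j\<^sub>+\<^sub>1\<close> at each doubling, and these
  losses are bounded by a geometric series.\<close>

lemma dyadic_lower_bound:
  assumes n0: "n0 \<ge> N\<^sub>0" and small: "exp (- (12 * \<gamma>) * real n0) \<le> 1 / 12"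
    and err: "\<And>J. (\<Sum>j<J. block_err \<gamma> c \<iota> (2 ^ j * n0)) \<le> \<gamma> * real n0"
    and start: "\<bar>u n0 - l\<bar> \<le> 3 * \<gamma>" "\<bar>u (2 * n0) - l\<bar> \<le> 3 * \<gamma>"
  shows "l - 16 * \<gamma> \<le> u (2 ^ J * n0)"
proof -
  have n1: "1 \<le> n0" using n0 N0 by simp
  define y where "y = (\<lambda>j. 2 * a (2 ^ j * n0) - a (2 ^ Suc j * n0))"
  define e where "e = (\<lambda>j. block_err \<gamma> c \<iota> (2 ^ j * n0))"
  have y0: "y 0 \<le> 12 * \<gamma> * real n0"
  proof -
    have "a n0 = u n0 * real n0" "a (2 * n0) = u (2 * n0) * (2 * real n0)" using n1 by (simp_all add: u_def)
    then have "y 0 = (2 * u n0 - 2 * u (2 * n0)) * real n0" by (simp add: y_def left_diff_distrib)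
    also have "\<dots> \<le> (12 * \<gamma>) * real n0" using start by (intro mult_right_mono) auto
    finally show ?thesis .
  qed
  have u_step: "u (2 ^ Suc j * n0) = u (2 ^ j * n0) - y j / (2 ^ Suc j * real n0)" for j
    using n1 by (simp add: y_def u_def field_simps)
  have bound: "l - 3 * \<gamma> - 13 * \<gamma> * (1 - (1 / 2) ^ j) \<ge> l - 16 * \<gamma>" for j :: nat
  proof -
    have "13 * \<gamma> * (1 - (1 / 2) ^ j) \<le> 13 * \<gamma> * 1" using \<gamma>0 by (intro mult_left_mono) auto
    then show ?thesis by simp
  qed
  have "y J \<le> y 0 + (\<Sum>j<J. e j) \<and> l - 3 * \<gamma> - 13 * \<gamma> * (1 - (1 / 2) ^ J) \<le> u (2 ^ J * n0)"
  proof (induction J)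
    case 0 then show ?case using start by simp
  next
    case (Suc J)
    have yJ: "y J \<le> 13 * \<gamma> * real n0" using Suc y0 err[of J] by (simp add: e_def)
    have "y J / (2 ^ Suc J * real n0) \<le> 13 * \<gamma> * real n0 / (2 ^ Suc J * real n0)"
      using yJ by (intro divide_right_mono) auto
    also have "\<dots> = 13 * \<gamma> * (1 / 2) ^ Suc J" using n1 by (simp add: power_one_over field_simps)
    finally have z: "y J / (2 ^ Suc J * real n0) \<le> 13 * \<gamma> * (1 / 2) ^ Suc J" .
    define p where "p = 13 * \<gamma> * (1 / 2) ^ J"
    define q where "q = y J / (2 ^ Suc J * real n0)"
    have p: "13 * \<gamma> * (1 / 2) ^ Suc J = p / 2" "13 * \<gamma> * (1 - (1 / 2) ^ J) = 13 * \<gamma> - p"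
      "13 * \<gamma> * (1 - (1 / 2) ^ Suc J) = 13 * \<gamma> - p / 2" by (simp_all add: p_def right_diff_distrib)
    have "q \<le> p / 2" using z unfolding p q_def .
    moreover have "l - 3 * \<gamma> - (13 * \<gamma> - p) \<le> u (2 ^ J * n0)" using Suc unfolding p by simp
    ultimately have uS: "l - 3 * \<gamma> - 13 * \<gamma> * (1 - (1 / 2) ^ Suc J) \<le> u (2 ^ Suc J * n0)"
      unfolding u_step[of J] q_def[symmetric] p by simp
    have "n0 \<le> 2 ^ J * n0" by simp
    then have nJ: "N\<^sub>0 \<le> 2 ^ J * n0" using n0 by linarith
    have "exp (- (12 * \<gamma>) * real (2 ^ J * n0)) \<le> exp (- (12 * \<gamma>) * real n0)"
    proof -
      have "real n0 \<le> real (2 ^ J * n0)" by (simp only: of_nat_le_iff) simp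
      then show ?thesis using \<gamma>0 by simp
    qed
    then have sJ: "exp (- (12 * \<gamma>) * real (2 ^ J * n0)) \<le> 1 / 12" using small by linarith
    have "l - 16 * \<gamma> \<le> u (2 ^ J * n0)" using Suc bound[of J] by linarith
    moreover have "l - 16 * \<gamma> \<le> u (2 * (2 ^ J * n0))" using uS bound[of "Suc J"] by (simp add: mult.assoc)
    ultimately have "3 * a (2 * (2 ^ J * n0)) - 2 * a (2 ^ J * n0) - e J \<le> a (4 * (2 ^ J * n0))"
      unfolding e_def by (rule four_block[OF nJ sJ])
    then have "y (Suc J) \<le> y J + e J" by (simp add: y_def mult.assoc)
    then show ?case using Suc uS by simp
  qed
  then show ?thesis using bound[of J] by linarith
qed

text \<open>By subadditivity, a scale \<open>n\<close> with \<open>u n < s\<close> forces \<open>u N < s\<close> for every large \<open>N\<close>, in particular for a large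
  dyadic one.\<close>

lemma lower_bound_all_scales:
  assumes n0: "n0 \<ge> 1" and dy: "\<And>J. s \<le> u (2 ^ J * n0)" and n: "n \<ge> 1"
  shows "s \<le> u n"
proof (rule ccontr)
  assume "\<not> s \<le> u n"
  then have d: "0 < s - u n" by simp
  have uK: "u n \<le> K" using a_le[OF n] n by (simp add: u_def field_simps)
  obtain J where J: "real n * (K - u n) / (s - u n) + real n < 2 ^ J" using real_arch_pow[of 2] by auto
  define N where "N = 2 ^ J * n0"
  have NJ: "(2::real) ^ J \<le> real N" using n0 by (simp add: N_def)
  have ge0: "0 \<le> real n * (K - u n) / (s - u n)" using d uK by simp
  have Nn: "n \<le> N"
  proof -
    have "real n \<le> real N" using J NJ ge0 by linarith
    then show ?thesis by simp
  qed
  define q where "q = N div n"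
  define r where "r = N mod n"
  have N: "N = q * n + r" and r: "r < n" using n by (auto simp: q_def r_def)
  have q: "1 \<le> q" using Nn n unfolding q_def by (simp add: Suc_leI div_greater_zero_iff)
  have "a N \<le> real q * a n + K * real r"
  proof (cases "r = 0")
    case True then show ?thesis using a_mult_le[OF q n] N by simp
  next
    case False
    then have r1: "1 \<le> r" by simp
    have "a N \<le> a (q * n) + a r" unfolding N using q n r1 by (intro a_subadditive) auto
    then show ?thesis using a_mult_le[OF q n] a_le[OF r1] by linarith
  qed
  moreover have "s * real N \<le> a N"
  proof -
    have "0 < real N" using Nn n by simp
    then show ?thesis using dy[of J, folded N_def] by (simp add: u_def field_simps)
  qed
  moreover have "real q * a n = (real N - real r) * u n" using n by (simp add: N u_def)
  ultimately have "s * real N \<le> (real N - real r) * u n + K * real r" by simp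
  then have "real N * (s - u n) \<le> real r * (K - u n)" by (simp add: algebra_simps)
  also have "\<dots> \<le> real n * (K - u n)" using r uK by (intro mult_right_mono) auto
  finally have "real N \<le> real n * (K - u n) / (s - u n)" using d by (simp add: field_simps)
  moreover have "0 \<le> real n" by simp
  ultimately show False using J NJ n by linarith
qed

end

section \<open>Limits of most expanding directions\<close>

lemma measurable_mat_mult_entry:
  fixes P Q :: "'a \<Rightarrow> real mat"
  assumes P: "\<And>x. x \<in> space M \<Longrightarrow> P x \<in> carrier_mat m m" "\<And>i j. i < m \<Longrightarrow> j < m \<Longrightarrow> (\<lambda>x. P x $$ (i, j)) \<in> borel_measurable M"
    and Q: "\<And>x. x \<in> space M \<Longrightarrow> Q x \<in> carrier_mat m m" "\<And>i j. i < m \<Longrightarrow> j < m \<Longrightarrow> (\<lambda>x. Q x $$ (i, j)) \<in> borel_measurable M"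
    and ij: "i < m" "j < m"
  shows "(\<lambda>x. (P x * Q x) $$ (i, j)) \<in> borel_measurable M"
proof -
  have e: "(P x * Q x) $$ (i, j) = (\<Sum>k<m. P x $$ (i, k) * Q x $$ (k, j))" if "x \<in> space M" for x
    using P(1)[OF that] Q(1)[OF that] ij by (simp add: scalar_prod_def atLeast0LessThan)
  have "(\<lambda>x. \<Sum>k<m. P x $$ (i, k) * Q x $$ (k, j)) \<in> borel_measurable M"
    using P(2) Q(2) ij by (intro borel_measurable_sum borel_measurable_times) auto
  then show ?thesis using e by (subst measurable_cong) auto
qed

lemma measurable_gram_power:
  fixes g :: "'a \<Rightarrow> real mat"
  assumes g: "\<And>x. x \<in> space M \<Longrightarrow> g x \<in> carrier_mat m m" "\<And>i j. i < m \<Longrightarrow> j < m \<Longrightarrow> (\<lambda>x. g x $$ (i, j)) \<in> borel_measurable M"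
    and ij: "i < m" "j < m"
  shows "(\<lambda>x. gram_power (g x) k (i, j)) \<in> borel_measurable M"
proof -
  define G where "G = (\<lambda>x. transpose_mat (g x) * g x)"
  have Gc: "G x \<in> carrier_mat m m" if "x \<in> space M" for x using g(1)[OF that] by (simp add: G_def)
  have gt: "(\<lambda>x. transpose_mat (g x) $$ (i, j)) \<in> borel_measurable M" if "i < m" "j < m" for i j
  proof -
    have "transpose_mat (g x) $$ (i, j) = g x $$ (j, i)" if "x \<in> space M" for x using g(1)[OF that] \<open>i < m\<close> \<open>j < m\<close> by simp
    then show ?thesis using g(2)[OF that(2,1)] by (subst measurable_cong) auto
  qed
  have Gm: "(\<lambda>x. G x $$ (i, j)) \<in> borel_measurable M" if "i < m" "j < m" for i j
    unfolding G_def by (rule measurable_mat_mult_entry[OF _ gt g that]) (use g(1) in auto)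
  have pw: "G x ^\<^sub>m k \<in> carrier_mat m m" if "x \<in> space M" for x k by (rule pow_carrier_mat[OF Gc[OF that]])
  have "(\<lambda>x. (G x ^\<^sub>m k) $$ (i, j)) \<in> borel_measurable M" if "i < m" "j < m" for i j
    using that
  proof (induction k arbitrary: i j)
    case 0
    have "dim_row (G x) = m" if "x \<in> space M" for x using Gc[OF that] by simp
    then show ?case using 0
      by (subst measurable_cong[where g = "\<lambda>x. if i = j then 1 else 0"]) auto
  next
    case (Suc k)
    show ?case unfolding pow_mat.simps by (rule measurable_mat_mult_entry[OF pw Suc.IH Gc Gm Suc.prems])
  qed
  from this[OF ij] have "(\<lambda>x. (G x ^\<^sub>m k) $$ (i, j)) \<in> borel_measurable M" .
  moreover have "(\<lambda>x. mat_norm (g x)) \<in> borel_measurable M" by (rule borel_measurable_mat_norm[OF g])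
  ultimately show ?thesis unfolding gram_power_def G_def by (intro borel_measurable_divide borel_measurable_power)
qed

lemma measurable_tendsto_pred:
  fixes f :: "nat \<Rightarrow> 'a \<Rightarrow> real"
  assumes [measurable]: "\<And>i. f i \<in> borel_measurable M"
  shows "Measurable.pred M (\<lambda>x. (\<lambda>i. f i x) \<longlonglongrightarrow> c)"
proof -
  have "((\<lambda>i. f i x) \<longlonglongrightarrow> c) \<longleftrightarrow> Cauchy (\<lambda>i. f i x) \<and> lim (\<lambda>i. f i x) = c" for x
    by (metis Cauchy_convergent_iff LIMSEQ_imp_Cauchy convergent_LIMSEQ_iff limI)
  then show ?thesis by simp
qed

lemma hs_dist_sq_le_2:
  assumes "P \<in> proj_space m" "Q \<in> proj_space m" shows "(hs_dist m P Q)\<^sup>2 \<le> 2"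
proof -
  obtain p where p: "p \<in> carrier_vec m" "vec_len p = 1" "P = line_of p" using proj_space_unit[OF assms(1)] .
  obtain q where q: "q \<in> carrier_vec m" "vec_len q = 1" "Q = line_of q" using proj_space_unit[OF assms(2)] .
  show ?thesis using hs_dist_unit[OF p(1,2) q(1,2)] by (simp add: p(3) q(3))
qed

lemma expanding_limit_unique:
  assumes P: "expanding_limit T B x P" and Q: "expanding_limit T B x Q"
  shows "P = Q"
proof -
  let ?m = "dim_row (B x)"
  let ?L = "\<lambda>n. most_expanding (iterate T B n x)"
  have h: "(\<lambda>n. hs_dist ?m (?L n) R) \<longlonglongrightarrow> 0" if "expanding_limit T B x R" for R
  proof -
    have R: "R \<in> proj_space ?m" "\<forall>\<^sub>F n in sequentially. ?L n \<in> proj_space ?m" "(\<lambda>n. proj_dist (?L n) R) \<longlonglongrightarrow> 0"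
      using that by (auto simp: expanding_limit_def)
    have "(\<lambda>n. 3 * proj_dist (?L n) R) \<longlonglongrightarrow> 0" using tendsto_mult_right_zero[OF R(3), of 3] by simp
    then show ?thesis
    proof (rule tendsto_sandwich[OF _ _ tendsto_const, rotated 2])
      show "\<forall>\<^sub>F n in sequentially. hs_dist ?m (?L n) R \<le> 3 * proj_dist (?L n) R"
        using R(2) by eventually_elim (rule proj_dist_hs_dist(3)[OF _ R(1)])
    qed simp
  qed
  have "(\<lambda>n. hs_dist ?m (?L n) P + hs_dist ?m (?L n) Q) \<longlonglongrightarrow> 0 + 0" by (intro tendsto_add h P Q)
  moreover have "hs_dist ?m P Q \<le> hs_dist ?m (?L n) P + hs_dist ?m (?L n) Q" for n
    using hs_dist_triangle[of ?m P Q "?L n"] hs_dist_commute[of ?m P "?L n"] by simp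
  ultimately have "hs_dist ?m P Q \<le> 0" using LIMSEQ_le_const[of _ 0 "hs_dist ?m P Q"] by auto
  then have "hs_dist ?m P Q = 0" using hs_dist_nonneg[of ?m P Q] by linarith
  then show ?thesis using P Q by (intro hs_dist_0_imp_eq) (auto simp: expanding_limit_def)
qed

lemma expanding_dir_eq: "expanding_limit T B x P \<Longrightarrow> expanding_dir T B x = P"
  unfolding expanding_dir_def using expanding_limit_unique[of T B x] by (auto intro!: the_equality)

text \<open>Convergence of directions means convergence of the entries of their projections.\<close>

lemma expanding_limit_iff:
  assumes m: "dim_row (B x) = m"
  shows "(\<exists>P. expanding_limit T B x P) \<longleftrightarrow>
    (\<forall>\<^sub>F n in sequentially. most_expanding (iterate T B n x) \<in> proj_space m) \<and>
    (\<forall>i<m. \<forall>j<m. Cauchy (\<lambda>n. line_proj (most_expanding (iterate T B n x)) (i, j)))"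
    and "expanding_limit T B x P \<Longrightarrow> i < m \<Longrightarrow> j < m \<Longrightarrow>
      (\<lambda>n. line_proj (most_expanding (iterate T B n x)) (i, j)) \<longlonglongrightarrow> line_proj P (i, j)"
proof -
  let ?L = "\<lambda>n. most_expanding (iterate T B n x)"
  show lim: "(\<lambda>n. line_proj (?L n) (i, j)) \<longlonglongrightarrow> line_proj P (i, j)"
    if P: "expanding_limit T B x P" and ij: "i < m" "j < m" for P i j
  proof -
    have R: "P \<in> proj_space m" "\<forall>\<^sub>F n in sequentially. ?L n \<in> proj_space m" "(\<lambda>n. proj_dist (?L n) P) \<longlonglongrightarrow> 0"
      using P m by (auto simp: expanding_limit_def)
    have z: "(\<lambda>n. 3 * proj_dist (?L n) P) \<longlonglongrightarrow> 0" using tendsto_mult_right_zero[OF R(3), of 3] by simp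
    have "\<forall>\<^sub>F n in sequentially. norm (line_proj (?L n) (i, j) - line_proj P (i, j)) \<le> 3 * proj_dist (?L n) P"
      using R(2)
    proof eventually_elim
      case (elim n)
      show ?case using line_proj_diff_le_hs_dist[OF ij, of "?L n" P] proj_dist_hs_dist(3)[OF elim R(1)] by simp
    qed
    then have "(\<lambda>n. line_proj (?L n) (i, j) - line_proj P (i, j)) \<longlonglongrightarrow> 0" by (rule Lim_null_comparison[OF _ z])
    then show ?thesis by (rule LIM_zero_cancel)
  qed
  show "(\<exists>P. expanding_limit T B x P) \<longleftrightarrow>
    (\<forall>\<^sub>F n in sequentially. ?L n \<in> proj_space m) \<and> (\<forall>i<m. \<forall>j<m. Cauchy (\<lambda>n. line_proj (?L n) (i, j)))"
  proof
    assume "\<exists>P. expanding_limit T B x P"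
    then obtain P where P: "expanding_limit T B x P" by blast
    have "Cauchy (\<lambda>n. line_proj (?L n) (i, j))" if "i < m" "j < m" for i j
      by (rule LIMSEQ_imp_Cauchy[OF lim[OF P that]])
    then show "(\<forall>\<^sub>F n in sequentially. ?L n \<in> proj_space m) \<and> (\<forall>i<m. \<forall>j<m. Cauchy (\<lambda>n. line_proj (?L n) (i, j)))"
      using P m by (auto simp: expanding_limit_def)
  next
    assume *: "(\<forall>\<^sub>F n in sequentially. ?L n \<in> proj_space m) \<and> (\<forall>i<m. \<forall>j<m. Cauchy (\<lambda>n. line_proj (?L n) (i, j)))"
    define R where "R = (\<lambda>p. lim (\<lambda>n. line_proj (?L n) p))"
    have R: "(\<lambda>n. line_proj (?L n) (i, j)) \<longlonglongrightarrow> R (i, j)" if "i < m" "j < m" for i j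
      unfolding R_def using * that by (simp add: Cauchy_convergent_iff convergent_LIMSEQ_iff)
    obtain P where P: "P \<in> proj_space m" "\<forall>i<m. \<forall>j<m. line_proj P (i, j) = R (i, j)"
      using proj_space_closed[OF conjunct1[OF *] R] by blast
    have "(\<lambda>n. hs_dist m (?L n) P) \<longlonglongrightarrow> 0" using R P(2) by (intro hs_dist_tendsto_0) auto
    then have "(\<lambda>n. proj_dist (?L n) P) \<longlonglongrightarrow> 0"
    proof (rule tendsto_sandwich[OF _ _ tendsto_const, rotated 2])
      show "\<forall>\<^sub>F n in sequentially. proj_dist (?L n) P \<le> hs_dist m (?L n) P"
        using conjunct1[OF *] by eventually_elim (rule proj_dist_hs_dist(2)[OF _ P(1)])
      show "\<forall>\<^sub>F n in sequentially. 0 \<le> proj_dist (?L n) P"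
        using conjunct1[OF *] by eventually_elim (rule proj_dist_hs_dist(4)[OF _ P(1)])
    qed
    then show "\<exists>P. expanding_limit T B x P" using P(1) * m unfolding expanding_limit_def by blast
  qed
qed

context ergodic_system
begin

lemma expanding_dir_in_proj_space:
  assumes B: "measurable_cocycle m B" and m: "m \<ge> 2" and x: "x \<in> space M"
  shows "expanding_dir T B x \<in> proj_space m"
proof (cases "\<exists>P. expanding_limit T B x P")
  case True
  then obtain P where P: "expanding_limit T B x P" by blast
  then show ?thesis using expanding_dir_eq[OF P] cocycle_carrier[OF B x] by (simp add: expanding_limit_def)
next
  case False
  then show ?thesis using cocycle_carrier[OF B x] m unit_line_in_proj_space[of "unit_vec m 0" m]
    by (simp add: expanding_dir_def)
qed

text \<open>The projection is an iterated limit of Borel functions: the power iteration gives the finite scale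
  directions, and these converge.  The set where both limits exist is Borel, and the projection is constant off it.\<close>

lemma measurable_expanding_dir:
  assumes B: "measurable_cocycle m B" and m: "m \<ge> 2" and ij: "i < m" "j < m"
  shows "(\<lambda>x. line_proj (expanding_dir T B x) (i, j)) \<in> borel_measurable M"
proof -
  let ?L = "\<lambda>n x. most_expanding (iterate T B n x)"
  note c = iterate_carrier[OF B]
  have dm: "dim_row (B x) = m" if "x \<in> space M" for x using cocycle_carrier[OF B that] by simp
  have gp [measurable]: "(\<lambda>x. gram_power (iterate T B n x) k (i, j)) \<in> borel_measurable M" if "i < m" "j < m" for n k i j
    by (rule measurable_gram_power[OF c iterate_measurable[OF B] that])
  define line where "line = (\<lambda>n x. (\<lambda>k. \<Sum>a<m. gram_power (iterate T B n x) k (a, a)) \<longlonglongrightarrow> 1)"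
  have line_m [measurable]: "Measurable.pred M (line n)" for n
    unfolding line_def by (intro measurable_tendsto_pred borel_measurable_sum) (auto intro: gp)
  have line_iff: "?L n x \<in> proj_space m \<longleftrightarrow> line n x" if "x \<in> space M" for n x
    unfolding line_def using most_expanding_in_proj_space_iff[OF c[OF that] m] gap_iff_gram_trace[OF c[OF that] m] by simp
  define q where "q = (\<lambda>n p x. if line n x then lim (\<lambda>k. gram_power (iterate T B n x) k p) else 0)"
  have q_m [measurable]: "(\<lambda>x. q n (i, j) x) \<in> borel_measurable M" if "i < m" "j < m" for n i j
    unfolding q_def using that by measurable
  have q_eq: "q n (i, j) x = line_proj (?L n x) (i, j)" if x: "x \<in> space M" and l: "line n x" and ij: "i < m" "j < m" for n x i j
  proof -
    obtain V where V: "right_singular_basis m (iterate T B n x) V" using right_singular_basis_exists(1)[OF c[OF x]] by blast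
    have "sing_val (iterate T B n x) 2 < cnorm B n x"
      using l line_iff[OF x] most_expanding_in_proj_space_iff[OF c[OF x] m] by simp
    from gram_power_tendsto[OF c[OF x] m V this ij] show ?thesis using l by (simp add: q_def limI)
  qed
  define conv where "conv = (\<lambda>x. (\<exists>N. \<forall>n\<ge>N. line n x) \<and> (\<forall>i\<in>{..<m}. \<forall>j\<in>{..<m}. Cauchy (\<lambda>n. q n (i, j) x)))"
  have cq: "Measurable.pred M (\<lambda>x. Cauchy (\<lambda>n. q n (i, j) x))" if "i \<in> {..<m}" "j \<in> {..<m}" for i j
    unfolding pred_def using that by (intro sets_Collect_Cauchy q_m) auto
  have conv_m [measurable]: "Measurable.pred M conv"
    unfolding conv_def by (intro pred_intros_logic pred_intros_countable pred_intros_finite cq line_m finite_lessThan) auto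
  have same: "\<forall>\<^sub>F n in sequentially. q n (i, j) x = line_proj (?L n x) (i, j)"
    if x: "x \<in> space M" and l: "\<exists>N. \<forall>n\<ge>N. line n x" and ij: "i < m" "j < m" for x i j
    using l q_eq[OF x _ ij] unfolding eventually_sequentially by blast
  have conv_iff: "(\<exists>P. expanding_limit T B x P) \<longleftrightarrow> conv x" if x: "x \<in> space M" for x
  proof -
    have ev: "(\<forall>\<^sub>F n in sequentially. ?L n x \<in> proj_space m) \<longleftrightarrow> (\<exists>N. \<forall>n\<ge>N. line n x)"
      using line_iff[OF x] by (simp add: eventually_sequentially)
    have "Cauchy (\<lambda>n. q n (i, j) x) \<longleftrightarrow> Cauchy (\<lambda>n. line_proj (?L n x) (i, j))" if "\<exists>N. \<forall>n\<ge>N. line n x" "i < m" "j < m" for i j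
    proof -
      have "((\<lambda>n. q n (i, j) x) \<longlonglongrightarrow> r) \<longleftrightarrow> ((\<lambda>n. line_proj (?L n x) (i, j)) \<longlonglongrightarrow> r)" for r
        by (rule tendsto_cong[OF same[OF x that]])
      then show ?thesis by (simp add: Cauchy_convergent_iff convergent_def)
    qed
    then show ?thesis unfolding expanding_limit_iff(1)[where B = B and x = x and m = m and T = T, OF dm[OF x]] ev conv_def by auto
  qed
  define r where "r = line_proj (line_of (unit_vec m 0)) (i, j)"
  have "(\<lambda>x. if conv x then lim (\<lambda>n. q n (i, j) x) else r) \<in> borel_measurable M"
    using q_m[OF ij] by measurable
  moreover have "line_proj (expanding_dir T B x) (i, j) = (if conv x then lim (\<lambda>n. q n (i, j) x) else r)" if x: "x \<in> space M" for x
  proof (cases "conv x")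
    case True
    then obtain P where P: "expanding_limit T B x P" using conv_iff[OF x] by blast
    have l: "\<exists>N. \<forall>n\<ge>N. line n x" using True by (simp add: conv_def)
    have "(\<lambda>n. q n (i, j) x) \<longlonglongrightarrow> line_proj P (i, j)"
      using expanding_limit_iff(2)[where B = B and x = x and m = m and T = T, OF dm[OF x] P ij] tendsto_cong[OF same[OF x l ij]] by simp
    then show ?thesis using True expanding_dir_eq[OF P] by (simp add: limI)
  next
    case False
    then show ?thesis using conv_iff[OF x] dm[OF x] by (simp add: expanding_dir_def r_def)
  qed
  ultimately show ?thesis by (subst measurable_cong) auto
qed

lemma measurable_dir_dist:
  assumes A: "measurable_cocycle m A" and B: "measurable_cocycle m B" and m: "m \<ge> 2"
  shows "(\<lambda>x. proj_dist (expanding_dir T A x) (expanding_dir T B x)) \<in> borel_measurable M"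
proof -
  have [measurable]: "(\<lambda>x. hs_dist m (expanding_dir T A x) (expanding_dir T B x)) \<in> borel_measurable M"
    unfolding hs_dist_def L2_set_def
    by (intro measurable_compose[OF _ borel_measurable_sqrt] borel_measurable_sum borel_measurable_power borel_measurable_diff)
      (auto intro!: measurable_expanding_dir[OF A m] measurable_expanding_dir[OF B m])
  define f where "f = (\<lambda>h :: real. arccos (max (- 1) (min 1 (sqrt (1 - h\<^sup>2 / 2)))))"
  have "continuous_on UNIV f" unfolding f_def by (intro continuous_intros) auto
  then have [measurable]: "f \<in> borel_measurable borel" by (rule borel_measurable_continuous_onI)
  have "(\<lambda>x. 2 / pi * f (hs_dist m (expanding_dir T A x) (expanding_dir T B x))) \<in> borel_measurable M"
    by measurable
  moreover have "proj_dist (expanding_dir T A x) (expanding_dir T B x) = 2 / pi * f (hs_dist m (expanding_dir T A x) (expanding_dir T B x))"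
    if x: "x \<in> space M" for x
  proof -
    let ?h = "hs_dist m (expanding_dir T A x) (expanding_dir T B x)"
    note P = expanding_dir_in_proj_space[OF A m x] and Q = expanding_dir_in_proj_space[OF B m x]
    have "?h\<^sup>2 \<le> 2" by (rule hs_dist_sq_le_2[OF P Q])
    then have "0 \<le> sqrt (1 - ?h\<^sup>2 / 2)" "sqrt (1 - ?h\<^sup>2 / 2) \<le> 1" by auto
    then have "max (- 1) (min 1 (sqrt (1 - ?h\<^sup>2 / 2))) = sqrt (1 - ?h\<^sup>2 / 2)" by linarith
    then show ?thesis unfolding f_def using proj_dist_hs_dist(1)[OF P Q] by simp
  qed
  ultimately show ?thesis by (subst measurable_cong) auto
qed

end

section \<open>Convergence of directions along good orbits\<close>

text \<open>Once the lower bound on the mean exponents is available on all scales, almost every orbit is good at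
  all large scales.\<close>

locale pinned_cocycle = ldt_cocycle +
  assumes lower: "\<And>n. n \<ge> 1 \<Longrightarrow> l - 16 * \<gamma> \<le> u n"
    and \<iota>_summable: "summable (\<lambda>n. \<iota> (real n))"
begin

lemma prob_not_good: "n \<ge> N\<^sub>0 \<Longrightarrow> prob {x \<in> space M. \<not> good n x} \<le> 3 * \<iota> (real n)"
  using prob_bad lower N0 by simp

lemma AE_eventually_good: "AE x in M. \<forall>\<^sub>F n in sequentially. good n x"
proof -
  have "summable (\<lambda>n. measure M {x \<in> space M. \<not> good n x})"
    by (rule summable_comparison_test'[OF summable_mult[OF \<iota>_summable, of 3], of N\<^sub>0]) (use prob_not_good in auto)
  then have "AE x in M. \<forall>\<^sub>F n in sequentially. x \<in> space M - {x \<in> space M. \<not> good n x}"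
    by (intro borel_cantelli_AE1) (auto simp: emeasure_eq_measure less_top[symmetric])
  then show ?thesis by eventually_elim (auto elim: eventually_mono)
qed

definition tail_bad :: "nat \<Rightarrow> 'a set" where
  "tail_bad n = {x \<in> space M. \<exists>j\<ge>n. \<not> good j x}"

lemma tail_bad_measurable [measurable]: "tail_bad n \<in> sets M"
  unfolding tail_bad_def by measurable

lemma prob_tail_bad:
  assumes n: "n \<ge> N\<^sub>0"
  shows "prob (tail_bad n) \<le> 3 * (\<Sum>k. \<iota> (real (k + n)))"
proof -
  have s: "summable (\<lambda>k. 3 * \<iota> (real (k + n)))" using summable_ignore_initial_segment[OF \<iota>_summable, of n] by (intro summable_mult) simp
  have le: "measure M {x \<in> space M. \<not> good (k + n) x} \<le> 3 * \<iota> (real (k + n))" for k using prob_not_good[of "k + n"] n by simp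
  have s': "summable (\<lambda>k. measure M {x \<in> space M. \<not> good (k + n) x})"
    by (rule summable_comparison_test'[OF s, of 0]) (use le in auto)
  have "tail_bad n = (\<Union>k. {x \<in> space M. \<not> good (k + n) x})"
  proof (intro Set.set_eqI iffI)
    fix x assume "x \<in> tail_bad n"
    then obtain j where "j \<ge> n" "x \<in> space M" "\<not> good j x" by (auto simp: tail_bad_def)
    then have "x \<in> {x \<in> space M. \<not> good ((j - n) + n) x}" by simp
    then show "x \<in> (\<Union>k. {x \<in> space M. \<not> good (k + n) x})" by blast
  qed (auto simp: tail_bad_def intro: exI[of _ "_ + n"])
  then have "prob (tail_bad n) \<le> (\<Sum>k. measure M {x \<in> space M. \<not> good (k + n) x})"
    using s' by (simp only:) (rule finite_measure_subadditive_countably, auto)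
  also have "\<dots> \<le> (\<Sum>k. 3 * \<iota> (real (k + n)))" by (rule suminf_le[OF le s' s])
  also have "\<dots> = 3 * (\<Sum>k. \<iota> (real (k + n)))" using summable_ignore_initial_segment[OF \<iota>_summable, of n] by (intro suminf_mult) simp
  finally show ?thesis .
qed

text \<open>The factor \<open>1 / (1 - e\<^bsup>- 66 \<gamma>\<^esup>)\<close> sums the geometric series of the single steps.\<close>

definition rate_const :: real where
  "rate_const = 2 * exp (K - l + 17 * \<gamma>) / (1 - exp (- 66 * \<gamma>))"

lemma rate_const_pos: "0 < rate_const"
  unfolding rate_const_def using \<gamma>0 by simp

text \<open>One more step moves the direction by at most \<open>2 \<parallel>B\<parallel> s\<^sub>2(B\<^bsup>(j)\<^esup>) / \<parallel>B\<^bsup>(j+1)\<^esup>\<parallel>\<close>.  The bound is written as a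
  difference so that it telescopes.\<close>

lemma direction_step:
  assumes x: "x \<in> space M" and b: "mat_norm (B ((T ^^ j) x)) \<le> exp K" and j: "j \<ge> 1" and g: "good j x" "good (Suc j) x"
  shows "hs_dist m (most_expanding (iterate T B j x)) (most_expanding (iterate T B (Suc j) x))
    \<le> rate_const * (exp (- (66 * \<gamma>) * real j) - exp (- (66 * \<gamma>) * real (Suc j)))"
proof -
  note c = iterate_carrier[OF B x, of j] and h = cocycle_carrier[OF B T_pow_space[OF x, of j]]
  let ?d = "hs_dist m (most_expanding (iterate T B j x)) (most_expanding (iterate T B (Suc j) x))"
  have "?d * cnorm B (Suc j) x \<le> 2 * (mat_norm (B ((T ^^ j) x)) * sing_val (iterate T B j x) 2)"
    using hs_dist_most_expanding_mult[OF c h m2 good_gap(2)[OF x j g(1)]] good_gap(2)[OF x _ g(2)] by simp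
  also have "\<dots> \<le> 2 * (exp K * exp ((l - 83 * \<gamma>) * real j))"
    using b good_gap(1)[OF x j g(1)] right_singular_basis_exists(3)[OF c, of 1] m2
    by (intro mult_left_mono mult_mono) (auto simp: numeral_2_eq_2)
  finally have 1: "?d * cnorm B (Suc j) x \<le> 2 * (exp K * exp ((l - 83 * \<gamma>) * real j))" .
  have "?d * exp ((l - 17 * \<gamma>) * real (Suc j)) \<le> ?d * cnorm B (Suc j) x"
    using g(2) by (intro mult_left_mono) (auto simp: good_def)
  also note 1
  also have "2 * (exp K * exp ((l - 83 * \<gamma>) * real j)) = (2 * exp (K - l + 17 * \<gamma>) * exp (- (66 * \<gamma>) * real j)) * exp ((l - 17 * \<gamma>) * real (Suc j))"
    by (simp add: exp_add[symmetric] algebra_simps)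
  finally have "?d \<le> 2 * exp (K - l + 17 * \<gamma>) * exp (- (66 * \<gamma>) * real j)" by simp
  also have "\<dots> = rate_const * ((1 - exp (- 66 * \<gamma>)) * exp (- (66 * \<gamma>) * real j))"
    unfolding rate_const_def using \<gamma>0 by simp
  also have "(1 - exp (- 66 * \<gamma>)) * exp (- (66 * \<gamma>) * real j) = exp (- (66 * \<gamma>) * real j) - exp (- (66 * \<gamma>) * real (Suc j))"
    by (simp add: left_diff_distrib exp_add[symmetric] algebra_simps)
  finally show ?thesis .
qed

lemma direction_convergence:
  assumes x: "x \<in> space M" and b: "\<And>j. mat_norm (B ((T ^^ j) x)) \<le> exp K" and n: "n \<ge> 1"
    and g: "\<And>j. j \<ge> n \<Longrightarrow> good j x"
  shows "\<exists>P. expanding_limit T B x P"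
    and "hs_dist m (most_expanding (iterate T B n x)) (expanding_dir T B x) \<le> rate_const * exp (- (66 * \<gamma>) * real n)"
proof -
  let ?L = "\<lambda>n. most_expanding (iterate T B n x)"
  let ?q = "\<lambda>n. exp (- (66 * \<gamma>) * real n)"
  have dm: "dim_row (B x) = m" using cocycle_carrier[OF B x] by simp
  have line: "?L j \<in> proj_space m" if "j \<ge> n" for j
    using most_expanding_in_proj_space_iff[OF iterate_carrier[OF B x] m2] good_gap(2)[OF x _ g[OF that]] that n by simp
  have tele: "hs_dist m (?L i) (?L (i + k)) \<le> rate_const * (?q i - ?q (i + k))" if "i \<ge> n" for i k
  proof (induction k)
    case 0 then show ?case by (simp add: hs_dist_def L2_set_def)
  next
    case (Suc k)
    have "hs_dist m (?L i) (?L (i + Suc k)) \<le> hs_dist m (?L i) (?L (i + k)) + hs_dist m (?L (i + k)) (?L (Suc (i + k)))"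
      using hs_dist_triangle[of m "?L i" "?L (Suc (i + k))" "?L (i + k)"] by simp
    also have "hs_dist m (?L (i + k)) (?L (Suc (i + k))) \<le> rate_const * (?q (i + k) - ?q (Suc (i + k)))"
      using that n by (intro direction_step[OF x b] g) auto
    finally show ?case using Suc by (simp add: algebra_simps)
  qed
  have near: "hs_dist m (?L i) (?L k) \<le> rate_const * ?q i" if "i \<ge> n" "i \<le> k" for i k
  proof -
    have "hs_dist m (?L i) (?L k) \<le> rate_const * (?q i - ?q k)" using tele[OF that(1), of "k - i"] that by simp
    also have "\<dots> \<le> rate_const * ?q i" using rate_const_pos by (intro mult_left_mono) auto
    finally show ?thesis .
  qed
  have q0: "(\<lambda>n. rate_const * ?q n) \<longlonglongrightarrow> 0"
  proof -
    have "(\<lambda>n. exp (- (66 * \<gamma>)) ^ n) \<longlonglongrightarrow> 0" using \<gamma>0 by (intro LIMSEQ_realpow_zero) auto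
    then have "(\<lambda>n. ?q n) \<longlonglongrightarrow> 0" by (simp add: exp_of_nat_mult[symmetric] mult.commute)
    from tendsto_mult_right_zero[OF this, of rate_const] show ?thesis .
  qed
  have cauchy: "Cauchy (\<lambda>n. line_proj (?L n) (i, j))" if ij: "i < m" "j < m" for i j
  proof (rule CauchyI)
    fix e :: real assume e: "0 < e"
    have "\<forall>\<^sub>F k in sequentially. rate_const * ?q k < e" using q0 e by (rule order_tendstoD)
    then obtain k0 where k0: "\<And>k. k \<ge> k0 \<Longrightarrow> rate_const * ?q k < e" unfolding eventually_sequentially by blast
    define N where "N = max n k0"
    have lt: "norm (line_proj (?L p) (i, j) - line_proj (?L q) (i, j)) < e" if "N \<le> p" "p \<le> q" for p q
    proof -
      have "norm (line_proj (?L p) (i, j) - line_proj (?L q) (i, j)) \<le> hs_dist m (?L p) (?L q)"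
        using line_proj_diff_le_hs_dist[OF ij] by simp
      also have "\<dots> \<le> rate_const * ?q p" using that by (intro near) (auto simp: N_def)
      also have "\<dots> < e" using that by (intro k0) (auto simp: N_def)
      finally show ?thesis .
    qed
    show "\<exists>M. \<forall>p\<ge>M. \<forall>q\<ge>M. norm (line_proj (?L p) (i, j) - line_proj (?L q) (i, j)) < e"
    proof (intro exI[of _ N] allI impI)
      fix p q assume "N \<le> p" "N \<le> q"
      then show "norm (line_proj (?L p) (i, j) - line_proj (?L q) (i, j)) < e"
        using lt[of p q] lt[of q p] by (cases "p \<le> q") (auto simp: norm_minus_commute)
    qed
  qed
  show ex: "\<exists>P. expanding_limit T B x P"
    unfolding expanding_limit_iff(1)[where B = B and x = x and m = m and T = T, OF dm]
    using line cauchy unfolding eventually_sequentially by blast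
  then obtain P where P: "expanding_limit T B x P" by blast
  have h0: "(\<lambda>k. hs_dist m (?L k) P) \<longlonglongrightarrow> 0"
    by (rule hs_dist_tendsto_0) (rule expanding_limit_iff(2)[where B = B and x = x and m = m and T = T, OF dm P])
  have "hs_dist m (?L n) P \<le> rate_const * ?q n"
  proof (rule LIMSEQ_le_const)
    show "(\<lambda>k. rate_const * ?q n + hs_dist m (?L k) P) \<longlonglongrightarrow> rate_const * ?q n"
      using tendsto_add[OF tendsto_const h0] by simp
    show "\<exists>N. \<forall>k\<ge>N. hs_dist m (?L n) P \<le> rate_const * ?q n + hs_dist m (?L k) P"
    proof (intro exI[of _ n] allI impI)
      fix k assume "n \<le> k"
      then show "hs_dist m (?L n) P \<le> rate_const * ?q n + hs_dist m (?L k) P"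
        using hs_dist_triangle[of m "?L n" P "?L k"] near[of n k] by simp
    qed
  qed
  then show "hs_dist m (?L n) (expanding_dir T B x) \<le> rate_const * ?q n" using expanding_dir_eq[OF P] by simp
qed

lemma AE_bounded: "AE x in M. \<forall>j. mat_norm (B ((T ^^ j) x)) \<le> exp K"
  by (rule AE_T_pow_all[OF BK])

lemma AE_expanding_limit: "AE x in M. \<exists>P. expanding_limit T B x P"
proof -
  have "AE x in M. x \<in> space M" by auto
  then show ?thesis using AE_bounded AE_eventually_good
  proof eventually_elim
    case (elim x)
    then obtain N where "\<And>j. j \<ge> N \<Longrightarrow> good j x" unfolding eventually_sequentially by blast
    then show ?case using elim by (intro direction_convergence(1)[of x "max N 1"]) auto
  qed
qed

lemma exponent_ge: "exponent B r \<Longrightarrow> ereal (l - 17 * \<gamma>) \<le> r"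
proof -
  assume "exponent B r"
  then have "AE x in M. ereal (l - 17 * \<gamma>) \<le> r"
    using AE_eventually_good unfolding exponent_def
  proof eventually_elim
    case (elim x)
    have "\<forall>\<^sub>F n in sequentially. ereal (l - 17 * \<gamma>) \<le> ereal (1 / real n) * elog (cnorm B n x)"
      using elim(2) eventually_ge_at_top[of 1]
      by eventually_elim (simp add: good_def scaled_elog_ge_iff mult.commute del: times_ereal.simps)
    then show ?case by (rule tendsto_lowerbound[OF elim(1)]) simp
  qed
  then show ?thesis by simp
qed

lemma exponent_ext_le: "exponent BB r \<Longrightarrow> r \<le> ereal (2 * l - 100 * \<gamma>)"
proof -
  assume "exponent BB r"
  then have "AE x in M. r \<le> ereal (2 * l - 100 * \<gamma>)"
    using AE_eventually_good unfolding exponent_def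
  proof eventually_elim
    case (elim x)
    have "\<forall>\<^sub>F n in sequentially. ereal (1 / real n) * elog (cnorm BB n x) \<le> ereal (2 * l - 100 * \<gamma>)"
      using elim(2) eventually_ge_at_top[of 1]
      by eventually_elim (simp add: good_def scaled_elog_le_iff mult.commute del: times_ereal.simps)
    then show ?case by (rule tendsto_upperbound[OF elim(1)]) simp
  qed
  then show ?thesis by simp
qed

end

section \<open>Comparison of two cocycles\<close>

text \<open>The two limits are joined through the directions at scale \<open>n\<close>, each \<open>e\<^bsup>- 66 \<gamma> n\<^esup>\<close>-close to its limit.  Those two
  directions belong to matrices of norm at least \<open>e\<^bsup>(l - 17 \<gamma>) n\<^esup>\<close> whose difference is at most \<open>n e\<^bsup>K n\<^esup> h \<le> e\<^bsup>(K + 1) n\<^esup> h\<close>.\<close>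

lemma (in ergodic_system) compare_directions:
  assumes P1: "pinned_cocycle M T B1 m K c l \<gamma> \<iota> N" and P2: "pinned_cocycle M T B2 m K c l \<gamma> \<iota> N"
    and h: "0 \<le> h" "AE x in M. mat_norm (B2 x - B1 x) \<le> h" and n: "n \<ge> N"
    and W: "K + 1 - l + 17 * \<gamma> \<le> W"
  shows "\<exists>E\<in>sets M. prob E \<le> 6 * (\<Sum>k. \<iota> (real (k + n))) \<and>
    (AE x in M. x \<notin> E \<longrightarrow> proj_dist (expanding_dir T B1 x) (expanding_dir T B2 x) \<le>
       (4 * exp (K - l + 17 * \<gamma>) / (1 - exp (- 66 * \<gamma>)) + 2) * exp (- (66 * \<gamma>) * real n) + 2 * (exp (W * real n) * h))"
proof -
  interpret P1: pinned_cocycle M T B1 m K c l \<gamma> \<iota> N by (rule P1)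
  interpret P2: pinned_cocycle M T B2 m K c l \<gamma> \<iota> N by (rule P2)
  have n1: "n \<ge> 1" using n P1.N0 by simp
  have m1: "m \<ge> 1" using P1.m2 by simp
  define E where "E = P1.tail_bad n \<union> P2.tail_bad n"
  have Em: "E \<in> sets M" unfolding E_def by (intro sets.Un P1.tail_bad_measurable P2.tail_bad_measurable)
  have "prob E \<le> prob (P1.tail_bad n) + prob (P2.tail_bad n)"
    unfolding E_def by (intro measure_Un_le P1.tail_bad_measurable P2.tail_bad_measurable)
  then have pE: "prob E \<le> 6 * (\<Sum>k. \<iota> (real (k + n)))" using P1.prob_tail_bad[OF n] P2.prob_tail_bad[OF n] by linarith
  define R where "R = 2 * exp (K - l + 17 * \<gamma>) / (1 - exp (- 66 * \<gamma>))"
  have R: "P1.rate_const = R" "P2.rate_const = R" by (simp_all add: R_def P1.rate_const_def P2.rate_const_def)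
  have "AE x in M. x \<in> space M" by auto
  then have "AE x in M. x \<notin> E \<longrightarrow> proj_dist (expanding_dir T B1 x) (expanding_dir T B2 x) \<le>
       (2 * R + 2) * exp (- (66 * \<gamma>) * real n) + 2 * (exp (W * real n) * h)"
    using P1.AE_bounded P2.AE_bounded iterate_diff_bound[OF P1.B P2.B m1 P1.K0 P1.BK P2.BK h]
  proof eventually_elim
    case (elim x)
    show ?case
    proof
      assume "x \<notin> E"
      then have g1: "P1.good j x" and g2: "P2.good j x" if "j \<ge> n" for j
        using elim(1) that by (auto simp: E_def P1.tail_bad_def P2.tail_bad_def)
      let ?L1 = "most_expanding (iterate T B1 n x)" and ?L2 = "most_expanding (iterate T B2 n x)"
      let ?D1 = "expanding_dir T B1 x" and ?D2 = "expanding_dir T B2 x"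
      note c1 = iterate_carrier[OF P1.B elim(1), of n] and c2 = iterate_carrier[OF P2.B elim(1), of n]
      have d1: "hs_dist m ?L1 ?D1 \<le> R * exp (- (66 * \<gamma>) * real n)"
        using P1.direction_convergence(2)[OF elim(1) _ n1 g1] elim(2) R by simp
      have d2: "hs_dist m ?L2 ?D2 \<le> R * exp (- (66 * \<gamma>) * real n)"
        using P2.direction_convergence(2)[OF elim(1) _ n1 g2] elim(3) R by simp
      have diff: "mat_norm (iterate T B2 n x - iterate T B1 n x) \<le> exp ((K + 1) * real n) * h"
      proof -
        have en: "real n \<le> exp (real n)" using exp_ge_add_one_self[of "real n"] by linarith
        have "mat_norm (iterate T B2 n x - iterate T B1 n x) \<le> real n * exp (K * real n) * h"
          using elim(4)[rule_format, of n 0] by simp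
        also have "\<dots> \<le> exp (real n) * exp (K * real n) * h"
          using h(1) en by (intro mult_right_mono) auto
        also have "exp (real n) * exp (K * real n) = exp ((K + 1) * real n)" by (simp add: exp_add[symmetric] algebra_simps)
        finally show ?thesis .
      qed
      have "hs_dist m ?L1 ?L2 * exp ((l - 17 * \<gamma>) * real n) \<le> hs_dist m ?L1 ?L2 * mat_norm (iterate T B2 n x)"
        using g2[of n] by (intro mult_left_mono) (auto simp: P2.good_def)
      also have "\<dots> \<le> 2 * (sing_val (iterate T B1 n x) 2 + mat_norm (iterate T B2 n x - iterate T B1 n x))"
        by (rule hs_dist_most_expanding_perturb[OF c1 c2 P1.m2 P1.good_gap(2)[OF elim(1) n1 g1] P2.good_gap(2)[OF elim(1) n1 g2]]) auto
      also have "\<dots> \<le> 2 * (exp ((l - 83 * \<gamma>) * real n) + exp ((K + 1) * real n) * h)"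
        using P1.good_gap(1)[OF elim(1) n1 g1[of n]] diff by simp
      also have "\<dots> = (2 * exp (- (66 * \<gamma>) * real n) + 2 * (exp ((K + 1 - l + 17 * \<gamma>) * real n) * h)) * exp ((l - 17 * \<gamma>) * real n)"
        by (simp add: exp_add[symmetric] algebra_simps)
      finally have "hs_dist m ?L1 ?L2 \<le> 2 * exp (- (66 * \<gamma>) * real n) + 2 * (exp ((K + 1 - l + 17 * \<gamma>) * real n) * h)"
        by simp
      also have "\<dots> \<le> 2 * exp (- (66 * \<gamma>) * real n) + 2 * (exp (W * real n) * h)"
      proof -
        have "(K + 1 - l + 17 * \<gamma>) * real n \<le> W * real n" using W by (intro mult_right_mono) auto
        then have "exp ((K + 1 - l + 17 * \<gamma>) * real n) * h \<le> exp (W * real n) * h" using h(1) by (intro mult_right_mono) auto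
        then show ?thesis by simp
      qed
      finally have d12: "hs_dist m ?L1 ?L2 \<le> 2 * exp (- (66 * \<gamma>) * real n) + 2 * (exp (W * real n) * h)" .
      have "proj_dist ?D1 ?D2 \<le> hs_dist m ?D1 ?D2"
        by (rule proj_dist_hs_dist(2)[OF expanding_dir_in_proj_space[OF P1.B P1.m2 elim(1)] expanding_dir_in_proj_space[OF P2.B P1.m2 elim(1)]])
      also have "\<dots> \<le> hs_dist m ?L1 ?D1 + (hs_dist m ?L1 ?L2 + hs_dist m ?L2 ?D2)"
        using hs_dist_triangle[of m ?D1 ?D2 ?L1] hs_dist_triangle[of m ?L1 ?D2 ?L2] hs_dist_commute[of m ?D1 ?L1] by simp
      finally show "proj_dist ?D1 ?D2 \<le> (2 * R + 2) * exp (- (66 * \<gamma>) * real n) + 2 * (exp (W * real n) * h)"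
        using d1 d2 d12 by (simp add: algebra_simps)
    qed
  qed
  then show ?thesis using Em pE by (intro bexI[of _ E]) (auto simp: R_def)
qed

text \<open>Here the modulus appears: the scale \<open>n\<close> is proportional to \<open>log (1/h)\<close>, so that both \<open>e\<^bsup>W n\<^esup> h\<close> and \<open>e\<^bsup>- 66 \<gamma> n\<^esup>\<close> are
  powers of \<open>h\<close>, and \<open>\<Sum>\<^bsub>j\<ge>n\<^esub> \<iota>\<^sub>j \<le> \<iota>\<^sub>n\<^bsup>1/2\<^esup> \<Sum>\<^bsub>j\<ge>n\<^esub> \<iota>\<^sub>j\<^bsup>1/2\<^esup>\<close>, whose second factor tends to \<open>0\<close> since \<open>\<iota>\<^sub>j\<close> is at most of order \<open>j\<^bsup>-10\<^esup>\<close>.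
  The exponential lower bound for \<open>\<iota>\<close> makes the modulus dominate \<open>h\<^bsup>\<alpha>\<^esup>\<close> once \<open>c\<close> is small.\<close>

lemma choose_scale:
  assumes \<P>: "\<forall>p\<in>\<P>. is_ldt_param p" and \<iota>: "\<iota> \<in> deviation_functions \<P>" and \<gamma>: "0 < \<gamma>" and W: "0 < W" and R: "0 \<le> (R::real)"
  shows "\<exists>c>0. \<exists>\<alpha>>0. \<exists>h\<^sub>0>0. h\<^sub>0 < 1 \<and> (\<forall>h. 0 < h \<longrightarrow> h < h\<^sub>0 \<longrightarrow> (\<exists>n\<ge>N.
     R * exp (- (66 * \<gamma>) * real n) + 2 * (exp (W * real n) * h) \<le> h powr \<alpha> \<and>
     h powr \<alpha> < deviation_modulus c \<iota> h / 2 \<and>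
     6 * (\<Sum>k. \<iota> (real (k + n))) \<le> deviation_modulus c \<iota> h / 2))"
proof -
  note pos = deviation_function_props(1)[OF \<P> \<iota>] and mono = deviation_function_props(2)[OF \<P> \<iota>]
  obtain b c0 where b: "b > 0" "c0 > 0" "\<forall>\<^sub>F t in at_top. b * exp (- c0 * t) \<le> \<iota> t"
    using deviation_function_props(4)[OF \<P> \<iota>] by blast
  obtain t0 where t0: "\<And>t. t \<ge> t0 \<Longrightarrow> b * exp (- c0 * t) \<le> \<iota> t" using b(3) unfolding eventually_at_top_linorder by blast
  have ss: "summable (\<lambda>n. sqrt (\<iota> (real n)))" and si: "summable (\<lambda>n. \<iota> (real n))" by (rule deviation_function_sums[OF \<P> \<iota>])+
  obtain N1 where N1: "\<And>n. n \<ge> N1 \<Longrightarrow> norm (\<Sum>k. sqrt (\<iota> (real (k + n)))) < 1 / 12"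
    using suminf_exist_split[OF _ ss, of "1 / 12"] by auto
  have tail: "6 * (\<Sum>k. \<iota> (real (k + n))) \<le> sqrt (\<iota> (real n)) / 2" if n: "n \<ge> N1" "n \<ge> 1" for n
  proof -
    have le: "\<iota> (real (k + n)) \<le> sqrt (\<iota> (real n)) * sqrt (\<iota> (real (k + n)))" for k
    proof -
      have "0 < \<iota> (real (k + n))" using pos n by simp
      then have "\<iota> (real (k + n)) = sqrt (\<iota> (real (k + n))) * sqrt (\<iota> (real (k + n)))" by simp
      also have "\<dots> \<le> sqrt (\<iota> (real n)) * sqrt (\<iota> (real (k + n)))"
        using n pos[of "real (k + n)"] mono[of "real n" "real (k + n)"] by (intro mult_right_mono) auto
      finally show ?thesis .
    qed
    have s1: "summable (\<lambda>k. sqrt (\<iota> (real (k + n))))" using summable_ignore_initial_segment[OF ss, of n] by simp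
    have s2: "summable (\<lambda>k. \<iota> (real (k + n)))" using summable_ignore_initial_segment[OF si, of n] by simp
    have "(\<Sum>k. \<iota> (real (k + n))) \<le> (\<Sum>k. sqrt (\<iota> (real n)) * sqrt (\<iota> (real (k + n))))"
      by (rule suminf_le[OF le s2 summable_mult[OF s1]])
    also have "\<dots> = sqrt (\<iota> (real n)) * (\<Sum>k. sqrt (\<iota> (real (k + n))))" by (rule suminf_mult[OF s1])
    also have "\<dots> \<le> sqrt (\<iota> (real n)) * (1 / 12)" using N1[OF n(1)] pos[of "real n"] n by (intro mult_left_mono) auto
    finally show ?thesis by simp
  qed
  \<comment> \<open>With \<open>n\<close> about \<open>c1 log (1/h)\<close>, \<open>e\<^bsup>W n\<^esup> h\<close> is about \<open>h\<^bsup>1/2\<^esup>\<close>; halving the smaller exponent in \<open>\<alpha>\<close> absorbs constants.\<close>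
  define c1 where "c1 = 1 / (2 * W)"
  define \<alpha> where "\<alpha> = min (66 * \<gamma> * c1) (1 / 2) / 2"
  have c1: "0 < c1" using W by (simp add: c1_def)
  have \<alpha>: "0 < \<alpha>" using \<gamma> c1 by (simp add: \<alpha>_def)
  define c where "c = min c1 (\<alpha> / c0)"
  have c: "0 < c" "c \<le> c1" "c0 * c \<le> \<alpha>"
  proof -
    show "0 < c" "c \<le> c1" using c1 \<alpha> b by (auto simp: c_def)
    have "c \<le> \<alpha> / c0" by (simp add: c_def)
    then show "c0 * c \<le> \<alpha>" using b(2) by (simp add: field_simps)
  qed
  define C where "C = R + 2 * exp W"
  have C: "0 < C" using R by (simp add: C_def add_nonneg_pos)
  have lim: "((\<lambda>s. exp (- \<alpha> * s)) \<longlongrightarrow> 0) at_top"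
  proof -
    have "filterlim (\<lambda>s. \<alpha> * s) at_top at_top" using \<alpha> by (intro filterlim_tendsto_pos_mult_at_top[OF tendsto_const _ filterlim_ident])
    then have "filterlim (\<lambda>s. - (\<alpha> * s)) at_bot at_top" by (simp add: filterlim_uminus_at_bot)
    from filterlim_compose[OF exp_at_bot this] show ?thesis by simp
  qed
  have "\<forall>\<^sub>F s in at_top. exp (- \<alpha> * s) < min (1 / C) (b / 4)" by (rule order_tendstoD(2)[OF lim]) (use C b in auto)
  then have "\<forall>\<^sub>F s in at_top. exp (- \<alpha> * s) < min (1 / C) (b / 4) \<and> s \<ge> max 1 (max t0 (real (max N N1 + 1)) / c)"
    using eventually_ge_at_top by (rule eventually_conj)
  then obtain s0 where s0: "\<And>s. s \<ge> s0 \<Longrightarrow> exp (- \<alpha> * s) < min (1 / C) (b / 4) \<and> s \<ge> max 1 (max t0 (real (max N N1 + 1)) / c)"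
    unfolding eventually_at_top_linorder by blast
  define h0 where "h0 = exp (- max 1 s0)"
  have main: "\<exists>n\<ge>N. R * exp (- (66 * \<gamma>) * real n) + 2 * (exp (W * real n) * h) \<le> h powr \<alpha> \<and>
     h powr \<alpha> < deviation_modulus c \<iota> h / 2 \<and> 6 * (\<Sum>k. \<iota> (real (k + n))) \<le> deviation_modulus c \<iota> h / 2"
    if h: "0 < h" "h < h0" for h
  proof -
    define s where "s = ln (1 / h)"
    have hs: "h = exp (- s)" using h by (simp add: s_def ln_div)
    have "max 1 s0 < s" using h(2) unfolding hs h0_def by simp
    then have "s \<ge> s0" by simp
    from s0[OF this] have e: "exp (- \<alpha> * s) < 1 / C" "exp (- \<alpha> * s) < b / 4" and s1: "s \<ge> 1" and "s \<ge> max t0 (real (max N N1 + 1)) / c" by auto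
    then have cs: "max t0 (real (max N N1 + 1)) \<le> c * s" using c(1) by (simp add: field_simps)
    have ct: "t0 \<le> c * s" "real N \<le> c * s" "real N1 \<le> c * s" "1 \<le> c * s" using cs by auto
    define n where "n = nat \<lceil>c1 * s\<rceil>"
    have cc1: "c * s \<le> c1 * s" using c(2) s1 by (intro mult_right_mono) auto
    have n_ge: "c1 * s \<le> real n" unfolding n_def by linarith
    have n_le: "real n \<le> c1 * s + 1"
    proof -
      have "0 \<le> c1 * s" using c1 s1 by simp
      then have "real n = of_int \<lceil>c1 * s\<rceil>" by (simp add: n_def)
      then show ?thesis by (simp add: of_int_ceiling_le_add_one)
    qed
    have csn: "c * s \<le> real n" using cc1 n_ge by linarith
    have nN: "n \<ge> N" "n \<ge> N1" "n \<ge> 1" using ct csn by linarith+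
    have hp: "h powr \<alpha> = exp (- \<alpha> * s)" unfolding hs powr_def by simp
    have 2: "exp (- (66 * \<gamma>) * real n) \<le> exp (- (2 * \<alpha>) * s)"
    proof -
      have "2 * \<alpha> * s \<le> (66 * \<gamma> * c1) * s" using s1 by (intro mult_right_mono) (auto simp: \<alpha>_def)
      also have "\<dots> = 66 * \<gamma> * (c1 * s)" by simp
      also have "\<dots> \<le> 66 * \<gamma> * real n" using n_ge \<gamma> by (intro mult_left_mono) auto
      finally show ?thesis by simp
    qed
    have 3: "exp (W * real n) * h \<le> exp W * exp (- (2 * \<alpha>) * s)"
    proof -
      have "W * real n \<le> W * (c1 * s + 1)" using n_le W by (intro mult_left_mono) auto
      also have "\<dots> = s / 2 + W" using W by (simp add: c1_def field_simps)
      finally have "exp (W * real n) * h \<le> exp (s / 2 + W) * exp (- s)" unfolding hs by (intro mult_right_mono) auto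
      also have "\<dots> = exp W * exp (- (1 / 2) * s)" by (simp add: exp_add[symmetric])
      also have "\<dots> \<le> exp W * exp (- (2 * \<alpha>) * s)"
      proof -
        have "2 * \<alpha> * s \<le> (1 / 2) * s" using s1 by (intro mult_right_mono) (auto simp: \<alpha>_def)
        then show ?thesis by simp
      qed
      finally show ?thesis .
    qed
    have "R * exp (- (66 * \<gamma>) * real n) + 2 * (exp (W * real n) * h) \<le> R * exp (- (2 * \<alpha>) * s) + 2 * (exp W * exp (- (2 * \<alpha>) * s))"
      using 2 3 R by (intro add_mono mult_left_mono) auto
    also have "\<dots> = C * exp (- \<alpha> * s) * exp (- \<alpha> * s)" by (simp add: C_def exp_add[symmetric] algebra_simps)
    also have "\<dots> \<le> 1 * exp (- \<alpha> * s)"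
      using e(1) C by (intro mult_right_mono) (auto simp: field_simps)
    finally have i: "R * exp (- (66 * \<gamma>) * real n) + 2 * (exp (W * real n) * h) \<le> h powr \<alpha>" unfolding hp by simp
    have cs0: "0 < c * s" using ct(4) by linarith
    have dm: "deviation_modulus c \<iota> h = sqrt (\<iota> (c * s))"
      unfolding deviation_modulus_def s_def[symmetric] using pos[OF cs0] by (simp add: powr_half_sqrt)
    have ii: "h powr \<alpha> < deviation_modulus c \<iota> h / 2"
    proof -
      have "4 * (exp (- \<alpha> * s))\<^sup>2 = 4 * exp (- \<alpha> * s) * exp (- \<alpha> * s)" by (simp add: power2_eq_square)
      also have "\<dots> < b * exp (- \<alpha> * s)" using e(2) by simp
      also have "\<dots> \<le> b * exp (- c0 * (c * s))"
      proof -
        have "c0 * c * s \<le> \<alpha> * s" using c(3) s1 by (intro mult_right_mono) auto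
        then show ?thesis using b(1) by (simp add: mult.assoc)
      qed
      also have "\<dots> \<le> \<iota> (c * s)" by (rule t0[OF ct(1)])
      finally have "(2 * exp (- \<alpha> * s))\<^sup>2 < \<iota> (c * s)" by (simp add: power_mult_distrib)
      then have "2 * exp (- \<alpha> * s) < sqrt (\<iota> (c * s))" by (rule real_less_rsqrt)
      then show ?thesis unfolding dm hp by simp
    qed
    have iii: "6 * (\<Sum>k. \<iota> (real (k + n))) \<le> deviation_modulus c \<iota> h / 2"
      using tail[OF nN(2,3)] mono[OF cs0 csn] unfolding dm by (meson divide_right_mono order_trans real_sqrt_le_mono zero_le_numeral)
    show ?thesis using nN(1) i ii iii by blast
  qed
  show ?thesis
    by (rule exI[of _ c], rule conjI[OF c(1)], rule exI[of _ \<alpha>], rule conjI[OF \<alpha>], rule exI[of _ h0]) (use main in \<open>auto simp: h0_def\<close>)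
qed

section \<open>Uniformity in a neighbourhood\<close>

lemma (in ergodic_system) prob_of_AE_eventually:
  assumes [measurable]: "\<And>n. Measurable.pred M (P n)" and ev: "AE x in M. \<forall>\<^sub>F n in sequentially. P n x"
  shows "(\<lambda>n. prob {x \<in> space M. \<not> P n x}) \<longlonglongrightarrow> 0"
proof -
  have "(\<lambda>n. \<integral>x. indicator {x \<in> space M. \<not> P n x} x \<partial>M) \<longlonglongrightarrow> (\<integral>x. (0 :: real) \<partial>M)"
  proof (rule integral_dominated_convergence[where w = "\<lambda>_. 1"])
    show "AE x in M. (\<lambda>n. indicator {x \<in> space M. \<not> P n x} x) \<longlonglongrightarrow> (0 :: real)"
      using ev
    proof eventually_elim
      case (elim x)
      then have "\<forall>\<^sub>F n in sequentially. 0 = (indicator {x \<in> space M. \<not> P n x} x :: real)"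
        by eventually_elim simp
      then show ?case by (rule Lim_transform_eventually[OF tendsto_const])
    qed
  qed (auto simp: indicator_def)
  then show ?thesis by simp
qed

locale ldt_lyapunov = ldt_system +
  assumes L2_bounded: "\<forall>k. \<forall>B\<in>C k. lyap M T B 1 > -\<infinity> \<longrightarrow> uniformly_L2_bounded M T C dst k B"
    and fiber_LDT: "\<forall>k\<ge>2. \<forall>B\<in>C k. lyap M T B 1 > lyap M T B 2 \<longrightarrow> uniform_fiber_LDT M T C dst \<P> k B"
begin

lemma exponent_gap:
  assumes A: "A \<in> C m" and m: "m \<ge> 2" and gap: "lyap M T A 1 > lyap M T A 2"
  obtains l \<gamma> lw where "0 < \<gamma>" "exponent A (ereal l)" "exponent (\<lambda>x. ext_power 2 (A x)) lw" "lw < ereal (2 * l - 101 * \<gamma>)"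
proof -
  obtain l1 where l1: "l1 < \<infinity>" "exponent A l1" using exponent_exists[OF A] by blast
  obtain lw where lw: "lw < \<infinity>" "exponent (\<lambda>x. ext_power 2 (A x)) lw" using exponent_exists[OF C_ext_power[OF A m]] by blast
  have "l1 \<noteq> -\<infinity>" using gap lyap_1[OF A l1(2)] by auto
  then obtain l where l: "l1 = ereal l" using l1(1) by (cases l1) auto
  have "lw - ereal l < ereal l" using gap lyap_1[OF A l1(2)] lyap_2[OF A m _ lw(2), of l] l1(2) unfolding l by simp
  then have "\<exists>\<gamma>>0. lw < ereal (2 * l - 101 * \<gamma>)"
  proof (cases lw)
    case (real r)
    then have "r < 2 * l" using \<open>lw - ereal l < ereal l\<close> by simp
    then show ?thesis using real by (intro exI[of _ "(2 * l - r) / 102"]) (simp add: field_simps)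
  next
    case MInf then show ?thesis by (intro exI[of _ 1]) simp
  qed (use lw in auto)
  then show thesis using that l1(2) lw(2) l by blast
qed

lemma ext_power_near:
  assumes A: "A \<in> C m" and m: "m \<ge> 2" and \<delta>: "0 < \<delta>"
  obtains \<delta>' where "0 < \<delta>'" "\<And>B. B \<in> C m \<Longrightarrow> dst m B A < \<delta>' \<Longrightarrow>
    dst (m choose 2) (\<lambda>x. ext_power 2 (B x)) (\<lambda>x. ext_power 2 (A x)) < \<delta>"
proof -
  have "2 \<in> {1..m}" using m by simp
  then obtain r L where r: "r > 0" "\<forall>B1\<in>C m. \<forall>B2\<in>C m. dst m B1 A < r \<longrightarrow> dst m B2 A < r \<longrightarrow>
      dst (m choose 2) (\<lambda>x. ext_power 2 (B1 x)) (\<lambda>x. ext_power 2 (B2 x)) \<le> L * dst m B1 B2"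
    using C_space A unfolding cocycle_space_def by blast
  have AA: "dst m A A = 0" using Metric_space.mdist_zero[OF C_metric A] by simp
  show thesis
  proof (rule that[of "min r (\<delta> / (\<bar>L\<bar> + 1))"])
    show "0 < min r (\<delta> / (\<bar>L\<bar> + 1))" using r \<delta> by simp
    fix B assume B: "B \<in> C m" "dst m B A < min r (\<delta> / (\<bar>L\<bar> + 1))"
    have d0: "0 \<le> dst m B A" using Metric_space.nonneg[OF C_metric] .
    have "dst (m choose 2) (\<lambda>x. ext_power 2 (B x)) (\<lambda>x. ext_power 2 (A x)) \<le> L * dst m B A"
      using r B A AA by auto
    also have "\<dots> \<le> (\<bar>L\<bar> + 1) * dst m B A" using d0 by (intro mult_right_mono) auto
    also have "\<dots> < (\<bar>L\<bar> + 1) * (\<delta> / (\<bar>L\<bar> + 1))" using B by (intro mult_strict_left_mono) auto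
    finally show "dst (m choose 2) (\<lambda>x. ext_power 2 (B x)) (\<lambda>x. ext_power 2 (A x)) < \<delta>" by simp
  qed
qed

text \<open>The upper bounds come from the base estimates for \<open>A\<close> and \<open>\<And>\<^sub>2 A\<close>, the remaining exceptional sets from the fiber
  estimate; \<open>\<iota>\<close> is the sum of the three deviation functions.\<close>

lemma ldt_cocycle_near:
  assumes A: "A \<in> C m" and m: "m \<ge> 2" and gap: "lyap M T A 1 > lyap M T A 2"
    and \<gamma>: "0 < \<gamma>" and l: "exponent A (ereal l)"
    and lw: "exponent (\<lambda>x. ext_power 2 (A x)) lw" "lw < ereal (2 * l - 101 * \<gamma>)"
  shows "\<exists>\<delta>>0. \<delta> \<le> 1 \<and> (\<exists>\<iota>\<in>deviation_functions \<P>. \<exists>K c N. 0 < c \<and>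
    (\<forall>B\<in>C m. dst m B A < \<delta> \<longrightarrow> ldt_cocycle M T B m K c l \<gamma> \<iota> N))"
proof -
  have AA: "dst m A A = 0" using Metric_space.mdist_zero[OF C_metric A] by simp
  obtain K :: real where K: "K \<ge> 1" "K \<ge> 0" "\<And>B. B \<in> C m \<Longrightarrow> dst m B A < 1 \<Longrightarrow> AE x in M. mat_norm (B x) \<le> exp K"
    using uniform_bound[OF A] by blast
  have "AE x in M. \<exists>n\<ge>1. cnorm A n x \<le> exp ((l + \<gamma> / 2) * real n)" using l by (rule exponent_hit) (use \<gamma> in simp)
  then obtain \<delta>1 \<iota>1 n1 where u1: "\<delta>1 > 0" "\<iota>1 \<in> deviation_functions \<P>"
    "\<forall>B\<in>C m. dst m B A < \<delta>1 \<longrightarrow> (\<forall>n\<ge>n1. prob {x \<in> space M. exp ((l + \<gamma>) * real n) < cnorm B n x} < \<iota>1 (real n))"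
    using uniform_upper_bound[OF A, of "l + \<gamma> / 2" "l + \<gamma>"] \<gamma> by auto
  have "AE x in M. \<exists>n\<ge>1. cnorm (\<lambda>x. ext_power 2 (A x)) n x \<le> exp ((2 * l - 101 * \<gamma>) * real n)" using lw by (rule exponent_hit)
  then obtain \<delta>2' \<iota>2 n2 where u2: "\<delta>2' > 0" "\<iota>2 \<in> deviation_functions \<P>"
    "\<forall>B\<in>C (m choose 2). dst (m choose 2) B (\<lambda>x. ext_power 2 (A x)) < \<delta>2' \<longrightarrow>
       (\<forall>n\<ge>n2. prob {x \<in> space M. exp ((2 * l - 100 * \<gamma>) * real n) < cnorm B n x} < \<iota>2 (real n))"
    using uniform_upper_bound[OF C_ext_power[OF A m], of "2 * l - 101 * \<gamma>" "2 * l - 100 * \<gamma>"] \<gamma> by auto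
  obtain \<delta>2 where \<delta>2: "0 < \<delta>2" "\<And>B. B \<in> C m \<Longrightarrow> dst m B A < \<delta>2 \<Longrightarrow>
    dst (m choose 2) (\<lambda>x. ext_power 2 (B x)) (\<lambda>x. ext_power 2 (A x)) < \<delta>2'" using ext_power_near[OF A m u2(1)] by blast
  have "uniform_fiber_LDT M T C dst \<P> m A" using fiber_LDT A m gap by blast
  then obtain n3 \<epsilon> \<iota>3 \<delta>3 where u3: "(n3, \<epsilon>, \<iota>3) \<in> \<P>" "\<delta>3 > 0" "\<forall>B\<in>C m. dst m B A < \<delta>3 \<longrightarrow>
       (\<forall>n\<ge>1. n \<ge> n3 \<longrightarrow> \<epsilon> (real n) \<le> \<gamma> \<and>
          measure M {x \<in> space M. \<bar>finite_scale_log T B n x - lyap_fin M T B n\<bar> > ereal (\<epsilon> (real n))} < \<iota>3 (real n))"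
    unfolding uniform_fiber_LDT_def using \<gamma> by fast
  have \<iota>3: "\<iota>3 \<in> deviation_functions \<P>" by (rule deviation_functions_single[OF u3(1)])
  have "lyap M T A 1 > -\<infinity>" using lyap_1[OF A l] by simp
  then have "uniformly_L2_bounded M T C dst m A" using L2_bounded A by blast
  then obtain \<delta>4 c where u4: "\<delta>4 > 0" "\<forall>n\<ge>1. \<forall>B\<in>C m. dst m B A < \<delta>4 \<longrightarrow> L2_norm_ereal M (finite_scale_log T B n) < ennreal c"
    unfolding uniformly_L2_bounded_def by blast
  have c0: "0 < c"
    using L2_norm_finite_scale(6)[OF C_measurable[OF A], of 1 c] u4 A AA by simp
  define \<iota> where "\<iota> = (\<lambda>t. \<iota>1 t + \<iota>2 t + \<iota>3 t)"
  have \<iota>: "\<iota> \<in> deviation_functions \<P>" unfolding \<iota>_def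
    by (rule deviation_functions_add[OF deviation_functions_add[OF u1(2) u2(2)] \<iota>3])
  define N where "N = max (max 1 n1) (max n2 n3)"
  define \<delta> where "\<delta> = min (min 1 \<delta>1) (min \<delta>2 (min \<delta>3 \<delta>4))"
  have \<delta>: "0 < \<delta>" "\<delta> \<le> 1" using u1 \<delta>2 u3 u4 by (auto simp: \<delta>_def)
  have \<iota>_ge: "\<iota>1 (real n) \<le> \<iota> (real n)" "\<iota>2 (real n) \<le> \<iota> (real n)" "\<iota>3 (real n) \<le> \<iota> (real n)" if "n \<ge> N" for n
  proof -
    have "0 < real n" using that by (simp add: N_def)
    then have "0 < \<iota>1 (real n)" "0 < \<iota>2 (real n)" "0 < \<iota>3 (real n)"
      using deviation_function_props(1)[OF \<P>_params] u1(2) u2(2) \<iota>3 by blast+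
    then show "\<iota>1 (real n) \<le> \<iota> (real n)" "\<iota>2 (real n) \<le> \<iota> (real n)" "\<iota>3 (real n) \<le> \<iota> (real n)" by (auto simp: \<iota>_def)
  qed
  have "ldt_cocycle M T B m K c l \<gamma> \<iota> N" if B: "B \<in> C m" "dst m B A < \<delta>" for B
  proof -
    note Bm = C_measurable[OF B(1)]
    have [measurable]: "(\<lambda>x. cnorm B n x) \<in> borel_measurable M" for n by (rule cnorm_measurable[OF Bm])
    have d: "dst m B A < 1" "dst m B A < \<delta>1" "dst m B A < \<delta>2" "dst m B A < \<delta>3" "dst m B A < \<delta>4"
      using B(2) by (auto simp: \<delta>_def)
    have L2: "L2_norm_ereal M (finite_scale_log T B n) < ennreal c" if "n \<ge> 1" for n using u4(2) that B(1) d(5) by blast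
    note s = L2_norm_finite_scale[OF Bm _ L2]
    show ?thesis
    proof
      show "measurable_cocycle m B" "2 \<le> m" "0 \<le> K" "0 < c" "0 < \<gamma>" "1 \<le> N" using Bm m K c0 \<gamma> by (auto simp: N_def)
      show "AE x in M. mat_norm (B x) \<le> exp K" by (rule K(3)[OF B(1) d(1)])
      show "AE x in M. 0 < cnorm B n x" "integrable M (\<lambda>x. (ln (cnorm B n x))\<^sup>2)"
        "(\<integral>x. (ln (cnorm B n x))\<^sup>2 \<partial>M) \<le> (real n * c)\<^sup>2" if "1 \<le> n" for n
        using s(1,2,3)[OF that that] by auto
      show "0 < \<iota> t" if "0 < t" for t by (rule deviation_function_props(1)[OF \<P>_params \<iota> that])
      show "\<iota> t \<le> \<iota> s" if "0 < s" "s \<le> t" for s t by (rule deviation_function_props(2)[OF \<P>_params \<iota> that])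
      fix n assume n: "N \<le> n"
      then have n': "1 \<le> n" "n1 \<le> n" "n2 \<le> n" "n3 \<le> n" by (auto simp: N_def)
      show "prob {x \<in> space M. exp ((l + \<gamma>) * real n) < cnorm B n x} \<le> \<iota> (real n)"
        using u1(3) B(1) d(2) n'(2) \<iota>_ge(1)[OF n] by fastforce
      show "prob {x \<in> space M. exp ((2 * l - 100 * \<gamma>) * real n) < cnorm (\<lambda>x. ext_power 2 (B x)) n x} \<le> \<iota> (real n)"
        using u2(3)[rule_format, OF C_ext_power[OF B(1) m] \<delta>2(2)[OF B(1) d(3)] n'(3)] \<iota>_ge(2)[OF n] by linarith
      let ?a = "(\<integral>x. ln (cnorm B n x) \<partial>M)"
      let ?E = "{x \<in> space M. \<bar>finite_scale_log T B n x - lyap_fin M T B n\<bar> > ereal (\<epsilon> (real n))}"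
      have lf: "lyap_fin M T B n = ereal (?a / real n)" by (rule s(5)[OF n'(1) n'(1)])
      have ep: "\<epsilon> (real n) \<le> \<gamma>" "prob ?E < \<iota>3 (real n)" using u3(3) B(1) d(4) n' by auto
      have [measurable]: "(\<lambda>x. finite_scale_log T B n x) \<in> borel_measurable M"
        unfolding finite_scale_log_def by (intro borel_measurable_ereal_times borel_measurable_const elog_measurable) measurable
      have "prob {x \<in> space M. \<gamma> < \<bar>ln (cnorm B n x) / real n - ?a / real n\<bar>} \<le> prob ?E"
      proof (rule finite_measure_mono_AE)
        show "AE x in M. x \<in> {x \<in> space M. \<gamma> < \<bar>ln (cnorm B n x) / real n - ?a / real n\<bar>} \<longrightarrow> x \<in> ?E"
          using s(1)[OF n'(1) n'(1)]
        proof eventually_elim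
          case (elim x)
          have "finite_scale_log T B n x = ereal (ln (cnorm B n x) / real n)"
            using elim by (simp add: finite_scale_log_def elog_def)
          then show ?case using ep(1) by (auto simp: lf)
        qed
        show "?E \<in> sets M" by measurable
      qed
      then show "prob {x \<in> space M. \<gamma> < \<bar>ln (cnorm B n x) / real n - ?a / real n\<bar>} \<le> \<iota> (real n)"
        using ep(2) \<iota>_ge(3)[OF n] by linarith
    qed
  qed
  then show ?thesis using \<delta> \<iota> c0 by blast
qed

text \<open>The starting scale \<open>n\<^sub>0\<close> is chosen by \<open>A\<close> alone.  At the scales \<open>n\<^sub>0\<close> and \<open>2 n\<^sub>0\<close>, a sufficiently close \<open>B\<close> has nearly the
  same norms as \<open>A\<close> almost everywhere.  A measure count yields a point that is typical for \<open>A\<close> and outside the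
  exceptional set of the fiber estimate for \<open>B\<close>; there the mean exponent of \<open>B\<close> can be read off.\<close>

lemma pinned_cocycle_near:
  assumes A: "A \<in> C m" and m: "m \<ge> 2" and gap: "lyap M T A 1 > lyap M T A 2"
  shows "\<exists>\<delta>>0. \<exists>\<iota>\<in>deviation_functions \<P>. \<exists>K c l \<gamma> N. \<forall>B\<in>C m. dst m B A < \<delta> \<longrightarrow> pinned_cocycle M T B m K c l \<gamma> \<iota> N"
proof -
  have AA: "dst m A A = 0" using Metric_space.mdist_zero[OF C_metric A] by simp
  obtain l \<gamma> lw where lg: "0 < \<gamma>" "exponent A (ereal l)" "exponent (\<lambda>x. ext_power 2 (A x)) lw" "lw < ereal (2 * l - 101 * \<gamma>)"
    using exponent_gap[OF A m gap] by blast
  obtain \<delta>1 \<iota> K c N where d1: "\<delta>1 > 0" "\<delta>1 \<le> 1" "\<iota> \<in> deviation_functions \<P>" "0 < c"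
    "\<forall>B\<in>C m. dst m B A < \<delta>1 \<longrightarrow> ldt_cocycle M T B m K c l \<gamma> \<iota> N"
    using ldt_cocycle_near[OF A m gap lg] by blast
  note Am = C_measurable[OF A] and m1 = C_dim[OF A]
  have [measurable]: "(\<lambda>x. cnorm A n x) \<in> borel_measurable M" for n by (rule cnorm_measurable[OF Am])
  define G where "G = (\<lambda>n x. exp ((l - \<gamma>) * real n) \<le> cnorm A n x \<and> cnorm A n x \<le> exp ((l + \<gamma>) * real n))"
  have G [measurable]: "Measurable.pred M (G n)" for n unfolding G_def by measurable
  have "AE x in M. \<forall>\<^sub>F n in sequentially. G n x"
    using lg(2) unfolding exponent_def
  proof eventually_elim
    case (elim x)
    have lo: "\<forall>\<^sub>F n in sequentially. ereal (l - \<gamma>) < ereal (1 / real n) * elog (cnorm A n x)"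
      and up: "\<forall>\<^sub>F n in sequentially. ereal (1 / real n) * elog (cnorm A n x) < ereal (l + \<gamma>)"
      using order_tendstoD[OF elim] lg(1) by auto
    show ?case
      using lo up eventually_ge_at_top[of 1]
    proof eventually_elim
      case (elim n)
      from less_imp_le[OF elim(1)] less_imp_le[OF elim(2)] elim(3) show ?case
        by (simp add: G_def scaled_elog_ge_iff scaled_elog_le_iff mult.commute del: times_ereal.simps)
    qed
  qed
  from prob_of_AE_eventually[OF G this] have "(\<lambda>n. prob {x \<in> space M. \<not> G n x}) \<longlonglongrightarrow> 0" .
  then have e1: "\<forall>\<^sub>F n in sequentially. prob {x \<in> space M. \<not> G n x} < 1 / 2" by (rule order_tendstoD) simp
  have e2: "\<forall>\<^sub>F n in sequentially. \<iota> (real n) < 1 / 4"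
    using deviation_function_sums(3)[OF \<P>_params d1(3)] by (rule order_tendstoD) simp
  have e3: "\<forall>\<^sub>F n in sequentially. 1 / \<gamma> \<le> real n"
    using filterlim_real_sequentially unfolding filterlim_at_top by blast
  obtain n1 where n1: "\<And>n. n \<ge> n1 \<Longrightarrow> prob {x \<in> space M. \<not> G n x} < 1 / 2 \<and> \<iota> (real n) < 1 / 4 \<and> 1 / \<gamma> \<le> real n"
    using eventually_conj[OF e1 eventually_conj[OF e2 e3]] unfolding eventually_sequentially by blast
  obtain n2 where n2: "\<And>n. n \<ge> n2 \<Longrightarrow> exp (- (12 * \<gamma>) * real n) \<le> 1 / 12"
    "\<And>n J. n \<ge> n2 \<Longrightarrow> (\<Sum>j<J. block_err \<gamma> c \<iota> (2 ^ j * n)) \<le> \<gamma> * real n"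
    using block_err_sum[OF \<P>_params d1(3) lg(1) d1(4)] by blast
  define n0 where "n0 = max (max n1 n2) (max 1 N)"
  define \<eta> where "\<eta> = (\<lambda>n. exp ((l - \<gamma>) * real n) / (2 * (real n * exp (K * real n))))"
  define \<delta> where "\<delta> = min \<delta>1 (min (\<eta> n0) (\<eta> (2 * n0)))"
  have n0: "n0 \<ge> 1" "n0 \<ge> n1" "n0 \<ge> n2" "n0 \<ge> N" by (auto simp: n0_def)
  have \<eta>: "0 < \<eta> n" if "n \<ge> 1" for n using that by (simp add: \<eta>_def)
  have \<delta>: "0 < \<delta>" using \<eta>[of n0] \<eta>[of "2 * n0"] n0 d1(1) by (simp add: \<delta>_def)
  have "pinned_cocycle M T B m K c l \<gamma> \<iota> N" if B: "B \<in> C m" "dst m B A < \<delta>" for B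
  proof -
    have dB: "dst m B A < \<delta>1" "dst m B A < \<eta> n0" "dst m B A < \<eta> (2 * n0)" using B(2) by (auto simp: \<delta>_def)
    have d0: "0 \<le> dst m B A" using Metric_space.nonneg[OF C_metric] .
    interpret LA: ldt_cocycle M T A m K c l \<gamma> \<iota> N using d1(5) A AA d1(1) by simp
    interpret L: ldt_cocycle M T B m K c l \<gamma> \<iota> N using d1(5) B(1) dB(1) by simp
    have near: "\<bar>L.u n - l\<bar> \<le> 3 * \<gamma>" if n: "n \<ge> n0" and dn: "dst m B A < \<eta> n" for n
    proof -
      have n': "n \<ge> 1" "n \<ge> n1" "n \<ge> N" using n n0 by auto
      define E1 where "E1 = {x \<in> space M. \<not> G n x}"
      define E2 where "E2 = {x \<in> space M. \<gamma> < \<bar>L.L n x / real n - L.u n\<bar>}"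
      have [measurable]: "E1 \<in> sets M" "E2 \<in> sets M" unfolding E1_def E2_def by measurable
      have "prob E1 < 1 / 2" "prob E2 < 1 / 4"
        using n1[OF n'(2)] L.ldt[OF n'(3)] by (auto simp: E1_def E2_def L.L_def L.u_def L.a_def)
      then have "prob (E1 \<union> E2) < 1" using measure_Un_le[of E1 M E2] by simp
      then have notae: "\<not> (AE x in M. x \<in> E1 \<union> E2)" using prob_eq_1[of "E1 \<union> E2"] by auto
      have "\<exists>x\<in>space M. x \<notin> E1 \<union> E2 \<and> 0 < cnorm B n x \<and>
         mat_norm (iterate T B n x - iterate T A n x) \<le> real n * exp (K * real n) * dst m B A"
      proof (rule ccontr)
        assume no: "\<not> ?thesis"
        have "AE x in M. x \<in> space M" by auto
        then have "AE x in M. x \<in> E1 \<union> E2"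
          using L.norm_pos[OF n'(1)] iterate_diff_bound[OF Am L.B m1 L.K0 LA.BK L.BK d0 dst_bound[OF A B(1)]]
        proof eventually_elim
          case (elim x)
          have "mat_norm (iterate T B n x - iterate T A n x) \<le> real n * exp (K * real n) * dst m B A"
            using elim(3)[rule_format, of n 0] by simp
          then show ?case using no elim(1,2) by blast
        qed
        with notae show False ..
      qed
      then obtain x where x: "x \<in> space M" "x \<notin> E1 \<union> E2" "0 < cnorm B n x"
         "mat_norm (iterate T B n x - iterate T A n x) \<le> real n * exp (K * real n) * dst m B A" by blast
      have gx: "exp ((l - \<gamma>) * real n) \<le> cnorm A n x" "cnorm A n x \<le> exp ((l + \<gamma>) * real n)"
        and ux: "\<bar>L.L n x / real n - L.u n\<bar> \<le> \<gamma>" using x(1,2) by (auto simp: E1_def E2_def G_def)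
      have "real n * exp (K * real n) * dst m B A \<le> real n * exp (K * real n) * \<eta> n"
        using dn by (intro mult_left_mono) auto
      also have "\<dots> = exp ((l - \<gamma>) * real n) / 2" using n'(1) by (simp add: \<eta>_def)
      finally have df: "mat_norm (iterate T B n x - iterate T A n x) \<le> cnorm A n x / 2" using x(4) gx(1) by linarith
      note cA = iterate_carrier[OF Am x(1), of n] and cB = iterate_carrier[OF L.B x(1), of n]
      have "iterate T B n x = iterate T A n x + (iterate T B n x - iterate T A n x)"
        "iterate T A n x = iterate T B n x + (iterate T A n x - iterate T B n x)"
        using cA cB by (auto intro!: eq_matI)
      then have "cnorm B n x \<le> cnorm A n x + mat_norm (iterate T B n x - iterate T A n x)"
        "cnorm A n x \<le> cnorm B n x + mat_norm (iterate T A n x - iterate T B n x)"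
        using mat_norm_add[OF cA minus_carrier_mat[OF cA], of "iterate T B n x"]
          mat_norm_add[OF cB minus_carrier_mat[OF cB], of "iterate T A n x"] by simp_all
      then have b: "cnorm B n x \<le> 2 * cnorm A n x" "cnorm A n x \<le> 2 * cnorm B n x"
        using df mat_norm_diff_commute[OF cA cB] by linarith+
      have Apos: "0 < cnorm A n x" using gx(1) by (rule less_le_trans[OF exp_gt_zero])
      have g1: "1 \<le> \<gamma> * real n" using n1[OF n'(2)] lg(1) by (simp add: field_simps)
      have ln2: "ln 2 \<le> (1 :: real)" using ln_le_minus_one[of "2 :: real"] by simp
      have lnA: "(l - \<gamma>) * real n \<le> ln (cnorm A n x)" "ln (cnorm A n x) \<le> (l + \<gamma>) * real n"
        using gx Apos ln_mono[OF gx(2) Apos] by (simp_all add: ln_ge_iff)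
      have "ln (cnorm B n x) \<le> ln (2 * cnorm A n x)" "ln (cnorm A n x) \<le> ln (2 * cnorm B n x)"
        using b x(3) Apos by simp_all
      then have "ln (cnorm B n x) \<le> ln 2 + ln (cnorm A n x)" "ln (cnorm A n x) \<le> ln 2 + ln (cnorm B n x)"
        using x(3) Apos by (simp_all add: ln_mult)
      then have "(l - 2 * \<gamma>) * real n \<le> L.L n x" "L.L n x \<le> (l + 2 * \<gamma>) * real n"
        using lnA ln2 g1 unfolding L.L_def by (simp_all add: algebra_simps)
      then have "l - 2 * \<gamma> \<le> L.L n x / real n" "L.L n x / real n \<le> l + 2 * \<gamma>" using n'(1) by (simp_all add: field_simps)
      then show ?thesis using ux by linarith
    qed
    have dy: "l - 16 * \<gamma> \<le> L.u (2 ^ J * n0)" for J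
      by (rule L.dyadic_lower_bound[OF n0(4) n2(1)[OF n0(3)] n2(2)[OF n0(3)]])
        (use near[of n0] near[of "2 * n0"] dB in auto)
    show ?thesis
    proof
      show "l - 16 * \<gamma> \<le> L.u n" if "1 \<le> n" for n by (rule L.lower_bound_all_scales[OF n0(1) dy that])
      show "summable (\<lambda>n. \<iota> (real n))" by (rule deviation_function_sums(1)[OF \<P>_params d1(3)])
    qed
  qed
  then show ?thesis using \<delta> d1(3) by blast
qed

end

theorem theorem3p1:
  fixes M :: "'a measure" and T :: "'a \<Rightarrow> 'a"
    and C :: "nat \<Rightarrow> ('a \<Rightarrow> real mat) set"
    and dst :: "nat \<Rightarrow> ('a \<Rightarrow> real mat) \<Rightarrow> ('a \<Rightarrow> real mat) \<Rightarrow> real"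
    and \<Xi> :: "('a \<Rightarrow> real) set"
    and \<P> :: "ldt_param set"
    and m :: nat and A :: "'a \<Rightarrow> real mat"
  assumes "prob_space M"
    and "ergodic_automorphism M T"
    and "cocycle_space M C dst"
    and "\<forall>\<xi>\<in>\<Xi>. \<xi> \<in> borel_measurable M"
    and "\<forall>p\<in>\<P>. is_ldt_param p"
    and "\<forall>k. \<forall>B\<in>C k. compatible M T \<Xi> B"
    and "\<forall>\<xi>\<in>\<Xi>. base_LDT M T \<P> \<xi>"
    and "\<forall>k. \<forall>B\<in>C k. lyap M T B 1 > -\<infinity> \<longrightarrow> uniformly_L2_bounded M T C dst k B"
    and "\<forall>k\<ge>2. \<forall>B\<in>C k. lyap M T B 1 > lyap M T B 2 \<longrightarrow> uniform_fiber_LDT M T C dst \<P> k B"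
    and "m \<ge> 2" and "A \<in> C m" and "lyap M T A 1 > lyap M T A 2"
  shows "\<exists>\<delta>>0. \<exists>\<iota>\<in>deviation_functions \<P>. \<exists>c>0. \<exists>\<alpha>>0.
    \<forall>B\<^sub>1\<in>C m. \<forall>B\<^sub>2\<in>C m. B\<^sub>1 \<noteq> B\<^sub>2 \<longrightarrow> dst m B\<^sub>1 A < \<delta> \<longrightarrow> dst m B\<^sub>2 A < \<delta> \<longrightarrow>
      (\<forall>B\<in>{B\<^sub>1, B\<^sub>2}. lyap M T B 1 > lyap M T B 2 \<and>
         (AE x in M. \<exists>P. expanding_limit T B x P)) \<and>
      (let D = (\<lambda>x. proj_dist (expanding_dir T B\<^sub>1 x) (expanding_dir T B\<^sub>2 x)) in
        {x \<in> space M. D x > dst m B\<^sub>1 B\<^sub>2 powr \<alpha>} \<in> sets M \<and>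
        measure M {x \<in> space M. D x > dst m B\<^sub>1 B\<^sub>2 powr \<alpha>}
          < deviation_modulus c \<iota> (dst m B\<^sub>1 B\<^sub>2) \<and>
        integrable M D \<and>
        integral\<^sup>L M D < deviation_modulus c \<iota> (dst m B\<^sub>1 B\<^sub>2))"
proof -
  interpret prob_space M by (rule assms(1))
  interpret ldt_lyapunov M T C dst \<Xi> \<P> by unfold_locales (rule assms)+
  note A = assms(11) and m = assms(10)
  have AA: "dst m A A = 0" using Metric_space.mdist_zero[OF C_metric A] by simp
  obtain \<delta> \<iota> K c' l \<gamma> N where pin: "0 < \<delta>" "\<iota> \<in> deviation_functions \<P>"
    "\<forall>B\<in>C m. dst m B A < \<delta> \<longrightarrow> pinned_cocycle M T B m K c' l \<gamma> \<iota> N"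
    using pinned_cocycle_near[OF A m assms(12)] by blast
  interpret PA: pinned_cocycle M T A m K c' l \<gamma> \<iota> N using pin(3) A AA pin(1) by simp
  define W where "W = K + 1 + \<bar>l\<bar> + 17 * \<gamma>"
  define R where "R = 4 * exp (K - l + 17 * \<gamma>) / (1 - exp (- 66 * \<gamma>)) + 2"
  have W: "0 < W" "K + 1 - l + 17 * \<gamma> \<le> W" using PA.K0 PA.\<gamma>0 by (auto simp: W_def)
  have R: "0 \<le> R" using PA.\<gamma>0 by (simp add: R_def)
  obtain c \<alpha> h0 where cs: "0 < c" "0 < \<alpha>" "0 < h0" and scale: "\<And>h. 0 < h \<Longrightarrow> h < h0 \<Longrightarrow> \<exists>n\<ge>N.
     R * exp (- (66 * \<gamma>) * real n) + 2 * (exp (W * real n) * h) \<le> h powr \<alpha> \<and>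
     h powr \<alpha> < deviation_modulus c \<iota> h / 2 \<and>
     6 * (\<Sum>k. \<iota> (real (k + n))) \<le> deviation_modulus c \<iota> h / 2"
    using choose_scale[OF \<P>_params pin(2) PA.\<gamma>0 W(1) R, of N] by (elim exE conjE) simp
  define \<delta>' where "\<delta>' = min \<delta> (h0 / 2)"
  have \<delta>': "0 < \<delta>'" using pin(1) cs(3) by (simp add: \<delta>'_def)
  have single: "lyap M T B 1 > lyap M T B 2 \<and> (AE x in M. \<exists>P. expanding_limit T B x P)"
    if B: "B \<in> C m" "dst m B A < \<delta>'" for B
  proof -
    interpret PB: pinned_cocycle M T B m K c' l \<gamma> \<iota> N using pin(3) B by (simp add: \<delta>'_def)
    obtain r where r: "r < \<infinity>" "exponent B r" using exponent_exists[OF B(1)] by blast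
    obtain s where s: "exponent (\<lambda>x. ext_power 2 (B x)) s" using exponent_exists[OF C_ext_power[OF B(1) m]] by blast
    have rl: "ereal (l - 17 * \<gamma>) \<le> r" by (rule PB.exponent_ge[OF r(2)])
    then obtain r' where r': "r = ereal r'" "l - 17 * \<gamma> \<le> r'" using r(1) by (cases r) auto
    have sl: "s \<le> ereal (2 * l - 100 * \<gamma>)" by (rule PB.exponent_ext_le[OF s])
    have "lyap M T B 1 = ereal r'" using lyap_1[OF B(1) r(2)] r' by simp
    moreover have "lyap M T B 2 = s - ereal r'" using lyap_2[OF B(1) m _ s, of r'] r(2) r' by simp
    moreover have "s - ereal r' < ereal r'" using sl r'(2) PB.\<gamma>0 by (cases s) auto
    ultimately show ?thesis using PB.AE_expanding_limit by simp
  qed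
  have pair: "{x \<in> space M. proj_dist (expanding_dir T B1 x) (expanding_dir T B2 x) > dst m B1 B2 powr \<alpha>} \<in> sets M \<and>
      prob {x \<in> space M. proj_dist (expanding_dir T B1 x) (expanding_dir T B2 x) > dst m B1 B2 powr \<alpha>} < deviation_modulus c \<iota> (dst m B1 B2) \<and>
      integrable M (\<lambda>x. proj_dist (expanding_dir T B1 x) (expanding_dir T B2 x)) \<and>
      (\<integral>x. proj_dist (expanding_dir T B1 x) (expanding_dir T B2 x) \<partial>M) < deviation_modulus c \<iota> (dst m B1 B2)"
    if B: "B1 \<in> C m" "B2 \<in> C m" "B1 \<noteq> B2" "dst m B1 A < \<delta>'" "dst m B2 A < \<delta>'" for B1 B2
  proof -
    define h where "h = dst m B1 B2"
    have hd: "h = dst m B2 B1" unfolding h_def by (rule Metric_space.commute[OF C_metric])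
    have h0: "0 < h"
      using Metric_space.zero[OF C_metric B(1,2)] Metric_space.nonneg[OF C_metric, of m B1 B2] B(3)
      unfolding h_def by linarith
    have "h \<le> dst m B1 A + dst m A B2" unfolding h_def by (rule Metric_space.triangle[OF C_metric B(1) A B(2)])
    also have "dst m A B2 = dst m B2 A" by (rule Metric_space.commute[OF C_metric])
    finally have hh: "h < h0" using B(4,5) by (simp add: \<delta>'_def)
    obtain n where n: "n \<ge> N" "R * exp (- (66 * \<gamma>) * real n) + 2 * (exp (W * real n) * h) \<le> h powr \<alpha>"
      "h powr \<alpha> < deviation_modulus c \<iota> h / 2" "6 * (\<Sum>k. \<iota> (real (k + n))) \<le> deviation_modulus c \<iota> h / 2"
      using scale[OF h0 hh] by blast
    have P1: "pinned_cocycle M T B1 m K c' l \<gamma> \<iota> N" and P2: "pinned_cocycle M T B2 m K c' l \<gamma> \<iota> N"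
      using pin(3) B by (auto simp: \<delta>'_def)
    define D where "D = (\<lambda>x. proj_dist (expanding_dir T B1 x) (expanding_dir T B2 x))"
    have [measurable]: "D \<in> borel_measurable M"
      unfolding D_def by (rule measurable_dir_dist[OF C_measurable[OF B(1)] C_measurable[OF B(2)] m])
    have D01: "0 \<le> D x" "D x \<le> 1" if "x \<in> space M" for x
      using proj_dist_hs_dist(4,5)[OF expanding_dir_in_proj_space[OF C_measurable[OF B(1)] m that]
        expanding_dir_in_proj_space[OF C_measurable[OF B(2)] m that]] by (auto simp: D_def)
    have "AE x in M. mat_norm (B2 x - B1 x) \<le> h" unfolding hd by (rule dst_bound[OF B(1,2)])
    from compare_directions[OF P1 P2 less_imp_le[OF h0] this n(1) W(2)]
    obtain E where E: "E \<in> sets M" "prob E \<le> 6 * (\<Sum>k. \<iota> (real (k + n)))"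
      "AE x in M. x \<notin> E \<longrightarrow> D x \<le> R * exp (- (66 * \<gamma>) * real n) + 2 * (exp (W * real n) * h)"
      unfolding D_def R_def by blast
    note [measurable] = E(1)
    have DE: "AE x in M. x \<notin> E \<longrightarrow> D x \<le> h powr \<alpha>" using E(3) by eventually_elim (use n(2) in linarith)
    have pE: "prob E \<le> deviation_modulus c \<iota> h / 2" using E(2) n(4) by linarith
    have mod: "0 < deviation_modulus c \<iota> h"
      using n(3) h0 by (smt (verit) powr_ge_zero field_sum_of_halves)
    have meas: "{x \<in> space M. D x > h powr \<alpha>} \<in> sets M" by measurable
    have "prob {x \<in> space M. D x > h powr \<alpha>} \<le> prob E"
      by (rule finite_measure_mono_AE[OF _ E(1)]) (use DE in \<open>eventually_elim, auto\<close>)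
    then have p: "prob {x \<in> space M. D x > h powr \<alpha>} < deviation_modulus c \<iota> h" using pE mod by linarith
    have int: "integrable M D"
    proof (rule integrable_const_bound[of D 1])
      have "AE x in M. x \<in> space M" by auto
      then show "AE x in M. norm (D x) \<le> 1" by eventually_elim (use D01 in auto)
    qed measurable
    have "(\<integral>x. D x \<partial>M) \<le> (\<integral>x. h powr \<alpha> + indicator E x \<partial>M)"
    proof (rule integral_mono_AE[OF int])
      show "integrable M (\<lambda>x. h powr \<alpha> + indicator E x)"
        by (intro Bochner_Integration.integrable_add) (auto simp: emeasure_eq_measure)
      have "AE x in M. x \<in> space M" by auto
      then show "AE x in M. D x \<le> h powr \<alpha> + indicator E x"
        using DE
      proof eventually_elim
        case (elim x)
        have hp: "0 \<le> h powr \<alpha>" by simp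
        show ?case
        proof (cases "x \<in> E")
          case True
          then have "indicator E x = (1::real)" by simp
          then show ?thesis using D01(2)[OF elim(1)] hp by linarith
        next
          case False
          then show ?thesis using elim(2) by simp
        qed
      qed
    qed
    also have "\<dots> = h powr \<alpha> + prob E"
      by (subst Bochner_Integration.integral_add) (auto simp: emeasure_eq_measure prob_space)
    also have "\<dots> < deviation_modulus c \<iota> h" using n(3) pE by linarith
    finally show ?thesis using meas p int unfolding D_def h_def by blast
  qed
  show ?thesis
  proof (rule exI[of _ \<delta>'], rule conjI[OF \<delta>'], rule bexI[OF _ pin(2)])
    show "\<exists>c>0. \<exists>\<alpha>>0. \<forall>B\<^sub>1\<in>C m. \<forall>B\<^sub>2\<in>C m. B\<^sub>1 \<noteq> B\<^sub>2 \<longrightarrow> dst m B\<^sub>1 A < \<delta>' \<longrightarrow> dst m B\<^sub>2 A < \<delta>' \<longrightarrow>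
      (\<forall>B\<in>{B\<^sub>1, B\<^sub>2}. lyap M T B 1 > lyap M T B 2 \<and> (AE x in M. \<exists>P. expanding_limit T B x P)) \<and>
      (let D = (\<lambda>x. proj_dist (expanding_dir T B\<^sub>1 x) (expanding_dir T B\<^sub>2 x)) in
        {x \<in> space M. D x > dst m B\<^sub>1 B\<^sub>2 powr \<alpha>} \<in> sets M \<and>
        measure M {x \<in> space M. D x > dst m B\<^sub>1 B\<^sub>2 powr \<alpha>} < deviation_modulus c \<iota> (dst m B\<^sub>1 B\<^sub>2) \<and>
        integrable M D \<and> integral\<^sup>L M D < deviation_modulus c \<iota> (dst m B\<^sub>1 B\<^sub>2))"
      unfolding Let_def
    proof (rule exI[of _ c], rule conjI[OF cs(1)], rule exI[of _ \<alpha>], rule conjI[OF cs(2)], intro ballI impI, rule conjI)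
      fix B1 B2 assume B: "B1 \<in> C m" "B2 \<in> C m" "B1 \<noteq> B2" "dst m B1 A < \<delta>'" "dst m B2 A < \<delta>'"
      show "\<forall>B\<in>{B1, B2}. lyap M T B 1 > lyap M T B 2 \<and> (AE x in M. \<exists>P. expanding_limit T B x P)"
        using single B by blast
      show "{x \<in> space M. proj_dist (expanding_dir T B1 x) (expanding_dir T B2 x) > dst m B1 B2 powr \<alpha>} \<in> sets M \<and>
        measure M {x \<in> space M. proj_dist (expanding_dir T B1 x) (expanding_dir T B2 x) > dst m B1 B2 powr \<alpha>} < deviation_modulus c \<iota> (dst m B1 B2) \<and>
        integrable M (\<lambda>x. proj_dist (expanding_dir T B1 x) (expanding_dir T B2 x)) \<and>
        (\<integral>x. proj_dist (expanding_dir T B1 x) (expanding_dir T B2 x) \<partial>M) < deviation_modulus c \<iota> (dst m B1 B2)"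
        by (rule pair[OF B])
    qed
  qed
qed

end
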